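(* Let $T,\delta\in(0,\infty)$, $\Theta=\bigcup_{n\in\mathbb N}\mathbb Z^n$, $f\in C^2(\mathbb R,\mathbb R)$, and let $g_d\in C^1(\mathbb R^d,\mathbb R)$, $d\in\mathbb N$, satisfy $$\sup_{d\in\mathbb N}\ \sup_{x=(x_1,\ldots,x_d)\in\mathbb R^d}\Bigl(|f(x_1)|+|f'(x_1)|+|f''(x_1)|+|g_d(x)|+\sum_{i=1}^d\bigl|\tfrac{\partial g_d}{\partial x_i}(x)\bigr|^2\Bigr)<\infty .$$ Let $(\Omega,\mathcal F,\mathbb P,(\mathbb F_t)_{t\in[0,T]})$ be a filtered probability space, let $\mathfrak r^\theta\colon\Omega\to[0,1]$, $\theta\in\Theta$, be i.i.d. random variables with $\mathbb P(\mathfrak r^0\le t)=t$ for all $t\in(0,1)$, let $W^{d,\theta}=(W^{d,\theta,1},\ldots,W^{d,\theta,d})\colon[0,T]\times\Omega\to\mathbb R^d$, $d\in\mathbb N$, $\theta\in\Theta$, be independent standard $(\mathbb F_t)_{t\in[0,T]}$-Brownian motions, and assume that $(\mathfrak r^\theta)_{\theta\in\Theta}$ and $(W^{d,\theta})_{(d,\theta)\in\mathbb N\times\Theta}$ are independent. Let $U^{d,\theta}_{n,M}\colon[0,T]\times\mathbb R^d\times\Omega\to\mathbb R$, $d,M,n\in\mathbb N_0$, $\theta\in\Theta$, satisfy for all $d,M\in\mathbb N$, $n\in\mathbb N_0$, $\theta\in\Theta$, $t\in[0,T]$, $x\in\mathbb R^d$ that $$U^{d,\theta}_{n,M}(t,x)=(T-t)f(0)\mathbf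 1_{\mathbb N}(n)+\frac{\mathbf 1_{\mathbb N}(n)}{M^n}\sum_{i=1}^{M^n}g_d\bigl(x+W^{d,(\theta,0,-i)}_{T-t}\bigr)$$ $$+\sum_{\ell=1}^{n-1}\Biggl[\frac{T-t}{M^{n-\ell}}\sum_{i=1}^{M^{n-\ell}}\bigl(f\circ U^{d,(\theta,\ell,i)}_{\ell,M}-f\circ U^{d,(\theta,-\ell,i)}_{\ell-1,M}\bigr)\bigl(t+(T-t)\mathfrak r^{(\theta,\ell,i)},\,x+W^{d,(\theta,\ell,i)}_{(T-t)\mathfrak r^{(\theta,\ell,i)}}\bigr)\Biggr].$$ Let $\lfloor\cdot\rfloor_M,\lceil\cdot\rceil_M\colon\mathbb R\to\mathbb R$, $M\in\mathbb N$, satisfy for all $M\in\mathbb N$, $t\in[0,T]$ that $\lfloor t\rfloor_M=\max(([0,t]\setminus\{T\})\cap\{0,\tfrac TM,\tfrac{2T}M,\ldots\})$ and $\lceil t\rceil_M=\min(((t,\infty)\cup\{T\})\cap\{0,\tfrac TM,\tfrac{2T}M,\ldots\})$. Let $\mathscr Y^{d,n,M}\colon[0,T]\times\Omega\to\mathbb R$, $d,n,M\in\mathbb N$, satisfy for all $d,n,M\in\mathbb N$, $t\in[0,T]$ that $$\mathscr Y^{d,n,M}_t=\sum_{\ell=0}^{n-1}\Biggl[\tfrac{\lceil t\rceil_{M^{\ell+1}}-t}{T/M^{\ell+1}}\,U^{d,\ell}_{n-\ell,M}\bigl(\lfloor t\rfloor_{M^{\ell+1}},W^{d,0}_{\lfloor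 t\rfloor_{M^{\ell+1}}}\bigr)+\tfrac{t-\lfloor t\rfloor_{M^{\ell+1}}}{T/M^{\ell+1}}\,U^{d,\ell}_{n-\ell,M}\bigl(\lceil t\rceil_{M^{\ell+1}},W^{d,0}_{\lceil t\rceil_{M^{\ell+1}}}\bigr)$$ $$-\mathbf 1_{\mathbb N}(\ell)\Bigl(\tfrac{\lceil t\rceil_{M^{\ell}}-t}{T/M^{\ell}}\,U^{d,\ell}_{n-\ell,M}\bigl(\lfloor t\rfloor_{M^{\ell}},W^{d,0}_{\lfloor t\rfloor_{M^{\ell}}}\bigr)+\tfrac{t-\lfloor t\rfloor_{M^{\ell}}}{T/M^{\ell}}\,U^{d,\ell}_{n-\ell,M}\bigl(\lceil t\rceil_{M^{\ell}},W^{d,0}_{\lceil t\rceil_{M^{\ell}}}\bigr)\Bigr)\Biggr].$$ For $d,n,M\in\mathbb N$ let $\mathfrak C_{d,n,M}\in\mathbb N_0$ be the computational cost of one realization of $(\mathscr Y^{d,n,M}_{kT/M^n})_{k\in\{0,1,\ldots,M^n\}}$, that is, the number of realizations of scalar random variables plus the number of function evaluations of $f$ plus the number of function evaluations of $g_d$ which are used; precisely, let $\mathcal C_{d,n,M}\in\mathbb N_0$ and $\mathfrak C_{d,n,M}\in\mathbb N_0$, $d,n,M\in\mathbb Z$, satisfy for all $d\in\mathbb N$, $n,M\in\mathbb N_0$ that $$\mathcal C_{d,n,M}\le(d+1)M^n\mathbf 1_{\mathbb N}(n)+\sum_{\ell=0}^{n-1}\bigl[M^{n-\ell}\bigl(2+d+\mathcal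 C_{d,\ell,M}+\mathcal C_{d,\ell-1,M}\mathbf 1_{\mathbb N}(\ell)\bigr)\bigr]$$ and $\mathfrak C_{d,n,M}\le(d+1)(M^n+1)+\sum_{\ell=0}^{n-1}\bigl[(M^{\ell+1}+1)\,\mathcal C_{d,n-\ell,M}\bigr]$. Let $\mathbf Y^d=(Y^d,Z^{d,1},Z^{d,2},\ldots,Z^{d,d})\colon[0,T]\times\Omega\to\mathbb R^{d+1}$, $d\in\mathbb N$, be $(\mathbb F_t)_{t\in[0,T]}$-predictable stochastic processes, assume for all $d\in\mathbb N$ that $\int_0^T\mathbb E\bigl[|Y^d_s|+\sum_{j=1}^d|Z^{d,j}_s|^2\bigr]\,ds<\infty$, and assume that for all $d\in\mathbb N$, $t\in[0,T]$ it holds $\mathbb P$-a.s. that $$Y^d_t=g_d(W^{d,0}_T)+\int_t^Tf(Y^d_s)\,ds-\sum_{j=1}^d\int_t^TZ^{d,j}_s\,dW^{d,0,j}_s .$$ Then there exist $c\in\mathbb R$ and $\mathsf n\colon\mathbb N\times(0,1]\to\mathbb N$ such that for all $d\in\mathbb N$, $\varepsilon\in(0,1]$ it holds that $$\sup_{t\in[0,T]}\bigl(\mathbb E\bigl[|\mathscr Y^{d,\mathsf n(d,\varepsilon),\mathsf n(d,\varepsilon)}_t-Y^d_t|^2\bigr]\bigr)^{1/2}\le\varepsilon\qquad\text{and}\qquad\mathfrak C_{d,\mathsf n(d,\varepsilon),\mathsf n(d,\varepsilon)}\le c\,d^{c}\,\varepsilon^{-(2+\delta)} .$$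
   Context: $\mathbb N=\{1,2,3,\ldots\}$, $\mathbb N_0=\{0,1,2,\ldots\}$; $\mathbf 1_A$ is the indicator function of the set $A$; empty sums are $0$ (so $U^{d,\theta}_{0,M}=0$). For $\theta\in\mathbb Z^k\subseteq\Theta$ and $\ell,i\in\mathbb Z$, $(\theta,\ell,i)$ denotes the concatenated tuple in $\mathbb Z^{k+2}\subseteq\Theta$; integers such as $0$ or $\ell$ used as upper indices are regarded as elements of $\mathbb Z^1\subseteq\Theta$. The dependence on $\omega\in\Omega$ is suppressed in the notation. The filtered probability space is not assumed to satisfy the usual conditions. *)

theory Defs
  imports "HOL-Probability.Probability"
begin

text \<open>
  \<open>Rd d\<close> is the space of real \<open>d\<close>-tuples, indexed by \<open>1, \<dots>, d\<close>. It is the underlying space of the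
  measure space \<open>Rd_borel d\<close>, and as a subspace of \<^typ>\<open>nat \<Rightarrow> real\<close> it carries the usual topology.
\<close>

definition Rd :: "nat \<Rightarrow> (nat \<Rightarrow> real) set"
  where "Rd d = {1..d} \<rightarrow>\<^sub>E UNIV"

definition Rd_borel :: "nat \<Rightarrow> (nat \<Rightarrow> real) measure"
  where "Rd_borel d = PiM {1..d} (\<lambda>_. borel)"

definition vadd :: "nat \<Rightarrow> (nat \<Rightarrow> real) \<Rightarrow> (nat \<Rightarrow> real) \<Rightarrow> nat \<Rightarrow> real"
  where "vadd d x y = (\<lambda>i\<in>{1..d}. x i + y i)"

definition vdiff :: "nat \<Rightarrow> (nat \<Rightarrow> real) \<Rightarrow> (nat \<Rightarrow> real) \<Rightarrow> nat \<Rightarrow> real"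
  where "vdiff d x y = (\<lambda>i\<in>{1..d}. x i - y i)"

definition partial_deriv :: "nat \<Rightarrow> ((nat \<Rightarrow> real) \<Rightarrow> real) \<Rightarrow> (nat \<Rightarrow> real) \<Rightarrow> real"
  where "partial_deriv i g x = deriv (\<lambda>h. g (x(i := h))) (x i)"

definition C1_on_Rd :: "nat \<Rightarrow> ((nat \<Rightarrow> real) \<Rightarrow> real) \<Rightarrow> bool"
  where "C1_on_Rd d g \<longleftrightarrow>
    continuous_on (Rd d) g \<and>
    (\<forall>i\<in>{1..d}.
      (\<forall>x\<in>Rd d. (\<lambda>h. g (x(i := h))) differentiable (at (x i))) \<and>
      continuous_on (Rd d) (partial_deriv i g))"

definition C2_real :: "(real \<Rightarrow> real) \<Rightarrow> bool"
  where "C2_real f \<longleftrightarrow>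
    (\<forall>x. f differentiable (at x)) \<and>
    (\<forall>x. deriv f differentiable (at x)) \<and>
    continuous_on UNIV (deriv (deriv f))"

text \<open>
  The index set is the union of the sets of integer \<open>n\<close>-tuples over \<open>n \<ge> 1\<close>, with tuples as lists;
  the concatenated tuple \<open>(\<theta>, l, i)\<close> is \<open>\<theta> @ [l, i]\<close>, and an integer \<open>l\<close> is identified with \<open>[l]\<close>.
\<close>

definition Theta :: "int list set"
  where "Theta = {\<theta>. \<theta> \<noteq> []}"

definition filtration_upto :: "'a measure \<Rightarrow> real \<Rightarrow> (real \<Rightarrow> 'a measure) \<Rightarrow> bool"
  where "filtration_upto M T F \<longleftrightarrow>
    (\<forall>t\<in>{0..T}. subalgebra M (F t)) \<and>
    (\<forall>s t. 0 \<le> s \<and> s \<le> t \<and> t \<le> T \<longrightarrow> sets (F s) \<subseteq> sets (F t))"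

definition generated_sets :: "'a measure \<Rightarrow> ('a \<Rightarrow> 'b) \<Rightarrow> 'b measure \<Rightarrow> 'a set set"
  where "generated_sets M X N = sets (vimage_algebra (space M) X N)"

text \<open>The trajectory of a process with values in \<open>Rd d\<close>, as an element of a product space.\<close>

definition path_space :: "real \<Rightarrow> nat \<Rightarrow> (real \<Rightarrow> nat \<Rightarrow> real) measure"
  where "path_space T d = PiM {0..T} (\<lambda>_. Rd_borel d)"

definition trajectory :: "real \<Rightarrow> (real \<Rightarrow> 'a \<Rightarrow> nat \<Rightarrow> real) \<Rightarrow> 'a \<Rightarrow> real \<Rightarrow> nat \<Rightarrow> real"
  where "trajectory T B \<omega> = (\<lambda>t\<in>{0..T}. B t \<omega>)"

text \<open>
  Convention of Karatzas and Shreve: every sample path is continuous, while the process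
  starts in \<open>0\<close> almost surely. For \<open>s < t\<close> the increment has the law \<open>N(0, (t - s) I\<^sub>d)\<close>, written
  as a product of one-dimensional normal laws.
\<close>

definition std_brownian_motion ::
    "'a measure \<Rightarrow> (real \<Rightarrow> 'a measure) \<Rightarrow> real \<Rightarrow> nat \<Rightarrow> (real \<Rightarrow> 'a \<Rightarrow> nat \<Rightarrow> real) \<Rightarrow> bool"
  where "std_brownian_motion M F T d B \<longleftrightarrow>
    (\<forall>t\<in>{0..T}. B t \<in> measurable (F t) (Rd_borel d)) \<and>
    (\<forall>\<omega>\<in>space M. continuous_on {0..T} (\<lambda>t. B t \<omega>)) \<and>
    (AE \<omega> in M. \<forall>i\<in>{1..d}. B 0 \<omega> i = 0) \<and>
    (\<forall>s t. 0 \<le> s \<and> s < t \<and> t \<le> T \<longrightarrow>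
      prob_space.indep_set M (sets (F s))
        (generated_sets M (\<lambda>\<omega>. vdiff d (B t \<omega>) (B s \<omega>)) (Rd_borel d)) \<and>
      distr M (Rd_borel d) (\<lambda>\<omega>. vdiff d (B t \<omega>) (B s \<omega>)) =
        PiM {1..d} (\<lambda>_. density lborel (normal_density 0 (sqrt (t - s)))))"

definition predictable_sigma :: "'a measure \<Rightarrow> (real \<Rightarrow> 'a measure) \<Rightarrow> real \<Rightarrow> (real \<times> 'a) measure"
  where "predictable_sigma M F T = sigma ({0..T} \<times> space M)
    ({{0} \<times> A | A. A \<in> sets (F 0)} \<union>
     {{s<..t} \<times> A | s t A. 0 \<le> s \<and> s < t \<and> t \<le> T \<and> A \<in> sets (F s)})"

definition predictable :: "'a measure \<Rightarrow> (real \<Rightarrow> 'a measure) \<Rightarrow> real \<Rightarrow> (real \<Rightarrow> 'a \<Rightarrow> real) \<Rightarrow> bool"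
  where "predictable M F T X \<longleftrightarrow>
    (\<lambda>(t, \<omega>). X t \<omega>) \<in> borel_measurable (predictable_sigma M F T)"

text \<open>
  A triple \<open>(m, \<tau>, \<xi>)\<close> encodes the elementary process \<open>\<Sum>k<m. \<xi>\<^sub>k 1\<^bsub>(\<tau>\<^sub>k, \<tau>\<^sub>k\<^sub>+\<^sub>1]\<^esub>\<close> on \<open>[a, b]\<close>.
\<close>

definition elementary_process ::
    "'a measure \<Rightarrow> (real \<Rightarrow> 'a measure) \<Rightarrow> real \<Rightarrow> real \<Rightarrow>
      nat \<Rightarrow> (nat \<Rightarrow> real) \<Rightarrow> (nat \<Rightarrow> 'a \<Rightarrow> real) \<Rightarrow> bool"
  where "elementary_process M F a b m \<tau> \<xi> \<longleftrightarrow>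
    (\<forall>k\<le>m. \<tau> k \<in> {a..b}) \<and>
    (\<forall>k<m. \<tau> k \<le> \<tau> (Suc k) \<and>
      \<xi> k \<in> borel_measurable (F (\<tau> k)) \<and>
      (\<exists>C. \<forall>\<omega>\<in>space M. \<bar>\<xi> k \<omega>\<bar> \<le> C))"

definition elementary_value ::
    "nat \<Rightarrow> (nat \<Rightarrow> real) \<Rightarrow> (nat \<Rightarrow> 'a \<Rightarrow> real) \<Rightarrow> real \<Rightarrow> 'a \<Rightarrow> real"
  where "elementary_value m \<tau> \<xi> s \<omega> =
    (\<Sum>k<m. \<xi> k \<omega> * indicator {\<tau> k<..\<tau> (Suc k)} s)"

definition elementary_integral ::
    "(real \<Rightarrow> 'a \<Rightarrow> real) \<Rightarrow> nat \<Rightarrow> (nat \<Rightarrow> real) \<Rightarrow> (nat \<Rightarrow> 'a \<Rightarrow> real) \<Rightarrow> 'a \<Rightarrow> real"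
  where "elementary_integral B m \<tau> \<xi> \<omega> =
    (\<Sum>k<m. \<xi> k \<omega> * (B (\<tau> (Suc k)) \<omega> - B (\<tau> k) \<omega>))"

text \<open>
  \<open>J\<close> is a version of the Ito integral of \<open>H\<close> with respect to the real Brownian motion \<open>B\<close> over
  \<open>[a, b]\<close>: the mean-square limit of the integrals of elementary processes that converge to \<open>H\<close>
  in \<open>L\<^sup>2([a, b] \<times> \<Omega>)\<close>. By the Ito isometry, \<open>J\<close> is determined up to null sets, and for
  predictable square-integrable \<open>H\<close> it exists.
\<close>

definition has_ito_integral ::
    "'a measure \<Rightarrow> (real \<Rightarrow> 'a measure) \<Rightarrow> (real \<Rightarrow> 'a \<Rightarrow> real) \<Rightarrow> real \<Rightarrow> real \<Rightarrow>
      (real \<Rightarrow> 'a \<Rightarrow> real) \<Rightarrow> ('a \<Rightarrow> real) \<Rightarrow> bool"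
  where "has_ito_integral M F B a b H J \<longleftrightarrow>
    J \<in> borel_measurable M \<and>
    (\<exists>m \<tau> \<xi>.
      (\<forall>n. elementary_process M F a b (m n) (\<tau> n) (\<xi> n)) \<and>
      (\<lambda>n. \<integral>\<^sup>+ s \<in> {a..b}. (\<integral>\<^sup>+ \<omega>.
          ennreal ((H s \<omega> - elementary_value (m n) (\<tau> n) (\<xi> n) s \<omega>)\<^sup>2) \<partial>M) \<partial>lborel)
        \<longlonglongrightarrow> 0 \<and>
      (\<lambda>n. \<integral>\<^sup>+ \<omega>. ennreal ((J \<omega> - elementary_integral B (m n) (\<tau> n) (\<xi> n) \<omega>)\<^sup>2) \<partial>M)
        \<longlonglongrightarrow> 0)"

text \<open>\<open>(E[|X|\<^sup>2])\<^sup>1\<^sup>/\<^sup>2\<close> as an element of \<open>[0, \<infinity>]\<close>; \<^const>\<open>enn2real\<close> alone would send \<open>\<infinity>\<close> to \<open>0\<close>.\<close>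

definition root_mean_square :: "'a measure \<Rightarrow> ('a \<Rightarrow> real) \<Rightarrow> ennreal"
  where "root_mean_square M X =
    (let m = \<integral>\<^sup>+ \<omega>. ennreal (\<bar>X \<omega>\<bar>\<^sup>2) \<partial>M
     in if m = \<infinity> then \<infinity> else ennreal (sqrt (enn2real m)))"

definition time_grid :: "real \<Rightarrow> nat \<Rightarrow> real set"
  where "time_grid T M = {real k * T / real M | k :: nat. True}"

end

theory Submission
  imports Defs
begin

text \<open>
  The solution is \<open>Y\<^sub>t = u (t, W\<^sub>t)\<close>, where \<open>u\<close> is the fixed point of the Feynman-Kac equation
  \<open>u (t, x) = E (g (x + W\<^sub>T\<^sub>-\<^sub>t)) + (T - t) E (f (u (t + (T - t) r, x + W\<^sub>(\<^sub>T\<^sub>-\<^sub>t\<^sub>)\<^sub>r)))\<close>: conditioning the backward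
  equation removes the stochastic integral, and the difference of the two sides vanishes by a Gronwall argument.

  The error \<open>U\<^sub>n - u\<close> is controlled in mean square together with its increments relative to a parabolic
  distance, which the random shift \<open>(t, x) \<mapsto> (t + (T - t) r, x + W\<^sub>(\<^sub>T\<^sub>-\<^sub>t\<^sub>)\<^sub>r)\<close> preserves in mean square.
  Since the time weight \<open>exp (M (T - t))\<close> integrates to \<open>1 / M\<close> of itself, the bias gains a factor \<open>1 / M\<close>
  in every recursion step, as the variance does by averaging, and the mean square error is at most
  \<open>exp (M T) A R\<^sup>n / M\<^sup>n\<close>. The increments supply the factor \<open>M ^ - l\<close> that the level \<open>l\<close> of the interpolated scheme
  needs. For \<open>M = n\<close> the mean square error \<open>A d\<^sup>2 R\<^sup>n / n\<^sup>n\<close> and the cost \<open>d S\<^sup>n n\<^sup>n\<close> are inverse to each other up to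
  exponential factors, which are negligible against any power of \<open>n\<^sup>n\<close>.
\<close>

section \<open>Bounded random variables and independence\<close>

text \<open>The interpolation needs increments of the error, and an increment of
  \<open>f \<circ> U - f \<circ> sol\<close> is a second order difference of \<open>f\<close>. A
  bounded second derivative splits it into the increment of \<open>U - sol\<close> and the product
  of an increment of \<open>sol\<close> with the size of \<open>U - sol\<close>. Values and
  increments are therefore estimated together, and \<open>sol\<close> needs a Lipschitz bound in the
  parabolic distance beforehand. Both come from one class of fields, \<open>ms_ctl\<close>, that is
  stable under composition with \<open>f\<close>, random shift and averaging. Its constants are free
  of the dimension, which enters through the distance alone, so one choice serves all
  \<open>d\<close>. The telescoping of the levels rests on the law of \<open>U \<theta> n\<close>
  being the same for all \<open>\<theta>\<close>; the tree of indices keeps the noise of different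
  summands disjoint. Conditioning is expressed by freezing an independent argument or by testing
  with sets of \<open>F t\<close>, so neither conditional expectations nor the usual conditions
  enter.\<close>

context prob_space
begin

text \<open>Bounds hold everywhere on the space. As \<open>f\<close> and \<open>g\<close> are
  bounded, all quantities of the scheme belong to this class, which is closed under products, so
  that moments of the scheme exist without further discussion.\<close>

definition bounded_rv :: "('a \<Rightarrow> real) \<Rightarrow> bool"
  where "bounded_rv X \<longleftrightarrow> X \<in> borel_measurable M \<and> (\<exists>C. \<forall>\<omega>\<in>space M. \<bar>X \<omega>\<bar> \<le> C)"

lemma bounded_rvI: "X \<in> borel_measurable M \<Longrightarrow> (\<And>\<omega>. \<omega> \<in> space M \<Longrightarrow> \<bar>X \<omega>\<bar> \<le> C) \<Longrightarrow> bounded_rv X"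
  unfolding bounded_rv_def by blast

lemma bounded_rv_measurable[measurable_dest]: "bounded_rv X \<Longrightarrow> X \<in> borel_measurable M"
  unfolding bounded_rv_def by blast

lemma bounded_rv_integrable: "bounded_rv X \<Longrightarrow> integrable M X"
  unfolding bounded_rv_def by (elim conjE exE, rule integrable_const_bound) auto

lemma bounded_rv_const[intro, simp]: "bounded_rv (\<lambda>_. c)"
  unfolding bounded_rv_def by auto

lemma bounded_rv_add[intro]: "bounded_rv X \<Longrightarrow> bounded_rv Y \<Longrightarrow> bounded_rv (\<lambda>\<omega>. X \<omega> + Y \<omega>)"
  unfolding bounded_rv_def
proof (elim conjE exE)
  fix C D assume "\<forall>\<omega>\<in>space M. \<bar>X \<omega>\<bar> \<le> C" "\<forall>\<omega>\<in>space M. \<bar>Y \<omega>\<bar> \<le> D"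
    and [measurable]: "X \<in> borel_measurable M" "Y \<in> borel_measurable M"
  then show "(\<lambda>\<omega>. X \<omega> + Y \<omega>) \<in> borel_measurable M \<and> (\<exists>C. \<forall>\<omega>\<in>space M. \<bar>X \<omega> + Y \<omega>\<bar> \<le> C)"
    by (intro conjI exI[of _ "C + D"]) (auto intro!: order_trans[OF abs_triangle_ineq] add_mono)
qed

lemma bounded_rv_mult[intro]: "bounded_rv X \<Longrightarrow> bounded_rv Y \<Longrightarrow> bounded_rv (\<lambda>\<omega>. X \<omega> * Y \<omega>)"
  unfolding bounded_rv_def
proof (elim conjE exE)
  fix C D assume *: "\<forall>\<omega>\<in>space M. \<bar>X \<omega>\<bar> \<le> C" "\<forall>\<omega>\<in>space M. \<bar>Y \<omega>\<bar> \<le> D"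
    and [measurable]: "X \<in> borel_measurable M" "Y \<in> borel_measurable M"
  have "\<bar>X \<omega> * Y \<omega>\<bar> \<le> \<bar>C\<bar> * \<bar>D\<bar>" if "\<omega> \<in> space M" for \<omega>
    unfolding abs_mult using *[THEN bspec, OF that] by (intro mult_mono) auto
  then show "(\<lambda>\<omega>. X \<omega> * Y \<omega>) \<in> borel_measurable M \<and> (\<exists>C. \<forall>\<omega>\<in>space M. \<bar>X \<omega> * Y \<omega>\<bar> \<le> C)"
    by (intro conjI exI[of _ "\<bar>C\<bar> * \<bar>D\<bar>"]) auto
qed

lemma bounded_rv_diff[intro]: "bounded_rv X \<Longrightarrow> bounded_rv Y \<Longrightarrow> bounded_rv (\<lambda>\<omega>. X \<omega> - Y \<omega>)"
  using bounded_rv_add[of X "\<lambda>\<omega>. -1 * Y \<omega>"] bounded_rv_mult[of "\<lambda>_. -1" Y] by simp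

lemma bounded_rv_power2[intro]: "bounded_rv X \<Longrightarrow> bounded_rv (\<lambda>\<omega>. (X \<omega>)\<^sup>2)"
  unfolding power2_eq_square by blast

lemma bounded_rv_sum[intro]:
  "(\<And>j. j \<in> J \<Longrightarrow> bounded_rv (X j)) \<Longrightarrow> bounded_rv (\<lambda>\<omega>. \<Sum>j\<in>J. X j \<omega>)"
  by (induction J rule: infinite_finite_induct) auto

lemma expectation_power2_le:
  assumes "bounded_rv X"
  shows "(expectation X)\<^sup>2 \<le> expectation (\<lambda>\<omega>. (X \<omega>)\<^sup>2)"
  using variance_positive[of X] assms
  by (subst (asm) variance_eq) (auto intro!: bounded_rv_integrable)

lemma measurable_subalgebra_id:
  "subalgebra M A \<Longrightarrow> (\<lambda>\<omega>. \<omega>) \<in> measurable M A"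
  unfolding subalgebra_def by (auto simp: measurable_def sets.Int_space_eq2)

text \<open>The two information sets are measures on the same space, so that the identity is a
  measurable map into either of them. A random field that depends on one of them can then be treated
  as a function of a point and of the outcome itself.\<close>

definition indep_subalg :: "'a measure \<Rightarrow> 'a measure \<Rightarrow> bool"
  where "indep_subalg A B \<longleftrightarrow> subalgebra M A \<and> subalgebra M B \<and> indep_set (sets A) (sets B)"

lemma indep_subalg_indep_var:
  assumes AB: "indep_subalg A B" and X: "X \<in> measurable A N" and Y: "Y \<in> measurable B L"
  shows "indep_var N X L Y"
proof -
  have sub: "subalgebra M A" "subalgebra M B" and ind: "indep_set (sets A) (sets B)"
    using AB by (auto simp: indep_subalg_def)
  have sp: "space A = space M" "space B = space M" using sub by (auto simp: subalgebra_def)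
  have XM: "X \<in> measurable M N" and YM: "Y \<in> measurable M L"
    using measurable_from_subalg[OF sub(1) X] measurable_from_subalg[OF sub(2) Y] by auto
  have "indep_set (sigma_sets (space M) {X -` A' \<inter> space M |A'. A' \<in> sets N})
      (sigma_sets (space M) {Y -` A' \<inter> space M |A'. A' \<in> sets L})"
  proof -
    have "sigma_sets (space M) {X -` A' \<inter> space M |A'. A' \<in> sets N} \<subseteq> sets A"
      unfolding sp(1)[symmetric] using X by (intro sets.sigma_sets_subset) (auto simp: measurable_sets)
    moreover have "sigma_sets (space M) {Y -` A' \<inter> space M |A'. A' \<in> sets L} \<subseteq> sets B"
      unfolding sp(2)[symmetric] using Y by (intro sets.sigma_sets_subset) (auto simp: measurable_sets)
    ultimately show ?thesis using ind unfolding indep_sets2_eq by blast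
  qed
  then show ?thesis unfolding indep_var_eq using XM YM by auto
qed

text \<open>A product measure is determined by its values on rectangles, where independence is the
  product formula.\<close>

lemma distr_Pair_indep_subalg:
  assumes AB: "indep_subalg A B" and X[measurable]: "X \<in> measurable A N" and Y[measurable]: "Y \<in> measurable B L"
  shows "distr M (N \<Otimes>\<^sub>M L) (\<lambda>\<omega>. (X \<omega>, Y \<omega>)) = distr M N X \<Otimes>\<^sub>M distr M L Y"
proof (rule pair_measure_eqI[symmetric])
  have sub: "subalgebra M A" "subalgebra M B" and ind: "indep_set (sets A) (sets B)"
    using AB by (auto simp: indep_subalg_def)
  have sp: "space A = space M" "space B = space M" using sub by (auto simp: subalgebra_def)
  have XM[measurable]: "X \<in> measurable M N" and YM[measurable]: "Y \<in> measurable M L"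
    using measurable_from_subalg[OF sub(1) X] measurable_from_subalg[OF sub(2) Y] by auto
  interpret X: prob_space "distr M N X" by (rule prob_space_distr) simp
  interpret Y: prob_space "distr M L Y" by (rule prob_space_distr) simp
  show "sigma_finite_measure (distr M N X)" "sigma_finite_measure (distr M L Y)"
    by unfold_locales
  show "sets (distr M N X \<Otimes>\<^sub>M distr M L Y) = sets (distr M (N \<Otimes>\<^sub>M L) (\<lambda>\<omega>. (X \<omega>, Y \<omega>)))"
    by (simp cong: sets_pair_measure_cong)
  fix C D assume C: "C \<in> sets (distr M N X)" and D: "D \<in> sets (distr M L Y)"
  have "emeasure (distr M (N \<Otimes>\<^sub>M L) (\<lambda>\<omega>. (X \<omega>, Y \<omega>))) (C \<times> D)
      = emeasure M ((X -` C \<inter> space M) \<inter> (Y -` D \<inter> space M))"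
    using C D by (subst emeasure_distr) (auto intro!: arg_cong[where f="emeasure M"])
  also have "\<dots> = ennreal (prob (X -` C \<inter> space M) * prob (Y -` D \<inter> space M))"
    using measurable_sets[OF X, of C] measurable_sets[OF Y, of D] C D sp
    by (subst emeasure_eq_measure, subst indep_setD[OF ind]) auto
  finally show "emeasure (distr M N X) C * emeasure (distr M L Y) D
      = emeasure (distr M (N \<Otimes>\<^sub>M L) (\<lambda>\<omega>. (X \<omega>, Y \<omega>))) (C \<times> D)"
    using C D by (simp add: emeasure_distr emeasure_eq_measure ennreal_mult)
qed

text \<open>Freezing: the argument drawn from the first source is fixed while the second is
  averaged. With the identity for \<open>Y\<close>, the function \<open>h\<close> becomes a random
  field evaluated at an independent random point.\<close>

lemma nn_integral_indep_subalg:
  fixes h :: "'b \<times> 'c \<Rightarrow> ennreal"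
  assumes AB: "indep_subalg A B" and X: "X \<in> measurable A N" and Y: "Y \<in> measurable B L"
    and h[measurable]: "h \<in> borel_measurable (N \<Otimes>\<^sub>M L)"
  shows "(\<integral>\<^sup>+\<omega>. h (X \<omega>, Y \<omega>) \<partial>M) = (\<integral>\<^sup>+\<omega>'. (\<integral>\<^sup>+\<omega>. h (X \<omega>', Y \<omega>) \<partial>M) \<partial>M)"
proof -
  have XM[measurable]: "X \<in> measurable M N" and YM[measurable]: "Y \<in> measurable M L"
    using AB measurable_from_subalg[OF _ X] measurable_from_subalg[OF _ Y] by (auto simp: indep_subalg_def)
  interpret Y: prob_space "distr M L Y" by (rule prob_space_distr) simp
  have "(\<integral>\<^sup>+\<omega>. h (X \<omega>, Y \<omega>) \<partial>M) = (\<integral>\<^sup>+z. h z \<partial>distr M (N \<Otimes>\<^sub>M L) (\<lambda>\<omega>. (X \<omega>, Y \<omega>)))"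
    by (subst nn_integral_distr) auto
  also have "\<dots> = (\<integral>\<^sup>+z. h z \<partial>(distr M N X \<Otimes>\<^sub>M distr M L Y))"
    by (simp add: distr_Pair_indep_subalg[OF AB X Y])
  also have "\<dots> = (\<integral>\<^sup>+x. (\<integral>\<^sup>+y. h (x, y) \<partial>distr M L Y) \<partial>distr M N X)"
    by (subst Y.nn_integral_fst[symmetric]) (auto cong: measurable_cong_sets sets_pair_measure_cong)
  also have "\<dots> = (\<integral>\<^sup>+\<omega>'. (\<integral>\<^sup>+y. h (X \<omega>', y) \<partial>distr M L Y) \<partial>M)"
    by (subst nn_integral_distr) auto
  also have "\<dots> = (\<integral>\<^sup>+\<omega>'. (\<integral>\<^sup>+\<omega>. h (X \<omega>', Y \<omega>) \<partial>M) \<partial>M)"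
    by (intro nn_integral_cong, subst nn_integral_distr)
      (auto intro!: measurable_compose[OF _ h] measurable_space[of X M N])
  finally show ?thesis .
qed

text \<open>Freezing for bounded real functions. The second claim makes the outer integrand
  available for the monotonicity of the integral.\<close>

lemma expectation_indep_subalg:
  fixes h :: "'b \<times> 'c \<Rightarrow> real"
  assumes AB: "indep_subalg A B" and X: "X \<in> measurable A N" and Y: "Y \<in> measurable B L"
    and h[measurable]: "h \<in> borel_measurable (N \<Otimes>\<^sub>M L)"
    and bnd: "\<And>z. z \<in> space (N \<Otimes>\<^sub>M L) \<Longrightarrow> \<bar>h z\<bar> \<le> C"
  shows "expectation (\<lambda>\<omega>. h (X \<omega>, Y \<omega>)) = expectation (\<lambda>\<omega>'. expectation (\<lambda>\<omega>. h (X \<omega>', Y \<omega>)))"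
    and "bounded_rv (\<lambda>\<omega>'. expectation (\<lambda>\<omega>. h (X \<omega>', Y \<omega>)))"
proof -
  have XM[measurable]: "X \<in> measurable M N" and YM[measurable]: "Y \<in> measurable M L"
    using AB measurable_from_subalg[OF _ X] measurable_from_subalg[OF _ Y] by (auto simp: indep_subalg_def)
  interpret X: prob_space "distr M N X" by (rule prob_space_distr) simp
  interpret Y: prob_space "distr M L Y" by (rule prob_space_distr) simp
  interpret XY: pair_prob_space "distr M N X" "distr M L Y" ..
  have sp: "space (distr M N X \<Otimes>\<^sub>M distr M L Y) = space (N \<Otimes>\<^sub>M L)"
    by (simp add: space_pair_measure)
  have h'[measurable]: "h \<in> borel_measurable (distr M N X \<Otimes>\<^sub>M distr M L Y)"
    by (auto cong: measurable_cong_sets sets_pair_measure_cong)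
  have int: "integrable (distr M N X \<Otimes>\<^sub>M distr M L Y) h"
    by (rule XY.integrable_const_bound[of _ C]) (use bnd sp in auto)
  have "expectation (\<lambda>\<omega>. h (X \<omega>, Y \<omega>)) = (\<integral>z. h z \<partial>distr M (N \<Otimes>\<^sub>M L) (\<lambda>\<omega>. (X \<omega>, Y \<omega>)))"
    by (subst integral_distr) auto
  also have "\<dots> = (\<integral>z. h z \<partial>(distr M N X \<Otimes>\<^sub>M distr M L Y))"
    by (simp add: distr_Pair_indep_subalg[OF AB X Y])
  also have "\<dots> = (\<integral>x. (\<integral>y. h (x, y) \<partial>distr M L Y) \<partial>distr M N X)"
    by (subst XY.integral_fst'[OF int]) simp
  also have "\<dots> = (\<integral>\<omega>'. (\<integral>y. h (X \<omega>', y) \<partial>distr M L Y) \<partial>M)"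
    by (subst integral_distr) auto
  also have "\<dots> = (\<integral>\<omega>'. (\<integral>\<omega>. h (X \<omega>', Y \<omega>) \<partial>M) \<partial>M)"
    by (intro Bochner_Integration.integral_cong refl, subst integral_distr)
      (auto intro!: measurable_compose[OF _ h] measurable_space[of X M N])
  finally show "expectation (\<lambda>\<omega>. h (X \<omega>, Y \<omega>)) = expectation (\<lambda>\<omega>'. expectation (\<lambda>\<omega>. h (X \<omega>', Y \<omega>)))" .
  have "(\<lambda>\<omega>'. expectation (\<lambda>\<omega>. h (X \<omega>', Y \<omega>))) \<in> borel_measurable M"
    by measurable
  moreover have "\<bar>expectation (\<lambda>\<omega>. h (X \<omega>', Y \<omega>))\<bar> \<le> C" if "\<omega>' \<in> space M" for \<omega>'
  proof -
    have X': "X \<omega>' \<in> space N" using that by (auto intro!: measurable_space[of X M N])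
    have b: "\<bar>h (X \<omega>', Y \<omega>)\<bar> \<le> C" if "\<omega> \<in> space M" for \<omega>
      using X' that by (intro bnd) (auto simp: space_pair_measure intro!: measurable_space[of Y M L])
    have "\<bar>expectation (\<lambda>\<omega>. h (X \<omega>', Y \<omega>))\<bar> \<le> expectation (\<lambda>\<omega>. \<bar>h (X \<omega>', Y \<omega>)\<bar>)"
      by (rule integral_abs_bound)
    also have "\<dots> \<le> expectation (\<lambda>\<omega>. C)"
    proof (rule integral_mono)
      show "integrable M (\<lambda>\<omega>. \<bar>h (X \<omega>', Y \<omega>)\<bar>)"
        using b X' by (intro integrable_const_bound[of _ C]) (auto intro!: measurable_compose[OF _ h])
    qed (use b in auto)
    finally show ?thesis by (simp add: prob_space)
  qed
  ultimately show "bounded_rv (\<lambda>\<omega>'. expectation (\<lambda>\<omega>. h (X \<omega>', Y \<omega>)))" by (rule bounded_rvI)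
qed

lemma variance_sum_indep:
  assumes "finite J" "indep_vars (\<lambda>_. borel) X J" "\<And>j. j \<in> J \<Longrightarrow> bounded_rv (X j)"
  shows "variance (\<lambda>\<omega>. \<Sum>j\<in>J. X j \<omega>) = (\<Sum>j\<in>J. variance (X j))"
  using assms
proof (induction J rule: finite_induct)
  case empty then show ?case by simp
next
  case (insert i J)
  define S where "S = (\<lambda>\<omega>. \<Sum>j\<in>J. X j \<omega>)"
  have X: "bounded_rv (X i)" and S: "bounded_rv S"
    using insert.prems unfolding S_def by auto
  note [simp] = bounded_rv_integrable[OF X] bounded_rv_integrable[OF S]
    bounded_rv_integrable[OF bounded_rv_power2[OF X]] bounded_rv_integrable[OF bounded_rv_power2[OF S]]
    bounded_rv_integrable[OF bounded_rv_mult[OF X S]]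
  have var: "variance Z = expectation (\<lambda>\<omega>. (Z \<omega>)\<^sup>2) - (expectation Z)\<^sup>2" if "bounded_rv Z" for Z
    using that by (intro variance_eq bounded_rv_integrable bounded_rv_power2)
  have "indep_vars (\<lambda>_. borel) X J"
    using insert.prems(1) by (rule indep_vars_subset) auto
  then have IH: "variance S = (\<Sum>j\<in>J. variance (X j))"
    unfolding S_def using insert by auto
  have "indep_var borel (X i) borel S"
    unfolding S_def using insert by (intro indep_vars_sum) auto
  then have prod: "expectation (\<lambda>\<omega>. X i \<omega> * S \<omega>) = expectation (X i) * expectation S"
    by (rule indep_var_lebesgue_integral) auto
  have XS: "bounded_rv (\<lambda>\<omega>. X i \<omega> + S \<omega>)" using X S by auto
  have "expectation (\<lambda>\<omega>. (X i \<omega> + S \<omega>)\<^sup>2)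
      = expectation (\<lambda>\<omega>. (X i \<omega>)\<^sup>2 + (S \<omega>)\<^sup>2 + 2 * (X i \<omega> * S \<omega>))"
    by (simp add: power2_sum mult.assoc)
  also have "\<dots> = expectation (\<lambda>\<omega>. (X i \<omega>)\<^sup>2) + expectation (\<lambda>\<omega>. (S \<omega>)\<^sup>2)
      + 2 * (expectation (X i) * expectation S)"
    by (simp add: prod)
  finally have "variance (\<lambda>\<omega>. X i \<omega> + S \<omega>) = variance (X i) + variance S"
    using var[OF X] var[OF S] var[OF XS] by (simp add: power2_sum)
  then show ?case using insert IH by (simp add: S_def)
qed

text \<open>Bias-variance splitting: the square of the mean plus the variance of an independent sum,
  where each variance is at most the second moment. The deterministic \<open>c\<close> shifts the
  mean and does not affect the variance.\<close>

lemma expectation_power2_sum_indep_le: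
  assumes "finite J" "indep_vars (\<lambda>_. borel) X J" "\<And>j. j \<in> J \<Longrightarrow> bounded_rv (X j)"
  shows "expectation (\<lambda>\<omega>. (c + (\<Sum>j\<in>J. X j \<omega>))\<^sup>2)
    \<le> (expectation (\<lambda>\<omega>. c + (\<Sum>j\<in>J. X j \<omega>)))\<^sup>2 + (\<Sum>j\<in>J. expectation (\<lambda>\<omega>. (X j \<omega>)\<^sup>2))"
proof -
  define S where "S = (\<lambda>\<omega>. \<Sum>j\<in>J. X j \<omega>)"
  have S: "bounded_rv S" unfolding S_def using assms by auto
  note [simp] = bounded_rv_integrable[OF S] bounded_rv_integrable[OF bounded_rv_power2[OF S]]
  have var: "variance Z = expectation (\<lambda>\<omega>. (Z \<omega>)\<^sup>2) - (expectation Z)\<^sup>2" if "bounded_rv Z" for Z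
    using that by (intro variance_eq bounded_rv_integrable bounded_rv_power2)
  have "expectation (\<lambda>\<omega>. (c + S \<omega>)\<^sup>2) = (expectation (\<lambda>\<omega>. c + S \<omega>))\<^sup>2 + variance S"
    using var[OF S] by (simp add: power2_sum prob_space)
  also have "variance S = (\<Sum>j\<in>J. variance (X j))"
    unfolding S_def by (rule variance_sum_indep[OF assms])
  also have "\<dots> \<le> (\<Sum>j\<in>J. expectation (\<lambda>\<omega>. (X j \<omega>)\<^sup>2))"
    by (intro sum_mono) (simp add: var assms)
  finally show ?thesis unfolding S_def by simp
qed

text \<open>Independence makes the joint law a product, so the law of the sum is a function of the
  individual laws. The summands of two copies of the scheme are known to agree in law one by one,
  and this extends the agreement to the sums.\<close>

lemma distr_sum_indep_cong:
  fixes X X' :: "'j \<Rightarrow> 'a \<Rightarrow> real"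
  assumes J: "finite J" and X: "indep_vars (\<lambda>_. borel) X J" and X': "indep_vars (\<lambda>_. borel) X' J"
    and eq: "\<And>j. j \<in> J \<Longrightarrow> distr M borel (X j) = distr M borel (X' j)"
  shows "distr M borel (\<lambda>\<omega>. \<Sum>j\<in>J. X j \<omega>) = distr M borel (\<lambda>\<omega>. \<Sum>j\<in>J. X' j \<omega>)"
\<comment> \<open>The characterisation of independence by the product law requires a nonempty index
  set.\<close>
proof (cases "J = {}")
  case False
  have *: "distr M borel (\<lambda>\<omega>. \<Sum>j\<in>J. Z j \<omega>)
      = distr (\<Pi>\<^sub>M j\<in>J. distr M borel (Z j)) borel (\<lambda>x. \<Sum>j\<in>J. x j)"
    if Z: "indep_vars (\<lambda>_. borel) Z J" for Z :: "'j \<Rightarrow> 'a \<Rightarrow> real"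
  proof -
    have [measurable]: "Z j \<in> borel_measurable M" if "j \<in> J" for j
      using Z that unfolding indep_vars_def by auto
    have "(\<Pi>\<^sub>M j\<in>J. distr M borel (Z j)) = distr M (\<Pi>\<^sub>M j\<in>J. borel) (\<lambda>\<omega>. \<lambda>j\<in>J. Z j \<omega>)"
      using Z False by (subst (asm) indep_vars_iff_distr_eq_PiM') auto
    then have "distr (\<Pi>\<^sub>M j\<in>J. distr M borel (Z j)) borel (\<lambda>x. \<Sum>j\<in>J. x j)
        = distr M borel ((\<lambda>x. \<Sum>j\<in>J. x j) \<circ> (\<lambda>\<omega>. \<lambda>j\<in>J. Z j \<omega>))"
      by (simp add: distr_distr)
    then show ?thesis by (simp add: comp_def)
  qed
  show ?thesis
    unfolding *[OF X] *[OF X'] by (intro arg_cong2[where f="\<lambda>a b. distr a b _"] PiM_cong refl eq) auto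
qed simp

text \<open>Reading independent sub-sigma-algebras as independent identity maps makes the
  composition rules for random variables applicable to them.\<close>

lemma indep_vars_id:
  assumes sub: "\<And>j. j \<in> J \<Longrightarrow> subalgebra M (A j)" and ind: "indep_sets (\<lambda>j. sets (A j)) J"
  shows "indep_vars A (\<lambda>_ \<omega>. \<omega>) J"
  unfolding indep_vars_def2
proof
  show "\<forall>j\<in>J. random_variable (A j) (\<lambda>\<omega>. \<omega>)"
    using sub by (auto intro: measurable_subalgebra_id)
  show "indep_sets (\<lambda>j. {(\<lambda>\<omega>. \<omega>) -` B \<inter> space M | B. B \<in> sets (A j)}) J"
  proof (rule indep_sets_mono_sets[OF ind])
    fix i assume "i \<in> J"
    then have "B \<inter> space M = B" if "B \<in> sets (A i)" for B
      using sub[of i] that unfolding subalgebra_def by (metis sets.Int_space_eq2)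
    then show "{(\<lambda>\<omega>. \<omega>) -` B \<inter> space M | B. B \<in> sets (A i)} \<subseteq> sets (A i)" by auto
  qed
qed

end

section \<open>The uniform distribution and integrals over time\<close>

lemma distr_uniform_01:
  assumes P: "prob_space P" and r[measurable]: "r \<in> borel_measurable P"
    and range: "\<And>\<omega>. \<omega> \<in> space P \<Longrightarrow> r \<omega> \<in> {0..1::real}"
    and cdf: "\<And>t. 0 < t \<Longrightarrow> t < 1 \<Longrightarrow> measure P {\<omega>\<in>space P. r \<omega> \<le> t} = t"
  shows "distr P borel r = density lborel (indicator {0..1})"
proof -
  interpret P: prob_space P by fact
  let ?U = "density lborel (indicator {0..1::real}) :: real measure"
  have em: "emeasure ?U A = emeasure lborel ({0..1} \<inter> A)" if "A \<in> sets borel" for A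
    using that by (simp add: emeasure_density indicator_inter_arith[symmetric])
  have U: "prob_space ?U"
    by (rule prob_spaceI) (simp add: em)
  have rd: "real_distribution (distr P borel r)"
    by (simp add: P.real_distribution_distr)
  have ru: "real_distribution ?U"
    using U by (simp add: real_distribution_def real_distribution_axioms_def)
  have "measure P {\<omega>\<in>space P. r \<omega> \<le> x} = measure lborel ({0..1} \<inter> {..x})" for x
  proof -
    consider "x < 0" | "x \<ge> 1" | "0 < x" "x < 1" | "x = 0" by linarith
    then show ?thesis
    proof cases
      case 1
      then have *: "{\<omega>\<in>space P. r \<omega> \<le> x} = {}" and "{0..1} \<inter> {..x} = {}" using range by (fastforce, auto)
      then show ?thesis by (simp only: * measure_empty)
    next
      case 2
      then have "{\<omega>\<in>space P. r \<omega> \<le> x} = space P" "{0..1} \<inter> {..x} = {0..1}" using range by (fastforce, auto)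
      then show ?thesis by (simp add: P.prob_space)
    next
      case 3
      then have "{0..1} \<inter> {..x} = {0..x}" by auto
      then show ?thesis using cdf[OF 3] 3 by simp
    next
      case 4
      \<comment> \<open>The distribution function is prescribed on the open unit interval only; that
        there is no atom at 0 follows from monotonicity as \<open>e\<close> tends to 0.\<close>
      have "measure P {\<omega>\<in>space P. r \<omega> \<le> 0} \<le> e" if "0 < e" "e < 1" for e
      proof -
        have "measure P {\<omega>\<in>space P. r \<omega> \<le> 0} \<le> measure P {\<omega>\<in>space P. r \<omega> \<le> e}"
          using that by (intro P.finite_measure_mono) auto
        then show ?thesis using cdf[OF that] by simp
      qed
      then have "measure P {\<omega>\<in>space P. r \<omega> \<le> 0} \<le> 0"
        by (intro dense_ge_bounded[of 0 1]) auto
      moreover have "{0..1} \<inter> {..0::real} = {0}" by auto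
      ultimately show ?thesis using 4 by (simp add: measure_le_0_iff)
    qed
  qed
  then have "Distribution_Functions.cdf (distr P borel r) = Distribution_Functions.cdf ?U"
    by (intro ext) (simp add: cdf_def emeasure_distr vimage_def Int_def measure_def em conj_commute)
  then show ?thesis by (rule cdf_unique[OF rd ru])
qed

text \<open>A uniform random time replaces a time integral. This links the Monte Carlo form of the
  recursion with the integral form of the backward equation. The affine substitution needs
  \<open>t < T\<close>, and for \<open>t = T\<close> both sides vanish.\<close>

lemma expectation_uniform_time:
  fixes \<phi> :: "real \<Rightarrow> real"
  assumes r[measurable]: "r \<in> borel_measurable P"
    and unif: "distr P borel r = density lborel (indicator {0..1})"
    and [measurable]: "\<phi> \<in> borel_measurable borel" and "t \<le> T"
  shows "(T - t) * (\<integral>\<omega>. \<phi> (t + (T - t) * r \<omega>) \<partial>P) = (LINT s:{t..T}|lborel. \<phi> s)"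
proof (cases "t = T")
  case True
  have "(LINT s:{T..T}|lborel. \<phi> s) = (\<integral>s. 0 \<partial>(lborel :: real measure))"
    unfolding set_lebesgue_integral_def
    by (rule Bochner_Integration.integral_cong_AE) (auto intro!: eventually_mono[OF AE_lborel_singleton[of T]])
  then show ?thesis using True by simp
next
  case False
  with \<open>t \<le> T\<close> have tT: "t < T" by simp
  have "(\<integral>\<omega>. \<phi> (t + (T - t) * r \<omega>) \<partial>P) = (\<integral>\<rho>. \<phi> (t + (T - t) * \<rho>) \<partial>distr P borel r)"
    by (subst integral_distr) auto
  also have "\<dots> = (\<integral>\<rho>. \<phi> (t + (T - t) * \<rho>) \<partial>density lborel (\<lambda>x. ennreal (indicator {0..1} x)))"
    by (simp add: unif ennreal_indicator)
  also have "\<dots> = (\<integral>\<rho>. indicator {0..1} \<rho> * \<phi> (t + (T - t) * \<rho>) \<partial>lborel)"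
    by (subst integral_density) auto
  finally have 1: "(\<integral>\<omega>. \<phi> (t + (T - t) * r \<omega>) \<partial>P) = (\<integral>\<rho>. indicator {0..1} \<rho> * \<phi> (t + (T - t) * \<rho>) \<partial>lborel)" .
  have "(LINT s:{t..T}|lborel. \<phi> s) = \<bar>T - t\<bar> *\<^sub>R (\<integral>\<rho>. indicator {t..T} (t + (T - t) * \<rho>) *\<^sub>R \<phi> (t + (T - t) * \<rho>) \<partial>lborel)"
    unfolding set_lebesgue_integral_def using tT by (intro lborel_integral_real_affine) auto
  also have "(\<lambda>\<rho>. indicator {t..T} (t + (T - t) * \<rho>) *\<^sub>R \<phi> (t + (T - t) * \<rho>))
     = (\<lambda>\<rho>. indicator {0..1} \<rho> * \<phi> (t + (T - t) * \<rho>))"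
  proof
    fix \<rho>
    have "t + (T - t) * \<rho> \<le> T \<longleftrightarrow> (T - t) * \<rho> \<le> (T - t) * 1" by simp linarith
    also have "\<dots> \<longleftrightarrow> \<rho> \<le> 1" using tT by (subst mult_le_cancel_left_pos) auto
    finally have "t + (T - t) * \<rho> \<in> {t..T} \<longleftrightarrow> \<rho> \<in> {0..1}"
      using tT by (auto simp: zero_le_mult_iff)
    then show "indicator {t..T} (t + (T - t) * \<rho>) *\<^sub>R \<phi> (t + (T - t) * \<rho>)
      = indicator {0..1} \<rho> * \<phi> (t + (T - t) * \<rho>)" by (simp add: indicator_def)
  qed
  finally show ?thesis using tT 1 by simp
qed

lemma integral_exp_time:
  fixes lam t T :: real
  assumes "lam > 0" "t \<le> T"
  shows "(LINT s:{t..T}|lborel. exp (lam * (T - s))) \<le> exp (lam * (T - t)) / lam"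
proof -
  have "has_bochner_integral lborel (\<lambda>s. indicator {t..T} s *\<^sub>R exp (lam * (T - s)))
     (- exp (lam * (T - T)) / lam - - exp (lam * (T - t)) / lam)"
    using assms
    by (intro has_bochner_integral_FTC_Icc) (auto intro!: derivative_eq_intros continuous_intros
      simp: has_real_derivative_iff_has_vector_derivative[symmetric])
  from has_bochner_integral_integral_eq[OF this] show ?thesis
    using assms by (simp add: set_lebesgue_integral_def diff_divide_distrib[symmetric] divide_right_mono)
qed

section \<open>The space-time noise of a fixed dimension\<close>

lemma space_Rd_borel[simp]: "space (Rd_borel d) = Rd d"
  by (simp add: Rd_borel_def Rd_def space_PiM)

lemma measurable_vadd[measurable (raw)]:
  assumes [measurable]: "X \<in> measurable M (Rd_borel d)" "Y \<in> measurable M (Rd_borel d)"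
  shows "(\<lambda>z. vadd d (X z) (Y z)) \<in> measurable M (Rd_borel d)"
proof -
  have "(\<lambda>z. X z i) \<in> borel_measurable M" "(\<lambda>z. Y z i) \<in> borel_measurable M" if "i \<in> {1..d}" for i
    using that assms unfolding Rd_borel_def by (auto intro: measurable_PiM_component_rev)
  then show ?thesis unfolding Rd_borel_def vadd_def by (intro measurable_restrict) auto
qed

lemma measurable_vdiff[measurable (raw)]:
  assumes [measurable]: "X \<in> measurable M (Rd_borel d)" "Y \<in> measurable M (Rd_borel d)"
  shows "(\<lambda>z. vdiff d (X z) (Y z)) \<in> measurable M (Rd_borel d)"
proof -
  have "(\<lambda>z. X z i) \<in> borel_measurable M" "(\<lambda>z. Y z i) \<in> borel_measurable M" if "i \<in> {1..d}" for i
    using that assms unfolding Rd_borel_def by (auto intro: measurable_PiM_component_rev)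
  then show ?thesis unfolding Rd_borel_def vdiff_def by (intro measurable_restrict) auto
qed

lemma measurable_Rd_component:
  "X \<in> measurable M (Rd_borel d) \<Longrightarrow> i \<in> {1..d} \<Longrightarrow> (\<lambda>z. X z i) \<in> borel_measurable M"
  unfolding Rd_borel_def by (auto intro: measurable_PiM_component_rev)

lemma measurable_Rd_componentI:
  "(\<And>z. z \<in> space M \<Longrightarrow> X z \<in> Rd d) \<Longrightarrow> (\<And>i. i \<in> {1..d} \<Longrightarrow> (\<lambda>z. X z i) \<in> borel_measurable M)
    \<Longrightarrow> X \<in> measurable M (Rd_borel d)"
  unfolding Rd_borel_def Rd_def by (intro measurable_PiM_single') (auto simp: PiE_iff Pi_iff)

lemma vadd_in_Rd[simp]: "vadd d x y \<in> Rd d" and vdiff_in_Rd[simp]: "vdiff d x y \<in> Rd d"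
  by (auto simp: vadd_def vdiff_def Rd_def)

lemma Rd_eqI: "x \<in> Rd d \<Longrightarrow> y \<in> Rd d \<Longrightarrow> (\<And>i. i \<in> {1..d} \<Longrightarrow> x i = y i) \<Longrightarrow> x = y"
  unfolding Rd_def by (rule PiE_ext)

lemma vadd_vdiff: "y \<in> Rd d \<Longrightarrow> vadd d x (vdiff d y x) = y"
  by (rule Rd_eqI) (auto simp: vadd_def vdiff_def Rd_def)

text \<open>Times are restricted to \<open>{0..T}\<close> and points to \<open>Rd d\<close>, since
  the scheme and the Brownian motions are specified there only.\<close>

definition timespace :: "real \<Rightarrow> nat \<Rightarrow> (real \<times> (nat \<Rightarrow> real)) measure"
  where "timespace T d = restrict_space borel {0..T} \<Otimes>\<^sub>M Rd_borel d"

lemma space_timespace: "space (timespace T d) = {0..T} \<times> Rd d"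
  by (simp add: timespace_def space_pair_measure space_restrict_space)

lemma measurable_timespaceD:
  assumes "Z \<in> measurable M (timespace T d)"
  shows "(\<lambda>z. fst (Z z)) \<in> borel_measurable M" "(\<lambda>z. fst (Z z)) \<in> measurable M (restrict_space borel {0..T})"
    "(\<lambda>z. snd (Z z)) \<in> measurable M (Rd_borel d)"
proof -
  show 1: "(\<lambda>z. fst (Z z)) \<in> measurable M (restrict_space borel {0..T})"
    using assms unfolding timespace_def by (rule measurable_compose) simp
  show "(\<lambda>z. fst (Z z)) \<in> borel_measurable M"
    using 1 by (auto simp: measurable_restrict_space2_iff)
  show "(\<lambda>z. snd (Z z)) \<in> measurable M (Rd_borel d)"
    using assms unfolding timespace_def by (rule measurable_compose) simp
qed

lemma measurable_timespaceI:
  assumes "A \<in> borel_measurable M" "\<And>z. z \<in> space M \<Longrightarrow> A z \<in> {0..T}" "B \<in> measurable M (Rd_borel d)"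
  shows "(\<lambda>z. (A z, B z)) \<in> measurable M (timespace T d)"
  using assms unfolding timespace_def by (intro measurable_Pair) (auto simp: measurable_restrict_space2_iff)

text \<open>
  Squared parabolic distance. The factor \<open>d\<close> absorbs the passage from the \<open>l\<^sup>1\<close>- to the Euclidean norm,
  and the time weight is chosen such that the distance is preserved in mean square by \<open>shift\<close> below.
\<close>

definition pdist2 :: "nat \<Rightarrow> real \<times> (nat \<Rightarrow> real) \<Rightarrow> real \<times> (nat \<Rightarrow> real) \<Rightarrow> real"
  where "pdist2 d p q = real d * ((\<Sum>i=1..d. (snd p i - snd q i)\<^sup>2) + real d * \<bar>fst p - fst q\<bar>)"

lemma pdist2_nonneg[simp]: "0 \<le> pdist2 d p q"
  by (auto simp: pdist2_def intro!: mult_nonneg_nonneg add_nonneg_nonneg sum_nonneg)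

lemma pdist2_commute: "pdist2 d p q = pdist2 d q p"
  by (simp add: pdist2_def power2_commute abs_minus_commute)

text \<open>For \<open>1 \<le> d\<close> the time weight in \<open>pdist2\<close> is at least 1.
  This pays for the increment of the prefactor \<open>T - t\<close> of the recursion.\<close>

lemma abs_time_le_pdist2: "1 \<le> d \<Longrightarrow> \<bar>fst p - fst q\<bar> \<le> pdist2 d p q"
proof -
  assume d: "1 \<le> d"
  have "1 * \<bar>fst p - fst q\<bar> \<le> (real d * real d) * \<bar>fst p - fst q\<bar>"
    using d by (intro mult_right_mono) (auto intro: order_trans[OF _ mult_mono[of 1 _ 1]])
  also have "\<dots> \<le> pdist2 d p q"
    by (simp add: pdist2_def distrib_left sum_nonneg)
  finally show ?thesis by simp
qed

lemma measurable_pdist2[measurable (raw)]: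
  assumes "X \<in> measurable M (timespace T d)" "Y \<in> measurable M (timespace T d)"
  shows "(\<lambda>z. pdist2 d (X z) (Y z)) \<in> borel_measurable M"
  unfolding pdist2_def
  using measurable_timespaceD[OF assms(1)] measurable_timespaceD[OF assms(2)]
  by (intro borel_measurable_times borel_measurable_add borel_measurable_sum borel_measurable_power
    borel_measurable_diff borel_measurable_const borel_measurable_abs) (auto intro: measurable_Rd_component)

text \<open>One dimension is fixed. \<open>src\<close> lists the events of the single sources as one
  independent family over \<open>UNIV \<times> Theta\<close>, so that independence of derived
  quantities reduces to the disjointness of sets of indices.\<close>

locale noise = prob_space P for P :: "'a measure" +
  fixes T :: real and d :: nat and F :: "real \<Rightarrow> 'a measure"
    and r :: "int list \<Rightarrow> 'a \<Rightarrow> real" and W :: "int list \<Rightarrow> real \<Rightarrow> 'a \<Rightarrow> nat \<Rightarrow> real"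
    and src :: "bool \<times> int list \<Rightarrow> 'a set set"
  assumes T_pos: "0 < T" and d_pos: "1 \<le> d"
    and filt: "filtration_upto P T F"
    and r_meas: "\<theta> \<in> Theta \<Longrightarrow> r \<theta> \<in> borel_measurable P"
    and r_range: "\<theta> \<in> Theta \<Longrightarrow> \<omega> \<in> space P \<Longrightarrow> r \<theta> \<omega> \<in> {0..1}"
    and r_law: "\<theta> \<in> Theta \<Longrightarrow> distr P borel (r \<theta>) = density lborel (indicator {0..1})"
    and W_BM: "\<theta> \<in> Theta \<Longrightarrow> std_brownian_motion P F T d (W \<theta>)"
    and src_r: "\<theta> \<in> Theta \<Longrightarrow> src (True, \<theta>) = generated_sets P (r \<theta>) borel"
    and src_W: "\<theta> \<in> Theta \<Longrightarrow> src (False, \<theta>) = generated_sets P (trajectory T (W \<theta>)) (path_space T d)"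
    and src_indep: "indep_sets src (UNIV \<times> Theta)"
begin

abbreviation E :: "(real \<times> (nat \<Rightarrow> real)) measure" where "E \<equiv> timespace T d"

text \<open>\<open>galg K\<close> is the information in the sources \<open>K\<close>; \<open>(True, \<theta>)\<close> stands for \<open>r \<theta>\<close>, \<open>(False, \<theta>)\<close> for \<open>W \<theta>\<close>.\<close>

definition galg :: "(bool \<times> int list) set \<Rightarrow> 'a measure"
  where "galg K = sigma (space P) (\<Union>k\<in>K. src k)"

lemma src_sub: "k \<in> UNIV \<times> Theta \<Longrightarrow> src k \<subseteq> sets P"
  using src_indep unfolding indep_sets_def by auto

lemma src_Pow: "K \<subseteq> UNIV \<times> Theta \<Longrightarrow> (\<Union>k\<in>K. src k) \<subseteq> Pow (space P)"
  using src_sub sets.sets_into_space by blast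

lemma space_galg[simp]: "space (galg K) = space P"
  by (simp add: galg_def space_measure_of_conv)

lemma sets_galg: "K \<subseteq> UNIV \<times> Theta \<Longrightarrow> sets (galg K) = sigma_sets (space P) (\<Union>k\<in>K. src k)"
  unfolding galg_def by (rule sets_measure_of[OF src_Pow])

lemma subalgebra_galg: "K \<subseteq> UNIV \<times> Theta \<Longrightarrow> subalgebra P (galg K)"
  using src_sub unfolding subalgebra_def sets_galg by (auto intro!: sets.sigma_sets_subset)

lemma measurable_galg_P: "K \<subseteq> UNIV \<times> Theta \<Longrightarrow> X \<in> measurable (galg K) N \<Longrightarrow> X \<in> measurable P N"
  by (rule measurable_from_subalg[OF subalgebra_galg])

lemma sets_galg_mono: "K \<subseteq> K' \<Longrightarrow> K' \<subseteq> UNIV \<times> Theta \<Longrightarrow> sets (galg K) \<subseteq> sets (galg K')"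
  by (subst (1 2) sets_galg) (auto intro!: sigma_sets_mono')

lemma id_galg:
  assumes "K \<subseteq> K'" "K' \<subseteq> UNIV \<times> Theta"
  shows "(\<lambda>\<omega>. \<omega>) \<in> measurable (galg K') (galg K)"
proof (rule measurableI)
  fix A assume A: "A \<in> sets (galg K)"
  then have "(\<lambda>\<omega>. \<omega>) -` A \<inter> space (galg K') = A" using sets.sets_into_space[OF A] by auto
  then show "(\<lambda>\<omega>. \<omega>) -` A \<inter> space (galg K') \<in> sets (galg K')" using A sets_galg_mono[OF assms] by auto
qed simp

lemma id_galg_P: "K \<subseteq> UNIV \<times> Theta \<Longrightarrow> (\<lambda>\<omega>. \<omega>) \<in> measurable P (galg K)"
  by (rule measurable_subalgebra_id[OF subalgebra_galg])

lemma src_subset_galg: "k \<in> K \<Longrightarrow> K \<subseteq> UNIV \<times> Theta \<Longrightarrow> src k \<subseteq> sets (galg K)"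
  by (auto simp: sets_galg)

lemma Int_stable_src: "k \<in> UNIV \<times> Theta \<Longrightarrow> Int_stable (src k)"
  by (cases k; cases "fst k") (auto simp: src_r src_W generated_sets_def Int_stable_def)

text \<open>Each \<open>src k\<close> is stable under intersections, so grouping an independent
  family into disjoint blocks preserves independence.\<close>

lemma indep_galg:
  assumes K: "\<And>j. j \<in> J \<Longrightarrow> K j \<subseteq> UNIV \<times> Theta" and dis: "disjoint_family_on K J"
  shows "indep_sets (\<lambda>j. sets (galg (K j))) J"
proof -
  have "indep_sets (\<lambda>j. sigma_sets (space P) (\<Union>k\<in>K j. src k)) J"
    by (rule indep_sets_collect_sigma[OF indep_sets_mono_index[OF _ src_indep] _ dis])
      (use K in \<open>auto intro!: Int_stable_src\<close>)
  then show ?thesis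
    using K by (subst indep_sets_cong[OF refl sets_galg]) auto
qed

lemma indep_subalg_galg:
  assumes K: "K \<subseteq> UNIV \<times> Theta" "K' \<subseteq> UNIV \<times> Theta" and dis: "K \<inter> K' = {}"
  shows "indep_subalg (galg K) (galg K')"
proof -
  have "indep_sets (\<lambda>j. sets (galg (case_bool K K' j))) UNIV"
    by (rule indep_galg) (use K dis in \<open>auto simp: disjoint_family_on_def split: bool.splits\<close>)
  also have "(\<lambda>j. sets (galg (case_bool K K' j))) = case_bool (sets (galg K)) (sets (galg K'))"
    by (auto split: bool.splits)
  finally show ?thesis using K subalgebra_galg by (simp add: indep_subalg_def indep_set_def)
qed

lemma indep_vars_galg:
  assumes K: "\<And>j. j \<in> J \<Longrightarrow> K j \<subseteq> UNIV \<times> Theta" and dis: "disjoint_family_on K J"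
    and X: "\<And>j. j \<in> J \<Longrightarrow> X j \<in> measurable (galg (K j)) N"
  shows "indep_vars (\<lambda>_. N) X J"
proof -
  have "indep_vars (\<lambda>j. galg (K j)) (\<lambda>_ \<omega>. \<omega>) J"
    by (rule indep_vars_id[OF _ indep_galg]) (use K dis subalgebra_galg in auto)
  from indep_vars_compose2[OF this, of X "\<lambda>_. N"] X show ?thesis by simp
qed

lemma r_measurable: "\<theta> \<in> Theta \<Longrightarrow> (True, \<theta>) \<in> K \<Longrightarrow> K \<subseteq> UNIV \<times> Theta \<Longrightarrow> r \<theta> \<in> borel_measurable (galg K)"
proof (rule measurableI)
  fix A :: "real set" assume \<theta>: "\<theta> \<in> Theta" and K: "(True, \<theta>) \<in> K" "K \<subseteq> UNIV \<times> Theta" and "A \<in> sets borel"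
  then have "r \<theta> -` A \<inter> space P \<in> generated_sets P (r \<theta>) borel"
    unfolding generated_sets_def by (intro in_vimage_algebra) auto
  then show "r \<theta> -` A \<inter> space (galg K) \<in> sets (galg K)"
    using src_subset_galg[OF K] src_r[OF \<theta>] by auto
qed simp

lemma W_in_Rd: "\<theta> \<in> Theta \<Longrightarrow> s \<in> {0..T} \<Longrightarrow> \<omega> \<in> space P \<Longrightarrow> W \<theta> s \<omega> \<in> Rd d"
  using W_BM[of \<theta>] filt unfolding std_brownian_motion_def filtration_upto_def subalgebra_def
  by (metis measurable_space space_Rd_borel)

text \<open>The source is generated by the whole trajectory, of which the value at a single time is
  a coordinate.\<close>

lemma W_measurable:
  assumes \<theta>: "\<theta> \<in> Theta" and K: "(False, \<theta>) \<in> K" "K \<subseteq> UNIV \<times> Theta" and s: "s \<in> {0..T}"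
  shows "W \<theta> s \<in> measurable (galg K) (Rd_borel d)"
proof (rule measurableI)
  fix A assume A: "A \<in> sets (Rd_borel d)"
  have tr: "trajectory T (W \<theta>) \<in> space P \<rightarrow> space (path_space T d)"
    using W_in_Rd[OF \<theta>] by (auto simp: trajectory_def path_space_def space_PiM)
  have "(\<lambda>w. w s) -` A \<inter> space (path_space T d) \<in> sets (path_space T d)"
    using A s unfolding path_space_def by (intro measurable_sets[OF measurable_component_singleton]) auto
  then have "trajectory T (W \<theta>) -` ((\<lambda>w. w s) -` A \<inter> space (path_space T d)) \<inter> space P
      \<in> generated_sets P (trajectory T (W \<theta>)) (path_space T d)"
    unfolding generated_sets_def by (rule in_vimage_algebra)
  also have "trajectory T (W \<theta>) -` ((\<lambda>w. w s) -` A \<inter> space (path_space T d)) \<inter> space P = W \<theta> s -` A \<inter> space P"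
    using tr s by (auto simp: trajectory_def)
  finally show "W \<theta> s -` A \<inter> space (galg K) \<in> sets (galg K)"
    using src_subset_galg[OF K] src_W[OF \<theta>] by auto
qed (use W_in_Rd[OF \<theta> s] in auto)

lemma W_measurable_P: "\<theta> \<in> Theta \<Longrightarrow> s \<in> {0..T} \<Longrightarrow> W \<theta> s \<in> measurable P (Rd_borel d)"
  using W_measurable[of \<theta> "{(False, \<theta>)}" s] measurable_galg_P[of "{(False, \<theta>)}"] by auto

text \<open>Path continuity reduces a random time to countably many deterministic ones:
  \<open>S\<close> is rounded down to a multiple of \<open>1 / (k + 1)\<close>, the resulting map is
  measurable, and it converges pointwise as \<open>k\<close> grows.\<close>

lemma W_joint_measurable:
  assumes \<theta>: "\<theta> \<in> Theta" and K: "(False, \<theta>) \<in> K" "K \<subseteq> UNIV \<times> Theta"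
    and S: "S \<in> borel_measurable N" "\<And>z. z \<in> space N \<Longrightarrow> S z \<in> {0..T}" and O: "X \<in> measurable N (galg K)"
  shows "(\<lambda>z. W \<theta> (S z) (X z)) \<in> measurable N (Rd_borel d)"
proof (rule measurable_Rd_componentI)
  have X: "X z \<in> space P" if "z \<in> space N" for z using measurable_space[OF O that] by simp
  show "W \<theta> (S z) (X z) \<in> Rd d" if "z \<in> space N" for z
    using W_in_Rd[OF \<theta> S(2)[OF that] X[OF that]] .
  fix i assume i: "i \<in> {1..d}"
  define G where "G = (\<lambda>k::nat. \<lambda>j::int. \<lambda>z.
    if real_of_int j / real (Suc k) \<in> {0..T} then W \<theta> (real_of_int j / real (Suc k)) (X z) i else 0)"
  have G: "G k j \<in> borel_measurable N" for k j
  proof (cases "real_of_int j / real (Suc k) \<in> {0..T}")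
    case True
    then have "(\<lambda>z. W \<theta> (real_of_int j / real (Suc k)) (X z)) \<in> measurable N (Rd_borel d)"
      by (intro measurable_compose[OF O] W_measurable[OF \<theta> K])
    from measurable_Rd_component[OF this i] True show ?thesis by (simp add: G_def)
  next
    case False then show ?thesis by (simp only: G_def if_False borel_measurable_const)
  qed
  have fl: "(\<lambda>z. \<lfloor>real (Suc k) * S z\<rfloor>) \<in> measurable N (count_space UNIV)" for k
    using S(1) by measurable
  show "(\<lambda>z. W \<theta> (S z) (X z) i) \<in> borel_measurable N"
  proof (rule borel_measurable_LIMSEQ_real)
    show "(\<lambda>z. G k \<lfloor>real (Suc k) * S z\<rfloor> z) \<in> borel_measurable N" for k
      by (rule measurable_compose_countable[OF G fl])
    fix z assume z: "z \<in> space N"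
    define tk where "tk = (\<lambda>k. real_of_int \<lfloor>real (Suc k) * S z\<rfloor> / real (Suc k))"
    have S0: "0 \<le> S z" "S z \<le> T" using S(2)[OF z] by auto
    have tk_le: "tk k \<le> S z" for k
    proof -
      have "real_of_int \<lfloor>real (Suc k) * S z\<rfloor> \<le> real (Suc k) * S z" by linarith
      then show ?thesis unfolding tk_def by (subst pos_divide_le_eq) (auto simp: mult.commute)
    qed
    have tk_ge: "S z - 1 / real (Suc k) \<le> tk k" for k
    proof -
      have "real (Suc k) * S z - 1 \<le> real_of_int \<lfloor>real (Suc k) * S z\<rfloor>" by linarith
      then have "(real (Suc k) * S z - 1) / real (Suc k) \<le> tk k"
        unfolding tk_def by (rule divide_right_mono) simp
      then show ?thesis by (simp add: diff_divide_distrib)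
    qed
    have tk_in: "tk k \<in> {0..T}" for k
      using tk_le[of k] S0 by (auto simp: tk_def)
    have "tk \<longlonglongrightarrow> S z"
    proof (rule real_tendsto_sandwich[of "\<lambda>k. S z - 1 / real (Suc k)" _ _ "\<lambda>_. S z"])
      have "(\<lambda>k. S z - inverse (real (Suc k))) \<longlonglongrightarrow> S z - 0"
        by (intro tendsto_intros LIMSEQ_inverse_real_of_nat)
      then show "(\<lambda>k. S z - 1 / real (Suc k)) \<longlonglongrightarrow> S z" by (simp add: inverse_eq_divide)
    qed (use tk_le tk_ge in auto)
    moreover have "continuous_on {0..T} (\<lambda>t. W \<theta> t (X z) i)"
    proof -
      have "continuous_on {0..T} (\<lambda>t. W \<theta> t (X z))"
        using W_BM[OF \<theta>] X[OF z] unfolding std_brownian_motion_def by auto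
      then show ?thesis by (rule continuous_on_product_then_coordinatewise)
    qed
    ultimately have "(\<lambda>k. W \<theta> (tk k) (X z) i) \<longlonglongrightarrow> W \<theta> (S z) (X z) i"
      using tk_in S(2)[OF z] by (intro continuous_on_tendsto_compose[of "{0..T}" "\<lambda>t. W \<theta> t (X z) i"]) auto
    moreover have "G k \<lfloor>real (Suc k) * S z\<rfloor> z = W \<theta> (tk k) (X z) i" for k
      using tk_in[of k] by (simp add: G_def tk_def)
    ultimately show "(\<lambda>k. G k \<lfloor>real (Suc k) * S z\<rfloor> z) \<longlonglongrightarrow> W \<theta> (S z) (X z) i" by simp
  qed
qed

text \<open>The random point at which the recursion and the Feynman-Kac equation evaluate the
  nonlinearity. Since \<open>r \<theta>\<close> is uniform, its time is uniform between
  \<open>fst p\<close> and \<open>T\<close>; the position is moved by \<open>W \<theta>\<close> over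
  the elapsed time only.\<close>

definition shift :: "int list \<Rightarrow> real \<times> (nat \<Rightarrow> real) \<Rightarrow> 'a \<Rightarrow> real \<times> (nat \<Rightarrow> real)"
  where "shift \<theta> p \<omega> = (fst p + (T - fst p) * r \<theta> \<omega>, vadd d (snd p) (W \<theta> ((T - fst p) * r \<theta> \<omega>) \<omega>))"

lemma scaled_time_in:
  assumes "t \<in> {0..T}" "\<rho> \<in> {0..1::real}"
  shows "(T - t) * \<rho> \<in> {0..T}" "t + (T - t) * \<rho> \<in> {0..T}"
proof -
  have "(T - t) * \<rho> \<le> (T - t) * 1" by (rule mult_left_mono) (use assms in auto)
  moreover have "0 \<le> (T - t) * \<rho>" using assms by auto
  ultimately show "(T - t) * \<rho> \<in> {0..T}" "t + (T - t) * \<rho> \<in> {0..T}" using assms by auto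
qed

lemma shift_in: "\<theta> \<in> Theta \<Longrightarrow> p \<in> space E \<Longrightarrow> \<omega> \<in> space P \<Longrightarrow> shift \<theta> p \<omega> \<in> space E"
  using scaled_time_in[of "fst p" "r \<theta> \<omega>"] r_range[of \<theta> \<omega>] by (auto simp: shift_def space_timespace)

lemma shift_measurable:
  assumes \<theta>: "\<theta> \<in> Theta" and K: "UNIV \<times> {\<theta>} \<subseteq> K" "K \<subseteq> UNIV \<times> Theta"
    and X: "X \<in> measurable N E" and O: "Y \<in> measurable N (galg K)"
  shows "(\<lambda>z. shift \<theta> (X z) (Y z)) \<in> measurable N E"
proof -
  have r[measurable]: "(\<lambda>z. r \<theta> (Y z)) \<in> borel_measurable N"
    using K by (intro measurable_compose[OF O] r_measurable[OF \<theta>]) auto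
  note [measurable] = measurable_timespaceD[OF X]
  have sp: "fst (X z) \<in> {0..T}" "r \<theta> (Y z) \<in> {0..1}" if "z \<in> space N" for z
    using measurable_space[OF X that] measurable_space[OF O that] r_range[OF \<theta>]
    by (auto simp: space_timespace)
  have [measurable]: "(\<lambda>z. W \<theta> ((T - fst (X z)) * r \<theta> (Y z)) (Y z)) \<in> measurable N (Rd_borel d)"
    using K by (intro W_joint_measurable[OF \<theta> _ _ _ _ O]) (auto intro!: scaled_time_in sp simp del: atLeastAtMost_iff)
  show ?thesis unfolding shift_def
    by (rule measurable_timespaceI) (use sp scaled_time_in in \<open>auto simp del: atLeastAtMost_iff\<close>)
qed

lemma shift_measurable1:
  assumes "\<theta> \<in> Theta" "UNIV \<times> {\<theta>} \<subseteq> K" "K \<subseteq> UNIV \<times> Theta" "p \<in> space E"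
  shows "shift \<theta> p \<in> measurable (galg K) E"
  using shift_measurable[OF assms(1-3), of "\<lambda>_. p" "galg K" "\<lambda>\<omega>. \<omega>"] assms(4) by simp

lemma increment_moments:
  assumes \<theta>: "\<theta> \<in> Theta" and st: "0 \<le> s" "s < t" "t \<le> T" and i: "i \<in> {1..d}"
  shows "expectation (\<lambda>\<omega>. W \<theta> t \<omega> i - W \<theta> s \<omega> i) = 0"
    and "expectation (\<lambda>\<omega>. (W \<theta> t \<omega> i - W \<theta> s \<omega> i)\<^sup>2) = t - s"
    and "integrable P (\<lambda>\<omega>. (W \<theta> t \<omega> i - W \<theta> s \<omega> i)\<^sup>2)"
    and "integrable P (\<lambda>\<omega>. W \<theta> t \<omega> i - W \<theta> s \<omega> i)"
proof -
  let ?D = "\<lambda>\<omega>. vdiff d (W \<theta> t \<omega>) (W \<theta> s \<omega>)" and ?n = "density lborel (normal_density 0 (sqrt (t - s)))"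
  have [measurable]: "W \<theta> t \<in> measurable P (Rd_borel d)" "W \<theta> s \<in> measurable P (Rd_borel d)"
    using st by (auto intro!: W_measurable_P \<theta>)
  have law: "distr P (Rd_borel d) ?D = PiM {1..d} (\<lambda>_. ?n)"
    using W_BM[OF \<theta>] st unfolding std_brownian_motion_def by auto
  have pos: "0 < sqrt (t - s)" using st by simp
  have comp[measurable]: "(\<lambda>x. x i) \<in> borel_measurable (Rd_borel d)"
    using i by (intro measurable_Rd_component[of "\<lambda>x. x"]) auto
  have eq: "?D \<omega> i = W \<theta> t \<omega> i - W \<theta> s \<omega> i" for \<omega> using i by (auto simp: vdiff_def)
  have "distr P borel (\<lambda>\<omega>. ?D \<omega> i) = distr (distr P (Rd_borel d) ?D) borel (\<lambda>x. x i)"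
    by (subst distr_distr) (auto simp: comp_def)
  also have "\<dots> = distr (PiM {1..d} (\<lambda>_. ?n)) ?n (\<lambda>x. x i)"
    unfolding law by (rule distr_cong) auto
  also have "\<dots> = ?n"
    by (rule distr_PiM_component) (use prob_space_normal_density[OF pos] i in auto)
  finally have "distr P borel (\<lambda>\<omega>. W \<theta> t \<omega> i - W \<theta> s \<omega> i) = ?n" by (simp add: eq)
  moreover have m[measurable]: "(\<lambda>\<omega>. W \<theta> t \<omega> i - W \<theta> s \<omega> i) \<in> borel_measurable P"
    using i by (intro borel_measurable_diff measurable_Rd_component) auto
  ultimately have D: "distributed P lborel (\<lambda>\<omega>. W \<theta> t \<omega> i - W \<theta> s \<omega> i) (normal_density 0 (sqrt (t - s)))"
    by (simp add: distributed_def distr_cong[OF refl sets_lborel])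
  show 1: "expectation (\<lambda>\<omega>. W \<theta> t \<omega> i - W \<theta> s \<omega> i) = 0"
    by (rule normal_distributed_expectation[OF pos D])
  show "expectation (\<lambda>\<omega>. (W \<theta> t \<omega> i - W \<theta> s \<omega> i)\<^sup>2) = t - s"
    using normal_distributed_variance[OF pos D] 1 st by simp
  show "integrable P (\<lambda>\<omega>. W \<theta> t \<omega> i - W \<theta> s \<omega> i)"
    using distributed_integrable[OF D, of "\<lambda>x. x"] integrable_normal_moment[OF pos, of 0 1] by simp
  show "integrable P (\<lambda>\<omega>. (W \<theta> t \<omega> i - W \<theta> s \<omega> i)\<^sup>2)"
    using distributed_integrable[OF D, of "\<lambda>x. x\<^sup>2"] integrable_normal_moment[OF pos, of 0 2] by simp
qed

text \<open>The increment is centred, so the cross term vanishes. The absolute value covers both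
  orders of the times by exchanging their roles together with the sign of \<open>c\<close>.\<close>

lemma shifted_increment_moment:
  assumes \<theta>: "\<theta> \<in> Theta" and s: "s \<in> {0..T}" and t: "t \<in> {0..T}" and i: "i \<in> {1..d}"
  shows "has_bochner_integral P (\<lambda>\<omega>. (c + W \<theta> t \<omega> i - W \<theta> s \<omega> i)\<^sup>2) (c\<^sup>2 + \<bar>t - s\<bar>)"
proof -
  have *: "has_bochner_integral P (\<lambda>\<omega>. (c + W \<theta> t \<omega> i - W \<theta> s \<omega> i)\<^sup>2) (c\<^sup>2 + (t - s))"
    if "s < t" "s \<in> {0..T}" "t \<in> {0..T}" for c s t
  proof -
    note m = increment_moments[OF \<theta> _ that(1) _ i]
    have "has_bochner_integral P (\<lambda>\<omega>. c\<^sup>2 + 2 * c * (W \<theta> t \<omega> i - W \<theta> s \<omega> i) + (W \<theta> t \<omega> i - W \<theta> s \<omega> i)\<^sup>2)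
      (c\<^sup>2 + 2 * c * 0 + (t - s))"
      using that m
      by (intro has_bochner_integral_add has_bochner_integral_mult_right)
        (auto simp: has_bochner_integral_iff prob_space)
    also have "(\<lambda>\<omega>. c\<^sup>2 + 2 * c * (W \<theta> t \<omega> i - W \<theta> s \<omega> i) + (W \<theta> t \<omega> i - W \<theta> s \<omega> i)\<^sup>2)
      = (\<lambda>\<omega>. (c + W \<theta> t \<omega> i - W \<theta> s \<omega> i)\<^sup>2)"
      by (auto simp: power2_eq_square algebra_simps)
    finally show ?thesis by simp
  qed
  consider "s < t" | "t < s" | "s = t" by linarith
  then show ?thesis
  proof cases
    case 1 then show ?thesis using *[OF 1 s t, of c] by simp
  next
    case 2
    have "(\<lambda>\<omega>. (- c + W \<theta> s \<omega> i - W \<theta> t \<omega> i)\<^sup>2) = (\<lambda>\<omega>. (c + W \<theta> t \<omega> i - W \<theta> s \<omega> i)\<^sup>2)"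
      by (auto simp: power2_eq_square algebra_simps)
    then show ?thesis using *[OF 2 t s, of "- c"] 2 by simp
  next
    case 3 then show ?thesis by (simp add: has_bochner_integral_iff prob_space)
  qed
qed

text \<open>Each of the \<open>d\<close> coordinates contributes \<open>\<bar>t - s\<bar>\<close>,
  so elapsed times receive the same factor \<open>d\<close> as clock times have in
  \<open>pdist2\<close>. Differences of both kinds can therefore be traded against each
  other.\<close>

lemma pdist2_shift_W:
  assumes \<theta>: "\<theta> \<in> Theta" and s: "s \<in> {0..T}" and t: "t \<in> {0..T}"
  shows "has_bochner_integral P (\<lambda>\<omega>. pdist2 d (a, vadd d x (W \<theta> t \<omega>)) (b, vadd d y (W \<theta> s \<omega>)))
    (real d * ((\<Sum>i=1..d. (x i - y i)\<^sup>2) + real d * (\<bar>t - s\<bar> + \<bar>a - b\<bar>)))"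
proof -
  have "has_bochner_integral P (\<lambda>\<omega>. real d * ((\<Sum>i=1..d. ((x i - y i) + W \<theta> t \<omega> i - W \<theta> s \<omega> i)\<^sup>2) + real d * \<bar>a - b\<bar>))
    (real d * ((\<Sum>i=1..d. (x i - y i)\<^sup>2 + \<bar>t - s\<bar>) + real d * \<bar>a - b\<bar>))"
    by (intro has_bochner_integral_mult_right has_bochner_integral_add has_bochner_integral_sum
      shifted_increment_moment \<theta> s t) (auto simp: has_bochner_integral_iff prob_space)
  also have "(\<lambda>\<omega>. real d * ((\<Sum>i=1..d. ((x i - y i) + W \<theta> t \<omega> i - W \<theta> s \<omega> i)\<^sup>2) + real d * \<bar>a - b\<bar>))
    = (\<lambda>\<omega>. pdist2 d (a, vadd d x (W \<theta> t \<omega>)) (b, vadd d y (W \<theta> s \<omega>)))"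
    by (intro ext) (auto simp: pdist2_def vadd_def algebra_simps intro!: arg_cong2[where f="(+)"] sum.cong)
  also have "(real d * ((\<Sum>i=1..d. (x i - y i)\<^sup>2 + \<bar>t - s\<bar>) + real d * \<bar>a - b\<bar>))
    = real d * ((\<Sum>i=1..d. (x i - y i)\<^sup>2) + real d * (\<bar>t - s\<bar> + \<bar>a - b\<bar>))"
    by (simp add: sum.distrib algebra_simps)
  finally show ?thesis .
qed

text \<open>The uniform time and the Brownian motion of one index are distinct sources, so the time
  can be frozen.\<close>

lemma nn_integral_r_W:
  fixes h :: "real \<Rightarrow> 'a \<Rightarrow> ennreal"
  assumes \<theta>: "\<theta> \<in> Theta" and h: "(\<lambda>(\<rho>, \<omega>). h \<rho> \<omega>) \<in> borel_measurable (restrict_space borel {0..1} \<Otimes>\<^sub>M galg {(False, \<theta>)})"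
  shows "(\<integral>\<^sup>+\<omega>. h (r \<theta> \<omega>) \<omega> \<partial>P) = (\<integral>\<^sup>+\<omega>'. (\<integral>\<^sup>+\<omega>. h (r \<theta> \<omega>') \<omega> \<partial>P) \<partial>P)"
proof -
  have "indep_subalg (galg {(True, \<theta>)}) (galg {(False, \<theta>)})"
    using \<theta> by (intro indep_subalg_galg) auto
  moreover have "r \<theta> \<in> measurable (galg {(True, \<theta>)}) (restrict_space borel {0..1})"
    using \<theta> r_measurable[OF \<theta>, of "{(True, \<theta>)}"] r_range[OF \<theta>] by (auto simp: measurable_restrict_space2_iff)
  ultimately show ?thesis
    using nn_integral_indep_subalg[of "galg {(True, \<theta>)}" "galg {(False, \<theta>)}" "r \<theta>" "restrict_space borel {0..1}"
      "\<lambda>\<omega>. \<omega>" "galg {(False, \<theta>)}" "\<lambda>(\<rho>, \<omega>). h \<rho> \<omega>"] h by simp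
qed

text \<open>The case \<open>s = 0\<close> is separate, since the process starts in 0 almost surely
  only and the law of the increments is given for strictly ordered times.\<close>

lemma distr_W:
  assumes \<theta>: "\<theta> \<in> Theta" and s: "s \<in> {0..T}"
  shows "distr P (Rd_borel d) (W \<theta> s) =
      (if s = 0 then distr P (Rd_borel d) (\<lambda>_. \<lambda>i\<in>{1..d}. 0)
       else PiM {1..d} (\<lambda>_. density lborel (normal_density 0 (sqrt s))))"
proof -
  have W0: "AE \<omega> in P. \<forall>i\<in>{1..d}. W \<theta> 0 \<omega> i = 0"
    using W_BM[OF \<theta>] unfolding std_brownian_motion_def by auto
  have [measurable]: "W \<theta> s \<in> measurable P (Rd_borel d)" "W \<theta> 0 \<in> measurable P (Rd_borel d)"
    using s T_pos by (auto intro!: W_measurable_P \<theta>)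
  have z: "(\<lambda>i\<in>{1..d}. 0::real) \<in> Rd d" by (auto simp: Rd_def)
  show ?thesis
  proof (cases "s = 0")
    case True
    have "AE \<omega> in P. W \<theta> 0 \<omega> = (\<lambda>i\<in>{1..d}. 0)"
      using W0 AE_space by eventually_elim (use z T_pos W_in_Rd[OF \<theta>, of 0] in \<open>auto intro!: Rd_eqI[of _ d]\<close>)
    then have "distr P (Rd_borel d) (W \<theta> 0) = distr P (Rd_borel d) (\<lambda>_. \<lambda>i\<in>{1..d}. 0)"
      using z by (intro distr_cong_AE) auto
    then show ?thesis using True by (simp del: distr_const)
  next
    case False
    have "AE \<omega> in P. W \<theta> s \<omega> = vdiff d (W \<theta> s \<omega>) (W \<theta> 0 \<omega>)"
      using W0 AE_space
      by eventually_elim (use W_in_Rd[OF \<theta> s] in \<open>auto intro!: Rd_eqI[of _ d] simp: vdiff_def Rd_def\<close>)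
    then have "distr P (Rd_borel d) (W \<theta> s) = distr P (Rd_borel d) (\<lambda>\<omega>. vdiff d (W \<theta> s \<omega>) (W \<theta> 0 \<omega>))"
      by (intro distr_cong_AE) auto
    also have "\<dots> = PiM {1..d} (\<lambda>_. density lborel (normal_density 0 (sqrt (s - 0))))"
      using W_BM[OF \<theta>] s False unfolding std_brownian_motion_def by auto
    finally show ?thesis using False by simp
  qed
qed

lemma W_law: "\<theta> \<in> Theta \<Longrightarrow> \<theta>' \<in> Theta \<Longrightarrow> s \<in> {0..T} \<Longrightarrow> distr P (Rd_borel d) (W \<theta> s) = distr P (Rd_borel d) (W \<theta>' s)"
  by (simp add: distr_W)

lemma distr_increment:
  assumes \<theta>: "\<theta> \<in> Theta" and st: "0 \<le> t" "t \<le> s" "s \<le> T"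
  shows "distr P (Rd_borel d) (\<lambda>\<omega>. vdiff d (W \<theta> s \<omega>) (W \<theta> t \<omega>)) = distr P (Rd_borel d) (W \<theta> (s - t))"
proof (cases "s = t")
  case True
  have "vdiff d x x = (\<lambda>i\<in>{1..d}. 0)" for x by (auto simp: vdiff_def)
  then show ?thesis using True st distr_W[OF \<theta>, of 0] T_pos by (simp del: distr_const)
next
  case False
  then have "distr P (Rd_borel d) (\<lambda>\<omega>. vdiff d (W \<theta> s \<omega>) (W \<theta> t \<omega>))
      = PiM {1..d} (\<lambda>_. density lborel (normal_density 0 (sqrt (s - t))))"
    using W_BM[OF \<theta>] st unfolding std_brownian_motion_def by auto
  then show ?thesis using False st distr_W[OF \<theta>, of "s - t"] by simp
qed

end

section \<open>Law, time integral and mean square isometry of the random shift\<close>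

context noise
begin

lemma W_shift_measurable:
  assumes \<theta>: "\<theta> \<in> Theta" and K: "(False, \<theta>) \<in> K" "K \<subseteq> UNIV \<times> Theta" and t: "t \<in> {0..T}" and x: "x \<in> Rd d"
    and R: "R \<in> borel_measurable N" "\<And>z. z \<in> space N \<Longrightarrow> R z \<in> {0..1}" and O: "Y \<in> measurable N (galg K)"
  shows "(\<lambda>z. (t + (T - t) * R z, vadd d x (W \<theta> ((T - t) * R z) (Y z)))) \<in> measurable N E"
proof -
  note [measurable] = R(1)
  have [measurable]: "(\<lambda>z. W \<theta> ((T - t) * R z) (Y z)) \<in> measurable N (Rd_borel d)"
    by (intro W_joint_measurable[OF \<theta> K _ _ O]) (use R(2) scaled_time_in[OF t] in \<open>auto simp del: atLeastAtMost_iff\<close>)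
  show ?thesis
    using x by (intro measurable_timespaceI) (use R(2) scaled_time_in[OF t] in \<open>auto simp del: atLeastAtMost_iff\<close>)
qed

text \<open>Freezing the time leaves a function of the law of \<open>W \<theta>\<close> at a single
  time, and the outer integral sees only the uniform law; neither depends on the index.\<close>

lemma distr_shift:
  assumes \<theta>: "\<theta> \<in> Theta" and \<theta>': "\<theta>' \<in> Theta" and p: "p \<in> space E"
  shows "distr P E (shift \<theta> p) = distr P E (shift \<theta>' p)"
proof -
  obtain t x where px: "p = (t, x)" by (cases p)
  have t: "t \<in> {0..T}" and x: "x \<in> Rd d" using p by (auto simp: px space_timespace)
  \<comment> \<open>The uniform law lives on the whole line while \<open>W\<close> is under control
    on \<open>{0..T}\<close> only. Clamping extends the integrand and changes nothing on the range
    of \<open>r\<close>.\<close>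
  let ?cl = "\<lambda>\<rho>. max 0 (min 1 \<rho>) :: real"
  let ?z = "\<lambda>\<theta> \<rho> \<omega>. (t + (T - t) * ?cl \<rho>, vadd d x (W \<theta> ((T - t) * ?cl \<rho>) \<omega>))"
  define \<Psi> where "\<Psi> = (\<lambda>\<theta> h \<rho>. \<integral>\<^sup>+\<omega>. h (?z \<theta> \<rho> \<omega>) \<partial>P)"
  have shm: "shift \<theta> p \<in> measurable P E" if "\<theta> \<in> Theta" for \<theta>
    using that by (intro measurable_galg_P[OF _ shift_measurable1[OF that order_refl _ p]]) auto
  have main: "(\<integral>\<^sup>+\<omega>. h (shift \<theta> p \<omega>) \<partial>P) = (\<integral>\<^sup>+\<rho>. \<Psi> \<theta> h \<rho> \<partial>density lborel (indicator {0..1}))"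
    if \<theta>: "\<theta> \<in> Theta" and h[measurable]: "h \<in> borel_measurable E" for \<theta> and h :: "_ \<Rightarrow> ennreal"
  proof -
    have zm: "(\<lambda>z. ?z \<theta> (fst z) (snd z)) \<in> measurable (borel \<Otimes>\<^sub>M P) E"
      using \<theta> by (intro W_shift_measurable[OF \<theta> _ _ t x, of "{(False, \<theta>)}"]
        measurable_compose[OF measurable_snd id_galg_P]) auto
    have \<Psi>m[measurable]: "\<Psi> \<theta> h \<in> borel_measurable borel"
      unfolding \<Psi>_def using measurable_compose[OF zm h]
      by (intro borel_measurable_nn_integral) (simp add: case_prod_unfold)
    have "(\<integral>\<^sup>+\<omega>. h (shift \<theta> p \<omega>) \<partial>P) = (\<integral>\<^sup>+\<omega>. h (?z \<theta> (r \<theta> \<omega>) \<omega>) \<partial>P)"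
    proof (intro nn_integral_cong)
      fix \<omega> assume "\<omega> \<in> space P"
      then have "?cl (r \<theta> \<omega>) = r \<theta> \<omega>" using r_range[OF \<theta>, of \<omega>] by auto
      then show "h (shift \<theta> p \<omega>) = h (?z \<theta> (r \<theta> \<omega>) \<omega>)" by (simp only: shift_def px fst_conv snd_conv)
    qed
    also have "\<dots> = (\<integral>\<^sup>+\<omega>'. (\<integral>\<^sup>+\<omega>. h (?z \<theta> (r \<theta> \<omega>') \<omega>) \<partial>P) \<partial>P)"
    proof (rule nn_integral_r_W[OF \<theta>])
      have "(\<lambda>z. ?z \<theta> (fst z) (snd z)) \<in> measurable (restrict_space borel {0..1} \<Otimes>\<^sub>M galg {(False, \<theta>)}) E"
      proof (intro W_shift_measurable[OF \<theta> _ _ t x, of "{(False, \<theta>)}"])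
        have "fst \<in> borel_measurable (restrict_space borel {0..1::real} \<Otimes>\<^sub>M galg {(False, \<theta>)})"
          by (rule measurable_compose[OF measurable_fst]) (simp add: measurable_restrict_space1)
        then show "(\<lambda>z. ?cl (fst z)) \<in> borel_measurable (restrict_space borel {0..1} \<Otimes>\<^sub>M galg {(False, \<theta>)})"
          by (rule measurable_compose) simp
      qed (use \<theta> in auto)
      from measurable_compose[OF this h]
      show "(\<lambda>(\<rho>, \<omega>). h (?z \<theta> \<rho> \<omega>)) \<in> borel_measurable (restrict_space borel {0..1} \<Otimes>\<^sub>M galg {(False, \<theta>)})"
        by (simp add: case_prod_unfold)
    qed
    also have "\<dots> = (\<integral>\<^sup>+\<omega>'. \<Psi> \<theta> h (r \<theta> \<omega>') \<partial>P)" by (simp add: \<Psi>_def)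
    also have "\<dots> = (\<integral>\<^sup>+\<rho>. \<Psi> \<theta> h \<rho> \<partial>distr P borel (r \<theta>))"
      using r_meas[OF \<theta>] by (subst nn_integral_distr) auto
    finally show ?thesis by (simp add: r_law[OF \<theta>])
  qed
  have \<Psi>eq: "\<Psi> \<theta> h \<rho> = \<Psi> \<theta>' h \<rho>" if h[measurable]: "h \<in> borel_measurable E" for h \<rho>
  proof -
    have s: "(T - t) * ?cl \<rho> \<in> {0..T}" "t + (T - t) * ?cl \<rho> \<in> {0..T}" using scaled_time_in[OF t, of "?cl \<rho>"] by auto
    have m: "(\<lambda>w. (t + (T - t) * ?cl \<rho>, vadd d x w)) \<in> measurable (Rd_borel d) E"
      using x s(2) by (intro measurable_timespaceI) auto
    have "\<Psi> \<eta> h \<rho> = (\<integral>\<^sup>+w. h (t + (T - t) * ?cl \<rho>, vadd d x w) \<partial>distr P (Rd_borel d) (W \<eta> ((T - t) * ?cl \<rho>)))"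
      if "\<eta> \<in> Theta" for \<eta>
      unfolding \<Psi>_def using measurable_compose[OF m h] W_measurable_P[OF that s(1)]
      by (subst nn_integral_distr) auto
    then show ?thesis using W_law[OF \<theta> \<theta>' s(1)] \<theta> \<theta>' by simp
  qed
  show ?thesis
  proof (rule measure_eqI)
    fix A assume "A \<in> sets (distr P E (shift \<theta> p))"
    then have A[measurable]: "A \<in> sets E" by simp
    have "emeasure (distr P E (shift \<eta> p)) A = (\<integral>\<^sup>+\<omega>. indicator A (shift \<eta> p \<omega>) \<partial>P)" if "\<eta> \<in> Theta" for \<eta>
      using nn_integral_distr[OF shm[OF that], of "indicator A"] by simp
    then show "emeasure (distr P E (shift \<theta> p)) A = emeasure (distr P E (shift \<theta>' p)) A"
      using main[OF \<theta>, of "indicator A"] main[OF \<theta>', of "indicator A"] \<Psi>eq[of "indicator A"] \<theta> \<theta>' by simp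
  qed simp
qed

text \<open>Freezing the uniform time turns the expectation over the shift into an average over
  deterministic times, the form to which the Markov property applies.\<close>

lemma shift_time_integral:
  assumes \<theta>: "\<theta> \<in> Theta" and p: "(t, x) \<in> space E" and \<phi>: "\<phi> \<in> borel_measurable E"
    and bnd: "\<And>z. z \<in> space E \<Longrightarrow> \<bar>\<phi> z\<bar> \<le> C"
  shows "(T - t) * expectation (\<lambda>\<omega>. \<phi> (shift \<theta> (t, x) \<omega>))
    = (LINT s:{t..T}|lborel. expectation (\<lambda>\<omega>. \<phi> (s, vadd d x (W \<theta> (s - t) \<omega>))))"
proof -
  have t: "t \<in> {0..T}" and x: "x \<in> Rd d" using p by (auto simp: space_timespace)
  let ?N = "restrict_space borel {0..1::real}"
  \<comment> \<open>Clamped so that the integrand is measurable on the whole line.\<close>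
  let ?cl = "\<lambda>s. max t (min T s)"
  define \<psi> where "\<psi> = (\<lambda>s. expectation (\<lambda>\<omega>. \<phi> (?cl s, vadd d x (W \<theta> (?cl s - t) \<omega>))))"
  have ind: "indep_subalg (galg {(True, \<theta>)}) (galg {(False, \<theta>)})"
    using \<theta> by (intro indep_subalg_galg) auto
  have rm: "r \<theta> \<in> measurable (galg {(True, \<theta>)}) ?N"
    using \<theta> r_measurable[OF \<theta>, of "{(True, \<theta>)}"] r_range[OF \<theta>] by (auto simp: measurable_restrict_space2_iff)
  have fstm: "fst \<in> borel_measurable (?N \<Otimes>\<^sub>M galg {(False, \<theta>)})"
    by (rule measurable_compose[OF measurable_fst]) (simp add: measurable_restrict_space1)
  have zm: "(\<lambda>z. (t + (T - t) * fst z, vadd d x (W \<theta> ((T - t) * fst z) (snd z))))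
      \<in> measurable (?N \<Otimes>\<^sub>M galg {(False, \<theta>)}) E"
    using \<theta> fstm by (intro W_shift_measurable[OF \<theta> _ _ t x, of "{(False, \<theta>)}"])
      (auto simp: space_pair_measure space_restrict_space)
  have "expectation (\<lambda>\<omega>. \<phi> (shift \<theta> (t, x) \<omega>))
      = expectation (\<lambda>\<omega>'. expectation (\<lambda>\<omega>. \<phi> (t + (T - t) * r \<theta> \<omega>', vadd d x (W \<theta> ((T - t) * r \<theta> \<omega>') \<omega>))))"
    using expectation_indep_subalg(1)[OF ind rm measurable_ident_sets[OF refl] measurable_compose[OF zm \<phi>], of C]
      bnd measurable_space[OF zm] by (simp add: shift_def)
  also have "\<dots> = expectation (\<lambda>\<omega>'. \<psi> (t + (T - t) * r \<theta> \<omega>'))"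
  proof (intro Bochner_Integration.integral_cong refl)
    fix \<omega>' assume "\<omega>' \<in> space P"
    then have "(T - t) * r \<theta> \<omega>' \<in> {0..T}" "r \<theta> \<omega>' \<in> {0..1}" using scaled_time_in[OF t r_range[OF \<theta>]] r_range[OF \<theta>] by auto
    moreover from this have "(T - t) * r \<theta> \<omega>' \<le> (T - t) * 1" using t by (intro mult_left_mono) auto
    ultimately have "?cl (t + (T - t) * r \<theta> \<omega>') = t + (T - t) * r \<theta> \<omega>'" by auto
    then show "expectation (\<lambda>\<omega>. \<phi> (t + (T - t) * r \<theta> \<omega>', vadd d x (W \<theta> ((T - t) * r \<theta> \<omega>') \<omega>)))
      = \<psi> (t + (T - t) * r \<theta> \<omega>')" by (simp add: \<psi>_def)
  qed
  also have "(T - t) * \<dots> = (LINT s:{t..T}|lborel. \<psi> s)"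
  proof (rule expectation_uniform_time)
    show "\<psi> \<in> borel_measurable borel" unfolding \<psi>_def
    proof (intro borel_measurable_lebesgue_integral)
      have "(\<lambda>z. W \<theta> (?cl (fst z) - t) (snd z)) \<in> measurable (borel \<Otimes>\<^sub>M P) (Rd_borel d)"
        using \<theta> t by (intro W_joint_measurable[OF \<theta>, of "{(False, \<theta>)}"] measurable_compose[OF measurable_snd id_galg_P]) auto
      then have "(\<lambda>z. (?cl (fst z), vadd d x (W \<theta> (?cl (fst z) - t) (snd z)))) \<in> measurable (borel \<Otimes>\<^sub>M P) E"
        using x t by (intro measurable_timespaceI) auto
      from measurable_compose[OF this \<phi>]
      show "(\<lambda>(s, \<omega>). \<phi> (?cl s, vadd d x (W \<theta> (?cl s - t) \<omega>))) \<in> borel_measurable (borel \<Otimes>\<^sub>M P)"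
        by (simp add: case_prod_unfold)
    qed
  qed (use r_meas[OF \<theta>] r_law[OF \<theta>] t in auto)
  also have "\<dots> = (LINT s:{t..T}|lborel. expectation (\<lambda>\<omega>. \<phi> (s, vadd d x (W \<theta> (s - t) \<omega>))))"
    by (intro set_lebesgue_integral_cong) (auto simp: \<psi>_def)
  finally show ?thesis .
qed

lemma exp_r_integrable: "\<theta> \<in> Theta \<Longrightarrow> bounded_rv (\<lambda>\<omega>. exp (c * (1 - r \<theta> \<omega>)))"
proof (rule bounded_rvI)
  assume \<theta>: "\<theta> \<in> Theta"
  show "(\<lambda>\<omega>. exp (c * (1 - r \<theta> \<omega>))) \<in> borel_measurable P" using r_meas[OF \<theta>] by measurable
  fix \<omega> assume "\<omega> \<in> space P"
  then have "\<bar>c * (1 - r \<theta> \<omega>)\<bar> \<le> \<bar>c\<bar> * 1"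
    unfolding abs_mult using r_range[OF \<theta>] by (intro mult_left_mono) auto
  then show "\<bar>exp (c * (1 - r \<theta> \<omega>))\<bar> \<le> exp \<bar>c\<bar>" by simp
qed

text \<open>After the shift the remaining time is \<open>(T - t) * (1 - r \<theta>)\<close>, so the
  left side is the time integral of the weight, which gains the factor
  \<open>1 / lam\<close>.\<close>

lemma expectation_exp_r_le:
  assumes \<theta>: "\<theta> \<in> Theta" and t: "t \<in> {0..T}" and lam: "lam > 0"
  shows "(T - t) * expectation (\<lambda>\<omega>. exp (lam * (T - t) * (1 - r \<theta> \<omega>))) \<le> exp (lam * (T - t)) / lam"
proof -
  have *: "exp (lam * (T - t) * (1 - \<rho>)) = exp (lam * (T - (t + (T - t) * \<rho>)))" for \<rho>
    by (simp add: algebra_simps)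
  have "(T - t) * expectation (\<lambda>\<omega>. exp (lam * (T - t) * (1 - r \<theta> \<omega>)))
      = (LINT s:{t..T}|lborel. exp (lam * (T - s)))"
    using expectation_uniform_time[OF r_meas[OF \<theta>] r_law[OF \<theta>], of "\<lambda>s. exp (lam * (T - s))" t T] t
    unfolding * by simp
  then show ?thesis using integral_exp_time[OF lam, of t T] t by simp
qed

text \<open>For a frozen \<open>r \<theta> = \<rho>\<close> the elapsed times differ by
  \<open>\<rho> * \<bar>t - s\<bar>\<close> and the clock times by
  \<open>(1 - \<rho>) * \<bar>t - s\<bar>\<close>: what the Brownian increment adds in space is
  removed in time. The weight depends on \<open>r \<theta>\<close> alone and is averaged
  afterwards.\<close>

lemma pdist2_shift:
  assumes \<theta>: "\<theta> \<in> Theta" and p: "p \<in> space E" and q: "q \<in> space E"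
  shows "has_bochner_integral P (\<lambda>\<omega>. exp (c * (1 - r \<theta> \<omega>)) * pdist2 d (shift \<theta> p \<omega>) (shift \<theta> q \<omega>))
    (expectation (\<lambda>\<omega>. exp (c * (1 - r \<theta> \<omega>))) * pdist2 d p q)"
proof (rule has_bochner_integral_nn_integral)
  obtain t x s y where px: "p = (t, x)" "q = (s, y)" by (cases p, cases q)
  have t: "t \<in> {0..T}" and x: "x \<in> Rd d" and s: "s \<in> {0..T}" and y: "y \<in> Rd d"
    using p q by (auto simp: px space_timespace)
  have shm: "shift \<theta> p \<in> measurable P E" if "p \<in> space E" for p
    using \<theta> by (intro measurable_galg_P[OF _ shift_measurable1[OF \<theta> order_refl _ that]]) auto
  note [measurable] = r_meas[OF \<theta>] shm[OF p] shm[OF q]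
  show "(\<lambda>\<omega>. exp (c * (1 - r \<theta> \<omega>)) * pdist2 d (shift \<theta> p \<omega>) (shift \<theta> q \<omega>)) \<in> borel_measurable P"
    by measurable
  show "AE \<omega> in P. 0 \<le> exp (c * (1 - r \<theta> \<omega>)) * pdist2 d (shift \<theta> p \<omega>) (shift \<theta> q \<omega>)"
    by simp
  show "0 \<le> expectation (\<lambda>\<omega>. exp (c * (1 - r \<theta> \<omega>))) * pdist2 d p q"
    by (intro mult_nonneg_nonneg Bochner_Integration.integral_nonneg) auto
  let ?N = "restrict_space borel {0..1::real}"
  let ?z = "\<lambda>t x \<rho> \<omega>. (t + (T - t) * \<rho>, vadd d x (W \<theta> ((T - t) * \<rho>) \<omega>))"
  let ?h = "\<lambda>\<rho> \<omega>. ennreal (exp (c * (1 - \<rho>)) * pdist2 d (?z t x \<rho> \<omega>) (?z s y \<rho> \<omega>))"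
  have inner: "(\<integral>\<^sup>+\<omega>. ?h \<rho> \<omega> \<partial>P) = ennreal (exp (c * (1 - \<rho>)) * pdist2 d p q)" if \<rho>: "\<rho> \<in> {0..1}" for \<rho>
  proof -
    have "\<bar>(T - t) * \<rho> - (T - s) * \<rho>\<bar> + \<bar>t + (T - t) * \<rho> - (s + (T - s) * \<rho>)\<bar>
        = \<bar>(s - t) * \<rho>\<bar> + \<bar>(t - s) * (1 - \<rho>)\<bar>"
      by (intro arg_cong2[where f="(+)"] arg_cong[where f=abs]) (simp_all add: algebra_simps)
    also have "\<dots> = \<bar>t - s\<bar> * \<rho> + \<bar>t - s\<bar> * (1 - \<rho>)"
      using \<rho> by (simp add: abs_mult abs_minus_commute)
    also have "\<dots> = \<bar>t - s\<bar>" by (simp add: algebra_simps)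
    finally have "has_bochner_integral P (\<lambda>\<omega>. pdist2 d (?z t x \<rho> \<omega>) (?z s y \<rho> \<omega>)) (pdist2 d p q)"
      using pdist2_shift_W[OF \<theta> scaled_time_in(1)[OF s \<rho>] scaled_time_in(1)[OF t \<rho>],
          of "t + (T - t) * \<rho>" x "s + (T - s) * \<rho>" y]
      by (simp add: px pdist2_def)
    then have "has_bochner_integral P (\<lambda>\<omega>. exp (c * (1 - \<rho>)) * pdist2 d (?z t x \<rho> \<omega>) (?z s y \<rho> \<omega>))
        (exp (c * (1 - \<rho>)) * pdist2 d p q)" by (rule has_bochner_integral_mult_right)
    then show ?thesis
      by (subst nn_integral_eq_integral) (auto simp: has_bochner_integral_iff)
  qed
  have fstm: "fst \<in> borel_measurable (?N \<Otimes>\<^sub>M galg {(False, \<theta>)})"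
    by (rule measurable_compose[OF measurable_fst]) (simp add: measurable_restrict_space1)
  have zm: "(\<lambda>z. ?z t x (fst z) (snd z)) \<in> measurable (?N \<Otimes>\<^sub>M galg {(False, \<theta>)}) E"
    if "t \<in> {0..T}" "x \<in> Rd d" for t x
    using \<theta> fstm by (intro W_shift_measurable[OF \<theta> _ _ that, of "{(False, \<theta>)}"])
      (auto simp: space_pair_measure space_restrict_space)
  have "(\<integral>\<^sup>+\<omega>. ennreal (exp (c * (1 - r \<theta> \<omega>)) * pdist2 d (shift \<theta> p \<omega>) (shift \<theta> q \<omega>)) \<partial>P)
      = (\<integral>\<^sup>+\<omega>. ?h (r \<theta> \<omega>) \<omega> \<partial>P)"
    by (simp add: shift_def px)
  also have "\<dots> = (\<integral>\<^sup>+\<omega>'. (\<integral>\<^sup>+\<omega>. ?h (r \<theta> \<omega>') \<omega> \<partial>P) \<partial>P)"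
    using zm[OF t x] zm[OF s y] fstm
    by (intro nn_integral_r_W[OF \<theta>]) (simp add: case_prod_unfold)
  also have "\<dots> = (\<integral>\<^sup>+\<omega>'. ennreal (exp (c * (1 - r \<theta> \<omega>')) * pdist2 d p q) \<partial>P)"
    using r_range[OF \<theta>] by (intro nn_integral_cong inner) auto
  also have "\<dots> = ennreal (expectation (\<lambda>\<omega>. exp (c * (1 - r \<theta> \<omega>)) * pdist2 d p q))"
    by (intro nn_integral_eq_integral integrable_mult_left bounded_rv_integrable exp_r_integrable \<theta>) auto
  finally show "(\<integral>\<^sup>+\<omega>. ennreal (exp (c * (1 - r \<theta> \<omega>)) * pdist2 d (shift \<theta> p \<omega>) (shift \<theta> q \<omega>)) \<partial>P)
      = ennreal (expectation (\<lambda>\<omega>. exp (c * (1 - r \<theta> \<omega>))) * pdist2 d p q)" by simp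
qed

section \<open>Random fields and their weighted mean square control\<close>

text \<open>Joint measurability allows evaluation at random points, and \<open>K\<close> records the
  sources of randomness, from which independence is read off.\<close>

definition rfield :: "(bool \<times> int list) set \<Rightarrow> (real \<times> (nat \<Rightarrow> real) \<Rightarrow> 'a \<Rightarrow> real) \<Rightarrow> bool"
  where "rfield K V \<longleftrightarrow> K \<subseteq> UNIV \<times> Theta \<and> (\<lambda>(p, \<omega>). V p \<omega>) \<in> borel_measurable (E \<Otimes>\<^sub>M galg K) \<and>
    (\<exists>C. \<forall>p\<in>space E. \<forall>\<omega>\<in>space P. \<bar>V p \<omega>\<bar> \<le> C)"

lemma rfield_compose:
  assumes "rfield K V" "X \<in> measurable N E" "Y \<in> measurable N (galg K)"
  shows "(\<lambda>z. V (X z) (Y z)) \<in> borel_measurable N"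
proof -
  have "(\<lambda>z. (X z, Y z)) \<in> measurable N (E \<Otimes>\<^sub>M galg K)" using assms by auto
  from measurable_compose[OF this, of "\<lambda>(p, \<omega>). V p \<omega>"] assms(1) show ?thesis by (auto simp: rfield_def)
qed

lemma rfield_measurable: "rfield K V \<Longrightarrow> p \<in> space E \<Longrightarrow> V p \<in> borel_measurable (galg K)"
  using rfield_compose[of K V "\<lambda>_. p" "galg K" "\<lambda>\<omega>. \<omega>"] by simp

lemma rfield_bounded_rv: "rfield K V \<Longrightarrow> p \<in> space E \<Longrightarrow> bounded_rv (V p)"
  using measurable_galg_P[OF _ rfield_measurable] unfolding bounded_rv_def rfield_def by blast

lemma rfieldI:
  assumes "K \<subseteq> UNIV \<times> Theta" "(\<lambda>z. V (fst z) (snd z)) \<in> borel_measurable (E \<Otimes>\<^sub>M galg K)"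
    "\<And>p \<omega>. p \<in> space E \<Longrightarrow> \<omega> \<in> space P \<Longrightarrow> \<bar>V p \<omega>\<bar> \<le> C"
  shows "rfield K V"
  using assms unfolding rfield_def case_prod_unfold by blast

lemma rfield_mono:
  assumes V: "rfield K V" and K: "K \<subseteq> K'" "K' \<subseteq> UNIV \<times> Theta"
  shows "rfield K' V"
proof -
  obtain C where C: "\<And>p \<omega>. p \<in> space E \<Longrightarrow> \<omega> \<in> space P \<Longrightarrow> \<bar>V p \<omega>\<bar> \<le> C" using V unfolding rfield_def by blast
  show ?thesis
    by (rule rfieldI[OF K(2) rfield_compose[OF V] C])
      (use measurable_compose[OF measurable_snd id_galg[OF K]] in auto)
qed

lemma rfield_cong:
  assumes V: "rfield K V" and eq: "\<And>p \<omega>. p \<in> space E \<Longrightarrow> \<omega> \<in> space P \<Longrightarrow> V' p \<omega> = V p \<omega>"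
  shows "rfield K V'"
proof -
  have "(\<lambda>(p, \<omega>). V' p \<omega>) \<in> borel_measurable (E \<Otimes>\<^sub>M galg K)"
    using V eq unfolding rfield_def by (subst measurable_cong[where g="\<lambda>(p, \<omega>). V p \<omega>"]) (auto simp: space_pair_measure)
  then show ?thesis using V eq unfolding rfield_def by auto
qed

lemma rfield_det:
  assumes "K \<subseteq> UNIV \<times> Theta" "v \<in> borel_measurable E" "\<And>p. p \<in> space E \<Longrightarrow> \<bar>v p\<bar> \<le> C"
  shows "rfield K (\<lambda>p _. v p)"
  by (rule rfieldI[where C=C]) (use assms in auto)

lemma rfield_add:
  assumes V: "rfield K V" and V': "rfield K V'"
  shows "rfield K (\<lambda>p \<omega>. V p \<omega> + V' p \<omega>)"
proof -
  obtain C where C: "\<And>p \<omega>. p \<in> space E \<Longrightarrow> \<omega> \<in> space P \<Longrightarrow> \<bar>V p \<omega>\<bar> \<le> C" using V unfolding rfield_def by blast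
  obtain C' where C': "\<And>p \<omega>. p \<in> space E \<Longrightarrow> \<omega> \<in> space P \<Longrightarrow> \<bar>V' p \<omega>\<bar> \<le> C'" using V' unfolding rfield_def by blast
  show ?thesis
  proof (rule rfieldI[where C="C + C'"])
    show "(\<lambda>z. V (fst z) (snd z) + V' (fst z) (snd z)) \<in> borel_measurable (E \<Otimes>\<^sub>M galg K)"
      by (intro borel_measurable_add rfield_compose[OF V] rfield_compose[OF V']) auto
    show "\<bar>V p \<omega> + V' p \<omega>\<bar> \<le> C + C'" if "p \<in> space E" "\<omega> \<in> space P" for p \<omega>
      using C[OF that] C'[OF that] by linarith
  qed (use V in \<open>auto simp: rfield_def\<close>)
qed

lemma rfield_mult:
  assumes V: "rfield K V" and V': "rfield K V'"
  shows "rfield K (\<lambda>p \<omega>. V p \<omega> * V' p \<omega>)"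
proof -
  obtain C where C: "\<And>p \<omega>. p \<in> space E \<Longrightarrow> \<omega> \<in> space P \<Longrightarrow> \<bar>V p \<omega>\<bar> \<le> C" using V unfolding rfield_def by blast
  obtain C' where C': "\<And>p \<omega>. p \<in> space E \<Longrightarrow> \<omega> \<in> space P \<Longrightarrow> \<bar>V' p \<omega>\<bar> \<le> C'" using V' unfolding rfield_def by blast
  show ?thesis
  proof (rule rfieldI[where C="\<bar>C\<bar> * \<bar>C'\<bar>"])
    show "(\<lambda>z. V (fst z) (snd z) * V' (fst z) (snd z)) \<in> borel_measurable (E \<Otimes>\<^sub>M galg K)"
      by (intro borel_measurable_times rfield_compose[OF V] rfield_compose[OF V']) auto
    show "\<bar>V p \<omega> * V' p \<omega>\<bar> \<le> \<bar>C\<bar> * \<bar>C'\<bar>" if "p \<in> space E" "\<omega> \<in> space P" for p \<omega>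
      unfolding abs_mult using C[OF that] C'[OF that] by (intro mult_mono) auto
  qed (use V in \<open>auto simp: rfield_def\<close>)
qed

lemma rfield_const: "K \<subseteq> UNIV \<times> Theta \<Longrightarrow> rfield K (\<lambda>_ _. c)"
  by (rule rfield_det[where C="\<bar>c\<bar>"]) auto

lemma rfield_diff: "rfield K V \<Longrightarrow> rfield K V' \<Longrightarrow> rfield K (\<lambda>p \<omega>. V p \<omega> - V' p \<omega>)"
  using rfield_add[of K V "\<lambda>p \<omega>. -1 * V' p \<omega>"] rfield_mult[of K "\<lambda>_ _. -1" V'] rfield_const[of K "-1"]
  by (auto simp: rfield_def)

lemma rfield_sum:
  "K \<subseteq> UNIV \<times> Theta \<Longrightarrow> (\<And>j. j \<in> J \<Longrightarrow> rfield K (V j)) \<Longrightarrow> rfield K (\<lambda>p \<omega>. \<Sum>j\<in>J. V j p \<omega>)"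
  by (induction J rule: infinite_finite_induct) (auto intro!: rfield_add rfield_const)

lemma rfield_comp:
  assumes V: "rfield K V" and f: "f \<in> borel_measurable borel" "\<And>a. \<bar>f a\<bar> \<le> C"
  shows "rfield K (\<lambda>p \<omega>. f (V p \<omega>))"
  by (rule rfieldI[where C=C])
    (use V f measurable_compose[OF rfield_compose[OF V] f(1)] in \<open>auto simp: rfield_def\<close>)

lemma rfield_shift:
  assumes V: "rfield K V" and K: "K \<subseteq> K'" "UNIV \<times> {\<theta>} \<subseteq> K'" "K' \<subseteq> UNIV \<times> Theta" and \<theta>: "\<theta> \<in> Theta"
  shows "rfield K' (\<lambda>p \<omega>. V (shift \<theta> p \<omega>) \<omega>)"
proof -
  obtain C where C: "\<And>p \<omega>. p \<in> space E \<Longrightarrow> \<omega> \<in> space P \<Longrightarrow> \<bar>V p \<omega>\<bar> \<le> C" using V unfolding rfield_def by blast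
  show ?thesis
  proof (rule rfieldI[where C=C])
    show "(\<lambda>z. V (shift \<theta> (fst z) (snd z)) (snd z)) \<in> borel_measurable (E \<Otimes>\<^sub>M galg K')"
      by (intro rfield_compose[OF V] shift_measurable[OF \<theta> K(2,3)]
        measurable_compose[OF measurable_snd id_galg[OF K(1,3)]]) auto
  qed (use K C shift_in[OF \<theta>] in auto)
qed

lemma rfield_time: "K \<subseteq> UNIV \<times> Theta \<Longrightarrow> rfield K (\<lambda>p _. T - fst p)"
  by (rule rfield_det[where C=T])
    (use measurable_timespaceD(1)[of "\<lambda>z. z"] in \<open>auto simp: space_timespace\<close>)

text \<open>The weight is taken at the earlier of the two times, where it is larger for positive
  \<open>lam\<close>; that is why the increments are ordered in time. Since \<open>pdist2\<close> is
  linear in the time difference, the second bound contains Hoelder continuity of order one half in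
  time, in mean square.\<close>

definition ms_ctl :: "real \<Rightarrow> real \<Rightarrow> (real \<times> (nat \<Rightarrow> real) \<Rightarrow> 'a \<Rightarrow> real) \<Rightarrow> bool"
  where "ms_ctl lam Q V \<longleftrightarrow>
    (\<forall>p\<in>space E. expectation (\<lambda>\<omega>. (V p \<omega>)\<^sup>2) \<le> Q * exp (lam * (T - fst p))) \<and>
    (\<forall>p\<in>space E. \<forall>q\<in>space E. fst p \<le> fst q \<longrightarrow>
      expectation (\<lambda>\<omega>. (V p \<omega> - V q \<omega>)\<^sup>2) \<le> Q * exp (lam * (T - fst p)) * pdist2 d p q)"

lemma ms_ctlI:
  assumes "\<And>p. p \<in> space E \<Longrightarrow> expectation (\<lambda>\<omega>. (V p \<omega>)\<^sup>2) \<le> Q * exp (lam * (T - fst p))"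
    "\<And>p q. p \<in> space E \<Longrightarrow> q \<in> space E \<Longrightarrow> fst p \<le> fst q \<Longrightarrow>
      expectation (\<lambda>\<omega>. (V p \<omega> - V q \<omega>)\<^sup>2) \<le> Q * exp (lam * (T - fst p)) * pdist2 d p q"
  shows "ms_ctl lam Q V"
  using assms unfolding ms_ctl_def by blast

lemma ms_ctlD:
  assumes "ms_ctl lam Q V"
  shows "p \<in> space E \<Longrightarrow> expectation (\<lambda>\<omega>. (V p \<omega>)\<^sup>2) \<le> Q * exp (lam * (T - fst p))"
    "p \<in> space E \<Longrightarrow> q \<in> space E \<Longrightarrow> fst p \<le> fst q \<Longrightarrow>
      expectation (\<lambda>\<omega>. (V p \<omega> - V q \<omega>)\<^sup>2) \<le> Q * exp (lam * (T - fst p)) * pdist2 d p q"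
  using assms unfolding ms_ctl_def by blast+

lemma ms_ctl_mono: "ms_ctl lam Q V \<Longrightarrow> Q \<le> Q' \<Longrightarrow> ms_ctl lam Q' V"
  by (rule ms_ctlI) (blast intro: order_trans[OF ms_ctlD(1)] order_trans[OF ms_ctlD(2)] mult_right_mono
    less_imp_le[OF exp_gt_zero] pdist2_nonneg)+

lemma ms_ctl_cong:
  assumes "ms_ctl lam Q V" "\<And>p \<omega>. p \<in> space E \<Longrightarrow> \<omega> \<in> space P \<Longrightarrow> V' p \<omega> = V p \<omega>"
  shows "ms_ctl lam Q V'"
proof (rule ms_ctlI)
  fix p q assume pq: "p \<in> space E" "q \<in> space E" "fst p \<le> fst q"
  have "expectation (\<lambda>\<omega>. (V' p \<omega> - V' q \<omega>)\<^sup>2) = expectation (\<lambda>\<omega>. (V p \<omega> - V q \<omega>)\<^sup>2)"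
    using assms(2) pq by (intro Bochner_Integration.integral_cong) auto
  then show "expectation (\<lambda>\<omega>. (V' p \<omega> - V' q \<omega>)\<^sup>2) \<le> Q * exp (lam * (T - fst p)) * pdist2 d p q"
    using ms_ctlD(2)[OF assms(1) pq] by simp
next
  fix p assume p: "p \<in> space E"
  have "expectation (\<lambda>\<omega>. (V' p \<omega>)\<^sup>2) = expectation (\<lambda>\<omega>. (V p \<omega>)\<^sup>2)"
    using assms(2) p by (intro Bochner_Integration.integral_cong) auto
  then show "expectation (\<lambda>\<omega>. (V' p \<omega>)\<^sup>2) \<le> Q * exp (lam * (T - fst p))"
    using ms_ctlD(1)[OF assms(1) p] by simp
qed

lemma expectation_square_add_le:
  assumes X: "bounded_rv X" and Y: "bounded_rv Y"
    and le: "\<And>\<omega>. \<omega> \<in> space P \<Longrightarrow> \<bar>Z \<omega>\<bar> \<le> \<bar>X \<omega>\<bar> + \<bar>Y \<omega>\<bar>"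
  shows "expectation (\<lambda>\<omega>. (Z \<omega>)\<^sup>2) \<le> 2 * expectation (\<lambda>\<omega>. (X \<omega>)\<^sup>2) + 2 * expectation (\<lambda>\<omega>. (Y \<omega>)\<^sup>2)"
proof -
  note i = bounded_rv_integrable[OF bounded_rv_power2[OF X]] bounded_rv_integrable[OF bounded_rv_power2[OF Y]]
  have "expectation (\<lambda>\<omega>. (Z \<omega>)\<^sup>2) \<le> expectation (\<lambda>\<omega>. 2 * (X \<omega>)\<^sup>2 + 2 * (Y \<omega>)\<^sup>2)"
  proof (rule integral_mono')
    show "integrable P (\<lambda>\<omega>. 2 * (X \<omega>)\<^sup>2 + 2 * (Y \<omega>)\<^sup>2)" using i by simp
    show "(Z \<omega>)\<^sup>2 \<le> 2 * (X \<omega>)\<^sup>2 + 2 * (Y \<omega>)\<^sup>2" if "\<omega> \<in> space P" for \<omega>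
    proof -
      have "(Z \<omega>)\<^sup>2 \<le> (\<bar>X \<omega>\<bar> + \<bar>Y \<omega>\<bar>)\<^sup>2"
        using le[OF that] by (metis abs_ge_zero abs_le_square_iff abs_of_nonneg order_trans)
      also have "\<dots> \<le> 2 * (X \<omega>)\<^sup>2 + 2 * (Y \<omega>)\<^sup>2"
        using zero_le_power2[of "\<bar>X \<omega>\<bar> - \<bar>Y \<omega>\<bar>"] by (simp add: power2_sum power2_diff)
      finally show ?thesis .
    qed
  qed simp
  then show ?thesis using i by simp
qed

lemma ms_ctl_diff:
  assumes "rfield K V" "rfield K' V'" "ms_ctl lam Q V" "ms_ctl lam Q' V'"
  shows "ms_ctl lam (2 * (Q + Q')) (\<lambda>p \<omega>. V p \<omega> - V' p \<omega>)"
proof (rule ms_ctlI)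
  fix p assume p: "p \<in> space E"
  show "expectation (\<lambda>\<omega>. (V p \<omega> - V' p \<omega>)\<^sup>2) \<le> 2 * (Q + Q') * exp (lam * (T - fst p))"
    using expectation_square_add_le[OF assms(1,2)[THEN rfield_bounded_rv[OF _ p]], of "\<lambda>\<omega>. V p \<omega> - V' p \<omega>",
        OF abs_triangle_ineq4]
      ms_ctlD(1)[OF assms(3) p] ms_ctlD(1)[OF assms(4) p] by (simp add: algebra_simps)
  fix q assume q: "q \<in> space E" "fst p \<le> fst q"
  have "bounded_rv (\<lambda>\<omega>. V p \<omega> - V q \<omega>)" "bounded_rv (\<lambda>\<omega>. V' p \<omega> - V' q \<omega>)"
    by (intro bounded_rv_diff rfield_bounded_rv[OF assms(1)] rfield_bounded_rv[OF assms(2)] p q(1))+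
  from expectation_square_add_le[OF this, of "\<lambda>\<omega>. (V p \<omega> - V' p \<omega>) - (V q \<omega> - V' q \<omega>)"]
  have "expectation (\<lambda>\<omega>. (V p \<omega> - V' p \<omega> - (V q \<omega> - V' q \<omega>))\<^sup>2)
      \<le> 2 * expectation (\<lambda>\<omega>. (V p \<omega> - V q \<omega>)\<^sup>2) + 2 * expectation (\<lambda>\<omega>. (V' p \<omega> - V' q \<omega>)\<^sup>2)" by linarith
  then show "expectation (\<lambda>\<omega>. (V p \<omega> - V' p \<omega> - (V q \<omega> - V' q \<omega>))\<^sup>2) \<le> 2 * (Q + Q') * exp (lam * (T - fst p)) * pdist2 d p q"
    using ms_ctlD(2)[OF assms(3) p q] ms_ctlD(2)[OF assms(4) p q] by (simp add: algebra_simps)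
qed

text \<open>The increment of \<open>f \<circ> U - f \<circ> u\<close> is split at
  \<open>f (u p + v)\<close>, where \<open>v\<close> is the error at \<open>q\<close>. The Lipschitz
  bound \<open>f1\<close> controls the first part by the increment of the error, the second order
  bound \<open>f2\<close> controls the rest by the increment of \<open>u\<close> times
  \<open>v\<close>. Hence the factor \<open>1 + Ku\<close>.\<close>

lemma ms_ctl_comp:
  assumes V: "rfield K U" "u \<in> borel_measurable E" "\<And>p. p \<in> space E \<Longrightarrow> \<bar>u p\<bar> \<le> Cu"
    and Q: "0 \<le> Q" "ms_ctl lam Q (\<lambda>p \<omega>. U p \<omega> - u p)" and lam: "0 \<le> lam"
    and u_Lip: "\<And>p q. p \<in> space E \<Longrightarrow> q \<in> space E \<Longrightarrow> (u p - u q)\<^sup>2 \<le> Ku * pdist2 d p q"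
    and Ku: "0 \<le> Ku" and L: "0 \<le> L"
    and f1: "\<And>a b. \<bar>f a - f b\<bar> \<le> L * \<bar>a - b\<bar>"
    and f2: "\<And>a b v. \<bar>f (a + v) - f a - (f (b + v) - f b)\<bar> \<le> L * \<bar>a - b\<bar> * \<bar>v\<bar>"
  shows "ms_ctl lam (2 * L\<^sup>2 * (1 + Ku) * Q) (\<lambda>p \<omega>. f (U p \<omega>) - f (u p))"
proof (rule ms_ctlI)
  have "rfield K (\<lambda>p _. u p)"
    by (rule rfield_det) (use V in \<open>auto simp: rfield_def\<close>)
  from rfield_bounded_rv[OF rfield_diff[OF V(1) this]]
  have bV: "bounded_rv (\<lambda>\<omega>. U p \<omega> - u p)" if "p \<in> space E" for p using that by simp
  fix p assume p: "p \<in> space E"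
  have "expectation (\<lambda>\<omega>. (f (U p \<omega>) - f (u p))\<^sup>2) \<le> expectation (\<lambda>\<omega>. L\<^sup>2 * (U p \<omega> - u p)\<^sup>2)"
  proof (rule integral_mono')
    show "(f (U p \<omega>) - f (u p))\<^sup>2 \<le> L\<^sup>2 * (U p \<omega> - u p)\<^sup>2" for \<omega>
      using power_mono[OF f1[of "U p \<omega>" "u p"], of 2] by (simp add: power_mult_distrib)
  qed (use bounded_rv_integrable[OF bounded_rv_power2[OF bV[OF p]]] in auto)
  also have "\<dots> \<le> L\<^sup>2 * (Q * exp (lam * (T - fst p)))"
    using ms_ctlD(1)[OF Q(2) p] by (simp add: mult_left_mono)
  also have "\<dots> \<le> 2 * L\<^sup>2 * (1 + Ku) * Q * exp (lam * (T - fst p))"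
  proof -
    have "L\<^sup>2 * Q * exp (lam * (T - fst p)) * 1 \<le> L\<^sup>2 * Q * exp (lam * (T - fst p)) * (2 * (1 + Ku))"
      using Q Ku by (intro mult_left_mono) auto
    then show ?thesis by (simp add: algebra_simps)
  qed
  finally show "expectation (\<lambda>\<omega>. (f (U p \<omega>) - f (u p))\<^sup>2) \<le> 2 * L\<^sup>2 * (1 + Ku) * Q * exp (lam * (T - fst p))" .
  fix q assume q: "q \<in> space E" "fst p \<le> fst q"
  let ?X = "\<lambda>\<omega>. L * ((U p \<omega> - u p) - (U q \<omega> - u q))" and ?Y = "\<lambda>\<omega>. L * (u p - u q) * (U q \<omega> - u q)"
  have "expectation (\<lambda>\<omega>. (f (U p \<omega>) - f (u p) - (f (U q \<omega>) - f (u q)))\<^sup>2)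
      \<le> 2 * expectation (\<lambda>\<omega>. (?X \<omega>)\<^sup>2) + 2 * expectation (\<lambda>\<omega>. (?Y \<omega>)\<^sup>2)"
  proof (rule expectation_square_add_le)
    show "bounded_rv ?X" "bounded_rv ?Y" using bV[OF p] bV[OF q(1)] by auto
    fix \<omega>
    let ?v = "U q \<omega> - u q"
    have "\<bar>f (U p \<omega>) - f (u p + ?v)\<bar> \<le> \<bar>?X \<omega>\<bar>"
    proof -
      have "?X \<omega> = L * (U p \<omega> - (u p + ?v))" by (simp add: algebra_simps)
      then have "\<bar>?X \<omega>\<bar> = L * \<bar>U p \<omega> - (u p + ?v)\<bar>" using L by (simp only: abs_mult abs_of_nonneg)
      then show ?thesis using f1[of "U p \<omega>" "u p + ?v"] by simp
    qed
    moreover have "\<bar>f (u p + ?v) - f (u p) - (f (u q + ?v) - f (u q))\<bar> \<le> \<bar>?Y \<omega>\<bar>"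
      using f2[of "u p" ?v "u q"] L by (simp add: abs_mult)
    ultimately show "\<bar>f (U p \<omega>) - f (u p) - (f (U q \<omega>) - f (u q))\<bar> \<le> \<bar>?X \<omega>\<bar> + \<bar>?Y \<omega>\<bar>"
      by (simp add: abs_if split: if_splits)
  qed
  also have "expectation (\<lambda>\<omega>. (?X \<omega>)\<^sup>2) \<le> L\<^sup>2 * (Q * exp (lam * (T - fst p)) * pdist2 d p q)"
    using ms_ctlD(2)[OF Q(2) p q] by (simp add: power_mult_distrib mult_left_mono)
  also have "expectation (\<lambda>\<omega>. (?Y \<omega>)\<^sup>2) = L\<^sup>2 * ((u p - u q)\<^sup>2 * expectation (\<lambda>\<omega>. (U q \<omega> - u q)\<^sup>2))"
    by (simp add: power_mult_distrib mult.assoc)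
  also have "\<dots> \<le> L\<^sup>2 * ((Ku * pdist2 d p q) * (Q * exp (lam * (T - fst p))))"
  proof (intro mult_left_mono mult_mono u_Lip p q)
    have "expectation (\<lambda>\<omega>. (U q \<omega> - u q)\<^sup>2) \<le> Q * exp (lam * (T - fst q))" by (rule ms_ctlD(1)[OF Q(2) q(1)])
    \<comment> \<open>\<open>q\<close> is the later point, so its weight is at most that of
      \<open>p\<close>.\<close>
    also have "\<dots> \<le> Q * exp (lam * (T - fst p))" using Q q lam by (intro mult_left_mono) (auto intro!: mult_left_mono)
    finally show "expectation (\<lambda>\<omega>. (U q \<omega> - u q)\<^sup>2) \<le> Q * exp (lam * (T - fst p))" .
  qed (use Ku in \<open>auto intro!: mult_nonneg_nonneg\<close>)
  finally show "expectation (\<lambda>\<omega>. (f (U p \<omega>) - f (u p) - (f (U q \<omega>) - f (u q)))\<^sup>2)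
      \<le> 2 * L\<^sup>2 * (1 + Ku) * Q * exp (lam * (T - fst p)) * pdist2 d p q"
    by (simp add: algebra_simps)
qed

text \<open>Both points are moved by the same noise. As the sources \<open>K\<close> of
  \<open>h\<close> do not contain that noise, the pair of shifted points can be frozen.\<close>

lemma expectation_shift2:
  assumes K: "K \<subseteq> UNIV \<times> Theta" "K \<inter> UNIV \<times> {\<theta>} = {}" and \<theta>: "\<theta> \<in> Theta"
    and p: "p \<in> space E" and q: "q \<in> space E"
    and h: "(\<lambda>((z, z'), \<omega>). h z z' \<omega>) \<in> borel_measurable ((E \<Otimes>\<^sub>M E) \<Otimes>\<^sub>M galg K)"
    and bnd: "\<And>z z' \<omega>. z \<in> space E \<Longrightarrow> z' \<in> space E \<Longrightarrow> \<omega> \<in> space P \<Longrightarrow> \<bar>h z z' \<omega>\<bar> \<le> C"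
  shows "expectation (\<lambda>\<omega>. h (shift \<theta> p \<omega>) (shift \<theta> q \<omega>) \<omega>)
    = expectation (\<lambda>\<omega>'. expectation (\<lambda>\<omega>. h (shift \<theta> p \<omega>') (shift \<theta> q \<omega>') \<omega>))"
    and "bounded_rv (\<lambda>\<omega>'. expectation (\<lambda>\<omega>. h (shift \<theta> p \<omega>') (shift \<theta> q \<omega>') \<omega>))"
proof -
  have ind: "indep_subalg (galg (UNIV \<times> {\<theta>})) (galg K)"
    using K \<theta> by (intro indep_subalg_galg) auto
  have X: "(\<lambda>\<omega>. (shift \<theta> p \<omega>, shift \<theta> q \<omega>)) \<in> measurable (galg (UNIV \<times> {\<theta>})) (E \<Otimes>\<^sub>M E)"
    using \<theta> by (intro measurable_Pair shift_measurable1 p q) auto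
  have b: "\<bar>(\<lambda>((z, z'), \<omega>). h z z' \<omega>) y\<bar> \<le> C" if "y \<in> space ((E \<Otimes>\<^sub>M E) \<Otimes>\<^sub>M galg K)" for y
    using that bnd by (auto simp: space_pair_measure)
  note * = expectation_indep_subalg[OF ind X measurable_ident_sets[OF refl] h b]
  show "expectation (\<lambda>\<omega>. h (shift \<theta> p \<omega>) (shift \<theta> q \<omega>) \<omega>)
    = expectation (\<lambda>\<omega>'. expectation (\<lambda>\<omega>. h (shift \<theta> p \<omega>') (shift \<theta> q \<omega>') \<omega>))"
    using *(1) by simp
  show "bounded_rv (\<lambda>\<omega>'. expectation (\<lambda>\<omega>. h (shift \<theta> p \<omega>') (shift \<theta> q \<omega>') \<omega>))"
    using *(2) by simp
qed

text \<open>Of the two factors \<open>T - t\<close> in the square, one is spent on integrating the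
  weight, which yields \<open>1 / lam\<close>; the other is bounded by \<open>T\<close>. For the
  increment of the prefactor itself, one factor is instead bounded by the parabolic distance.
  \<open>pdist2_shift\<close> returns the distance of the original points.\<close>

lemma ms_ctl_shift:
  assumes V: "rfield K V" and dis: "K \<inter> UNIV \<times> {\<theta>} = {}" and \<theta>: "\<theta> \<in> Theta"
    and Q: "0 \<le> Q" "ms_ctl lam Q V" and lam: "0 < lam"
  shows "ms_ctl lam (2 * (1 + T) * Q / lam) (\<lambda>p \<omega>. (T - fst p) * V (shift \<theta> p \<omega>) \<omega>)"
proof -
  have K: "K \<subseteq> UNIV \<times> Theta" using V by (simp add: rfield_def)
  obtain C where C: "\<And>p \<omega>. p \<in> space E \<Longrightarrow> \<omega> \<in> space P \<Longrightarrow> \<bar>V p \<omega>\<bar> \<le> C" using V unfolding rfield_def by blast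
  have sh: "rfield (UNIV \<times> Theta) (\<lambda>p \<omega>. V (shift \<theta> p \<omega>) \<omega>)"
    by (rule rfield_shift[OF V]) (use K \<theta> in auto)
  let ?e = "\<lambda>p. expectation (\<lambda>\<omega>. exp (lam * (T - fst p) * (1 - r \<theta> \<omega>)))"
  have exp_eq: "exp (lam * (T - fst (shift \<theta> p \<omega>))) = exp (lam * (T - fst p) * (1 - r \<theta> \<omega>))" for p \<omega>
    by (simp add: shift_def algebra_simps)
  have e0: "0 \<le> ?e p" for p by (intro Bochner_Integration.integral_nonneg) auto
  have ee: "(T - fst p) * ?e p \<le> exp (lam * (T - fst p)) / lam" if "p \<in> space E" for p
    using that by (intro expectation_exp_r_le[OF \<theta> _ lam]) (auto simp: space_timespace)
  have one: "expectation (\<lambda>\<omega>. (V (shift \<theta> p \<omega>) \<omega>)\<^sup>2) \<le> Q * ?e p" if p: "p \<in> space E" for p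
  proof -
    have "(\<lambda>((z, z'), \<omega>). (V z \<omega>)\<^sup>2) \<in> borel_measurable ((E \<Otimes>\<^sub>M E) \<Otimes>\<^sub>M galg K)"
      unfolding case_prod_unfold by (intro borel_measurable_power rfield_compose[OF V]) auto
    moreover have "\<bar>(V z \<omega>)\<^sup>2\<bar> \<le> C\<^sup>2" if "z \<in> space E" "\<omega> \<in> space P" for z \<omega>
      using power_mono[OF C[OF that], of 2] by simp
    ultimately have *: "expectation (\<lambda>\<omega>. (V (shift \<theta> p \<omega>) \<omega>)\<^sup>2)
        = expectation (\<lambda>\<omega>'. expectation (\<lambda>\<omega>. (V (shift \<theta> p \<omega>') \<omega>)\<^sup>2))"
      "bounded_rv (\<lambda>\<omega>'. expectation (\<lambda>\<omega>. (V (shift \<theta> p \<omega>') \<omega>)\<^sup>2))"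
      using expectation_shift2[OF K dis \<theta> p p, of "\<lambda>z _ \<omega>. (V z \<omega>)\<^sup>2" "C\<^sup>2"] by auto
    have "expectation (\<lambda>\<omega>'. expectation (\<lambda>\<omega>. (V (shift \<theta> p \<omega>') \<omega>)\<^sup>2)) \<le> expectation (\<lambda>\<omega>'. Q * exp (lam * (T - fst p) * (1 - r \<theta> \<omega>')))"
      using ms_ctlD(1)[OF Q(2) shift_in[OF \<theta> p]] *(2) exp_r_integrable[OF \<theta>]
      by (intro integral_mono) (auto simp: exp_eq intro!: bounded_rv_integrable)
    then show ?thesis using * by simp
  qed
  have two: "expectation (\<lambda>\<omega>. (V (shift \<theta> p \<omega>) \<omega> - V (shift \<theta> q \<omega>) \<omega>)\<^sup>2) \<le> Q * ?e p * pdist2 d p q"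
    if p: "p \<in> space E" and q: "q \<in> space E" and pq: "fst p \<le> fst q" for p q
  proof -
    have "(\<lambda>((z, z'), \<omega>). (V z \<omega> - V z' \<omega>)\<^sup>2) \<in> borel_measurable ((E \<Otimes>\<^sub>M E) \<Otimes>\<^sub>M galg K)"
      unfolding case_prod_unfold by (intro borel_measurable_power borel_measurable_diff rfield_compose[OF V]) auto
    moreover have "\<bar>(V z \<omega> - V z' \<omega>)\<^sup>2\<bar> \<le> (C + C)\<^sup>2" if "z \<in> space E" "z' \<in> space E" "\<omega> \<in> space P" for z z' \<omega>
    proof -
      have "\<bar>V z \<omega> - V z' \<omega>\<bar> \<le> C + C" using C[OF that(1,3)] C[OF that(2,3)] by linarith
      from power_mono[OF this, of 2] show ?thesis by simp
    qed
    ultimately have *: "expectation (\<lambda>\<omega>. (V (shift \<theta> p \<omega>) \<omega> - V (shift \<theta> q \<omega>) \<omega>)\<^sup>2)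
        = expectation (\<lambda>\<omega>'. expectation (\<lambda>\<omega>. (V (shift \<theta> p \<omega>') \<omega> - V (shift \<theta> q \<omega>') \<omega>)\<^sup>2))"
      "bounded_rv (\<lambda>\<omega>'. expectation (\<lambda>\<omega>. (V (shift \<theta> p \<omega>') \<omega> - V (shift \<theta> q \<omega>') \<omega>)\<^sup>2))"
      using expectation_shift2[OF K dis \<theta> p q, of "\<lambda>z z' \<omega>. (V z \<omega> - V z' \<omega>)\<^sup>2" "(C + C)\<^sup>2"] by auto
    \<comment> \<open>A common \<open>r \<theta>\<close> keeps the order of the times, so the
      increment bound applies to the shifted points.\<close>
    have le: "fst (shift \<theta> p \<omega>') \<le> fst (shift \<theta> q \<omega>')" if "\<omega>' \<in> space P" for \<omega>'
    proof -
      have "0 \<le> (fst q - fst p) * (1 - r \<theta> \<omega>')" using pq r_range[OF \<theta> that] by auto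
      then show ?thesis by (simp add: shift_def algebra_simps)
    qed
    have hb: "has_bochner_integral P
        (\<lambda>\<omega>. Q * (exp (lam * (T - fst p) * (1 - r \<theta> \<omega>)) * pdist2 d (shift \<theta> p \<omega>) (shift \<theta> q \<omega>)))
        (Q * (?e p * pdist2 d p q))"
      by (intro has_bochner_integral_mult_right pdist2_shift \<theta> p q)
    have "expectation (\<lambda>\<omega>'. expectation (\<lambda>\<omega>. (V (shift \<theta> p \<omega>') \<omega> - V (shift \<theta> q \<omega>') \<omega>)\<^sup>2))
      \<le> expectation (\<lambda>\<omega>. Q * (exp (lam * (T - fst p) * (1 - r \<theta> \<omega>)) * pdist2 d (shift \<theta> p \<omega>) (shift \<theta> q \<omega>)))"
      using ms_ctlD(2)[OF Q(2) shift_in[OF \<theta> p] shift_in[OF \<theta> q] le] *(2) hb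
      by (intro integral_mono) (auto simp: exp_eq mult.assoc has_bochner_integral_iff intro!: bounded_rv_integrable)
    then show ?thesis unfolding *(1) has_bochner_integral_integral_eq[OF hb] by (simp only: mult.assoc)
  qed
  have b: "bounded_rv (\<lambda>\<omega>. V (shift \<theta> p \<omega>) \<omega>)" if "p \<in> space E" for p
    by (rule rfield_bounded_rv[OF sh that])
  show ?thesis
  proof (rule ms_ctlI)
    fix p assume p: "p \<in> space E"
    then have t: "0 \<le> T - fst p" "T - fst p \<le> T" by (auto simp: space_timespace)
    have "expectation (\<lambda>\<omega>. ((T - fst p) * V (shift \<theta> p \<omega>) \<omega>)\<^sup>2)
        = (T - fst p) * ((T - fst p) * expectation (\<lambda>\<omega>. (V (shift \<theta> p \<omega>) \<omega>)\<^sup>2))"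
      by (simp add: power_mult_distrib power2_eq_square[of "T - fst p"] mult.assoc)
    also have "\<dots> \<le> T * ((T - fst p) * (Q * ?e p))"
      using t one[OF p] Q(1) e0[of p] by (intro mult_mono) auto
    also have "\<dots> = T * Q * ((T - fst p) * ?e p)" by simp
    also have "\<dots> \<le> T * Q * (exp (lam * (T - fst p)) / lam)"
      using T_pos Q(1) ee[OF p] by (intro mult_left_mono) auto
    also have "\<dots> \<le> 2 * (1 + T) * Q / lam * exp (lam * (T - fst p))"
    proof -
      have "(Q * exp (lam * (T - fst p)) / lam) * T \<le> (Q * exp (lam * (T - fst p)) / lam) * (2 * (1 + T))"
        using T_pos Q(1) lam by (intro mult_left_mono) auto
      then show ?thesis by (simp add: mult_ac)
    qed
    finally show "expectation (\<lambda>\<omega>. ((T - fst p) * V (shift \<theta> p \<omega>) \<omega>)\<^sup>2) \<le> 2 * (1 + T) * Q / lam * exp (lam * (T - fst p))" .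
    fix q assume q: "q \<in> space E" "fst p \<le> fst q"
    then have s: "0 \<le> T - fst q" "T - fst q \<le> T - fst p" "0 \<le> fst q - fst p" "fst q - fst p \<le> T - fst p"
      by (auto simp: space_timespace)
    \<comment> \<open>The product rule for increments: the increment of the prefactor with the field
      at \<open>p\<close>, plus the prefactor at \<open>q\<close> with the increment of the
      field.\<close>
    let ?X = "\<lambda>\<omega>. (fst q - fst p) * V (shift \<theta> p \<omega>) \<omega>"
    let ?Y = "\<lambda>\<omega>. (T - fst q) * (V (shift \<theta> p \<omega>) \<omega> - V (shift \<theta> q \<omega>) \<omega>)"
    have "expectation (\<lambda>\<omega>. ((T - fst p) * V (shift \<theta> p \<omega>) \<omega> - (T - fst q) * V (shift \<theta> q \<omega>) \<omega>)\<^sup>2)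
        \<le> 2 * expectation (\<lambda>\<omega>. (?X \<omega>)\<^sup>2) + 2 * expectation (\<lambda>\<omega>. (?Y \<omega>)\<^sup>2)"
    proof (rule expectation_square_add_le)
      show "bounded_rv ?X" "bounded_rv ?Y" using b[OF p] b[OF q(1)] by auto
      have "(T - fst p) * V (shift \<theta> p \<omega>) \<omega> - (T - fst q) * V (shift \<theta> q \<omega>) \<omega> = ?X \<omega> + ?Y \<omega>" for \<omega>
        by (simp add: algebra_simps)
      then show "\<bar>(T - fst p) * V (shift \<theta> p \<omega>) \<omega> - (T - fst q) * V (shift \<theta> q \<omega>) \<omega>\<bar> \<le> \<bar>?X \<omega>\<bar> + \<bar>?Y \<omega>\<bar>" for \<omega>
        by (metis abs_triangle_ineq)
    qed
    also have "expectation (\<lambda>\<omega>. (?X \<omega>)\<^sup>2) \<le> Q / lam * exp (lam * (T - fst p)) * pdist2 d p q"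
    proof -
      have "expectation (\<lambda>\<omega>. (?X \<omega>)\<^sup>2) = (fst q - fst p) * ((fst q - fst p) * expectation (\<lambda>\<omega>. (V (shift \<theta> p \<omega>) \<omega>)\<^sup>2))"
        by (simp add: power_mult_distrib power2_eq_square[of "fst q - fst p"] mult.assoc)
      also have "\<dots> \<le> pdist2 d p q * ((T - fst p) * (Q * ?e p))"
        using s t one[OF p] Q(1) e0[of p] abs_time_le_pdist2[OF d_pos, of p q] by (intro mult_mono) auto
      also have "\<dots> = pdist2 d p q * Q * ((T - fst p) * ?e p)" by simp
      also have "\<dots> \<le> pdist2 d p q * Q * (exp (lam * (T - fst p)) / lam)"
        using Q(1) ee[OF p] by (intro mult_left_mono) auto
      finally show ?thesis by (simp add: mult_ac)
    qed
    also have "expectation (\<lambda>\<omega>. (?Y \<omega>)\<^sup>2) \<le> T * Q / lam * exp (lam * (T - fst p)) * pdist2 d p q"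
    proof -
      have "expectation (\<lambda>\<omega>. (?Y \<omega>)\<^sup>2) = (T - fst q) * ((T - fst q) * expectation (\<lambda>\<omega>. (V (shift \<theta> p \<omega>) \<omega> - V (shift \<theta> q \<omega>) \<omega>)\<^sup>2))"
        by (simp add: power_mult_distrib power2_eq_square[of "T - fst q"] mult.assoc)
      also have "\<dots> \<le> T * ((T - fst p) * (Q * ?e p * pdist2 d p q))"
        using s t two[OF p q] Q(1) e0[of p] by (intro mult_mono) auto
      also have "\<dots> = T * Q * pdist2 d p q * ((T - fst p) * ?e p)" by simp
      also have "\<dots> \<le> T * Q * pdist2 d p q * (exp (lam * (T - fst p)) / lam)"
        using T_pos Q(1) ee[OF p] by (intro mult_left_mono) auto
      finally show ?thesis by (simp add: mult_ac)
    qed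
    finally show "expectation (\<lambda>\<omega>. ((T - fst p) * V (shift \<theta> p \<omega>) \<omega> - (T - fst q) * V (shift \<theta> q \<omega>) \<omega>)\<^sup>2)
        \<le> 2 * (1 + T) * Q / lam * exp (lam * (T - fst p)) * pdist2 d p q"
      by (simp add: algebra_simps add_divide_distrib)
  qed
qed

text \<open>Both points use the same Brownian motion, at the times \<open>T - t\<close> and
  \<open>T - s\<close>. The mean square distance of the end points therefore grows by
  \<open>d\<close> times the time difference, which is exactly the time part of
  \<open>pdist2\<close>.\<close>

lemma ms_ctl_terminal:
  assumes \<theta>: "\<theta> \<in> Theta" and g: "G \<in> borel_measurable (Rd_borel d)"
    and bnd: "\<And>x. x \<in> Rd d \<Longrightarrow> (G x)\<^sup>2 \<le> Kg"
    and Lip: "\<And>x y. x \<in> Rd d \<Longrightarrow> y \<in> Rd d \<Longrightarrow> (G x - G y)\<^sup>2 \<le> Kg * (real d * (\<Sum>i=1..d. (x i - y i)\<^sup>2))"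
    and lam: "0 \<le> lam"
  shows "ms_ctl lam Kg (\<lambda>p \<omega>. G (vadd d (snd p) (W \<theta> (T - fst p) \<omega>)))"
    and "rfield {(False, \<theta>)} (\<lambda>p \<omega>. G (vadd d (snd p) (W \<theta> (T - fst p) \<omega>)))"
proof -
  obtain x0 where "x0 \<in> Rd d" unfolding Rd_def using PiE_eq_empty_iff[of "{1..d}" "\<lambda>_. UNIV::real set"] by blast
  then have Kg: "0 \<le> Kg" using bnd[of x0] zero_le_power2[of "G x0"] by linarith
  have abs: "\<bar>G x\<bar> \<le> sqrt Kg" if "x \<in> Rd d" for x using bnd[OF that] real_le_rsqrt by fastforce
  have "(\<lambda>z. W \<theta> (T - fst (fst z)) (snd z)) \<in> measurable (E \<Otimes>\<^sub>M galg {(False, \<theta>)}) (Rd_borel d)"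
    using \<theta> borel_measurable_diff[OF borel_measurable_const measurable_timespaceD(1)[OF measurable_fst]]
    by (intro W_joint_measurable[OF \<theta>, of "{(False, \<theta>)}"]) (auto simp: space_pair_measure space_timespace)
  then have "(\<lambda>z. vadd d (snd (fst z)) (W \<theta> (T - fst (fst z)) (snd z))) \<in> measurable (E \<Otimes>\<^sub>M galg {(False, \<theta>)}) (Rd_borel d)"
    using measurable_timespaceD(3)[OF measurable_fst] by (intro measurable_vadd) auto
  from measurable_compose[OF this g]
  show F: "rfield {(False, \<theta>)} (\<lambda>p \<omega>. G (vadd d (snd p) (W \<theta> (T - fst p) \<omega>)))"
    by (intro rfieldI[where C="sqrt Kg"]) (use \<theta> abs in auto)
  have e1: "1 \<le> exp (lam * (T - fst p))" if "p \<in> space E" for p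
    using that lam by (auto simp: space_timespace intro!: mult_nonneg_nonneg)
  show "ms_ctl lam Kg (\<lambda>p \<omega>. G (vadd d (snd p) (W \<theta> (T - fst p) \<omega>)))"
  proof (rule ms_ctlI)
    fix p assume p: "p \<in> space E"
    have "expectation (\<lambda>\<omega>. (G (vadd d (snd p) (W \<theta> (T - fst p) \<omega>)))\<^sup>2) \<le> expectation (\<lambda>\<omega>. Kg)"
      using bnd by (intro integral_mono bounded_rv_integrable bounded_rv_power2 rfield_bounded_rv[OF F p]) auto
    also have "\<dots> \<le> Kg * exp (lam * (T - fst p))"
      using mult_left_mono[OF e1[OF p] Kg] by (simp add: prob_space)
    finally show "expectation (\<lambda>\<omega>. (G (vadd d (snd p) (W \<theta> (T - fst p) \<omega>)))\<^sup>2) \<le> Kg * exp (lam * (T - fst p))" .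
    fix q assume q: "q \<in> space E" "fst p \<le> fst q"
    have t: "T - fst p \<in> {0..T}" "T - fst q \<in> {0..T}" using p q by (auto simp: space_timespace)
    \<comment> \<open>Equal clock times 0 make \<open>pdist2\<close> purely spatial, in accordance
      with \<open>Lip\<close>.\<close>
    have hb: "has_bochner_integral P (\<lambda>\<omega>. Kg * pdist2 d (0, vadd d (snd p) (W \<theta> (T - fst p) \<omega>)) (0, vadd d (snd q) (W \<theta> (T - fst q) \<omega>)))
      (Kg * pdist2 d p q)"
      using has_bochner_integral_mult_right[OF pdist2_shift_W[OF \<theta> t(2,1), of 0 "snd p" 0 "snd q"], of Kg]
      by (simp add: pdist2_def abs_minus_commute)
    have "expectation (\<lambda>\<omega>. (G (vadd d (snd p) (W \<theta> (T - fst p) \<omega>)) - G (vadd d (snd q) (W \<theta> (T - fst q) \<omega>)))\<^sup>2)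
      \<le> expectation (\<lambda>\<omega>. Kg * pdist2 d (0, vadd d (snd p) (W \<theta> (T - fst p) \<omega>)) (0, vadd d (snd q) (W \<theta> (T - fst q) \<omega>)))"
    proof (rule integral_mono)
      show "integrable P (\<lambda>\<omega>. (G (vadd d (snd p) (W \<theta> (T - fst p) \<omega>)) - G (vadd d (snd q) (W \<theta> (T - fst q) \<omega>)))\<^sup>2)"
        by (intro bounded_rv_integrable bounded_rv_power2 bounded_rv_diff rfield_bounded_rv[OF F p] rfield_bounded_rv[OF F q(1)])
      show "(G (vadd d (snd p) (W \<theta> (T - fst p) \<omega>)) - G (vadd d (snd q) (W \<theta> (T - fst q) \<omega>)))\<^sup>2
        \<le> Kg * pdist2 d (0, vadd d (snd p) (W \<theta> (T - fst p) \<omega>)) (0, vadd d (snd q) (W \<theta> (T - fst q) \<omega>))" for \<omega>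
        using Lip[of "vadd d (snd p) (W \<theta> (T - fst p) \<omega>)" "vadd d (snd q) (W \<theta> (T - fst q) \<omega>)"]
        by (simp add: pdist2_def)
    qed (use hb in \<open>auto simp: has_bochner_integral_iff\<close>)
    also have "\<dots> = Kg * pdist2 d p q * 1" using hb by (simp add: has_bochner_integral_iff)
    also have "\<dots> \<le> Kg * pdist2 d p q * exp (lam * (T - fst p))"
      using Kg e1[OF p] by (intro mult_left_mono) auto
    finally show "expectation (\<lambda>\<omega>. (G (vadd d (snd p) (W \<theta> (T - fst p) \<omega>)) - G (vadd d (snd q) (W \<theta> (T - fst q) \<omega>)))\<^sup>2)
      \<le> Kg * exp (lam * (T - fst p)) * pdist2 d p q" by (simp add: mult_ac)
  qed
qed

end

section \<open>Expectations of controlled fields\<close>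

context noise
begin

lemma rfield_expectation:
  assumes V: "rfield K V"
  shows "(\<lambda>p. expectation (V p)) \<in> borel_measurable E"
proof -
  have "(\<lambda>z. V (fst z) (snd z)) \<in> borel_measurable (E \<Otimes>\<^sub>M P)"
    using V by (intro rfield_compose[OF V] measurable_compose[OF measurable_snd id_galg_P]) (auto simp: rfield_def)
  then have "(\<lambda>p. \<integral>\<omega>. V p \<omega> \<partial>P) \<in> borel_measurable E"
    by (intro borel_measurable_lebesgue_integral) (simp add: case_prod_unfold)
  then show ?thesis by simp
qed

lemma expectation_abs_le:
  assumes "bounded_rv X" "\<And>\<omega>. \<omega> \<in> space P \<Longrightarrow> \<bar>X \<omega>\<bar> \<le> C"
  shows "\<bar>expectation X\<bar> \<le> C"
proof -
  have "\<bar>expectation X\<bar> \<le> expectation (\<lambda>\<omega>. \<bar>X \<omega>\<bar>)" by (rule integral_abs_bound)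
  also have "\<dots> \<le> expectation (\<lambda>\<omega>. C)"
    using assms by (intro integral_mono integrable_abs bounded_rv_integrable) auto
  finally show ?thesis by (simp add: prob_space)
qed

lemma ms_ctl_uminus: "ms_ctl lam Q V \<Longrightarrow> ms_ctl lam Q (\<lambda>p \<omega>. - V p \<omega>)"
  unfolding ms_ctl_def by (simp add: power2_commute[of "- V _ _ "] add.commute)
    (simp add: power2_commute)

lemma rfield_uminus: "rfield K V \<Longrightarrow> rfield K (\<lambda>p \<omega>. - V p \<omega>)"
  using rfield_diff[OF rfield_const[of K 0], of V] by (auto simp: rfield_def)

lemma ms_ctl_add:
  assumes "rfield K V" "rfield K' V'" "ms_ctl lam Q V" "ms_ctl lam Q' V'"
  shows "ms_ctl lam (2 * (Q + Q')) (\<lambda>p \<omega>. V p \<omega> + V' p \<omega>)"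
  using ms_ctl_diff[OF assms(1) rfield_uminus[OF assms(2)] assms(3) ms_ctl_uminus[OF assms(4)]] by simp

text \<open>Jensen's inequality for values and increments. It transfers bounds for random fields to
  the deterministic iterates of the fixed point map.\<close>

lemma ms_ctl_expectation:
  assumes V: "rfield K V" and c: "ms_ctl lam Q V"
  shows "ms_ctl lam Q (\<lambda>p _. expectation (V p))"
proof (rule ms_ctlI)
  fix p assume p: "p \<in> space E"
  show "expectation (\<lambda>_. (expectation (V p))\<^sup>2) \<le> Q * exp (lam * (T - fst p))"
    using expectation_power2_le[OF rfield_bounded_rv[OF V p]] ms_ctlD(1)[OF c p] by (simp add: prob_space)
  fix q assume q: "q \<in> space E" "fst p \<le> fst q"
  have "expectation (V p) - expectation (V q) = expectation (\<lambda>\<omega>. V p \<omega> - V q \<omega>)"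
    using rfield_bounded_rv[OF V] p q by (simp add: bounded_rv_integrable)
  then show "expectation (\<lambda>_. (expectation (V p) - expectation (V q))\<^sup>2) \<le> Q * exp (lam * (T - fst p)) * pdist2 d p q"
    using expectation_power2_le[OF bounded_rv_diff[OF rfield_bounded_rv[OF V p] rfield_bounded_rv[OF V q(1)]]]
      ms_ctlD(2)[OF c p q] by (simp add: prob_space)
qed

end

section \<open>The fixed point equation\<close>

text \<open>\<open>f_Lip2\<close> is the bound on the second derivative in integrated form. The
  explicit factor \<open>real d\<close> in \<open>G_Lip\<close> arises from moving along one
  coordinate at a time; with it, \<open>Kg\<close> can be chosen independently of the
  dimension.\<close>

locale semilinear = noise +
  fixes f :: "real \<Rightarrow> real" and G :: "(nat \<Rightarrow> real) \<Rightarrow> real" and K L Kg :: real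
  assumes f_bound: "\<bar>f a\<bar> \<le> K"
    and L_nonneg: "0 \<le> L"
    and f_Lip: "\<bar>f a - f b\<bar> \<le> L * \<bar>a - b\<bar>"
    and f_Lip2: "\<bar>f (a + v) - f a - (f (b + v) - f b)\<bar> \<le> L * \<bar>a - b\<bar> * \<bar>v\<bar>"
    and G_meas: "G \<in> borel_measurable (Rd_borel d)"
    and G_bound: "x \<in> Rd d \<Longrightarrow> (G x)\<^sup>2 \<le> Kg"
    and G_Lip: "x \<in> Rd d \<Longrightarrow> y \<in> Rd d \<Longrightarrow> (G x - G y)\<^sup>2 \<le> Kg * (real d * (\<Sum>i=1..d. (x i - y i)\<^sup>2))"
begin

lemma K_nonneg: "0 \<le> K" using f_bound[of 0] by linarith

lemma Kg_nonneg: "0 \<le> Kg"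
proof -
  have "(\<lambda>i\<in>{1..d}. 0) \<in> Rd d" by (auto simp: Rd_def)
  from G_bound[OF this] show ?thesis using zero_le_power2 order_trans by blast
qed

lemma G_abs: "x \<in> Rd d \<Longrightarrow> \<bar>G x\<bar> \<le> sqrt Kg"
  using G_bound real_le_rsqrt by fastforce

lemma f_cont: "continuous_on A f"
proof (rule continuous_on_subset[OF _ subset_UNIV])
  show "continuous_on UNIV f"
    using f_Lip L_nonneg by (intro lipschitz_on_continuous_on[of L] lipschitz_onI) (auto simp: dist_real_def)
qed

lemma f_meas: "f \<in> borel_measurable borel"
  by (intro borel_measurable_continuous_onI f_cont)

abbreviation terminal :: "int list \<Rightarrow> real \<times> (nat \<Rightarrow> real) \<Rightarrow> 'a \<Rightarrow> real"
  where "terminal \<theta> p \<omega> \<equiv> G (vadd d (snd p) (W \<theta> (T - fst p) \<omega>))"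

lemma rfield_terminal: "\<theta> \<in> Theta \<Longrightarrow> rfield {(False, \<theta>)} (terminal \<theta>)"
  by (rule ms_ctl_terminal(2)[OF _ G_meas G_bound G_Lip order_refl])

lemma terminal_ctl: "\<theta> \<in> Theta \<Longrightarrow> 0 \<le> lam \<Longrightarrow> ms_ctl lam Kg (terminal \<theta>)"
  by (rule ms_ctl_terminal(1)[OF _ G_meas G_bound G_Lip])

text \<open>The index of the Brownian motion in the backward equation. It also serves as reference
  index for laws that are the same for all indices.\<close>

definition base :: "int list" where "base = [0]"

lemma base_Theta[simp]: "base \<in> Theta" by (simp add: base_def Theta_def)

definition picard :: "(real \<times> (nat \<Rightarrow> real) \<Rightarrow> real) \<Rightarrow> real \<times> (nat \<Rightarrow> real) \<Rightarrow> real"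
  where "picard v p = expectation (terminal base p) + (T - fst p) * expectation (\<lambda>\<omega>. f (v (shift base p \<omega>)))"

text \<open>\<open>solRate\<close> makes the shift constant \<open>2 * (1 + T) / solRate\<close>
  equal to \<open>1 / (4 * (1 + L\<^sup>2))\<close>. A bound \<open>B\<close> is then preserved by
  \<open>picard\<close> if \<open>2 * (Kg + (K\<^sup>2 + B) / 4) \<le> B\<close>, and
  \<open>solB\<close> satisfies this with equality.\<close>

definition solB :: real where "solB = 4 * Kg + K\<^sup>2"
definition solRate :: real where "solRate = 8 * (1 + T) * (1 + L\<^sup>2)"
definition solCu :: real where "solCu = sqrt Kg + T * K"

lemma rfield_f_shift:
  assumes v: "v \<in> borel_measurable E" and \<theta>: "\<theta> \<in> Theta"
  shows "rfield (UNIV \<times> {\<theta>}) (\<lambda>p \<omega>. f (v (shift \<theta> p \<omega>)))"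
proof -
  have "rfield {} (\<lambda>p _. f (v p))"
    by (rule rfield_det[where C=K]) (use measurable_compose[OF v f_meas] f_bound in auto)
  from rfield_shift[OF this _ _ _ \<theta>, of "UNIV \<times> {\<theta>}"] \<theta> show ?thesis by auto
qed

lemma picard_measurable: "v \<in> borel_measurable E \<Longrightarrow> picard v \<in> borel_measurable E"
  unfolding picard_def
  using rfield_expectation[OF rfield_terminal[OF base_Theta]] rfield_expectation[OF rfield_f_shift[OF _ base_Theta]]
    measurable_timespaceD(1)[of "\<lambda>z. z" E T d]
  by (intro borel_measurable_add borel_measurable_times borel_measurable_diff) auto

lemma picard_bound:
  assumes v: "v \<in> borel_measurable E" and p: "p \<in> space E"
  shows "\<bar>picard v p\<bar> \<le> solCu"
proof -
  have 1: "\<bar>expectation (terminal base p)\<bar> \<le> sqrt Kg"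
    by (rule expectation_abs_le[OF rfield_bounded_rv[OF rfield_terminal[OF base_Theta] p]]) (simp add: G_abs)
  have 2: "\<bar>expectation (\<lambda>\<omega>. f (v (shift base p \<omega>)))\<bar> \<le> K"
    by (rule expectation_abs_le[OF rfield_bounded_rv[OF rfield_f_shift[OF v base_Theta] p]]) (rule f_bound)
  have "\<bar>picard v p\<bar> \<le> \<bar>expectation (terminal base p)\<bar> + \<bar>T - fst p\<bar> * \<bar>expectation (\<lambda>\<omega>. f (v (shift base p \<omega>)))\<bar>"
    unfolding picard_def abs_mult[symmetric] by (rule abs_triangle_ineq)
  also have "\<dots> \<le> sqrt Kg + T * K"
    using 1 2 p K_nonneg by (intro add_mono mult_mono) (auto simp: space_timespace)
  finally show ?thesis by (simp add: solCu_def)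
qed

lemma solRate_pos: "0 < solRate"
  unfolding solRate_def using T_pos by (intro mult_pos_pos add_pos_nonneg) auto

lemma solB_nonneg: "0 \<le> solB" using Kg_nonneg by (simp add: solB_def)

text \<open>The bounds describe a set that the fixed point map leaves invariant: the boundedness of
  \<open>f\<close> controls values, its Lipschitz constant the increments, and the rate makes the
  contribution of \<open>v\<close> small enough for the bound to be reproduced.\<close>

lemma picard_ctl:
  assumes v: "v \<in> borel_measurable E" and c: "ms_ctl solRate solB (\<lambda>p _. v p)"
  shows "ms_ctl solRate solB (\<lambda>p _. picard v p)"
proof -
  let ?lam = solRate and ?B = solB
  have fv: "rfield {} (\<lambda>p _. f (v p))"
    by (rule rfield_det[where C=K]) (use measurable_compose[OF v f_meas] f_bound in auto)
  have "ms_ctl ?lam (K\<^sup>2 + L\<^sup>2 * ?B) (\<lambda>p _. f (v p))"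
  proof (rule ms_ctlI)
    fix p assume p: "p \<in> space E"
    have e1: "1 \<le> exp (?lam * (T - fst p))" using p solRate_pos by (auto simp: space_timespace)
    have "(f (v p))\<^sup>2 \<le> K\<^sup>2" using power_mono[OF f_bound[of "v p"], of 2] by simp
    also have "\<dots> \<le> (K\<^sup>2 + L\<^sup>2 * ?B) * 1" using solB_nonneg by simp
    also have "\<dots> \<le> (K\<^sup>2 + L\<^sup>2 * ?B) * exp (?lam * (T - fst p))"
      using solB_nonneg e1 by (intro mult_left_mono) auto
    finally show "expectation (\<lambda>_. (f (v p))\<^sup>2) \<le> (K\<^sup>2 + L\<^sup>2 * ?B) * exp (?lam * (T - fst p))"
      by (simp add: prob_space)
    fix q assume q: "q \<in> space E" "fst p \<le> fst q"
    have "(f (v p) - f (v q))\<^sup>2 \<le> L\<^sup>2 * (v p - v q)\<^sup>2"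
      using power_mono[OF f_Lip[of "v p" "v q"], of 2] by (simp add: power_mult_distrib)
    also have "\<dots> \<le> L\<^sup>2 * (?B * exp (?lam * (T - fst p)) * pdist2 d p q)"
      using ms_ctlD(2)[OF c p q] by (intro mult_left_mono) (auto simp: prob_space)
    also have "\<dots> \<le> (K\<^sup>2 + L\<^sup>2 * ?B) * exp (?lam * (T - fst p)) * pdist2 d p q"
      by (simp add: algebra_simps)
    finally show "expectation (\<lambda>_. (f (v p) - f (v q))\<^sup>2) \<le> (K\<^sup>2 + L\<^sup>2 * ?B) * exp (?lam * (T - fst p)) * pdist2 d p q"
      by (simp add: prob_space)
  qed
  from ms_ctl_shift[OF fv _ base_Theta _ this solRate_pos]
  have S: "ms_ctl ?lam (2 * (1 + T) * (K\<^sup>2 + L\<^sup>2 * ?B) / ?lam) (\<lambda>p \<omega>. (T - fst p) * f (v (shift base p \<omega>)))"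
    using solB_nonneg by simp
  have rS: "rfield (UNIV \<times> {base}) (\<lambda>p \<omega>. (T - fst p) * f (v (shift base p \<omega>)))"
    by (intro rfield_mult rfield_time rfield_f_shift v) auto
  have rT: "rfield (UNIV \<times> {base}) (terminal base)"
    by (rule rfield_mono[OF rfield_terminal]) auto
  have "ms_ctl ?lam (2 * (Kg + 2 * (1 + T) * (K\<^sup>2 + L\<^sup>2 * ?B) / ?lam))
      (\<lambda>p \<omega>. terminal base p \<omega> + (T - fst p) * f (v (shift base p \<omega>)))"
    by (rule ms_ctl_add[OF rT rS terminal_ctl S]) (use solRate_pos in auto)
  from ms_ctl_expectation[OF rfield_add[OF rT rS] this]
  have "ms_ctl ?lam (2 * (Kg + 2 * (1 + T) * (K\<^sup>2 + L\<^sup>2 * ?B) / ?lam)) (\<lambda>p _. picard v p)"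
  proof (rule ms_ctl_cong)
    fix p assume p: "p \<in> space E"
    have "integrable P (terminal base p)" "integrable P (\<lambda>\<omega>. f (v (shift base p \<omega>)))"
      using rfield_bounded_rv[OF rT p] rfield_bounded_rv[OF rfield_f_shift[OF v base_Theta] p]
      by (auto intro: bounded_rv_integrable)
    then show "picard v p = expectation (\<lambda>\<omega>. terminal base p \<omega> + (T - fst p) * f (v (shift base p \<omega>)))"
      by (simp add: picard_def)
  qed
  moreover have "2 * (Kg + 2 * (1 + T) * (K\<^sup>2 + L\<^sup>2 * ?B) / ?lam) \<le> ?B"
  proof -
    have "2 * (1 + T) * (K\<^sup>2 + L\<^sup>2 * ?B) / ?lam = (K\<^sup>2 + L\<^sup>2 * ?B) / (4 * (1 + L\<^sup>2))"
    proof -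
      have "solRate = (2 * (1 + T)) * (4 * (1 + L\<^sup>2))" by (simp add: solRate_def algebra_simps)
      then show ?thesis using T_pos by (simp only: mult_divide_mult_cancel_left_if) simp
    qed
    also have "\<dots> \<le> ((K\<^sup>2 + ?B) * (1 + L\<^sup>2)) / (4 * (1 + L\<^sup>2))"
      using solB_nonneg by (intro divide_right_mono) (auto simp: algebra_simps intro!: mult_nonneg_nonneg)
    also have "\<dots> = (K\<^sup>2 + ?B) / 4"
      by (rule mult_divide_mult_cancel_right, rule less_imp_neq[THEN not_sym], rule add_pos_nonneg) auto
    finally show ?thesis by (simp add: solB_def)
  qed
  ultimately show ?thesis by (rule ms_ctl_mono)
qed

text \<open>In the supremum norm weighted by \<open>exp (2 * (1 + L) * (T - t))\<close> the time
  integral contributes \<open>1 / (2 * (1 + L))\<close> and \<open>f\<close> contributes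
  \<open>L\<close>, which gives the factor 1/2 on the whole of \<open>{0..T}\<close>, however large
  \<open>T\<close> is.\<close>

lemma picard_contraction:
  assumes v: "v \<in> borel_measurable E" and w: "w \<in> borel_measurable E"
    and le: "\<And>p. p \<in> space E \<Longrightarrow> \<bar>v p - w p\<bar> \<le> a * exp (2 * (1 + L) * (T - fst p))" and p: "p \<in> space E"
  shows "\<bar>picard v p - picard w p\<bar> \<le> a / 2 * exp (2 * (1 + L) * (T - fst p))"
proof -
  let ?mu = "2 * (1 + L)"
  note i = bounded_rv_integrable[OF rfield_bounded_rv[OF rfield_f_shift[OF v base_Theta] p]]
    bounded_rv_integrable[OF rfield_bounded_rv[OF rfield_f_shift[OF w base_Theta] p]]
  have t: "fst p \<in> {0..T}" using p by (auto simp: space_timespace)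
  have a: "0 \<le> a"
  proof -
    have "0 \<le> a * exp (2 * (1 + L) * (T - fst p))" using le[OF p] by linarith
    then show ?thesis by (simp add: zero_le_mult_iff)
  qed
  have "\<bar>picard v p - picard w p\<bar> = (T - fst p) * \<bar>expectation (\<lambda>\<omega>. f (v (shift base p \<omega>)) - f (w (shift base p \<omega>)))\<bar>"
    unfolding picard_def using i t by (simp add: right_diff_distrib[symmetric] abs_mult)
  also have "\<dots> \<le> (T - fst p) * expectation (\<lambda>\<omega>. \<bar>f (v (shift base p \<omega>)) - f (w (shift base p \<omega>))\<bar>)"
    using t by (intro mult_left_mono integral_abs_bound) auto
  also have "\<dots> \<le> (T - fst p) * expectation (\<lambda>\<omega>. (L * a) * exp (?mu * (T - fst p) * (1 - r base \<omega>)))"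
  proof (intro mult_left_mono integral_mono integrable_abs integrable_mult_right bounded_rv_integrable exp_r_integrable)
    fix \<omega> assume "\<omega> \<in> space P"
    from le[OF shift_in[OF base_Theta p this]]
    have "\<bar>v (shift base p \<omega>) - w (shift base p \<omega>)\<bar> \<le> a * exp (?mu * (T - fst p) * (1 - r base \<omega>))"
      by (simp add: shift_def algebra_simps)
    from mult_left_mono[OF this L_nonneg] f_Lip[of "v (shift base p \<omega>)" "w (shift base p \<omega>)"]
    show "\<bar>f (v (shift base p \<omega>)) - f (w (shift base p \<omega>))\<bar> \<le> (L * a) * exp (?mu * (T - fst p) * (1 - r base \<omega>))"
      by (simp add: mult.assoc)
  qed (use t rfield_bounded_rv[OF rfield_f_shift[OF v base_Theta] p] rfield_bounded_rv[OF rfield_f_shift[OF w base_Theta] p] in auto)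
  also have "\<dots> = (L * a) * ((T - fst p) * expectation (\<lambda>\<omega>. exp (?mu * (T - fst p) * (1 - r base \<omega>))))"
    by simp
  also have "\<dots> \<le> (L * a) * (exp (?mu * (T - fst p)) / ?mu)"
    using L_nonneg a t by (intro mult_left_mono expectation_exp_r_le) auto
  also have "\<dots> = (L / (1 + L)) * (a / 2 * exp (?mu * (T - fst p)))"
    using L_nonneg by (simp add: field_simps)
  also have "\<dots> \<le> 1 * (a / 2 * exp (?mu * (T - fst p)))"
    using L_nonneg a by (intro mult_right_mono) auto
  finally show ?thesis by simp
qed

definition picard_seq :: "nat \<Rightarrow> real \<times> (nat \<Rightarrow> real) \<Rightarrow> real"
  where "picard_seq k = (picard ^^ k) (\<lambda>_. 0)"

lemma picard_seq_Suc: "picard_seq (Suc k) = picard (picard_seq k)"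
  by (simp add: picard_seq_def)

lemma picard_seq_measurable: "picard_seq k \<in> borel_measurable E"
  by (induction k) (auto simp: picard_seq_Suc picard_measurable, simp add: picard_seq_def)

lemma picard_seq_ctl: "ms_ctl solRate solB (\<lambda>p _. picard_seq k p)"
proof (induction k)
  case 0 then show ?case unfolding ms_ctl_def picard_seq_def
    using solB_nonneg by (auto intro!: mult_nonneg_nonneg)
next
  case (Suc k) then show ?case
    unfolding picard_seq_Suc using picard_seq_measurable by (intro picard_ctl)
qed

lemma picard_seq_diff:
  "p \<in> space E \<Longrightarrow> \<bar>picard_seq (Suc k) p - picard_seq k p\<bar> \<le> solCu * (1/2) ^ k * exp (2 * (1 + L) * (T - fst p))"
proof (induction k arbitrary: p)
  case 0
  have "\<bar>picard_seq 1 p - picard_seq 0 p\<bar> \<le> solCu * 1"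
    using picard_bound[OF _ 0, of "\<lambda>_. 0"] by (simp add: picard_seq_def)
  also have "\<dots> \<le> solCu * exp (2 * (1 + L) * (T - fst p))"
    using 0 L_nonneg Kg_nonneg K_nonneg T_pos
    by (intro mult_left_mono) (auto simp: space_timespace solCu_def)
  finally show ?case by simp
next
  case (Suc k)
  from picard_contraction[OF picard_seq_measurable picard_seq_measurable Suc.IH Suc.prems]
  show ?case by (simp add: picard_seq_Suc[of k] picard_seq_Suc[of "Suc k"] )
qed

definition sol :: "real \<times> (nat \<Rightarrow> real) \<Rightarrow> real"
  where "sol p = (if p \<in> space E then lim (\<lambda>k. picard_seq k p) else 0)"

text \<open>The successive differences are dominated by a geometric series.\<close>

lemma picard_seq_tendsto: 
  assumes p: "p \<in> space E" shows "(\<lambda>k. picard_seq k p) \<longlonglongrightarrow> sol p"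
proof -
  have "summable (\<lambda>k. picard_seq (Suc k) p - picard_seq k p)"
  proof (rule summable_comparison_test'[where N=0])
    show "summable (\<lambda>k. solCu * (1/2) ^ k * exp (2 * (1 + L) * (T - fst p)))"
      by (intro summable_mult2 summable_mult summable_geometric) auto
  qed (use picard_seq_diff[OF p] in auto)
  then have "(\<lambda>k. \<Sum>j<k. picard_seq (Suc j) p - picard_seq j p) \<longlonglongrightarrow> (\<Sum>j. picard_seq (Suc j) p - picard_seq j p)"
    by (rule summable_LIMSEQ)
  then have "(\<lambda>k. picard_seq k p - picard_seq 0 p) \<longlonglongrightarrow> (\<Sum>j. picard_seq (Suc j) p - picard_seq j p)"
    by (simp only: sum_lessThan_telescope[of "\<lambda>k. picard_seq k p"])
  then have "convergent (\<lambda>k. picard_seq k p)"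
    unfolding convergent_def by (auto simp: picard_seq_def[of 0])
  then show ?thesis using p by (simp add: sol_def convergent_LIMSEQ_iff)
qed

lemma sol_measurable: "sol \<in> borel_measurable E"
  by (rule borel_measurable_LIMSEQ_real[OF picard_seq_tendsto picard_seq_measurable])

lemma sol_bound: "p \<in> space E \<Longrightarrow> \<bar>sol p\<bar> \<le> solCu"
proof (rule tendsto_upperbound[OF tendsto_rabs[OF picard_seq_tendsto]])
  assume p: "p \<in> space E"
  have "\<bar>picard_seq k p\<bar> \<le> solCu" for k
  proof (cases k)
    case 0 then show ?thesis using Kg_nonneg K_nonneg T_pos by (simp add: picard_seq_def solCu_def)
  next
    case (Suc j) then show ?thesis using picard_bound[OF picard_seq_measurable p] by (simp add: picard_seq_Suc)
  qed
  then show "\<forall>\<^sub>F k in sequentially. \<bar>picard_seq k p\<bar> \<le> solCu" by simp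
qed auto

definition solKu :: real where "solKu = solB * exp (solRate * T)"

lemma solKu_nonneg: "0 \<le> solKu" using solB_nonneg by (simp add: solKu_def)

text \<open>Inherited from the iterates: these are deterministic, so that the mean square bound of
  \<open>ms_ctl\<close> is a pointwise one. The constant \<open>solKu\<close> takes the weight at
  its largest value, at time 0.\<close>

lemma sol_Lip: "p \<in> space E \<Longrightarrow> q \<in> space E \<Longrightarrow> (sol p - sol q)\<^sup>2 \<le> solKu * pdist2 d p q"
proof -
  have *: "(sol p - sol q)\<^sup>2 \<le> solKu * pdist2 d p q" if p: "p \<in> space E" and q: "q \<in> space E" and pq: "fst p \<le> fst q" for p q
  proof (rule tendsto_upperbound[OF tendsto_power[OF tendsto_diff[OF picard_seq_tendsto[OF p] picard_seq_tendsto[OF q]]]])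
    have "(picard_seq k p - picard_seq k q)\<^sup>2 \<le> solKu * pdist2 d p q" for k
    proof -
      have "(picard_seq k p - picard_seq k q)\<^sup>2 \<le> solB * exp (solRate * (T - fst p)) * pdist2 d p q"
        using ms_ctlD(2)[OF picard_seq_ctl p q pq] by (simp add: prob_space)
      also have "\<dots> \<le> solKu * pdist2 d p q"
        unfolding solKu_def using solB_nonneg solRate_pos p
        by (intro mult_right_mono mult_left_mono) (auto simp: space_timespace)
      finally show ?thesis .
    qed
    then show "\<forall>\<^sub>F k in sequentially. (picard_seq k p - picard_seq k q)\<^sup>2 \<le> solKu * pdist2 d p q" by simp
  qed auto
  assume "p \<in> space E" "q \<in> space E"
  then show ?thesis
    using *[of p q] *[of q p] by (cases "fst p \<le> fst q") (auto simp: power2_commute pdist2_commute)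
qed

lemma expectation_shift_cong:
  assumes \<theta>: "\<theta> \<in> Theta" "\<theta>' \<in> Theta" and p: "p \<in> space E" and h: "h \<in> borel_measurable E"
  shows "expectation (\<lambda>\<omega>. h (shift \<theta> p \<omega>)) = expectation (\<lambda>\<omega>. (h (shift \<theta>' p \<omega>) :: real))"
proof -
  have m: "shift \<theta> p \<in> measurable P E" if "\<theta> \<in> Theta" for \<theta>
    using that by (intro measurable_galg_P[OF _ shift_measurable1[OF that order_refl _ p]]) auto
  have "expectation (\<lambda>\<omega>. h (shift \<eta> p \<omega>)) = (\<integral>z. h z \<partial>distr P E (shift \<eta> p))" if "\<eta> \<in> Theta" for \<eta>
    using m[OF that] h by (subst integral_distr) auto
  then show ?thesis using \<theta> distr_shift[OF \<theta> p] by simp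
qed

lemma expectation_terminal_cong:
  assumes \<theta>: "\<theta> \<in> Theta" "\<theta>' \<in> Theta" and p: "p \<in> space E"
  shows "expectation (terminal \<theta> p) = expectation (terminal \<theta>' p)"
proof -
  have t: "T - fst p \<in> {0..T}" using p by (auto simp: space_timespace)
  have x: "snd p \<in> Rd d" using p by (auto simp: space_timespace)
  have "expectation (terminal \<eta> p) = (\<integral>w. G (vadd d (snd p) w) \<partial>distr P (Rd_borel d) (W \<eta> (T - fst p)))" if "\<eta> \<in> Theta" for \<eta>
    using W_measurable_P[OF that t] x by (subst integral_distr) (auto intro!: measurable_compose[OF _ G_meas])
  then show ?thesis using \<theta> W_law[OF \<theta> t] by simp
qed

text \<open>The terminal term and the shift may carry different indices, since only their laws
  enter. Dominated convergence with the bound on \<open>f\<close> allows the limit in the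
  iteration.\<close>

lemma sol_fixed_point:
  assumes \<theta>: "\<theta> \<in> Theta" "\<theta>' \<in> Theta" and p: "p \<in> space E"
  shows "sol p = expectation (terminal \<theta> p) + (T - fst p) * expectation (\<lambda>\<omega>. f (sol (shift \<theta>' p \<omega>)))"
proof -
  have "(\<lambda>k. picard_seq (Suc k) p) \<longlonglongrightarrow> sol p"
    using picard_seq_tendsto[OF p] by (rule LIMSEQ_Suc)
  moreover have "(\<lambda>k. picard_seq (Suc k) p) \<longlonglongrightarrow> picard sol p"
    unfolding picard_seq_Suc picard_def
  proof (intro tendsto_add tendsto_mult tendsto_const integral_dominated_convergence[where w="\<lambda>_. K"])
    show "(\<lambda>\<omega>. f (sol (shift base p \<omega>))) \<in> borel_measurable P"
      using bounded_rv_measurable[OF rfield_bounded_rv[OF rfield_f_shift[OF sol_measurable base_Theta] p]] .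
    show "(\<lambda>\<omega>. f (picard_seq k (shift base p \<omega>))) \<in> borel_measurable P" for k
      using bounded_rv_measurable[OF rfield_bounded_rv[OF rfield_f_shift[OF picard_seq_measurable base_Theta] p]] .
    show "AE \<omega> in P. (\<lambda>k. f (picard_seq k (shift base p \<omega>))) \<longlonglongrightarrow> f (sol (shift base p \<omega>))"
    proof (rule AE_I2)
      fix \<omega> assume "\<omega> \<in> space P"
      from picard_seq_tendsto[OF shift_in[OF base_Theta p this]]
      show "(\<lambda>k. f (picard_seq k (shift base p \<omega>))) \<longlonglongrightarrow> f (sol (shift base p \<omega>))"
        by (rule continuous_on_tendsto_compose[OF f_cont[of UNIV]]) auto
    qed
  qed (use f_bound in auto)
  ultimately have "sol p = picard sol p" by (rule LIMSEQ_unique)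
  then show ?thesis
    using expectation_shift_cong[OF base_Theta \<theta>(2) p measurable_compose[OF sol_measurable f_meas]]
      expectation_terminal_cong[OF base_Theta \<theta>(1) p] by (simp add: picard_def)
qed

end

section \<open>Error of the multilevel Picard scheme\<close>

locale mlp_scheme = semilinear +
  fixes M :: nat and U :: "int list \<Rightarrow> nat \<Rightarrow> real \<times> (nat \<Rightarrow> real) \<Rightarrow> 'a \<Rightarrow> real"
  assumes M_pos: "1 \<le> M"
    and U_eq: "\<theta> \<in> Theta \<Longrightarrow> p \<in> space E \<Longrightarrow> \<omega> \<in> space P \<Longrightarrow>
      U \<theta> n p \<omega> = (T - fst p) * f 0 * indicator {1..} n
        + indicator {1..} n / real M ^ n * (\<Sum>i=1..M ^ n. terminal (\<theta> @ [0, - int i]) p \<omega>)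
        + (\<Sum>l\<in>{1..<n}. (T - fst p) / real M ^ (n - l) *
            (\<Sum>i=1..M ^ (n - l).
              f (U (\<theta> @ [int l, int i]) l (shift (\<theta> @ [int l, int i]) p \<omega>) \<omega>)
              - f (U (\<theta> @ [- int l, int i]) (l - 1) (shift (\<theta> @ [int l, int i]) p \<omega>) \<omega>)))"
begin

text \<open>The scheme with index \<open>\<theta>\<close> uses noise of proper extensions of
  \<open>\<theta>\<close> only. Leaving out \<open>\<theta>\<close> itself makes
  \<open>U \<theta> n\<close> independent of the shift with index \<open>\<theta>\<close>.\<close>

definition desc :: "int list \<Rightarrow> int list set"
  where "desc \<theta> = {\<theta> @ \<kappa> | \<kappa>. \<kappa> \<noteq> []}"

definition level_index :: "nat \<Rightarrow> (nat \<times> nat) set"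
  where "level_index n = (SIGMA l:{0..<n}. {1..M ^ (n - l)})"

text \<open>The summand \<open>(l, i)\<close> of the scheme; the Monte Carlo terms for \<open>g\<close> form the level \<open>l = 0\<close>.\<close>

definition summand :: "int list \<Rightarrow> nat \<Rightarrow> nat \<times> nat \<Rightarrow> real \<times> (nat \<Rightarrow> real) \<Rightarrow> 'a \<Rightarrow> real"
  where "summand \<theta> n j p \<omega> = (case j of (l, i) \<Rightarrow>
    if l = 0 then 1 / real M ^ n * terminal (\<theta> @ [0, - int i]) p \<omega>
    else 1 / real M ^ (n - l) * ((T - fst p) *
      (f (U (\<theta> @ [int l, int i]) l (shift (\<theta> @ [int l, int i]) p \<omega>) \<omega>)
       - f (U (\<theta> @ [- int l, int i]) (l - 1) (shift (\<theta> @ [int l, int i]) p \<omega>) \<omega>))))"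

text \<open>Index trees including their roots, since the noise of the root moves the point of
  evaluation. A positive level has two trees, one for the field of level \<open>l\<close> and one
  for the field of level \<open>l - 1\<close>.\<close>

definition summand_src :: "int list \<Rightarrow> nat \<times> nat \<Rightarrow> int list set"
  where "summand_src \<theta> j = (case j of (l, i) \<Rightarrow>
    {\<theta> @ a # b # \<kappa> | a b \<kappa>. (a, b) \<in> (if l = 0 then {(0, - int i)} else {(int l, int i), (- int l, int i)})})"

lemma append_Theta[simp]: "\<theta> \<in> Theta \<Longrightarrow> \<theta> @ \<kappa> \<in> Theta" by (simp add: Theta_def)

lemma desc_Theta: "\<theta> \<in> Theta \<Longrightarrow> UNIV \<times> desc \<theta> \<subseteq> UNIV \<times> Theta" by (auto simp: desc_def)

lemma summand_src_desc: "summand_src \<theta> j \<subseteq> desc \<theta>"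
  by (auto simp: summand_src_def desc_def split: prod.splits)

lemma summand_src_Theta: "\<theta> \<in> Theta \<Longrightarrow> UNIV \<times> summand_src \<theta> j \<subseteq> UNIV \<times> Theta"
  using summand_src_desc desc_Theta by blast

text \<open>The first entries 0, \<open>l\<close> and \<open>- l\<close> separate the levels and the
  second entry separates the samples; this is the purpose of the signs in the indices.\<close>

lemma summand_src_disjoint: "disjoint_family_on (\<lambda>j. UNIV \<times> summand_src \<theta> j) (level_index n)"
  by (auto simp: disjoint_family_on_def summand_src_def level_index_def split: if_splits)

lemma finite_level_index: "finite (level_index n)" by (auto simp: level_index_def)

lemma U_0: "\<theta> \<in> Theta \<Longrightarrow> p \<in> space E \<Longrightarrow> \<omega> \<in> space P \<Longrightarrow> U \<theta> 0 p \<omega> = 0"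
  by (subst U_eq) auto

lemma U_decomp:
  assumes \<theta>: "\<theta> \<in> Theta" and p: "p \<in> space E" and \<omega>: "\<omega> \<in> space P" and n: "1 \<le> n"
  shows "U \<theta> n p \<omega> = (T - fst p) * f 0 + (\<Sum>j\<in>level_index n. summand \<theta> n j p \<omega>)"
proof -
  have "{0..<n} = insert 0 {1..<n}" using n by auto
  then have "(\<Sum>j\<in>level_index n. summand \<theta> n j p \<omega>)
    = (\<Sum>i=1..M ^ n. summand \<theta> n (0, i) p \<omega>) + (\<Sum>l\<in>{1..<n}. \<Sum>i=1..M ^ (n - l). summand \<theta> n (l, i) p \<omega>)"
  proof -
    have "(\<Sum>j\<in>level_index n. summand \<theta> n j p \<omega>) = (\<Sum>l\<in>{0..<n}. \<Sum>i=1..M ^ (n - l). summand \<theta> n (l, i) p \<omega>)"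
      unfolding level_index_def by (subst sum.Sigma) (auto intro!: sum.cong)
    then show ?thesis unfolding \<open>{0..<n} = insert 0 {1..<n}\<close> by simp
  qed
  also have "(\<Sum>i=1..M ^ n. summand \<theta> n (0, i) p \<omega>)
      = 1 / real M ^ n * (\<Sum>i=1..M ^ n. terminal (\<theta> @ [0, - int i]) p \<omega>)"
    unfolding sum_distrib_left by (simp add: summand_def)
  also have "(\<Sum>l\<in>{1..<n}. \<Sum>i=1..M ^ (n - l). summand \<theta> n (l, i) p \<omega>)
    = (\<Sum>l\<in>{1..<n}. (T - fst p) / real M ^ (n - l) *
            (\<Sum>i=1..M ^ (n - l).
              f (U (\<theta> @ [int l, int i]) l (shift (\<theta> @ [int l, int i]) p \<omega>) \<omega>)
              - f (U (\<theta> @ [- int l, int i]) (l - 1) (shift (\<theta> @ [int l, int i]) p \<omega>) \<omega>)))"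
    unfolding sum_distrib_left by (intro sum.cong refl) (auto simp: summand_def)
  finally show ?thesis using n by (subst U_eq[OF \<theta> p \<omega>]) simp
qed

text \<open>The lower levels enter as an assumption, because the lemma is applied within the
  induction that shows them to be random fields.\<close>

lemma rfield_summand:
  assumes IH: "\<And>l \<theta>. l < n \<Longrightarrow> \<theta> \<in> Theta \<Longrightarrow> rfield (UNIV \<times> desc \<theta>) (U \<theta> l)" and \<theta>: "\<theta> \<in> Theta" and j: "j \<in> level_index n"
  shows "rfield (UNIV \<times> summand_src \<theta> j) (summand \<theta> n j)"
proof -
  obtain l i where ji: "j = (l, i)" and l: "l < n" using j by (auto simp: level_index_def)
  note K = summand_src_Theta[OF \<theta>, of j]
  show ?thesis
  proof (cases "l = 0")
    case True
    have "rfield (UNIV \<times> summand_src \<theta> j) (terminal (\<theta> @ [0, - int i]))"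
      by (rule rfield_mono[OF rfield_terminal _ K]) (use \<theta> True in \<open>auto simp: ji summand_src_def\<close>)
    from rfield_mult[OF rfield_const[OF K, of "1 / real M ^ n"] this] True
    show ?thesis by (simp add: summand_def[abs_def] ji)
  next
    case False
    let ?e = "\<theta> @ [int l, int i]" and ?e' = "\<theta> @ [- int l, int i]"
    have sub: "UNIV \<times> desc ?e \<subseteq> UNIV \<times> summand_src \<theta> j" "UNIV \<times> desc ?e' \<subseteq> UNIV \<times> summand_src \<theta> j"
      "UNIV \<times> {?e} \<subseteq> UNIV \<times> summand_src \<theta> j"
      using False by (auto simp: ji summand_src_def desc_def)
    have "rfield (UNIV \<times> summand_src \<theta> j) (\<lambda>p \<omega>. f (U ?e l (shift ?e p \<omega>) \<omega>))"
      by (rule rfield_comp[OF rfield_shift[OF IH sub(1) sub(3) K] f_meas f_bound]) (use \<theta> l in auto)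
    moreover have "rfield (UNIV \<times> summand_src \<theta> j) (\<lambda>p \<omega>. f (U ?e' (l - 1) (shift ?e p \<omega>) \<omega>))"
      by (rule rfield_comp[OF rfield_shift[OF IH sub(2) sub(3) K] f_meas f_bound]) (use \<theta> l in auto)
    ultimately have "rfield (UNIV \<times> summand_src \<theta> j) (\<lambda>p \<omega>. 1 / real M ^ (n - l) * ((T - fst p) *
        (f (U ?e l (shift ?e p \<omega>) \<omega>) - f (U ?e' (l - 1) (shift ?e p \<omega>) \<omega>))))"
      by (intro rfield_mult rfield_const rfield_time rfield_diff K)
    then show ?thesis using False by (simp add: summand_def[abs_def] ji)
  qed
qed

lemma rfield_U: "\<theta> \<in> Theta \<Longrightarrow> rfield (UNIV \<times> desc \<theta>) (U \<theta> n)"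
proof (induction n arbitrary: \<theta> rule: less_induct)
  case (less n)
  note K = desc_Theta[OF less.prems]
  show ?case
  proof (cases "n = 0")
    case True
    show ?thesis by (rule rfield_cong[OF rfield_const[OF K, of 0]]) (use True less.prems in \<open>simp add: U_0\<close>)
  next
    case False
    have s: "rfield (UNIV \<times> desc \<theta>) (summand \<theta> n j)" if "j \<in> level_index n" for j
      by (rule rfield_mono[OF rfield_summand[OF less.IH less.prems that] _ K]) (use summand_src_desc[of \<theta> j] in auto)
    show ?thesis
    proof (rule rfield_cong)
      show "rfield (UNIV \<times> desc \<theta>) (\<lambda>p \<omega>. (T - fst p) * f 0 + (\<Sum>j\<in>level_index n. summand \<theta> n j p \<omega>))"
        by (intro rfield_add rfield_mult rfield_time rfield_const rfield_sum s K)
    qed (use False less.prems in \<open>simp add: U_decomp\<close>)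
  qed
qed

lemmas rfield_summand' = rfield_summand[OF rfield_U]

lemma indep_summands:
  assumes \<theta>: "\<theta> \<in> Theta" and X: "\<And>j. j \<in> level_index n \<Longrightarrow> X j \<in> borel_measurable (galg (UNIV \<times> summand_src \<theta> j))"
  shows "indep_vars (\<lambda>_. borel) X (level_index n)"
  by (rule indep_vars_galg[OF summand_src_Theta[OF \<theta>] summand_src_disjoint X])

text \<open>Induction over the level. The summands of two copies agree in law one by one: the
  shifted points agree in law, and for a frozen point the two inner fields are independent with laws
  known by induction. Since the summands are independent, their sums agree in law as well.\<close>

lemma distr_U_cong:
  assumes "\<theta> \<in> Theta" "\<theta>' \<in> Theta" "p \<in> space E"
  shows "distr P borel (U \<theta> n p) = distr P borel (U \<theta>' n p)"
  using assms
proof (induction n arbitrary: \<theta> \<theta>' p rule: less_induct)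
  case (less n)
  note \<theta> = less.prems(1,2) and p = less.prems(3)
  show ?case
  proof (cases "n = 0")
    case True
    have "distr P borel (U \<theta> 0 p) = distr P borel (U \<theta>' 0 p)"
      by (intro distr_cong) (use \<theta> p in \<open>auto simp: U_0\<close>)
    then show ?thesis using True by simp
  next
    case False
    then have n: "1 \<le> n" by simp
    have sm: "summand \<eta> n j p \<in> borel_measurable (galg (UNIV \<times> summand_src \<eta> j))"
      if "\<eta> \<in> Theta" "j \<in> level_index n" for \<eta> j
      by (rule rfield_measurable[OF rfield_summand'[OF _ that] p]) auto
    have eq: "distr P borel (summand \<theta> n j p) = distr P borel (summand \<theta>' n j p)" if j: "j \<in> level_index n" for j
    proof -
      obtain l i where ji: "j = (l, i)" and l: "l < n" using j by (auto simp: level_index_def)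
      show ?thesis
      proof (cases "l = 0")
        case True
        have t: "T - fst p \<in> {0..T}" and x: "snd p \<in> Rd d" using p by (auto simp: space_timespace)
        have m: "(\<lambda>w. 1 / real M ^ n * G (vadd d (snd p) w)) \<in> borel_measurable (Rd_borel d)"
          using x by (intro borel_measurable_times borel_measurable_const measurable_compose[OF _ G_meas] measurable_vadd) auto
        have "distr P borel (summand \<eta> n j p) = distr (distr P (Rd_borel d) (W (\<eta> @ [0, - int i]) (T - fst p))) borel (\<lambda>w. 1 / real M ^ n * G (vadd d (snd p) w))"
          if "\<eta> \<in> Theta" for \<eta>
          using True W_measurable_P[OF append_Theta[OF that] t] m
          by (subst distr_distr) (auto simp: ji summand_def[abs_def] comp_def)
        moreover have "distr P (Rd_borel d) (W (\<theta> @ [0, - int i]) (T - fst p)) = distr P (Rd_borel d) (W (\<theta>' @ [0, - int i]) (T - fst p))"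
          by (rule W_law) (use \<theta> t in auto)
        ultimately show ?thesis using \<theta> by simp
      next
        case l0: False
        define c where "c = 1 / real M ^ (n - l)"
        define H where "H = (\<lambda>a b. c * ((T - fst p) * (f a - f b)))"
        have Hm: "(\<lambda>(a, b). H a b) \<in> borel_measurable (borel \<Otimes>\<^sub>M borel)"
          unfolding H_def using f_meas by measurable
        \<comment> \<open>The probability that the summand lies in \<open>A\<close> when the shifted
          point is frozen at \<open>z\<close>. It is written with the laws for the fixed index
          \<open>\<theta>\<close>, so that it is the same function for every index
          \<open>\<eta>\<close>.\<close>
        define \<Psi> where "\<Psi> = (\<lambda>A z. \<integral>\<^sup>+y. indicator A (H (fst y) (snd y))
          \<partial>(distr P borel (U \<theta> l z) \<Otimes>\<^sub>M distr P borel (U \<theta> (l - 1) z)))"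
        have key: "emeasure (distr P borel (summand \<eta> n j p)) A = (\<integral>\<^sup>+\<omega>. \<Psi> A (shift \<eta>0 p \<omega>) \<partial>P)"
          if \<eta>: "\<eta> \<in> Theta" "\<eta>0 = \<eta> @ [int l, int i]" and A[measurable]: "A \<in> sets borel" for \<eta> \<eta>0 A
        proof -
          let ?e' = "\<eta> @ [- int l, int i]"
          have e: "\<eta>0 \<in> Theta" "?e' \<in> Theta" using \<eta> by auto
          let ?K = "UNIV \<times> desc \<eta>0 \<union> UNIV \<times> desc ?e'"
          have K: "?K \<subseteq> UNIV \<times> Theta" using desc_Theta[OF e(1)] desc_Theta[OF e(2)] by auto
          \<comment> \<open>\<open>\<eta>0\<close> is a proper extension neither of itself nor of
            \<open>?e'\<close>, so the shift is independent of both inner fields.\<close>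
          have d0: "(UNIV \<times> {\<eta>0}) \<inter> ?K = {}" using l0 \<eta> by (auto simp: desc_def)
          have d1: "(UNIV \<times> desc \<eta>0) \<inter> (UNIV \<times> desc ?e') = {}" using l0 \<eta> by (auto simp: desc_def)
          have ind: "indep_subalg (galg (UNIV \<times> {\<eta>0})) (galg ?K)"
            using e K d0 by (intro indep_subalg_galg) auto
          have X: "shift \<eta>0 p \<in> measurable (galg (UNIV \<times> {\<eta>0})) E"
            using e by (intro shift_measurable1 p) auto
          have rU: "rfield ?K (U \<eta>0 l)" "rfield ?K (U ?e' (l - 1))"
            by (rule rfield_mono[OF rfield_U _ K], use e in auto)+
          have Um: "(\<lambda>z. U \<eta>0 l (fst z) (snd z)) \<in> borel_measurable (E \<Otimes>\<^sub>M galg ?K)"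
            "(\<lambda>z. U ?e' (l - 1) (fst z) (snd z)) \<in> borel_measurable (E \<Otimes>\<^sub>M galg ?K)"
            by (intro rfield_compose[OF rU(1)] rfield_compose[OF rU(2)] measurable_fst measurable_snd)+
          have HU: "(\<lambda>z. H (U \<eta>0 l (fst z) (snd z)) (U ?e' (l - 1) (fst z) (snd z))) \<in> borel_measurable (E \<Otimes>\<^sub>M galg ?K)"
            using measurable_compose[OF measurable_Pair[OF Um] Hm] by simp
          have "emeasure (distr P borel (summand \<eta> n j p)) A = (\<integral>\<^sup>+\<omega>. indicator A (summand \<eta> n j p \<omega>) \<partial>P)"
            using measurable_galg_P[OF summand_src_Theta[OF \<eta>(1)] sm[OF \<eta>(1) j]]
            by (subst nn_integral_indicator[symmetric], simp) (subst nn_integral_distr, auto)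
          also have "\<dots> = (\<integral>\<^sup>+\<omega>. indicator A (H (U \<eta>0 l (shift \<eta>0 p \<omega>) \<omega>) (U ?e' (l - 1) (shift \<eta>0 p \<omega>) \<omega>)) \<partial>P)"
            using l0 by (simp add: summand_def ji \<eta>(2) H_def c_def)
          also have "\<dots> = (\<integral>\<^sup>+\<omega>'. (\<integral>\<^sup>+\<omega>. indicator A (H (U \<eta>0 l (shift \<eta>0 p \<omega>') \<omega>) (U ?e' (l - 1) (shift \<eta>0 p \<omega>') \<omega>)) \<partial>P) \<partial>P)"
            using nn_integral_indep_subalg[OF ind X measurable_ident_sets[OF refl],
                of "\<lambda>z. indicator A (H (U \<eta>0 l (fst z) (snd z)) (U ?e' (l - 1) (fst z) (snd z)))"]
              measurable_compose[OF HU, of "indicator A" borel] A by simp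
          also have "\<dots> = (\<integral>\<^sup>+\<omega>'. \<Psi> A (shift \<eta>0 p \<omega>') \<partial>P)"
          proof (rule nn_integral_cong)
            fix \<omega>' assume "\<omega>' \<in> space P"
            then have z: "shift \<eta>0 p \<omega>' \<in> space E" (is "?z \<in> _") by (rule shift_in[OF e(1) p])
            have i1: "indep_subalg (galg (UNIV \<times> desc \<eta>0)) (galg (UNIV \<times> desc ?e'))"
              using e d1 by (intro indep_subalg_galg desc_Theta) auto
            note u = rfield_measurable[OF rfield_U[OF e(1)] z, of l] rfield_measurable[OF rfield_U[OF e(2)] z, of "l - 1"]
            note uP = measurable_galg_P[OF desc_Theta[OF e(1)] u(1)] measurable_galg_P[OF desc_Theta[OF e(2)] u(2)]
            have "\<Psi> A ?z = (\<integral>\<^sup>+y. indicator A (H (fst y) (snd y)) \<partial>(distr P borel (U \<eta>0 l ?z) \<Otimes>\<^sub>M distr P borel (U ?e' (l - 1) ?z)))"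
              unfolding \<Psi>_def using less.IH[OF l \<theta>(1) e(1) z] less.IH[OF _ \<theta>(1) e(2) z, of "l - 1"] l by simp
            also have "\<dots> = (\<integral>\<^sup>+y. indicator A (H (fst y) (snd y)) \<partial>(distr P (borel \<Otimes>\<^sub>M borel) (\<lambda>\<omega>. (U \<eta>0 l ?z \<omega>, U ?e' (l - 1) ?z \<omega>))))"
              by (simp only: distr_Pair_indep_subalg[OF i1 u])
            also have "\<dots> = (\<integral>\<^sup>+\<omega>. indicator A (H (U \<eta>0 l ?z \<omega>) (U ?e' (l - 1) ?z \<omega>)) \<partial>P)"
              using measurable_Pair[OF uP] measurable_compose[OF Hm, of "indicator A" borel] A
              by (subst nn_integral_distr) (auto simp: case_prod_unfold)
            finally show "(\<integral>\<^sup>+\<omega>. indicator A (H (U \<eta>0 l ?z \<omega>) (U ?e' (l - 1) ?z \<omega>)) \<partial>P) = \<Psi> A ?z" ..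
          qed
          finally show ?thesis .
        qed
        \<comment> \<open>Measurability in the point cannot be seen from a family of laws; it is
          taken from the representation by jointly measurable fields.\<close>
        have \<Psi>m: "\<Psi> A \<in> borel_measurable E" if A[measurable]: "A \<in> sets borel" for A
        proof -
          let ?e = "\<theta> @ [int l, int i]" and ?e' = "\<theta> @ [- int l, int i]"
          have e: "?e \<in> Theta" "?e' \<in> Theta" using \<theta> by auto
          have d1: "(UNIV \<times> desc ?e) \<inter> (UNIV \<times> desc ?e') = {}" using l0 by (auto simp: desc_def)
          have i1: "indep_subalg (galg (UNIV \<times> desc ?e)) (galg (UNIV \<times> desc ?e'))"
            using e d1 by (intro indep_subalg_galg desc_Theta) auto
          have Um: "(\<lambda>z. U ?e l (fst z) (snd z)) \<in> borel_measurable (E \<Otimes>\<^sub>M P)"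
            "(\<lambda>z. U ?e' (l - 1) (fst z) (snd z)) \<in> borel_measurable (E \<Otimes>\<^sub>M P)"
            by (intro rfield_compose[OF rfield_U[OF e(1)]] rfield_compose[OF rfield_U[OF e(2)]]
              measurable_compose[OF measurable_snd id_galg_P] desc_Theta e measurable_fst)+
          have "(\<lambda>z. H (U ?e l (fst z) (snd z)) (U ?e' (l - 1) (fst z) (snd z))) \<in> borel_measurable (E \<Otimes>\<^sub>M P)"
            using measurable_compose[OF measurable_Pair[OF Um] Hm] by simp
          from measurable_compose[OF this, of "indicator A" borel]
          have "(\<lambda>z. \<integral>\<^sup>+\<omega>. indicator A (H (U ?e l z \<omega>) (U ?e' (l - 1) z \<omega>)) \<partial>P) \<in> borel_measurable E"
            by (intro borel_measurable_nn_integral) (auto simp: case_prod_unfold)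
          also have "?this \<longleftrightarrow> ?thesis"
          proof (rule measurable_cong)
            fix z assume z: "z \<in> space E"
            note u = rfield_measurable[OF rfield_U[OF e(1)] z, of l] rfield_measurable[OF rfield_U[OF e(2)] z, of "l - 1"]
            note uP = measurable_galg_P[OF desc_Theta[OF e(1)] u(1)] measurable_galg_P[OF desc_Theta[OF e(2)] u(2)]
            have "\<Psi> A z = (\<integral>\<^sup>+y. indicator A (H (fst y) (snd y)) \<partial>(distr P borel (U ?e l z) \<Otimes>\<^sub>M distr P borel (U ?e' (l - 1) z)))"
              unfolding \<Psi>_def using less.IH[OF l \<theta>(1) e(1) z] less.IH[OF _ \<theta>(1) e(2) z, of "l - 1"] l by simp
            also have "\<dots> = (\<integral>\<^sup>+y. indicator A (H (fst y) (snd y)) \<partial>(distr P (borel \<Otimes>\<^sub>M borel) (\<lambda>\<omega>. (U ?e l z \<omega>, U ?e' (l - 1) z \<omega>))))"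
              by (simp only: distr_Pair_indep_subalg[OF i1 u])
            also have "\<dots> = (\<integral>\<^sup>+\<omega>. indicator A (H (U ?e l z \<omega>) (U ?e' (l - 1) z \<omega>)) \<partial>P)"
              using measurable_Pair[OF uP] measurable_compose[OF Hm, of "indicator A" borel] A
              by (subst nn_integral_distr) (auto simp: case_prod_unfold)
            finally show "(\<integral>\<^sup>+\<omega>. indicator A (H (U ?e l z \<omega>) (U ?e' (l - 1) z \<omega>)) \<partial>P) = \<Psi> A z" ..
          qed
          finally show ?thesis .
        qed
        show ?thesis
        proof (rule measure_eqI)
          fix A assume "A \<in> sets (distr P borel (summand \<theta> n j p))"
          then have A: "A \<in> sets borel" by simp
          let ?e = "\<theta> @ [int l, int i]" and ?e' = "\<theta>' @ [int l, int i]"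
          have e: "?e \<in> Theta" "?e' \<in> Theta" using \<theta> by auto
          have sp: "shift \<eta> p \<in> measurable P E" if "\<eta> \<in> Theta" for \<eta>
            using that by (intro measurable_galg_P[OF _ shift_measurable1[OF that order_refl _ p]]) auto
          have "(\<integral>\<^sup>+\<omega>. \<Psi> A (shift \<eta> p \<omega>) \<partial>P) = (\<integral>\<^sup>+z. \<Psi> A z \<partial>distr P E (shift \<eta> p))" if "\<eta> \<in> Theta" for \<eta>
            using sp[OF that] \<Psi>m[OF A] by (subst nn_integral_distr) auto
          then show "emeasure (distr P borel (summand \<theta> n j p)) A = emeasure (distr P borel (summand \<theta>' n j p)) A"
            using key[OF \<theta>(1) refl A] key[OF \<theta>(2) refl A] distr_shift[OF e p] e by simp
        qed simp
      qed
    qed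
    have sum_eq: "distr P borel (\<lambda>\<omega>. \<Sum>j\<in>level_index n. summand \<theta> n j p \<omega>) = distr P borel (\<lambda>\<omega>. \<Sum>j\<in>level_index n. summand \<theta>' n j p \<omega>)"
      by (rule distr_sum_indep_cong[OF finite_level_index indep_summands[OF \<theta>(1) sm[OF \<theta>(1)]] indep_summands[OF \<theta>(2) sm[OF \<theta>(2)]] eq])
    have "distr P borel (U \<eta> n p) = distr (distr P borel (\<lambda>\<omega>. \<Sum>j\<in>level_index n. summand \<eta> n j p \<omega>)) borel (\<lambda>a. (T - fst p) * f 0 + a)"
      if "\<eta> \<in> Theta" for \<eta>
    proof -
      have [measurable]: "(\<lambda>\<omega>. \<Sum>j\<in>level_index n. summand \<eta> n j p \<omega>) \<in> borel_measurable P"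
        by (intro borel_measurable_sum measurable_galg_P[OF summand_src_Theta[OF that] sm[OF that]])
      show ?thesis
        by (subst distr_distr, simp, simp, intro distr_cong refl) (simp add: U_decomp[OF that p _ n])
    qed
    then show ?thesis using \<theta> sum_eq by simp
  qed
qed

end

section \<open>Bias, variance and the error recursion\<close>

context mlp_scheme
begin

text \<open>\<open>[1]\<close> is a reference index with \<open>base \<notin> desc [1]\<close>, so
  that the shift and the field are independent. By equality in law its choice does not influence the
  value.\<close>

definition mean_fU :: "nat \<Rightarrow> real \<times> (nat \<Rightarrow> real) \<Rightarrow> real"
  where "mean_fU l p = expectation (\<lambda>\<omega>. f (U [1] l (shift base p \<omega>) \<omega>))"

text \<open>If the shift is independent of the field, the expectation depends on the two laws only,
  and these are the same for all indices.\<close>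

lemma expectation_f_U_shift:
  assumes \<eta>: "\<eta> \<in> Theta" "\<eta>' \<in> Theta" and dis: "\<eta> \<notin> desc \<eta>'" and p: "p \<in> space E"
  shows "expectation (\<lambda>\<omega>. f (U \<eta>' l (shift \<eta> p \<omega>) \<omega>)) = mean_fU l p"
proof -
  define \<psi> where "\<psi> = (\<lambda>z. expectation (\<lambda>\<omega>. f (U [1] l z \<omega>)))"
  have one: "[1] \<in> Theta" by (simp add: Theta_def)
  have fU: "rfield (UNIV \<times> desc \<theta>) (\<lambda>p \<omega>. f (U \<theta> l p \<omega>))" if "\<theta> \<in> Theta" for \<theta>
    by (rule rfield_comp[OF rfield_U[OF that] f_meas f_bound])
  have \<psi>m: "\<psi> \<in> borel_measurable E"
    unfolding \<psi>_def by (rule rfield_expectation[OF fU[OF one]])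
  have \<psi>eq: "expectation (\<lambda>\<omega>. f (U \<theta> l z \<omega>)) = \<psi> z" if \<theta>: "\<theta> \<in> Theta" and z: "z \<in> space E" for \<theta> z
  proof -
    have "expectation (\<lambda>\<omega>. f (U \<theta> l z \<omega>)) = (\<integral>y. f y \<partial>distr P borel (U \<theta> l z))" if "\<theta> \<in> Theta" for \<theta>
      using measurable_galg_P[OF desc_Theta[OF that] rfield_measurable[OF rfield_U[OF that] z]] f_meas
      by (subst integral_distr) auto
    then show ?thesis unfolding \<psi>_def using distr_U_cong[OF \<theta> one z, of l] \<theta> one by simp
  qed
  have *: "expectation (\<lambda>\<omega>. f (U \<theta> l (shift \<eta> p \<omega>) \<omega>)) = expectation (\<lambda>\<omega>'. \<psi> (shift \<eta> p \<omega>'))"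
    if \<theta>: "\<theta> \<in> Theta" and \<eta>: "\<eta> \<in> Theta" and dis: "\<eta> \<notin> desc \<theta>" for \<theta> \<eta>
  proof -
    have "(\<lambda>((z, z'), \<omega>). f (U \<theta> l z \<omega>)) \<in> borel_measurable ((E \<Otimes>\<^sub>M E) \<Otimes>\<^sub>M galg (UNIV \<times> desc \<theta>))"
      unfolding case_prod_unfold by (intro rfield_compose[OF fU[OF \<theta>]]) auto
    then have "expectation (\<lambda>\<omega>. f (U \<theta> l (shift \<eta> p \<omega>) \<omega>))
        = expectation (\<lambda>\<omega>'. expectation (\<lambda>\<omega>. f (U \<theta> l (shift \<eta> p \<omega>') \<omega>)))"
      using expectation_shift2(1)[OF desc_Theta[OF \<theta>] _ \<eta> p p, of "\<lambda>z _ \<omega>. f (U \<theta> l z \<omega>)" K] dis f_bound by auto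
    also have "\<dots> = expectation (\<lambda>\<omega>'. \<psi> (shift \<eta> p \<omega>'))"
      by (intro Bochner_Integration.integral_cong refl \<psi>eq[OF \<theta>] shift_in[OF \<eta> p])
    finally show ?thesis .
  qed
  have "base \<notin> desc [1]" by (auto simp: base_def desc_def)
  then show ?thesis
    unfolding mean_fU_def using *[OF \<eta>(2,1) dis] *[OF one base_Theta] expectation_shift_cong[OF \<eta>(1) base_Theta p \<psi>m] by simp
qed

text \<open>\<open>U \<theta> 0\<close> vanishes. Hence the separate term
  \<open>(T - t) * f 0\<close> of the scheme acts as the missing first term of the telescoping sum
  over the levels.\<close>

lemma mean_fU_0: "p \<in> space E \<Longrightarrow> mean_fU 0 p = f 0"
proof -
  assume p: "p \<in> space E"
  have "mean_fU 0 p = expectation (\<lambda>\<omega>. f 0)"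
    unfolding mean_fU_def
    by (intro Bochner_Integration.integral_cong refl) (use U_0[of "[1]"] shift_in[OF base_Theta p] in \<open>auto simp: Theta_def\<close>)
  then show ?thesis by (simp add: prob_space)
qed

text \<open>Both fields of a summand are evaluated at the same shifted point, but each of them is
  independent of it, so linearity reduces the mean to \<open>mean_fU\<close>.\<close>

lemma expectation_summand:
  assumes \<theta>: "\<theta> \<in> Theta" and p: "p \<in> space E" and j: "(l, i) \<in> level_index n"
  shows "expectation (summand \<theta> n (l, i) p) = 1 / real M ^ (n - l) *
    (if l = 0 then expectation (terminal base p) else (T - fst p) * (mean_fU l p - mean_fU (l - 1) p))"
proof (cases "l = 0")
  case True
  have "expectation (terminal (\<theta> @ [0, - int i]) p) = expectation (terminal base p)"
    by (rule expectation_terminal_cong[OF _ _ p]) (use \<theta> in auto)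
  then show ?thesis using True by (simp add: summand_def[abs_def])
next
  case False
  let ?e = "\<theta> @ [int l, int i]" and ?e' = "\<theta> @ [- int l, int i]"
  have e: "?e \<in> Theta" "?e' \<in> Theta" using \<theta> by auto
  have d: "?e \<notin> desc ?e" "?e \<notin> desc ?e'" using False by (auto simp: desc_def)
  have "rfield (UNIV \<times> Theta) (\<lambda>p \<omega>. f (U \<eta> k (shift ?e p \<omega>) \<omega>))" if "\<eta> \<in> Theta" for \<eta> k
    by (rule rfield_comp[OF rfield_shift[OF rfield_U[OF that]] f_meas f_bound]) (use e desc_Theta[OF that] in auto)
  from rfield_bounded_rv[OF this[OF e(1)] p, of l] rfield_bounded_rv[OF this[OF e(2)] p, of "l - 1"]
  have "expectation (\<lambda>\<omega>. f (U ?e l (shift ?e p \<omega>) \<omega>) - f (U ?e' (l - 1) (shift ?e p \<omega>) \<omega>))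
    = mean_fU l p - mean_fU (l - 1) p"
    using expectation_f_U_shift[OF e(1,1) d(1) p] expectation_f_U_shift[OF e d(2) p]
    by (subst Bochner_Integration.integral_diff) (auto intro: bounded_rv_integrable)
  then show ?thesis using False by (simp add: summand_def[abs_def])
qed

text \<open>The number of samples cancels against the prefactor, the levels telescope, and only the
  finest level \<open>n - 1\<close> remains: the mean of the scheme has the form of the fixed point
  equation with the preceding scheme inserted.\<close>

lemma expectation_U:
  assumes \<theta>: "\<theta> \<in> Theta" and p: "p \<in> space E" and n: "1 \<le> n"
  shows "expectation (U \<theta> n p) = expectation (terminal base p) + (T - fst p) * mean_fU (n - 1) p"
proof -
  have b: "bounded_rv (summand \<theta> n j p)" if "j \<in> level_index n" for j
    by (rule rfield_bounded_rv[OF rfield_summand'[OF _ \<theta> that] p])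
  have "expectation (U \<theta> n p) = expectation (\<lambda>\<omega>. (T - fst p) * f 0 + (\<Sum>j\<in>level_index n. summand \<theta> n j p \<omega>))"
    by (intro Bochner_Integration.integral_cong refl U_decomp[OF \<theta> p _ n])
  also have "\<dots> = (T - fst p) * f 0 + (\<Sum>j\<in>level_index n. expectation (summand \<theta> n j p))"
    using b by (subst Bochner_Integration.integral_add)
      (auto simp: prob_space intro!: bounded_rv_integrable bounded_rv_sum Bochner_Integration.integral_sum)
  also have "(\<Sum>j\<in>level_index n. expectation (summand \<theta> n j p))
      = (\<Sum>(l, i)\<in>level_index n. 1 / real M ^ (n - l) *
        (if l = 0 then expectation (terminal base p) else (T - fst p) * (mean_fU l p - mean_fU (l - 1) p)))"
    by (intro sum.cong refl) (auto simp: expectation_summand[OF \<theta> p])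
  also have "\<dots> = (\<Sum>l\<in>{0..<n}. \<Sum>i=1..M ^ (n - l). 1 / real M ^ (n - l) *
        (if l = 0 then expectation (terminal base p) else (T - fst p) * (mean_fU l p - mean_fU (l - 1) p)))"
    unfolding level_index_def by (subst sum.Sigma) (auto intro!: sum.cong)
  also have "\<dots> = (\<Sum>l\<in>{0..<n}. if l = 0 then expectation (terminal base p) else (T - fst p) * (mean_fU l p - mean_fU (l - 1) p))"
    using M_pos by (intro sum.cong refl) (simp add: divide_simps)
  also have "\<dots> = expectation (terminal base p) + (\<Sum>l\<in>{1..<n}. (T - fst p) * (mean_fU l p - mean_fU (l - 1) p))"
  proof -
    have "{0..<n} = insert 0 {1..<n}" using n by auto
    then show ?thesis by (auto intro!: sum.cong)
  qed
  also have "(\<Sum>l\<in>{1..<n}. (T - fst p) * (mean_fU l p - mean_fU (l - 1) p)) = (T - fst p) * (mean_fU (n - 1) p - mean_fU 0 p)"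
  proof -
    obtain m where m: "n = Suc m" using n by (cases n) auto
    have "(\<Sum>l\<in>{1..<n}. mean_fU l p - mean_fU (l - 1) p) = (\<Sum>l<m. mean_fU (Suc l) p - mean_fU l p)"
      unfolding m by (rule sum.reindex_bij_witness[of _ Suc "\<lambda>l. l - 1"]) auto
    also have "\<dots> = mean_fU m p - mean_fU 0 p" by (rule sum_lessThan_telescope)
    finally show ?thesis by (simp add: sum_distrib_left[symmetric] m)
  qed
  finally show ?thesis using mean_fU_0[OF p] by (simp add: algebra_simps)
qed

text \<open>By the telescoping of the levels, \<open>bias n\<close> and the error \<open>U \<theta> n - sol\<close> have the same expectation.\<close>

definition bias :: "nat \<Rightarrow> real \<times> (nat \<Rightarrow> real) \<Rightarrow> 'a \<Rightarrow> real"
  where "bias n p \<omega> = (T - fst p) * (f (U [1] (n - 1) (shift base p \<omega>) \<omega>) - f (sol (shift base p \<omega>)))"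

lemma rfield_f_diff: "\<theta> \<in> Theta \<Longrightarrow> rfield (UNIV \<times> desc \<theta>) (\<lambda>p \<omega>. f (U \<theta> l p \<omega>) - f (sol p))"
proof -
  assume \<theta>: "\<theta> \<in> Theta"
  have "rfield (UNIV \<times> desc \<theta>) (\<lambda>p _. f (sol p))"
    by (rule rfield_det[where C=K]) (use desc_Theta[OF \<theta>] measurable_compose[OF sol_measurable f_meas] f_bound in auto)
  then show ?thesis by (intro rfield_diff rfield_comp[OF rfield_U[OF \<theta>] f_meas f_bound])
qed

lemma one_Theta: "[1] \<in> Theta" by (simp add: Theta_def)

lemma rfield_bias: "rfield (UNIV \<times> Theta) (bias n)"
proof -
  have "rfield (UNIV \<times> Theta) (\<lambda>p \<omega>. f (U [1] (n - 1) (shift base p \<omega>) \<omega>) - f (sol (shift base p \<omega>)))"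
    by (rule rfield_shift[OF rfield_f_diff[OF one_Theta]]) (use desc_Theta[OF one_Theta] in auto)
  then show ?thesis unfolding bias_def[abs_def] by (intro rfield_mult rfield_time) auto
qed

lemma expectation_error:
  assumes \<theta>: "\<theta> \<in> Theta" and p: "p \<in> space E" and n: "1 \<le> n"
  shows "expectation (U \<theta> n p) - sol p = expectation (bias n p)"
proof -
  have "rfield (UNIV \<times> Theta) (\<lambda>p \<omega>. f (U [1] (n - 1) (shift base p \<omega>) \<omega>))"
    by (rule rfield_comp[OF rfield_shift[OF rfield_U[OF one_Theta]] f_meas f_bound]) (use desc_Theta[OF one_Theta] in auto)
  from rfield_bounded_rv[OF this p] rfield_bounded_rv[OF rfield_f_shift[OF sol_measurable base_Theta] p]
  have "expectation (bias n p) = (T - fst p) * (mean_fU (n - 1) p - expectation (\<lambda>\<omega>. f (sol (shift base p \<omega>))))"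
    unfolding bias_def mean_fU_def by (simp add: bounded_rv_integrable)
  then show ?thesis
    unfolding expectation_U[OF assms] sol_fixed_point[OF base_Theta base_Theta p] by (simp add: algebra_simps)
qed

text \<open>The factors by which one step multiplies a bound: \<open>errF\<close> for passing from
  \<open>U - sol\<close> to \<open>f \<circ> U - f \<circ> sol\<close>, and \<open>errS / M\<close>
  for the shift when the weight has rate \<open>M\<close>.\<close>

definition errF :: real where "errF = 2 * L\<^sup>2 * (1 + solKu)"
definition errS :: real where "errS = 2 * (1 + T)"

lemma errF_nonneg: "0 \<le> errF" using solKu_nonneg by (simp add: errF_def)
lemma errS_nonneg: "0 \<le> errS" using T_pos by (simp add: errS_def)

lemma f_diff_ctl:
  assumes \<theta>: "\<theta> \<in> Theta" and Q: "0 \<le> Q" "ms_ctl (real M) Q (\<lambda>p \<omega>. U \<theta> l p \<omega> - sol p)"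
  shows "ms_ctl (real M) (errF * Q) (\<lambda>p \<omega>. f (U \<theta> l p \<omega>) - f (sol p))"
  unfolding errF_def
  by (rule ms_ctl_comp[OF rfield_U[OF \<theta>] sol_measurable sol_bound Q _ sol_Lip solKu_nonneg L_nonneg f_Lip f_Lip2]) auto

lemma bias_ctl:
  assumes Q: "0 \<le> Q" "\<And>\<theta>. \<theta> \<in> Theta \<Longrightarrow> ms_ctl (real M) Q (\<lambda>p \<omega>. U \<theta> (n - 1) p \<omega> - sol p)"
  shows "ms_ctl (real M) (errS * (errF * Q) / real M) (bias n)"
proof -
  have "UNIV \<times> desc [1] \<inter> UNIV \<times> {base} = {}" by (auto simp: base_def desc_def)
  from ms_ctl_shift[OF rfield_f_diff[OF one_Theta] this base_Theta _ f_diff_ctl[OF one_Theta Q(1) Q(2)[OF one_Theta]]]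
  show ?thesis using M_pos Q(1) errF_nonneg by (simp add: bias_def[abs_def] errS_def)
qed

text \<open>\<open>f \<circ> sol\<close> can be inserted since both fields are evaluated at the same
  shifted point, so the level difference is controlled by the errors of the levels \<open>l\<close>
  and \<open>l - 1\<close>. The prefactor \<open>real M ^ (n - l)\<close> undoes the
  averaging.\<close>

lemma summand_ctl:
  assumes \<theta>: "\<theta> \<in> Theta" and j: "(l, i) \<in> level_index n"
    and Q: "\<And>l. 0 \<le> Q l" "\<And>l \<theta>. l < n \<Longrightarrow> \<theta> \<in> Theta \<Longrightarrow> ms_ctl (real M) (Q l) (\<lambda>p \<omega>. U \<theta> l p \<omega> - sol p)"
  shows "ms_ctl (real M) ((if l = 0 then Kg else errS * (2 * (errF * Q l + errF * Q (l - 1))) / real M))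
    (\<lambda>p \<omega>. real M ^ (n - l) * summand \<theta> n (l, i) p \<omega>)"
proof (cases "l = 0")
  case True
  have "ms_ctl (real M) Kg (terminal (\<theta> @ [0, - int i]))"
    by (rule terminal_ctl) (use \<theta> in auto)
  then show ?thesis using True M_pos by (simp add: summand_def[abs_def])
next
  case False
  let ?e = "\<theta> @ [int l, int i]" and ?e' = "\<theta> @ [- int l, int i]"
  have e: "?e \<in> Theta" "?e' \<in> Theta" using \<theta> by auto
  have l: "l < n" "l - 1 < n" using j by (auto simp: level_index_def)
  note c = f_diff_ctl[OF e(1) Q(1) Q(2)[OF l(1) e(1)]] f_diff_ctl[OF e(2) Q(1) Q(2)[OF l(2) e(2)]]
  let ?K = "UNIV \<times> desc ?e \<union> UNIV \<times> desc ?e'"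
  have K: "?K \<subseteq> UNIV \<times> Theta" using desc_Theta[OF e(1)] desc_Theta[OF e(2)] by auto
  have rf: "rfield ?K (\<lambda>p \<omega>. f (U ?e l p \<omega>) - f (sol p))" "rfield ?K (\<lambda>p \<omega>. f (U ?e' (l - 1) p \<omega>) - f (sol p))"
    by (rule rfield_mono[OF rfield_f_diff[OF e(1)] _ K], simp, rule rfield_mono[OF rfield_f_diff[OF e(2)] _ K], simp)
  have dis: "?K \<inter> UNIV \<times> {?e} = {}" using False by (auto simp: desc_def)
  have "0 \<le> 2 * (errF * Q l + errF * Q (l - 1))" using Q(1) errF_nonneg by simp
  from ms_ctl_shift[OF rfield_diff[OF rf] dis e(1) this ms_ctl_diff[OF rf c]]
  have "ms_ctl (real M) (errS * (2 * (errF * Q l + errF * Q (l - 1))) / real M)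
    (\<lambda>p \<omega>. (T - fst p) * (f (U ?e l (shift ?e p \<omega>) \<omega>) - f (sol (shift ?e p \<omega>))
      - (f (U ?e' (l - 1) (shift ?e p \<omega>) \<omega>) - f (sol (shift ?e p \<omega>)))))"
    using M_pos by (simp add: errS_def)
  then show ?thesis using False M_pos by (simp add: summand_def[abs_def])
qed

text \<open>Bias-variance decomposition, applied to values as well as to increments of the scheme.\<close>

lemma error_ctl_step:
  assumes n: "1 \<le> n" and Q: "\<And>l. 0 \<le> Q l"
      "\<And>l \<theta>. l < n \<Longrightarrow> \<theta> \<in> Theta \<Longrightarrow> ms_ctl (real M) (Q l) (\<lambda>p \<omega>. U \<theta> l p \<omega> - sol p)"
    and \<theta>: "\<theta> \<in> Theta"
  shows "ms_ctl (real M) (errS * (errF * Q (n - 1)) / real M + Kg / real M ^ n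
      + (\<Sum>l\<in>{1..<n}. errS * (2 * (errF * Q l + errF * Q (l - 1))) / real M / real M ^ (n - l)))
    (\<lambda>p \<omega>. U \<theta> n p \<omega> - sol p)"
proof -
  define B where "B = errS * (errF * Q (n - 1)) / real M"
  define D where "D = (\<lambda>l. if l = 0 then Kg else errS * (2 * (errF * Q l + errF * Q (l - 1))) / real M)"
  have M0: "0 < real M" using M_pos by simp
  have b: "bounded_rv (summand \<theta> n j p)" if "p \<in> space E" "j \<in> level_index n" for j p
    by (rule rfield_bounded_rv[OF rfield_summand'[OF _ \<theta> that(2)] that(1)])
  have sm: "summand \<theta> n j p \<in> borel_measurable (galg (UNIV \<times> summand_src \<theta> j))"
    if "p \<in> space E" "j \<in> level_index n" for j p
    by (rule rfield_measurable[OF rfield_summand'[OF _ \<theta> that(2)] that(1)]) auto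
  have bctl: "ms_ctl (real M) B (bias n)" unfolding B_def by (rule bias_ctl) (use Q n in auto)
  have sctl: "ms_ctl (real M) (D l) (\<lambda>p \<omega>. real M ^ (n - l) * summand \<theta> n (l, i) p \<omega>)" if "(l, i) \<in> level_index n" for l i
    unfolding D_def using summand_ctl[OF \<theta> that Q] .
  have bU: "bounded_rv (U \<theta> n p)" if "p \<in> space E" for p
    by (rule rfield_bounded_rv[OF rfield_U[OF \<theta>] that])
  have bb: "bounded_rv (bias n p)" if "p \<in> space E" for p by (rule rfield_bounded_rv[OF rfield_bias that])
  \<comment> \<open>There are \<open>M ^ (n - l)\<close> samples, each with a second moment scaled
    by the square of \<open>1 / M ^ (n - l)\<close>; one power survives, which is the gain by
    averaging.\<close>
  have sumD: "(\<Sum>(l, i)\<in>level_index n. D l / (real M ^ (n - l))\<^sup>2 * y)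
      = (Kg / real M ^ n + (\<Sum>l\<in>{1..<n}. errS * (2 * (errF * Q l + errF * Q (l - 1))) / real M / real M ^ (n - l))) * y" for y
  proof -
    have "(\<Sum>(l, i)\<in>level_index n. D l / (real M ^ (n - l))\<^sup>2 * y) = (\<Sum>l\<in>{0..<n}. \<Sum>i=1..M ^ (n - l). D l / (real M ^ (n - l))\<^sup>2 * y)"
      unfolding level_index_def by (subst sum.Sigma) (auto intro!: sum.cong)
    also have "\<dots> = (\<Sum>l\<in>{0..<n}. D l / real M ^ (n - l) * y)"
      using M0 by (intro sum.cong refl) (simp add: power2_eq_square)
    also have "\<dots> = (\<Sum>l\<in>insert 0 {1..<n}. D l / real M ^ (n - l) * y)"
      using n by (intro sum.cong) auto
    also have "\<dots> = Kg / real M ^ n * y + (\<Sum>l\<in>{1..<n}. D l / real M ^ (n - l) * y)"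
      by (simp add: D_def)
    also have "(\<Sum>l\<in>{1..<n}. D l / real M ^ (n - l) * y)
      = (\<Sum>l\<in>{1..<n}. errS * (2 * (errF * Q l + errF * Q (l - 1))) / real M / real M ^ (n - l)) * y"
      unfolding sum_distrib_right by (intro sum.cong) (auto simp: D_def)
    finally show ?thesis by (simp add: distrib_right)
  qed
  have "ms_ctl (real M) (B + (Kg / real M ^ n + (\<Sum>l\<in>{1..<n}. errS * (2 * (errF * Q l + errF * Q (l - 1))) / real M / real M ^ (n - l))))
    (\<lambda>p \<omega>. U \<theta> n p \<omega> - sol p)"
  proof (rule ms_ctlI)
    fix p assume p: "p \<in> space E"
    let ?e = "exp (real M * (T - fst p))"
    have tm: "expectation (\<lambda>\<omega>. (summand \<theta> n j p \<omega>)\<^sup>2) \<le> (case j of (l, i) \<Rightarrow> D l / (real M ^ (n - l))\<^sup>2 * ?e)"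
      if j: "j \<in> level_index n" for j
    proof -
      obtain l i where ji: "j = (l, i)" by (cases j)
      have "(real M ^ (n - l))\<^sup>2 * expectation (\<lambda>\<omega>. (summand \<theta> n (l, i) p \<omega>)\<^sup>2) \<le> D l * ?e"
        using ms_ctlD(1)[OF sctl p] j by (simp add: ji power_mult_distrib)
      then show ?thesis using M0 by (simp add: ji field_simps)
    qed
    have dec: "U \<theta> n p \<omega> - sol p = ((T - fst p) * f 0 - sol p) + (\<Sum>j\<in>level_index n. summand \<theta> n j p \<omega>)"
      if "\<omega> \<in> space P" for \<omega> using U_decomp[OF \<theta> p that n] by simp
    have "expectation (\<lambda>\<omega>. (U \<theta> n p \<omega> - sol p)\<^sup>2)
        = expectation (\<lambda>\<omega>. (((T - fst p) * f 0 - sol p) + (\<Sum>j\<in>level_index n. summand \<theta> n j p \<omega>))\<^sup>2)"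
      by (intro Bochner_Integration.integral_cong refl) (simp add: dec)
    also have "\<dots> \<le> (expectation (\<lambda>\<omega>. ((T - fst p) * f 0 - sol p) + (\<Sum>j\<in>level_index n. summand \<theta> n j p \<omega>)))\<^sup>2
        + (\<Sum>j\<in>level_index n. expectation (\<lambda>\<omega>. (summand \<theta> n j p \<omega>)\<^sup>2))"
      by (rule expectation_power2_sum_indep_le[OF finite_level_index indep_summands[OF \<theta> sm[OF p]] b[OF p]])
    also have "expectation (\<lambda>\<omega>. ((T - fst p) * f 0 - sol p) + (\<Sum>j\<in>level_index n. summand \<theta> n j p \<omega>))
        = expectation (\<lambda>\<omega>. U \<theta> n p \<omega> - sol p)"
      by (intro Bochner_Integration.integral_cong refl) (simp add: dec)
    \<comment> \<open>The error has the same mean as \<open>bias\<close>, whose second moment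
      carries the factor \<open>1 / M\<close>.\<close>
    also have "\<dots> = expectation (bias n p)"
      using expectation_error[OF \<theta> p n] bounded_rv_integrable[OF bU[OF p]] by (simp add: prob_space)
    also have "(expectation (bias n p))\<^sup>2 \<le> B * ?e"
      using expectation_power2_le[OF bb[OF p]] ms_ctlD(1)[OF bctl p] by simp
    also have "(\<Sum>j\<in>level_index n. expectation (\<lambda>\<omega>. (summand \<theta> n j p \<omega>)\<^sup>2)) \<le> (\<Sum>(l, i)\<in>level_index n. D l / (real M ^ (n - l))\<^sup>2 * ?e)"
      using tm by (intro sum_mono) auto
    finally show "expectation (\<lambda>\<omega>. (U \<theta> n p \<omega> - sol p)\<^sup>2) \<le> (B + (Kg / real M ^ n
        + (\<Sum>l\<in>{1..<n}. errS * (2 * (errF * Q l + errF * Q (l - 1))) / real M / real M ^ (n - l)))) * ?e"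
      unfolding sumD by (simp only: distrib_right)
    fix q assume q: "q \<in> space E" "fst p \<le> fst q"
    have tm: "expectation (\<lambda>\<omega>. (summand \<theta> n j p \<omega> - summand \<theta> n j q \<omega>)\<^sup>2)
        \<le> (case j of (l, i) \<Rightarrow> D l / (real M ^ (n - l))\<^sup>2 * (?e * pdist2 d p q))"
      if j: "j \<in> level_index n" for j
    proof -
      obtain l i where ji: "j = (l, i)" by (cases j)
      have "(real M ^ (n - l))\<^sup>2 * expectation (\<lambda>\<omega>. (summand \<theta> n (l, i) p \<omega> - summand \<theta> n (l, i) q \<omega>)\<^sup>2) \<le> D l * ?e * pdist2 d p q"
        using ms_ctlD(2)[OF sctl p q] j by (simp add: ji power_mult_distrib right_diff_distrib[symmetric])
      then show ?thesis using M0 by (simp add: ji field_simps)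
    qed
    \<comment> \<open>The part of the increment that is not random; it affects the mean but not the
      variance.\<close>
    let ?c = "((T - fst p) * f 0 - sol p) - ((T - fst q) * f 0 - sol q)"
    have dec: "(U \<theta> n p \<omega> - sol p) - (U \<theta> n q \<omega> - sol q) = ?c + (\<Sum>j\<in>level_index n. summand \<theta> n j p \<omega> - summand \<theta> n j q \<omega>)"
      if "\<omega> \<in> space P" for \<omega> using U_decomp[OF \<theta> p that n] U_decomp[OF \<theta> q(1) that n] by (simp add: sum_subtractf)
    have "expectation (\<lambda>\<omega>. ((U \<theta> n p \<omega> - sol p) - (U \<theta> n q \<omega> - sol q))\<^sup>2)
        = expectation (\<lambda>\<omega>. (?c + (\<Sum>j\<in>level_index n. summand \<theta> n j p \<omega> - summand \<theta> n j q \<omega>))\<^sup>2)"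
      by (intro Bochner_Integration.integral_cong refl) (simp only: dec)
    also have "\<dots> \<le> (expectation (\<lambda>\<omega>. ?c + (\<Sum>j\<in>level_index n. summand \<theta> n j p \<omega> - summand \<theta> n j q \<omega>)))\<^sup>2
        + (\<Sum>j\<in>level_index n. expectation (\<lambda>\<omega>. (summand \<theta> n j p \<omega> - summand \<theta> n j q \<omega>)\<^sup>2))"
      by (intro expectation_power2_sum_indep_le[OF finite_level_index] indep_summands[OF \<theta>] borel_measurable_diff
        sm p q(1) bounded_rv_diff b)
    also have "expectation (\<lambda>\<omega>. ?c + (\<Sum>j\<in>level_index n. summand \<theta> n j p \<omega> - summand \<theta> n j q \<omega>))
        = expectation (\<lambda>\<omega>. (U \<theta> n p \<omega> - sol p) - (U \<theta> n q \<omega> - sol q))"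
      by (intro Bochner_Integration.integral_cong refl) (simp only: dec)
    also have "\<dots> = (expectation (U \<theta> n p) - sol p) - (expectation (U \<theta> n q) - sol q)"
      using bounded_rv_integrable[OF bU[OF p]] bounded_rv_integrable[OF bU[OF q(1)]] by (simp add: prob_space)
    also have "\<dots> = expectation (\<lambda>\<omega>. bias n p \<omega> - bias n q \<omega>)"
      using expectation_error[OF \<theta> p n] expectation_error[OF \<theta> q(1) n]
        bounded_rv_integrable[OF bb[OF p]] bounded_rv_integrable[OF bb[OF q(1)]] by simp
    also have "(expectation (\<lambda>\<omega>. bias n p \<omega> - bias n q \<omega>))\<^sup>2 \<le> B * (?e * pdist2 d p q)"
      using expectation_power2_le[OF bounded_rv_diff[OF bb[OF p] bb[OF q(1)]]] ms_ctlD(2)[OF bctl p q] by (simp add: mult.assoc)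
    also have "(\<Sum>j\<in>level_index n. expectation (\<lambda>\<omega>. (summand \<theta> n j p \<omega> - summand \<theta> n j q \<omega>)\<^sup>2))
        \<le> (\<Sum>(l, i)\<in>level_index n. D l / (real M ^ (n - l))\<^sup>2 * (?e * pdist2 d p q))"
      using tm by (intro sum_mono) auto
    finally show "expectation (\<lambda>\<omega>. (U \<theta> n p \<omega> - sol p - (U \<theta> n q \<omega> - sol q))\<^sup>2) \<le> (B + (Kg / real M ^ n
        + (\<Sum>l\<in>{1..<n}. errS * (2 * (errF * Q l + errF * Q (l - 1))) / real M / real M ^ (n - l)))) * ?e * pdist2 d p q"
      unfolding sumD by (simp only: distrib_right mult.assoc)
  qed
  then show ?thesis by (simp add: B_def add.assoc)
qed

text \<open>\<open>errA\<close> dominates the terminal constant and the error at level 0, where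
  \<open>U\<close> vanishes and \<open>- sol\<close> remains. With \<open>b = errS * errF\<close> a
  step gives \<open>M ^ n\<close> times the error bound at most
  \<open>errA * (1 + 5 * b * (\<Sum>l<n. errR ^ l))\<close>, where 5 is 1 from the bias and 2 from
  each of the two fields of a level. The choice \<open>errR = 1 + 5 * b\<close> turns this into
  \<open>errA * errR ^ n\<close>.\<close>

definition errA :: real where "errA = solCu\<^sup>2 + solKu + Kg"
definition errR :: real where "errR = 1 + 5 * (errS * errF)"

lemma errA_nonneg: "0 \<le> errA" using solKu_nonneg Kg_nonneg by (simp add: errA_def)
lemma errR_ge_1: "1 \<le> errR" using errS_nonneg errF_nonneg by (simp add: errR_def)

text \<open>One step involves the errors of all lower levels, but weighted such that each of them
  contributes \<open>1 / M ^ n\<close> up to powers of \<open>errR\<close>; the geometric sum of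
  these powers closes the induction.\<close>

lemma error_ctl:
  "\<theta> \<in> Theta \<Longrightarrow> ms_ctl (real M) (errA * errR ^ n / real M ^ n) (\<lambda>p \<omega>. U \<theta> n p \<omega> - sol p)"
proof (induction n arbitrary: \<theta> rule: less_induct)
  case (less n)
  have M0: "0 < real M" and M1: "1 \<le> real M" using M_pos by auto
  show ?case
  proof (cases "n = 0")
    case True
    have "ms_ctl (real M) (solCu\<^sup>2 + solKu + Kg) (\<lambda>p _. - sol p)"
    proof (rule ms_ctlI)
      fix p assume p: "p \<in> space E"
      have e1: "1 \<le> exp (real M * (T - fst p))" using p by (auto simp: space_timespace)
      have A: "0 \<le> solCu\<^sup>2 + solKu + Kg" using errA_nonneg by (simp add: errA_def)
      have "(sol p)\<^sup>2 \<le> solCu\<^sup>2" using power_mono[OF sol_bound[OF p], of 2] by simp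
      also have "\<dots> \<le> (solCu\<^sup>2 + solKu + Kg) * 1" using solKu_nonneg Kg_nonneg by simp
      also have "\<dots> \<le> (solCu\<^sup>2 + solKu + Kg) * exp (real M * (T - fst p))" by (rule mult_left_mono[OF e1 A])
      finally show "expectation (\<lambda>_. (- sol p)\<^sup>2) \<le> (solCu\<^sup>2 + solKu + Kg) * exp (real M * (T - fst p))"
        by (simp add: prob_space)
      fix q assume q: "q \<in> space E"
      have "(- sol p - - sol q)\<^sup>2 = (sol p - sol q)\<^sup>2" by (simp add: power2_commute)
      also have "\<dots> \<le> solKu * pdist2 d p q" by (rule sol_Lip[OF p q])
      also have "\<dots> \<le> ((solCu\<^sup>2 + solKu + Kg) * 1) * pdist2 d p q"
        using Kg_nonneg by (intro mult_right_mono) auto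
      also have "\<dots> \<le> (solCu\<^sup>2 + solKu + Kg) * exp (real M * (T - fst p)) * pdist2 d p q"
        by (intro mult_right_mono mult_left_mono[OF e1 A]) auto
      finally show "expectation (\<lambda>_. (- sol p - - sol q)\<^sup>2) \<le> (solCu\<^sup>2 + solKu + Kg) * exp (real M * (T - fst p)) * pdist2 d p q"
        by (simp add: prob_space)
    qed
    from ms_ctl_cong[OF this, of "\<lambda>p \<omega>. U \<theta> n p \<omega> - sol p"] True less.prems
    show ?thesis by (simp add: U_0 errA_def)
  next
    case False
    then have n: "1 \<le> n" by simp
    define b where "b = errS * errF"
    have b0: "0 \<le> b" using errS_nonneg errF_nonneg by (simp add: b_def)
    define Q where "Q = (\<lambda>l. errA * errR ^ l / real M ^ l)"
    have Q0: "0 \<le> Q l" for l using errA_nonneg errR_ge_1 by (simp add: Q_def)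
    have step: "ms_ctl (real M) (errS * (errF * Q (n - 1)) / real M + Kg / real M ^ n
      + (\<Sum>l\<in>{1..<n}. errS * (2 * (errF * Q l + errF * Q (l - 1))) / real M / real M ^ (n - l)))
      (\<lambda>p \<omega>. U \<theta> n p \<omega> - sol p)"
      by (rule error_ctl_step[OF n Q0 _ less.prems]) (use less.IH in \<open>auto simp: Q_def\<close>)
    have "errS * (errF * Q (n - 1)) / real M = b * errA * errR ^ (n - 1) / real M ^ n"
      using n by (cases n) (auto simp: Q_def b_def mult_ac)
    also have "\<dots> \<le> b * errA * (\<Sum>l<n. errR ^ l) / real M ^ n"
      using b0 errA_nonneg errR_ge_1 n M0 
      by (intro divide_right_mono mult_left_mono member_le_sum[of "n - 1" "{..<n}" "\<lambda>l. errR ^ l"]) auto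
    finally have 1: "errS * (errF * Q (n - 1)) / real M \<le> b * errA * (\<Sum>l<n. errR ^ l) / real M ^ n" .
    have "(\<Sum>l\<in>{1..<n}. errS * (2 * (errF * Q l + errF * Q (l - 1))) / real M / real M ^ (n - l))
      \<le> (\<Sum>l\<in>{1..<n}. 2 * b * errA * (errR ^ l + errR ^ (l - 1)) / real M ^ n)"
    proof (rule sum_mono)
      fix l assume l: "l \<in> {1..<n}"
      then obtain k where k: "l = Suc k" by (cases l) auto
      have Mn: "real M ^ n = real M ^ l * real M ^ (n - l)" using l by (simp add: power_add[symmetric])
      \<comment> \<open>The field of level \<open>l\<close> carries one factor \<open>1 / M\<close>
        more than needed, the field of level \<open>l - 1\<close> exactly as many.\<close>
      have "Q l / real M / real M ^ (n - l) = errA * errR ^ l / real M ^ n / real M"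
        unfolding Mn Q_def by simp
      also have "\<dots> \<le> errA * errR ^ l / real M ^ n"
      proof -
        have "0 \<le> errA * errR ^ l / real M ^ n" (is "0 \<le> ?X") using errA_nonneg errR_ge_1 by simp
        then have "?X * 1 \<le> ?X * real M" using M1 by (intro mult_left_mono)
        then show ?thesis using M0 by (subst pos_divide_le_eq) auto
      qed
      finally have "Q l / real M / real M ^ (n - l) \<le> errA * errR ^ l / real M ^ n" .
      moreover have "Q (l - 1) / real M / real M ^ (n - l) = errA * errR ^ (l - 1) / real M ^ n"
        unfolding Mn Q_def k using M0 by simp
      ultimately have "2 * b * (Q l / real M / real M ^ (n - l) + Q (l - 1) / real M / real M ^ (n - l))
          \<le> 2 * b * (errA * errR ^ l / real M ^ n + errA * errR ^ (l - 1) / real M ^ n)"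
        using b0 by (intro mult_left_mono add_mono) auto
      then show "errS * (2 * (errF * Q l + errF * Q (l - 1))) / real M / real M ^ (n - l)
          \<le> 2 * b * errA * (errR ^ l + errR ^ (l - 1)) / real M ^ n"
        unfolding b_def by (simp add: add_divide_distrib distrib_left mult_ac)
    qed
    also have "\<dots> = 2 * b * errA * ((\<Sum>l\<in>{1..<n}. errR ^ l) + (\<Sum>l\<in>{1..<n}. errR ^ (l - 1))) / real M ^ n"
      by (simp add: sum_distrib_left[symmetric] sum_divide_distrib[symmetric] sum.distrib[symmetric])
    also have "\<dots> \<le> 2 * b * errA * ((\<Sum>l<n. errR ^ l) + (\<Sum>l<n. errR ^ l)) / real M ^ n"
    proof (intro divide_right_mono mult_left_mono add_mono)
      show "(\<Sum>l\<in>{1..<n}. errR ^ l) \<le> (\<Sum>l<n. errR ^ l)" using errR_ge_1 by (intro sum_mono2) auto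
      have "(\<Sum>l\<in>{1..<n}. errR ^ (l - 1)) = (\<Sum>l<n - 1. errR ^ l)"
        by (rule sum.reindex_bij_witness[of _ Suc "\<lambda>l. l - 1"]) auto
      also have "\<dots> \<le> (\<Sum>l<n. errR ^ l)" using errR_ge_1 by (intro sum_mono2) auto
      finally show "(\<Sum>l\<in>{1..<n}. errR ^ (l - 1)) \<le> (\<Sum>l<n. errR ^ l)" .
    qed (use b0 errA_nonneg in auto)
    finally have 2: "(\<Sum>l\<in>{1..<n}. errS * (2 * (errF * Q l + errF * Q (l - 1))) / real M / real M ^ (n - l))
      \<le> 4 * b * errA * (\<Sum>l<n. errR ^ l) / real M ^ n" by simp
    have geo: "5 * b * (\<Sum>l<n. errR ^ l) = errR ^ n - 1"
      using power_diff_1_eq[of errR n] by (simp add: errR_def b_def)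
    have 3: "Kg / real M ^ n \<le> errA / real M ^ n"
      using solKu_nonneg by (intro divide_right_mono) (auto simp: errA_def)
    have "errS * (errF * Q (n - 1)) / real M + Kg / real M ^ n
      + (\<Sum>l\<in>{1..<n}. errS * (2 * (errF * Q l + errF * Q (l - 1))) / real M / real M ^ (n - l))
      \<le> b * errA * (\<Sum>l<n. errR ^ l) / real M ^ n + errA / real M ^ n + 4 * b * errA * (\<Sum>l<n. errR ^ l) / real M ^ n"
      using 1 2 3 by linarith
    also have "\<dots> = errA * (1 + 5 * b * (\<Sum>l<n. errR ^ l)) / real M ^ n"
      by (simp add: add_divide_distrib distrib_left algebra_simps)
    also have "\<dots> = errA * errR ^ n / real M ^ n" by (simp add: geo)
    finally show ?thesis by (rule ms_ctl_mono[OF step])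
  qed
qed

end

section \<open>Identification of the backward equation with the fixed point\<close>

text \<open>For variables that are square integrable but not bounded, such as stochastic
  integrals.\<close>

lemma (in prob_space) expectation_power2_le':
  fixes X :: "'a \<Rightarrow> real"
  assumes "X \<in> borel_measurable M" "integrable M (\<lambda>\<omega>. (X \<omega>)\<^sup>2)"
  shows "(expectation X)\<^sup>2 \<le> expectation (\<lambda>\<omega>. (X \<omega>)\<^sup>2)"
proof -
  have "integrable M X" by (rule square_integrable_imp_integrable[OF assms])
  then show ?thesis using variance_positive[of X] assms by (subst (asm) variance_eq) auto
qed

section \<open>Predictable processes, stochastic integrals and the Markov property\<close>

context noise
begin

lemma F_subalgebra: "t \<in> {0..T} \<Longrightarrow> subalgebra P (F t)"
  using filt by (auto simp: filtration_upto_def)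

lemma space_F: "t \<in> {0..T} \<Longrightarrow> space (F t) = space P"
  using F_subalgebra by (auto simp: subalgebra_def)

lemma F_mono: "0 \<le> s \<Longrightarrow> s \<le> t \<Longrightarrow> t \<le> T \<Longrightarrow> sets (F s) \<subseteq> sets (F t)"
  using filt by (auto simp: filtration_upto_def)

lemma measurable_F_P: "t \<in> {0..T} \<Longrightarrow> X \<in> measurable (F t) N \<Longrightarrow> X \<in> measurable P N"
  by (rule measurable_from_subalg[OF F_subalgebra])

lemma W_F_measurable: "\<theta> \<in> Theta \<Longrightarrow> t \<in> {0..T} \<Longrightarrow> W \<theta> t \<in> measurable (F t) (Rd_borel d)"
  using W_BM by (auto simp: std_brownian_motion_def)

definition incr_alg :: "int list \<Rightarrow> real \<Rightarrow> real \<Rightarrow> 'a measure"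
  where "incr_alg \<theta> s t = vimage_algebra (space P) (\<lambda>\<omega>. vdiff d (W \<theta> t \<omega>) (W \<theta> s \<omega>)) (Rd_borel d)"

lemma incr_measurable: "(\<lambda>\<omega>. vdiff d (W \<theta> t \<omega>) (W \<theta> s \<omega>)) \<in> measurable (incr_alg \<theta> s t) (Rd_borel d)"
  unfolding incr_alg_def by (rule measurable_vimage_algebra1) auto

text \<open>Here independence comes from the filtration and not from the sources: \<open>Y\<close>
  is adapted to \<open>F\<close>, which may carry more information than the noise.\<close>

lemma indep_incr:
  assumes \<theta>: "\<theta> \<in> Theta" and st: "0 \<le> s" "s < t" "t \<le> T"
  shows "indep_subalg (F s) (incr_alg \<theta> s t)"
proof -
  have "indep_set (sets (F s)) (sets (incr_alg \<theta> s t))"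
    using W_BM[OF \<theta>] st unfolding std_brownian_motion_def incr_alg_def generated_sets_def by auto
  moreover have "(\<lambda>\<omega>. vdiff d (W \<theta> t \<omega>) (W \<theta> s \<omega>)) \<in> measurable P (Rd_borel d)"
    using st by (intro measurable_vdiff W_measurable_P \<theta>) auto
  then have "subalgebra P (incr_alg \<theta> s t)"
    unfolding subalgebra_def incr_alg_def by (auto simp: sets_vimage_algebra2 measurable_def)
  ultimately show ?thesis using F_subalgebra[of s] st by (auto simp: indep_subalg_def)
qed

lemma predictable_generator_Pow:
  "{{0} \<times> A |A. A \<in> sets (F 0)} \<union> {{s<..t} \<times> A |s t A. 0 \<le> s \<and> s < t \<and> t \<le> T \<and> A \<in> sets (F s)}
    \<subseteq> Pow ({0..T} \<times> space P)"
proof -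
  have "A \<subseteq> space P" if "A \<in> sets (F s)" "s \<in> {0..T}" for A s
    using sets.sets_into_space[OF that(1)] space_F[OF that(2)] by simp
  then have "{s<..t} \<times> A \<subseteq> {0..T} \<times> space P" if "0 \<le> s" "s < t" "t \<le> T" "A \<in> sets (F s)" for s t A
    using that by (intro Sigma_mono) auto
  moreover have "{0} \<times> A \<subseteq> {0..T} \<times> space P" if "A \<in> sets (F 0)" for A
    using that sets.sets_into_space[OF that] space_F[of 0] T_pos by (intro Sigma_mono) auto
  ultimately show ?thesis by blast
qed

text \<open>The sections at time \<open>t\<close> of the generating rectangles are empty or events
  of some \<open>F s\<close> with \<open>s \<le> t\<close>, hence events of
  \<open>F t\<close>.\<close>

lemma predictable_section:
  assumes X: "predictable P F T X" and t: "t \<in> {0..T}"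
  shows "X t \<in> borel_measurable (F t)"
proof -
  have "(\<lambda>\<omega>. (t, \<omega>)) \<in> measurable (F t) (predictable_sigma P F T)"
    unfolding predictable_sigma_def
  proof (rule measurable_measure_of)
    show "{{0} \<times> A |A. A \<in> sets (F 0)} \<union> {{s<..t} \<times> A |s t A. 0 \<le> s \<and> s < t \<and> t \<le> T \<and> A \<in> sets (F s)}
        \<subseteq> Pow ({0..T} \<times> space P)" by (rule predictable_generator_Pow)
    show "(\<lambda>\<omega>. (t, \<omega>)) \<in> space (F t) \<rightarrow> {0..T} \<times> space P" using t space_F by auto
    fix a assume "a \<in> {{0} \<times> A |A. A \<in> sets (F 0)} \<union> {{s<..t} \<times> A |s t A. 0 \<le> s \<and> s < t \<and> t \<le> T \<and> A \<in> sets (F s)}"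
    then consider A where "a = {0} \<times> A" "A \<in> sets (F 0)"
      | s t' A where "a = {s<..t'} \<times> A" "0 \<le> s" "s < t'" "t' \<le> T" "A \<in> sets (F s)" by blast
    then show "(\<lambda>\<omega>. (t, \<omega>)) -` a \<inter> space (F t) \<in> sets (F t)"
    proof cases
      case 1
      then have "(\<lambda>\<omega>. (t, \<omega>)) -` a \<inter> space (F t) = (if t = 0 then A else {})"
        using sets.sets_into_space[OF 1(2)] t space_F T_pos by auto
      then show ?thesis using 1 by auto
    next
      case 2
      then have "(\<lambda>\<omega>. (t, \<omega>)) -` a \<inter> space (F t) = (if s < t \<and> t \<le> t' then A else {})"
        using sets.sets_into_space[OF 2(5)] t space_F[of s] space_F[OF t] by auto
      moreover have "A \<in> sets (F t)" if "s < t" using F_mono[of s t] that 2 t by auto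
      ultimately show ?thesis by auto
    qed
  qed
  from measurable_compose[OF this X[unfolded predictable_def]] show ?thesis by simp
qed

text \<open>The generating rectangles are products of Borel sets and events, so predictability
  implies the joint measurability that Fubini's theorem asks for.\<close>

lemma predictable_joint:
  assumes X: "predictable P F T X"
  shows "(\<lambda>(t, \<omega>). X t \<omega>) \<in> borel_measurable (restrict_space borel {0..T} \<Otimes>\<^sub>M P)"
proof -
  have "(\<lambda>z. z) \<in> measurable (restrict_space borel {0..T} \<Otimes>\<^sub>M P) (predictable_sigma P F T)"
    unfolding predictable_sigma_def
  proof (rule measurable_measure_of)
    show "{{0} \<times> A |A. A \<in> sets (F 0)} \<union> {{s<..t} \<times> A |s t A. 0 \<le> s \<and> s < t \<and> t \<le> T \<and> A \<in> sets (F s)}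
        \<subseteq> Pow ({0..T} \<times> space P)" by (rule predictable_generator_Pow)
    show "(\<lambda>z. z) \<in> space (restrict_space borel {0..T} \<Otimes>\<^sub>M P) \<rightarrow> {0..T} \<times> space P"
      by (simp add: space_pair_measure space_restrict_space)
    fix a assume a: "a \<in> {{0} \<times> A |A. A \<in> sets (F 0)} \<union> {{s<..t} \<times> A |s t A. 0 \<le> s \<and> s < t \<and> t \<le> T \<and> A \<in> sets (F s)}"
    have "a \<in> sets (restrict_space borel {0..T} \<Otimes>\<^sub>M P)"
    proof -
      from a consider A where "a = {0} \<times> A" "A \<in> sets (F 0)"
        | s t' A where "a = {s<..t'} \<times> A" "0 \<le> s" "s < t'" "t' \<le> T" "A \<in> sets (F s)" by blast
      then show ?thesis
      proof cases
        case 1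
        then have "A \<in> sets P" using F_subalgebra[of 0] T_pos by (auto simp: subalgebra_def)
        moreover have "{0} \<in> sets (restrict_space borel {0..T})"
          using T_pos by (subst sets_restrict_space_iff) auto
        ultimately show ?thesis using 1 by auto
      next
        case 2
        then have "A \<in> sets P" using F_subalgebra[of s] by (auto simp: subalgebra_def)
        moreover have "{s<..t'} \<in> sets (restrict_space borel {0..T})"
          using 2 by (subst sets_restrict_space_iff) auto
        ultimately show ?thesis using 2 by auto
      qed
    qed
    from sets.Int_space_eq2[OF this] this
    show "(\<lambda>z. z) -` a \<inter> space (restrict_space borel {0..T} \<Otimes>\<^sub>M P) \<in> sets (restrict_space borel {0..T} \<Otimes>\<^sub>M P)"
      by simp
  qed
  from measurable_compose[OF this X[unfolded predictable_def]] show ?thesis by simp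
qed

text \<open>For \<open>s < t\<close> the increment is centred and independent of \<open>F s\<close>;
  for \<open>s = t\<close> it vanishes.\<close>

lemma expectation_adapted_increment:
  assumes \<theta>: "\<theta> \<in> Theta" and st: "0 \<le> s" "s \<le> t" "t \<le> T" and i: "i \<in> {1..d}"
    and \<xi>: "\<xi> \<in> borel_measurable (F s)" "\<And>\<omega>. \<omega> \<in> space P \<Longrightarrow> \<bar>\<xi> \<omega>\<bar> \<le> C"
  shows "integrable P (\<lambda>\<omega>. \<xi> \<omega> * (W \<theta> t \<omega> i - W \<theta> s \<omega> i))"
    and "expectation (\<lambda>\<omega>. \<xi> \<omega> * (W \<theta> t \<omega> i - W \<theta> s \<omega> i)) = 0"
proof -
  have "integrable P (\<lambda>\<omega>. \<xi> \<omega> * (W \<theta> t \<omega> i - W \<theta> s \<omega> i)) \<and> expectation (\<lambda>\<omega>. \<xi> \<omega> * (W \<theta> t \<omega> i - W \<theta> s \<omega> i)) = 0"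
  proof (cases "s = t")
    case False
    then have "s < t" using st by simp
    note m = increment_moments[OF \<theta> st(1) this st(3) i]
    have "(\<lambda>\<omega>. vdiff d (W \<theta> t \<omega>) (W \<theta> s \<omega>) i) \<in> borel_measurable (incr_alg \<theta> s t)"
      by (rule measurable_Rd_component[OF incr_measurable i])
    then have "(\<lambda>\<omega>. W \<theta> t \<omega> i - W \<theta> s \<omega> i) \<in> borel_measurable (incr_alg \<theta> s t)"
      using i by (simp add: vdiff_def)
    with \<xi>(1) have iv: "indep_var borel \<xi> borel (\<lambda>\<omega>. W \<theta> t \<omega> i - W \<theta> s \<omega> i)"
      by (intro indep_subalg_indep_var[OF indep_incr[OF \<theta> st(1) \<open>s < t\<close> st(3)]])
    have i\<xi>: "integrable P \<xi>"
      using \<xi>(2) measurable_F_P[OF _ \<xi>(1)] st by (intro integrable_const_bound[of _ C]) auto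
    show ?thesis
      using indep_var_integrable[OF iv i\<xi> m(4)] indep_var_lebesgue_integral[OF iv i\<xi> m(4)] m(1) by simp
  qed simp
  then show "integrable P (\<lambda>\<omega>. \<xi> \<omega> * (W \<theta> t \<omega> i - W \<theta> s \<omega> i))"
    "expectation (\<lambda>\<omega>. \<xi> \<omega> * (W \<theta> t \<omega> i - W \<theta> s \<omega> i)) = 0" by auto
qed

text \<open>In an elementary integral the indicator of \<open>A\<close> is absorbed into the
  coefficients, which stay adapted because \<open>A\<close> is already known at time
  \<open>a\<close>; each term then has mean zero. This passes to the limit in mean square. In other
  words, the integral has conditional expectation zero given \<open>F a\<close>.\<close>

lemma ito_integral_mean_zero:
  assumes \<theta>: "\<theta> \<in> Theta" and ab: "0 \<le> a" "a \<le> b" "b \<le> T" and i: "i \<in> {1..d}"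
    and J: "has_ito_integral P F (\<lambda>s \<omega>. W \<theta> s \<omega> i) a b H J"
  shows "integrable P J" and "A \<in> sets (F a) \<Longrightarrow> expectation (\<lambda>\<omega>. indicator A \<omega> * J \<omega>) = 0"
proof -
  obtain m \<tau> \<xi> where el: "\<And>n. elementary_process P F a b (m n) (\<tau> n) (\<xi> n)"
    and lim: "(\<lambda>n. \<integral>\<^sup>+ \<omega>. ennreal ((J \<omega> - elementary_integral (\<lambda>s \<omega>. W \<theta> s \<omega> i) (m n) (\<tau> n) (\<xi> n) \<omega>)\<^sup>2) \<partial>P) \<longlonglongrightarrow> 0"
    and Jm[measurable]: "J \<in> borel_measurable P"
    using J unfolding has_ito_integral_def by blast
  define I where "I = (\<lambda>n. elementary_integral (\<lambda>s \<omega>. W \<theta> s \<omega> i) (m n) (\<tau> n) (\<xi> n))"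
  have Ik: "integrable P (\<lambda>\<omega>. indicator A \<omega> * I n \<omega>) \<and> expectation (\<lambda>\<omega>. indicator A \<omega> * I n \<omega>) = 0"
    if A: "A \<in> sets (F a)" for A n
  proof -
    have *: "integrable P (\<lambda>\<omega>. (indicator A \<omega> * \<xi> n k \<omega>) * (W \<theta> (\<tau> n (Suc k)) \<omega> i - W \<theta> (\<tau> n k) \<omega> i)) \<and>
      expectation (\<lambda>\<omega>. (indicator A \<omega> * \<xi> n k \<omega>) * (W \<theta> (\<tau> n (Suc k)) \<omega> i - W \<theta> (\<tau> n k) \<omega> i)) = 0" if k: "k < m n" for k
    proof -
      have "\<tau> n k \<in> {a..b}" "\<tau> n (Suc k) \<in> {a..b}" "\<tau> n k \<le> \<tau> n (Suc k)" and \<xi>m: "\<xi> n k \<in> borel_measurable (F (\<tau> n k))"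
        using el[of n] k unfolding elementary_process_def by auto
      then have t: "0 \<le> \<tau> n k" "\<tau> n k \<le> \<tau> n (Suc k)" "\<tau> n (Suc k) \<le> T" "a \<le> \<tau> n k" using ab by auto
      obtain C where C: "\<And>\<omega>. \<omega> \<in> space P \<Longrightarrow> \<bar>\<xi> n k \<omega>\<bar> \<le> C"
        using el[of n] k unfolding elementary_process_def by blast
      have "A \<in> sets (F (\<tau> n k))" using F_mono[OF ab(1) t(4)] t A by auto
      then have "(\<lambda>\<omega>. indicator A \<omega> * \<xi> n k \<omega>) \<in> borel_measurable (F (\<tau> n k))" using \<xi>m by measurable
      moreover have "\<bar>indicator A \<omega> * \<xi> n k \<omega>\<bar> \<le> \<bar>C\<bar>" if "\<omega> \<in> space P" for \<omega>
        using C[OF that] by (auto simp: indicator_def)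
      ultimately show ?thesis
        using expectation_adapted_increment[OF \<theta> t(1-3) i] by blast
    qed
    have "(\<lambda>\<omega>. indicator A \<omega> * I n \<omega>)
        = (\<lambda>\<omega>. \<Sum>k<m n. (indicator A \<omega> * \<xi> n k \<omega>) * (W \<theta> (\<tau> n (Suc k)) \<omega> i - W \<theta> (\<tau> n k) \<omega> i))"
      by (simp add: I_def elementary_integral_def sum_distrib_left mult.assoc)
    then show ?thesis
      using * by (auto simp: Bochner_Integration.integral_sum intro!: Bochner_Integration.integrable_sum)
  qed
  have a: "a \<in> {0..T}" using ab by auto
  have Iint: "integrable P (I n)" for n
  proof -
    have "integrable P (\<lambda>\<omega>. indicator (space P) \<omega> * I n \<omega>)"
      using Ik[of "space P" n] sets.top[of "F a"] space_F[OF a] by simp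
    then show ?thesis by (rule Bochner_Integration.integrable_cong[THEN iffD1, rotated 2]) auto
  qed
  have [measurable]: "I n \<in> borel_measurable P" for n using Iint by auto
  define e where "e = (\<lambda>n. \<integral>\<^sup>+ \<omega>. ennreal ((J \<omega> - I n \<omega>)\<^sup>2) \<partial>P)"
  have elim: "e \<longlonglongrightarrow> 0" using lim by (simp add: e_def I_def)
  have fin: "\<forall>\<^sub>F n in sequentially. e n < \<infinity>"
    using order_tendstoD(2)[OF elim, of \<infinity>] by simp
  have sq: "integrable P (\<lambda>\<omega>. (J \<omega> - I n \<omega>)\<^sup>2)" "expectation (\<lambda>\<omega>. (J \<omega> - I n \<omega>)\<^sup>2) = enn2real (e n)" if "e n < \<infinity>" for n
  proof -
    show "integrable P (\<lambda>\<omega>. (J \<omega> - I n \<omega>)\<^sup>2)"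
      using that unfolding e_def by (intro integrableI_nonneg) auto
    show "expectation (\<lambda>\<omega>. (J \<omega> - I n \<omega>)\<^sup>2) = enn2real (e n)"
      unfolding e_def by (rule integral_eq_nn_integral) auto
  qed
  \<comment> \<open>One approximant at finite distance in mean square suffices for the integrability
    of \<open>J\<close>.\<close>
  obtain n0 where "e n0 < \<infinity>" using eventually_happens[OF fin] by auto
  then have "integrable P (\<lambda>\<omega>. J \<omega> - I n0 \<omega>)"
    by (intro square_integrable_imp_integrable[OF _ sq(1)]) measurable
  from Bochner_Integration.integrable_add[OF this Iint[of n0]] show Ji: "integrable P J" by simp
  assume A: "A \<in> sets (F a)"
  then have AP[measurable]: "A \<in> sets P" using F_subalgebra[OF a] by (auto simp: subalgebra_def)
  have le: "(expectation (\<lambda>\<omega>. indicator A \<omega> * J \<omega>))\<^sup>2 \<le> enn2real (e n)" if e: "e n < \<infinity>" for n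
  proof -
    have dom: "(indicator A \<omega> * (J \<omega> - I n \<omega>))\<^sup>2 \<le> (J \<omega> - I n \<omega>)\<^sup>2" for \<omega> by (auto simp: indicator_def)
    have int2: "integrable P (\<lambda>\<omega>. (indicator A \<omega> * (J \<omega> - I n \<omega>))\<^sup>2)"
      by (rule Bochner_Integration.integrable_bound[OF sq(1)[OF e]]) (use dom in auto)
    have "expectation (\<lambda>\<omega>. indicator A \<omega> * J \<omega>) = expectation (\<lambda>\<omega>. indicator A \<omega> * J \<omega>) - expectation (\<lambda>\<omega>. indicator A \<omega> * I n \<omega>)"
      using Ik[OF A, of n] by simp
    also have "\<dots> = expectation (\<lambda>\<omega>. indicator A \<omega> * (J \<omega> - I n \<omega>))"
      using Ik[OF A, of n] integrable_real_mult_indicator[OF AP Ji]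
      by (subst Bochner_Integration.integral_diff[symmetric]) (auto simp: mult.commute right_diff_distrib left_diff_distrib)
    finally have "(expectation (\<lambda>\<omega>. indicator A \<omega> * J \<omega>))\<^sup>2 \<le> expectation (\<lambda>\<omega>. (indicator A \<omega> * (J \<omega> - I n \<omega>))\<^sup>2)"
      using expectation_power2_le'[OF _ int2] by simp
    also have "\<dots> \<le> expectation (\<lambda>\<omega>. (J \<omega> - I n \<omega>)\<^sup>2)"
      by (intro integral_mono int2 sq(1)[OF e] dom)
    finally show ?thesis using sq(2)[OF e] by simp
  qed
  have "(\<lambda>n. enn2real (e n)) \<longlonglongrightarrow> 0"
    using tendsto_enn2real[of e 0 sequentially] elim by simp
  then have "(expectation (\<lambda>\<omega>. indicator A \<omega> * J \<omega>))\<^sup>2 \<le> 0"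
    by (rule tendsto_lowerbound) (use fin le in \<open>auto elim!: eventually_mono\<close>)
  then show "expectation (\<lambda>\<omega>. indicator A \<omega> * J \<omega>) = 0" by simp
qed

text \<open>Interchange of time and expectation for integrands that are known on
  \<open>{0..T}\<close> only; \<open>cl\<close> extends them to the line. The remaining claims
  supply the integrability of both iterated integrals.\<close>

lemma Fubini_time:
  fixes k :: "real \<Rightarrow> 'a \<Rightarrow> real"
  assumes k: "(\<lambda>(s, \<omega>). k s \<omega>) \<in> borel_measurable (restrict_space borel {0..T} \<Otimes>\<^sub>M P)"
    and bnd: "\<And>s \<omega>. s \<in> {0..T} \<Longrightarrow> \<omega> \<in> space P \<Longrightarrow> \<bar>k s \<omega>\<bar> \<le> C" and t: "t \<in> {0..T}"
  shows "expectation (\<lambda>\<omega>. LINT s:{t..T}|lborel. k s \<omega>) = (LINT s:{t..T}|lborel. expectation (k s))"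
    and "bounded_rv (\<lambda>\<omega>. LINT s:{t..T}|lborel. k s \<omega>)"
    and "set_integrable lborel {t..T} (\<lambda>s. expectation (k s))"
    and "\<And>\<omega>. \<omega> \<in> space P \<Longrightarrow> set_integrable lborel {t..T} (\<lambda>s. k s \<omega>)"
proof -
  define cl where "cl = (\<lambda>s. max 0 (min T s))"
  have cl: "cl s \<in> {0..T}" "s \<in> {t..T} \<Longrightarrow> cl s = s" for s using T_pos t by (auto simp: cl_def)
  define k' where "k' = (\<lambda>s \<omega>. indicator {t..T} s * k (cl s) \<omega>)"
  have k'_eq: "indicator {t..T} s *\<^sub>R k s \<omega> = k' s \<omega>" for s \<omega>
    using cl(2)[of s] by (auto simp: k'_def indicator_def)
  have [measurable]: "cl \<in> borel_measurable borel" unfolding cl_def by simp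
  have "(\<lambda>z. (cl (fst z), snd z)) \<in> measurable (lborel \<Otimes>\<^sub>M P) (restrict_space borel {0..T} \<Otimes>\<^sub>M P)"
    using cl(1) by (intro measurable_Pair) (auto simp: measurable_restrict_space2_iff)
  from measurable_compose[OF this k]
  have "(\<lambda>z. k (cl (fst z)) (snd z)) \<in> borel_measurable (lborel \<Otimes>\<^sub>M P)" by simp
  then have k'm[measurable]: "(\<lambda>(s, \<omega>). k' s \<omega>) \<in> borel_measurable (lborel \<Otimes>\<^sub>M P)"
    unfolding k'_def case_prod_unfold by (intro borel_measurable_times) auto
  interpret L: pair_sigma_finite lborel P by unfold_locales
  have C: "\<bar>k (cl s) \<omega>\<bar> \<le> C" if "\<omega> \<in> space P" for s \<omega> by (rule bnd[OF cl(1) that])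
  have int: "integrable (lborel \<Otimes>\<^sub>M P) (\<lambda>(s, \<omega>). k' s \<omega>)"
  proof (rule integrableI_bounded_set[where A="{t..T} \<times> space P" and B=C])
    show "emeasure (lborel \<Otimes>\<^sub>M P) ({t..T} \<times> space P) < \<infinity>"
      using t by (subst emeasure_pair_measure_Times) (auto simp: emeasure_space_1)
    show "AE x\<in>{t..T} \<times> space P in lborel \<Otimes>\<^sub>M P. norm (case x of (s, \<omega>) \<Rightarrow> k' s \<omega>) \<le> C"
      using C by (intro AE_I2) (auto simp: k'_def)
    show "AE x in lborel \<Otimes>\<^sub>M P. x \<notin> {t..T} \<times> space P \<longrightarrow> (case x of (s, \<omega>) \<Rightarrow> k' s \<omega>) = 0"
      by (intro AE_I2) (auto simp: k'_def space_pair_measure indicator_def split: if_splits)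
  qed auto
  have Ek': "expectation (k' s) = indicator {t..T} s *\<^sub>R expectation (k s)" for s
    unfolding k'_eq[symmetric] by simp
  have "expectation (\<lambda>\<omega>. \<integral>s. k' s \<omega> \<partial>lborel) = (\<integral>s. expectation (k' s) \<partial>lborel)"
    using L.Fubini_integral[OF int] by simp
  then show "expectation (\<lambda>\<omega>. LINT s:{t..T}|lborel. k s \<omega>) = (LINT s:{t..T}|lborel. expectation (k s))"
    unfolding set_lebesgue_integral_def by (simp only: k'_eq Ek')
  have mb: "(\<lambda>\<omega>. \<integral>s. k' s \<omega> \<partial>lborel) \<in> borel_measurable P"
    using k'm by (intro lborel.borel_measurable_lebesgue_integral) (simp add: case_prod_unfold measurable_pair_swap_iff[of "\<lambda>z. k' (snd z) (fst z)"])
  have setint: "set_integrable lborel {t..T} (\<lambda>s. k s \<omega>)" if \<omega>: "\<omega> \<in> space P" for \<omega>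
    unfolding set_integrable_def k'_eq
  proof (rule integrableI_bounded_set[where A="{t..T}" and B=C])
    show "(\<lambda>s. k' s \<omega>) \<in> borel_measurable lborel"
      using measurable_compose[OF _ k'm, of "\<lambda>s. (s, \<omega>)" lborel] \<omega> by simp
  qed (use C[OF \<omega>] t in \<open>auto simp: k'_def\<close>)
  have "\<bar>LINT s:{t..T}|lborel. k s \<omega>\<bar> \<le> (T - t) * C" if \<omega>: "\<omega> \<in> space P" for \<omega>
  proof -
    have "\<bar>LINT s:{t..T}|lborel. k s \<omega>\<bar> \<le> (LINT s:{t..T}|lborel. \<bar>k s \<omega>\<bar>)"
      using set_integral_norm_bound[OF setint[OF \<omega>]] by simp
    also have "\<dots> \<le> (LINT s:{t..T}|lborel. C)"
      using setint[OF \<omega>] t \<omega> bnd by (intro set_integral_mono set_integrable_abs) (auto simp: set_integrable_def)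
    also have "\<dots> = (T - t) * C" using t by (simp add: set_lebesgue_integral_def)
    finally show ?thesis .
  qed
  with mb show "bounded_rv (\<lambda>\<omega>. LINT s:{t..T}|lborel. k s \<omega>)"
    unfolding set_lebesgue_integral_def k'_eq by (rule bounded_rvI)
  show "\<And>\<omega>. \<omega> \<in> space P \<Longrightarrow> set_integrable lborel {t..T} (\<lambda>s. k s \<omega>)" by (rule setint)
  have "integrable lborel (\<lambda>s. expectation (k' s))"
    using L.integrable_fst[OF int] by simp
  then show "set_integrable lborel {t..T} (\<lambda>s. expectation (k s))"
    unfolding set_integrable_def by (simp only: Ek')
qed

text \<open>\<open>W s\<close> is \<open>W t\<close> plus an increment independent of
  \<open>F t\<close>. Freezing \<open>W t\<close> leaves an average over the increment, which has
  the law of \<open>W (s - t)\<close>. Testing with the sets \<open>A\<close> stands in for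
  conditional expectation.\<close>

lemma Markov_property:
  fixes h :: "(nat \<Rightarrow> real) \<Rightarrow> real"
  assumes \<theta>: "\<theta> \<in> Theta" and ts: "0 \<le> t" "t \<le> s" "s \<le> T" and A: "A \<in> sets (F t)"
    and h: "h \<in> borel_measurable (Rd_borel d)" "\<And>x. x \<in> Rd d \<Longrightarrow> \<bar>h x\<bar> \<le> C"
  shows "expectation (\<lambda>\<omega>. indicator A \<omega> * h (W \<theta> s \<omega>))
    = expectation (\<lambda>\<omega>'. indicator A \<omega>' * expectation (\<lambda>\<omega>. h (vadd d (W \<theta> t \<omega>') (W \<theta> (s - t) \<omega>))))"
proof -
  let ?D = "\<lambda>\<omega>. vdiff d (W \<theta> s \<omega>) (W \<theta> t \<omega>)"
  have tin: "t \<in> {0..T}" "s \<in> {0..T}" "s - t \<in> {0..T}" using ts by auto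
  have [measurable]: "?D \<in> measurable P (Rd_borel d)" "W \<theta> (s - t) \<in> measurable P (Rd_borel d)"
    using tin by (auto intro!: measurable_vdiff W_measurable_P \<theta>)
  have law: "expectation (\<lambda>\<omega>. h (vadd d x (?D \<omega>))) = expectation (\<lambda>\<omega>. h (vadd d x (W \<theta> (s - t) \<omega>)))" if x: "x \<in> Rd d" for x
  proof -
    have m: "(\<lambda>w. h (vadd d x w)) \<in> borel_measurable (Rd_borel d)"
      using x by (intro measurable_compose[OF _ h(1)] measurable_vadd) auto
    have "expectation (\<lambda>\<omega>. h (vadd d x (?D \<omega>))) = (\<integral>w. h (vadd d x w) \<partial>distr P (Rd_borel d) ?D)"
      using m by (subst integral_distr) auto
    also have "\<dots> = expectation (\<lambda>\<omega>. h (vadd d x (W \<theta> (s - t) \<omega>)))"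
      unfolding distr_increment[OF \<theta> ts] using m by (subst integral_distr) auto
    finally show ?thesis .
  qed
  have eq: "vadd d (W \<theta> t \<omega>) (?D \<omega>) = W \<theta> s \<omega>" if "\<omega> \<in> space P" for \<omega>
    by (rule vadd_vdiff[OF W_in_Rd[OF \<theta> tin(2) that]])
  have "expectation (\<lambda>\<omega>. indicator A \<omega> * h (W \<theta> s \<omega>)) = expectation (\<lambda>\<omega>. indicator A \<omega> * h (vadd d (W \<theta> t \<omega>) (?D \<omega>)))"
    by (intro Bochner_Integration.integral_cong refl) (simp add: eq)
  also have "\<dots> = expectation (\<lambda>\<omega>'. expectation (\<lambda>\<omega>. indicator A \<omega>' * h (vadd d (W \<theta> t \<omega>') (?D \<omega>))))"
  \<comment> \<open>Independence of increments is available for strictly ordered times only.\<close>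
  proof (cases "s = t")
    case True
    have z: "vdiff d x x = vdiff d y y" for x y by (auto simp: vdiff_def)
    have e: "expectation (\<lambda>\<omega>. indicator A \<omega>' * h (vadd d (W \<theta> t \<omega>') (vdiff d (W \<theta> t \<omega>) (W \<theta> t \<omega>))))
        = indicator A \<omega>' * h (vadd d (W \<theta> t \<omega>') (vdiff d (W \<theta> t \<omega>') (W \<theta> t \<omega>')))" for \<omega>'
      by (subst z[of _ "W \<theta> t \<omega>'"]) (simp add: prob_space)
    show ?thesis unfolding True by (intro Bochner_Integration.integral_cong refl) (simp only: e)
  next
    case False
    then have "t < s" using ts by simp
    note ind = indep_incr[OF \<theta> ts(1) this ts(3)]
    have X: "(\<lambda>\<omega>. (W \<theta> t \<omega>, \<omega>)) \<in> measurable (F t) (Rd_borel d \<Otimes>\<^sub>M F t)"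
      by (intro measurable_Pair W_F_measurable \<theta> tin) auto
    have hm: "(\<lambda>z. indicator A (snd (fst z)) * h (vadd d (fst (fst z)) (snd z)))
        \<in> borel_measurable ((Rd_borel d \<Otimes>\<^sub>M F t) \<Otimes>\<^sub>M Rd_borel d)"
      using A by (intro borel_measurable_times measurable_compose[OF _ h(1)] measurable_vadd
        measurable_compose[OF _ borel_measurable_indicator[OF A]]) auto
    have "\<bar>indicator A (snd (fst z)) * h (vadd d (fst (fst z)) (snd z))\<bar> \<le> \<bar>C\<bar>" for z :: "((nat \<Rightarrow> real) \<times> 'a) \<times> (nat \<Rightarrow> real)"
      using h(2)[of "vadd d (fst (fst z)) (snd z)"] by (auto simp: indicator_def)
    from expectation_indep_subalg(1)[OF ind X incr_measurable hm this] show ?thesis by simp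
  qed
  also have "\<dots> = expectation (\<lambda>\<omega>'. indicator A \<omega>' * expectation (\<lambda>\<omega>. h (vadd d (W \<theta> t \<omega>') (W \<theta> (s - t) \<omega>))))"
    by (intro Bochner_Integration.integral_cong refl) (simp add: law[OF W_in_Rd[OF \<theta> tin(1)]])
  finally show ?thesis .
qed

end

section \<open>Comparison of the backward equation with the fixed point\<close>

context semilinear
begin

lemma sol_path_measurable:
  "(\<lambda>(s, \<omega>). sol (s, W base s \<omega>)) \<in> borel_measurable (restrict_space borel {0..T} \<Otimes>\<^sub>M P)"
proof -
  have fstm: "fst \<in> borel_measurable (restrict_space borel {0..T} \<Otimes>\<^sub>M P)"
    by (rule measurable_compose[OF measurable_fst]) (simp add: measurable_restrict_space1)
  have "(\<lambda>z. W base (fst z) (snd z)) \<in> measurable (restrict_space borel {0..T} \<Otimes>\<^sub>M P) (Rd_borel d)"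
    using fstm by (intro W_joint_measurable[OF base_Theta, of "{(False, base)}"] measurable_compose[OF measurable_snd id_galg_P])
      (auto simp: space_pair_measure space_restrict_space)
  then have "(\<lambda>z. (fst z, W base (fst z) (snd z))) \<in> measurable (restrict_space borel {0..T} \<Otimes>\<^sub>M P) E"
    using fstm by (intro measurable_timespaceI) (auto simp: space_pair_measure space_restrict_space)
  from measurable_compose[OF this sol_measurable] show ?thesis by (simp add: case_prod_unfold)
qed

lemma path_in: "t \<in> {0..T} \<Longrightarrow> \<omega> \<in> space P \<Longrightarrow> (t, W base t \<omega>) \<in> space E"
  using W_in_Rd[OF base_Theta] by (auto simp: space_timespace)

lemma sol_section_measurable: "s \<in> {0..T} \<Longrightarrow> (\<lambda>x. sol (s, x)) \<in> borel_measurable (Rd_borel d)"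
  by (rule measurable_compose[OF _ sol_measurable]) (auto intro!: measurable_timespaceI)

text \<open>The fixed point equation at the random point \<open>(t, W t)\<close>, with the Markov
  property applied to the terminal value and to each later time. This is what conditioning on
  \<open>F t\<close> leaves of a backward equation.\<close>

lemma sol_martingale:
  assumes t: "t \<in> {0..T}" and A: "A \<in> sets (F t)"
  shows "expectation (\<lambda>\<omega>. indicator A \<omega> * sol (t, W base t \<omega>))
    = expectation (\<lambda>\<omega>. indicator A \<omega> * G (W base T \<omega>))
      + (LINT s:{t..T}|lborel. expectation (\<lambda>\<omega>. indicator A \<omega> * f (sol (s, W base s \<omega>))))"
proof -
  have AP[measurable]: "A \<in> sets P" using A F_subalgebra[OF t] by (auto simp: subalgebra_def)
  have W[measurable]: "W base t \<in> measurable P (Rd_borel d)" by (rule W_measurable_P[OF base_Theta t])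
  define k1 where "k1 = (\<lambda>\<omega>'. expectation (\<lambda>\<omega>. G (vadd d (W base t \<omega>') (W base (T - t) \<omega>))))"
  \<comment> \<open>The maximum makes \<open>k\<close> meaningful for all times in
    \<open>{0..T}\<close>; on \<open>{t..T}\<close> it is \<open>s - t\<close>.\<close>
  define k where "k = (\<lambda>s \<omega>'. indicator A \<omega>' * expectation (\<lambda>\<omega>. f (sol (s, vadd d (W base t \<omega>') (W base (max 0 (s - t)) \<omega>)))))"
  have Tt: "T - t \<in> {0..T}" using t by auto
  have bound_k1: "\<bar>k1 \<omega>'\<bar> \<le> sqrt Kg" if "\<omega>' \<in> space P" for \<omega>'
    unfolding k1_def
  proof (rule expectation_abs_le)
    show "bounded_rv (\<lambda>\<omega>. G (vadd d (W base t \<omega>') (W base (T - t) \<omega>)))"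
      using W_in_Rd[OF base_Theta t that]
      by (intro bounded_rvI[where C="sqrt Kg"] measurable_compose[OF _ G_meas] measurable_vadd W_measurable_P[OF base_Theta Tt] G_abs) auto
  qed (simp add: G_abs)
  have k1m[measurable]: "k1 \<in> borel_measurable P"
  proof -
    have "(\<lambda>z. G (vadd d (W base t (fst z)) (W base (T - t) (snd z)))) \<in> borel_measurable (P \<Otimes>\<^sub>M P)"
      by (intro measurable_compose[OF _ G_meas] measurable_vadd measurable_compose[OF measurable_fst W]
        measurable_compose[OF measurable_snd W_measurable_P[OF base_Theta Tt]])
    then show ?thesis unfolding k1_def
      by (intro borel_measurable_lebesgue_integral) (simp add: case_prod_unfold)
  qed
  have km: "(\<lambda>(s, \<omega>'). k s \<omega>') \<in> borel_measurable (restrict_space borel {0..T} \<Otimes>\<^sub>M P)"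
  proof -
    let ?N = "(restrict_space borel {0..T} \<Otimes>\<^sub>M P) \<Otimes>\<^sub>M P"
    have s: "(\<lambda>z. fst (fst z)) \<in> borel_measurable ?N"
      by (rule measurable_compose[OF measurable_fst], rule measurable_compose[OF measurable_fst]) (simp add: measurable_restrict_space1)
    then have s': "(\<lambda>z. max 0 (fst (fst z) - t)) \<in> borel_measurable ?N" by measurable
    have "(\<lambda>z. W base (max 0 (fst (fst z) - t)) (snd z)) \<in> measurable ?N (Rd_borel d)"
      using s' t T_pos by (intro W_joint_measurable[OF base_Theta, of "{(False, base)}"] measurable_compose[OF measurable_snd id_galg_P])
        (auto simp: space_pair_measure space_restrict_space)
    then have "(\<lambda>z. (fst (fst z), vadd d (W base t (snd (fst z))) (W base (max 0 (fst (fst z) - t)) (snd z)))) \<in> measurable ?N E"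
      using s by (intro measurable_timespaceI measurable_vadd measurable_compose[OF _ W]) (auto simp: space_pair_measure space_restrict_space)
    from measurable_compose[OF measurable_compose[OF this sol_measurable] f_meas]
    have "(\<lambda>z. expectation (\<lambda>\<omega>. f (sol (fst z, vadd d (W base t (snd z)) (W base (max 0 (fst z - t)) \<omega>)))))
        \<in> borel_measurable (restrict_space borel {0..T} \<Otimes>\<^sub>M P)"
      by (intro borel_measurable_lebesgue_integral) (simp add: case_prod_unfold)
    then show ?thesis unfolding k_def case_prod_unfold
      by (intro borel_measurable_times measurable_compose[OF measurable_snd borel_measurable_indicator[OF AP]])
  qed
  have kb: "\<bar>k s \<omega>'\<bar> \<le> K" if s: "s \<in> {0..T}" and \<omega>': "\<omega>' \<in> space P" for s \<omega>'
  proof -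
    have "max 0 (s - t) \<in> {0..T}" using s t by auto
    then have "\<bar>expectation (\<lambda>\<omega>. f (sol (s, vadd d (W base t \<omega>') (W base (max 0 (s - t)) \<omega>))))\<bar> \<le> K"
      using W_in_Rd[OF base_Theta t \<omega>'] f_bound
      by (intro expectation_abs_le bounded_rvI[where C=K] measurable_compose[OF _ f_meas]
        measurable_compose[OF _ sol_section_measurable[OF s]] measurable_vadd W_measurable_P[OF base_Theta]) auto
    then show ?thesis using K_nonneg by (auto simp: k_def indicator_def)
  qed
  note Fub = Fubini_time[OF km kb t]
  have "indicator A \<omega>' * sol (t, W base t \<omega>') = indicator A \<omega>' * k1 \<omega>' + (LINT s:{t..T}|lborel. k s \<omega>')"
    if \<omega>': "\<omega>' \<in> space P" for \<omega>'
  proof -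
    let ?x = "W base t \<omega>'"
    note p = path_in[OF t \<omega>']
    have "sol (t, ?x) = k1 \<omega>' + (T - t) * expectation (\<lambda>\<omega>. f (sol (shift base (t, ?x) \<omega>)))"
      using sol_fixed_point[OF base_Theta base_Theta p] by (simp add: k1_def)
    also have "(T - t) * expectation (\<lambda>\<omega>. f (sol (shift base (t, ?x) \<omega>)))
        = (LINT s:{t..T}|lborel. expectation (\<lambda>\<omega>. f (sol (s, vadd d ?x (W base (s - t) \<omega>)))))"
      by (rule shift_time_integral[OF base_Theta p measurable_compose[OF sol_measurable f_meas] f_bound])
    finally have "indicator A \<omega>' * sol (t, ?x) = indicator A \<omega>' * k1 \<omega>' +
        (LINT s:{t..T}|lborel. indicator A \<omega>' * expectation (\<lambda>\<omega>. f (sol (s, vadd d ?x (W base (s - t) \<omega>)))))"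
      by (simp add: distrib_left)
    also have "(LINT s:{t..T}|lborel. indicator A \<omega>' * expectation (\<lambda>\<omega>. f (sol (s, vadd d ?x (W base (s - t) \<omega>)))))
        = (LINT s:{t..T}|lborel. k s \<omega>')"
      by (intro set_lebesgue_integral_cong) (auto simp: k_def max_def)
    finally show ?thesis .
  qed
  then have "expectation (\<lambda>\<omega>'. indicator A \<omega>' * sol (t, W base t \<omega>'))
      = expectation (\<lambda>\<omega>'. indicator A \<omega>' * k1 \<omega>' + (LINT s:{t..T}|lborel. k s \<omega>'))"
    by (intro Bochner_Integration.integral_cong refl)
  also have "\<dots> = expectation (\<lambda>\<omega>'. indicator A \<omega>' * k1 \<omega>') + expectation (\<lambda>\<omega>'. LINT s:{t..T}|lborel. k s \<omega>')"
  proof (rule Bochner_Integration.integral_add)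
    have "bounded_rv k1" by (rule bounded_rvI[OF k1m bound_k1])
    moreover have "bounded_rv (indicator A)"
      by (rule bounded_rvI[where C=1]) (auto simp: indicator_def)
    ultimately show "integrable P (\<lambda>\<omega>'. indicator A \<omega>' * k1 \<omega>')"
      by (intro bounded_rv_integrable[OF bounded_rv_mult])
    show "integrable P (\<lambda>\<omega>'. LINT s:{t..T}|lborel. k s \<omega>')" by (rule bounded_rv_integrable[OF Fub(2)])
  qed
  also have "expectation (\<lambda>\<omega>'. indicator A \<omega>' * k1 \<omega>') = expectation (\<lambda>\<omega>. indicator A \<omega> * G (W base T \<omega>))"
    unfolding k1_def using t by (intro Markov_property[OF base_Theta _ _ _ A G_meas G_abs, symmetric]) auto
  also have "expectation (\<lambda>\<omega>'. LINT s:{t..T}|lborel. k s \<omega>') = (LINT s:{t..T}|lborel. expectation (k s))"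
    by (rule Fub(1))
  also have "\<dots> = (LINT s:{t..T}|lborel. expectation (\<lambda>\<omega>. indicator A \<omega> * f (sol (s, W base s \<omega>))))"
  proof (intro set_lebesgue_integral_cong allI impI)
    fix s assume s: "s \<in> {t..T}"
    then have s': "s \<in> {0..T}" "max 0 (s - t) = s - t" using t by auto
    show "expectation (k s) = expectation (\<lambda>\<omega>. indicator A \<omega> * f (sol (s, W base s \<omega>)))"
      unfolding k_def s'(2) using s t
      by (intro Markov_property[OF base_Theta _ _ _ A measurable_compose[OF sol_section_measurable[OF s'(1)] f_meas] f_bound, symmetric]) auto
  qed simp
  finally show ?thesis .
qed

text \<open>\<open>Y\<close> and \<open>X\<close>, the process \<open>sol (s, W s)\<close>, satisfy
  the same equation tested with sets of \<open>F t\<close>. Testing with the event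
  \<open>Y > X\<close> and its complement bounds the mean of \<open>\<bar>Y t - X t\<bar>\<close> by
  the integral over \<open>{t..T}\<close> of \<open>H\<close>, the mean of
  \<open>\<bar>f Y - f X\<bar>\<close>. The Lipschitz bound then yields an integral inequality for
  \<open>H\<close>. The Gronwall argument is run for \<open>H\<close>, because \<open>H\<close> is
  bounded by \<open>2 * K\<close> although \<open>Y\<close> itself need not be bounded.\<close>

theorem bsde_solution:
  assumes Yp: "predictable P F T Y"
    and BSDE: "\<And>t. t \<in> {0..T} \<Longrightarrow>
      \<exists>J. (\<forall>j\<in>{1..d}. has_ito_integral P F (\<lambda>s \<omega>. W base s \<omega> j) t T (Z j) (J j)) \<and>
        (AE \<omega> in P. Y t \<omega> = G (W base T \<omega>) + (LINT s:{t..T}|lborel. f (Y s \<omega>)) - (\<Sum>j=1..d. J j \<omega>))"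
    and t: "t \<in> {0..T}"
  shows "AE \<omega> in P. Y t \<omega> = sol (t, W base t \<omega>)"
proof -
  define X where "X = (\<lambda>s \<omega>. sol (s, W base s \<omega>))"
  define k where "k = (\<lambda>s \<omega>. f (Y s \<omega>) - f (X s \<omega>))"
  define H where "H = (\<lambda>s. expectation (\<lambda>\<omega>. \<bar>k s \<omega>\<bar>))"
  have Xm: "X s \<in> borel_measurable (F s)" if "s \<in> {0..T}" for s
    unfolding X_def by (rule measurable_compose[OF W_F_measurable[OF base_Theta that] sol_section_measurable[OF that]])
  have Ym: "Y s \<in> borel_measurable (F s)" if "s \<in> {0..T}" for s
    by (rule predictable_section[OF Yp that])
  have XP: "bounded_rv (X s)" if "s \<in> {0..T}" for s
    by (rule bounded_rvI[OF measurable_F_P[OF that Xm[OF that]]]) (use sol_bound path_in that in \<open>auto simp: X_def\<close>)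
  have fYj: "(\<lambda>(s, \<omega>). f (Y s \<omega>)) \<in> borel_measurable (restrict_space borel {0..T} \<Otimes>\<^sub>M P)"
    using measurable_compose[OF predictable_joint[OF Yp] f_meas] by (simp add: case_prod_unfold)
  have fXj: "(\<lambda>(s, \<omega>). f (X s \<omega>)) \<in> borel_measurable (restrict_space borel {0..T} \<Otimes>\<^sub>M P)"
    using measurable_compose[OF sol_path_measurable f_meas] by (simp add: case_prod_unfold X_def)
  have kj: "(\<lambda>(s, \<omega>). k s \<omega>) \<in> borel_measurable (restrict_space borel {0..T} \<Otimes>\<^sub>M P)"
    using borel_measurable_diff[OF fYj fXj] by (simp add: case_prod_unfold k_def)
  have akj: "(\<lambda>(s, \<omega>). \<bar>k s \<omega>\<bar>) \<in> borel_measurable (restrict_space borel {0..T} \<Otimes>\<^sub>M P)"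
    using borel_measurable_abs[OF kj] by (simp add: case_prod_unfold)
  have kb: "\<bar>k s \<omega>\<bar> \<le> 2 * K" for s \<omega>
    using f_bound[of "Y s \<omega>"] f_bound[of "X s \<omega>"] unfolding k_def by linarith
  have AA: "(\<lambda>(s, \<omega>). indicator A \<omega> * q s \<omega>) \<in> borel_measurable (restrict_space borel {0..T} \<Otimes>\<^sub>M P)"
    if "(\<lambda>(s, \<omega>). q s \<omega>) \<in> borel_measurable (restrict_space borel {0..T} \<Otimes>\<^sub>M P)" "A \<in> sets P" for q :: "real \<Rightarrow> 'a \<Rightarrow> real" and A
    using borel_measurable_times[OF measurable_compose[OF measurable_snd borel_measurable_indicator[OF that(2)]] that(1)]
    by (simp add: case_prod_unfold)
  have main: "integrable P (Y t) \<and> expectation (\<lambda>\<omega>. \<bar>Y t \<omega> - X t \<omega>\<bar>) \<le> (LINT s:{t..T}|lborel. H s)"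
    if t: "t \<in> {0..T}" for t
  proof -
    obtain J where J: "\<And>j. j \<in> {1..d} \<Longrightarrow> has_ito_integral P F (\<lambda>s \<omega>. W base s \<omega> j) t T (Z j) (J j)"
      and ae: "AE \<omega> in P. Y t \<omega> = G (W base T \<omega>) + (LINT s:{t..T}|lborel. f (Y s \<omega>)) - (\<Sum>j=1..d. J j \<omega>)"
      using BSDE[OF t] by blast
    have tT: "0 \<le> t" "t \<le> T" "T \<le> T" using t by auto
    note ito = ito_integral_mean_zero[OF base_Theta tT _ J]
    have YP: "Y t \<in> borel_measurable P" by (rule measurable_F_P[OF t Ym[OF t]])
    have T': "T \<in> {0..T}" using T_pos by auto
    have GW: "bounded_rv (\<lambda>\<omega>. G (W base T \<omega>))"
      by (rule bounded_rvI[where C="sqrt Kg"])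
        (use measurable_compose[OF W_measurable_P[OF base_Theta T'] G_meas] G_abs W_in_Rd[OF base_Theta T'] in auto)
    note FY = Fubini_time[OF fYj f_bound t] and FX = Fubini_time[OF fXj f_bound t] and Fk = Fubini_time[OF kj kb t]
    let ?R = "\<lambda>\<omega>. G (W base T \<omega>) + (LINT s:{t..T}|lborel. f (Y s \<omega>)) - (\<Sum>j=1..d. J j \<omega>)"
    have Ri: "integrable P ?R"
      by (intro Bochner_Integration.integrable_diff Bochner_Integration.integrable_add Bochner_Integration.integrable_sum
        bounded_rv_integrable GW FY(2) ito(1)) auto
    have Yi: "integrable P (Y t)"
      using integrable_cong_AE[OF YP _ ae] Ri by auto
    have ident: "expectation (\<lambda>\<omega>. indicator A \<omega> * (Y t \<omega> - X t \<omega>)) = expectation (\<lambda>\<omega>. indicator A \<omega> * (LINT s:{t..T}|lborel. k s \<omega>))"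
      if A: "A \<in> sets (F t)" for A
    proof -
      have AP[measurable]: "A \<in> sets P" using A F_subalgebra[OF t] by (auto simp: subalgebra_def)
      have Ai: "integrable P (\<lambda>\<omega>. indicator A \<omega> * q \<omega>)" if "integrable P q" for q :: "'a \<Rightarrow> real"
        using integrable_real_mult_indicator[OF AP that] by (simp add: mult.commute)
      have iJ: "integrable P (J j)" "expectation (\<lambda>\<omega>. indicator A \<omega> * J j \<omega>) = 0" if "j \<in> {1..d}" for j
        using ito[OF that] that A by auto
      have i1: "integrable P (\<lambda>\<omega>. G (W base T \<omega>))" "integrable P (\<lambda>\<omega>. LINT s:{t..T}|lborel. f (Y s \<omega>))"
        "integrable P (\<lambda>\<omega>. \<Sum>j=1..d. J j \<omega>)"
        by (auto intro!: bounded_rv_integrable GW FY(2) Bochner_Integration.integrable_sum iJ(1))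
      have sJ: "expectation (\<lambda>\<omega>. indicator A \<omega> * (\<Sum>j=1..d. J j \<omega>)) = 0"
        unfolding sum_distrib_left using iJ by (subst Bochner_Integration.integral_sum) (auto intro!: Ai)
      have "expectation (\<lambda>\<omega>. indicator A \<omega> * Y t \<omega>) = expectation (\<lambda>\<omega>. indicator A \<omega> * ?R \<omega>)"
        using ae Ri YP by (intro Bochner_Integration.integral_cong_AE) (auto elim!: eventually_mono)
      also have "\<dots> = expectation (\<lambda>\<omega>. indicator A \<omega> * G (W base T \<omega>) + indicator A \<omega> * (LINT s:{t..T}|lborel. f (Y s \<omega>))
          - indicator A \<omega> * (\<Sum>j=1..d. J j \<omega>))"
        by (simp only: distrib_left right_diff_distrib)
      also have "\<dots> = expectation (\<lambda>\<omega>. indicator A \<omega> * G (W base T \<omega>)) + expectation (\<lambda>\<omega>. indicator A \<omega> * (LINT s:{t..T}|lborel. f (Y s \<omega>)))"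
        using Ai[OF i1(1)] Ai[OF i1(2)] Ai[OF i1(3)] sJ by simp
      finally have 1: "expectation (\<lambda>\<omega>. indicator A \<omega> * Y t \<omega>)
        = expectation (\<lambda>\<omega>. indicator A \<omega> * G (W base T \<omega>)) + expectation (\<lambda>\<omega>. indicator A \<omega> * (LINT s:{t..T}|lborel. f (Y s \<omega>)))" .
      have Ab: "\<bar>indicator A \<omega> * f (X s \<omega>)\<bar> \<le> K" for s \<omega> using f_bound K_nonneg by (auto simp: indicator_def)
      have 2: "expectation (\<lambda>\<omega>. indicator A \<omega> * X t \<omega>)
        = expectation (\<lambda>\<omega>. indicator A \<omega> * G (W base T \<omega>)) + expectation (\<lambda>\<omega>. indicator A \<omega> * (LINT s:{t..T}|lborel. f (X s \<omega>)))"
        using sol_martingale[OF t A] Fubini_time(1)[OF AA[OF fXj AP] Ab t] by (simp add: X_def)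
      have lin: "(LINT s:{t..T}|lborel. k s \<omega>) = (LINT s:{t..T}|lborel. f (Y s \<omega>)) - (LINT s:{t..T}|lborel. f (X s \<omega>))"
        if "\<omega> \<in> space P" for \<omega>
        unfolding k_def using FY(4)[OF that] FX(4)[OF that] by (rule set_integral_diff(2))
      have "expectation (\<lambda>\<omega>. indicator A \<omega> * (Y t \<omega> - X t \<omega>))
          = expectation (\<lambda>\<omega>. indicator A \<omega> * Y t \<omega>) - expectation (\<lambda>\<omega>. indicator A \<omega> * X t \<omega>)"
        unfolding right_diff_distrib
        by (rule Bochner_Integration.integral_diff[OF Ai[OF Yi] Ai[OF bounded_rv_integrable[OF XP[OF t]]]])
      also have "\<dots> = expectation (\<lambda>\<omega>. indicator A \<omega> * (LINT s:{t..T}|lborel. f (Y s \<omega>)))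
          - expectation (\<lambda>\<omega>. indicator A \<omega> * (LINT s:{t..T}|lborel. f (X s \<omega>)))"
        using 1 2 by simp
      also have "\<dots> = expectation (\<lambda>\<omega>. indicator A \<omega> * (LINT s:{t..T}|lborel. f (Y s \<omega>))
          - indicator A \<omega> * (LINT s:{t..T}|lborel. f (X s \<omega>)))"
        by (rule Bochner_Integration.integral_diff[OF Ai[OF i1(2)] Ai[OF bounded_rv_integrable[OF FX(2)]], symmetric])
      also have "\<dots> = expectation (\<lambda>\<omega>. indicator A \<omega> * (LINT s:{t..T}|lborel. k s \<omega>))"
        by (intro Bochner_Integration.integral_cong refl) (simp add: lin right_diff_distrib)
      finally show ?thesis .
    qed
    \<comment> \<open>The sign of the difference is an event of \<open>F t\<close>, as both
      processes are adapted.\<close>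
    define A where "A = {\<omega>\<in>space P. Y t \<omega> - X t \<omega> > 0}"
    define B where "B = space P - A"
    have "A = {\<omega>\<in>space (F t). Y t \<omega> - X t \<omega> > 0}" by (simp add: A_def space_F[OF t])
    also have "\<dots> \<in> sets (F t)" using Ym[OF t] Xm[OF t] by measurable
    finally have A: "A \<in> sets (F t)" .
    then have B: "B \<in> sets (F t)" unfolding B_def space_F[OF t, symmetric] by auto
    have AP[measurable]: "A \<in> sets P" "B \<in> sets P" using A B F_subalgebra[OF t] by (auto simp: subalgebra_def)
    have Di: "integrable P (\<lambda>\<omega>. Y t \<omega> - X t \<omega>)"
      by (intro Bochner_Integration.integrable_diff Yi bounded_rv_integrable XP t)
    have Ai: "integrable P (\<lambda>\<omega>. indicator A' \<omega> * q \<omega>)" if "integrable P q" "A' \<in> sets P" for q :: "'a \<Rightarrow> real" and A'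
      using integrable_real_mult_indicator[OF that(2,1)] by (simp add: mult.commute)
    have Ki: "integrable P (\<lambda>\<omega>. LINT s:{t..T}|lborel. k s \<omega>)" by (rule bounded_rv_integrable[OF Fk(2)])
    have "expectation (\<lambda>\<omega>. \<bar>Y t \<omega> - X t \<omega>\<bar>) = expectation (\<lambda>\<omega>. indicator A \<omega> * (Y t \<omega> - X t \<omega>) - indicator B \<omega> * (Y t \<omega> - X t \<omega>))"
      by (intro Bochner_Integration.integral_cong refl) (auto simp: A_def B_def indicator_def)
    also have "\<dots> = expectation (\<lambda>\<omega>. indicator A \<omega> * (Y t \<omega> - X t \<omega>)) - expectation (\<lambda>\<omega>. indicator B \<omega> * (Y t \<omega> - X t \<omega>))"
      by (rule Bochner_Integration.integral_diff[OF Ai[OF Di AP(1)] Ai[OF Di AP(2)]])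
    also have "\<dots> = expectation (\<lambda>\<omega>. indicator A \<omega> * (LINT s:{t..T}|lborel. k s \<omega>) - indicator B \<omega> * (LINT s:{t..T}|lborel. k s \<omega>))"
      unfolding ident[OF A] ident[OF B]
      by (rule Bochner_Integration.integral_diff[OF Ai[OF Ki AP(1)] Ai[OF Ki AP(2)], symmetric])
    also have "\<dots> \<le> expectation (\<lambda>\<omega>. LINT s:{t..T}|lborel. \<bar>k s \<omega>\<bar>)"
    proof (rule integral_mono)
      show "integrable P (\<lambda>\<omega>. indicator A \<omega> * (LINT s:{t..T}|lborel. k s \<omega>) - indicator B \<omega> * (LINT s:{t..T}|lborel. k s \<omega>))"
        by (intro Bochner_Integration.integrable_diff Ai Ki AP)
      show "integrable P (\<lambda>\<omega>. LINT s:{t..T}|lborel. \<bar>k s \<omega>\<bar>)"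
        by (rule bounded_rv_integrable[OF Fubini_time(2)[OF akj _ t, of "2 * K"]]) (use kb in auto)
      fix \<omega> assume \<omega>: "\<omega> \<in> space P"
      have "\<bar>LINT s:{t..T}|lborel. k s \<omega>\<bar> \<le> (LINT s:{t..T}|lborel. \<bar>k s \<omega>\<bar>)"
        using set_integral_norm_bound[OF Fk(4)[OF \<omega>]] by simp
      then show "indicator A \<omega> * (LINT s:{t..T}|lborel. k s \<omega>) - indicator B \<omega> * (LINT s:{t..T}|lborel. k s \<omega>)
          \<le> (LINT s:{t..T}|lborel. \<bar>k s \<omega>\<bar>)"
        by (auto simp: indicator_def B_def)
    qed
    also have "\<dots> = (LINT s:{t..T}|lborel. H s)"
      unfolding H_def by (rule Fubini_time(1)[OF akj _ t, of "2 * K"]) (use kb in auto)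
    finally show ?thesis using Yi by simp
  qed
  have Hint: "set_integrable lborel {t..T} H" if "t \<in> {0..T}" for t
    unfolding H_def by (rule Fubini_time(3)[OF akj _ that, of "2 * K"]) (use kb in auto)
  have kbr: "bounded_rv (\<lambda>\<omega>. \<bar>k s \<omega>\<bar>)" if "s \<in> {0..T}" for s
    by (rule bounded_rvI[where C="2 * K"])
      (use measurable_compose[OF measurable_F_P[OF that Ym[OF that]] f_meas] measurable_compose[OF measurable_F_P[OF that Xm[OF that]] f_meas] kb
        in \<open>auto simp: k_def\<close>)
  have HL: "H s \<le> L * (LINT v:{s..T}|lborel. H v)" if s: "s \<in> {0..T}" for s
  proof -
    have Di: "integrable P (\<lambda>\<omega>. \<bar>Y s \<omega> - X s \<omega>\<bar>)"
      using main[OF s] bounded_rv_integrable[OF XP[OF s]] by (intro integrable_abs Bochner_Integration.integrable_diff) auto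
    have "H s \<le> expectation (\<lambda>\<omega>. L * \<bar>Y s \<omega> - X s \<omega>\<bar>)"
      unfolding H_def
    proof (rule integral_mono)
      show "integrable P (\<lambda>\<omega>. \<bar>k s \<omega>\<bar>)" by (rule bounded_rv_integrable[OF kbr[OF s]])
      show "integrable P (\<lambda>\<omega>. L * \<bar>Y s \<omega> - X s \<omega>\<bar>)" using Di by simp
      show "\<bar>k s \<omega>\<bar> \<le> L * \<bar>Y s \<omega> - X s \<omega>\<bar>" for \<omega> unfolding k_def by (rule f_Lip)
    qed
    also have "\<dots> \<le> L * (LINT v:{s..T}|lborel. H v)"
      using main[OF s] L_nonneg by (simp add: mult_left_mono)
    finally show ?thesis .
  qed
  \<comment> \<open>With this rate every iteration of the integral inequality gains the factor
    \<open>L / (2 * (1 + L))\<close>, which is at most 1/2.\<close>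
  let ?mu = "2 * (1 + L)"
  have mu: "0 < ?mu" using L_nonneg by simp
  have frac: "L * (c * (e / ?mu)) = (L / (1 + L)) * (c / 2 * e)" for c e :: real
    using L_nonneg by (simp add: divide_simps)
  have decay: "H s \<le> 2 * K * (1/2) ^ n * exp (?mu * (T - s))" if "s \<in> {0..T}" for n s
    using that
  proof (induction n arbitrary: s)
    case 0
    have "H s \<le> expectation (\<lambda>\<omega>. 2 * K)" unfolding H_def using kb by (intro integral_mono bounded_rv_integrable kbr 0) auto
    also have "\<dots> = 2 * K * 1" by (simp add: prob_space)
    also have "\<dots> \<le> 2 * K * exp (?mu * (T - s))" using K_nonneg mu 0 by (intro mult_left_mono) auto
    finally show ?case by simp
  next
    case (Suc n)
    let ?c = "2 * K * (1/2) ^ n"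
    have ei: "set_integrable lborel {s..T} (\<lambda>v. exp (?mu * (T - v)))"
      by (rule borel_integrable_atLeastAtMost') (intro continuous_intros)
    have "(LINT v:{s..T}|lborel. H v) \<le> (LINT v:{s..T}|lborel. ?c * exp (?mu * (T - v)))"
      by (intro set_integral_mono Hint Suc.prems set_integrable_mult_right ei Suc.IH) (use Suc.prems in auto)
    also have "\<dots> = ?c * (LINT v:{s..T}|lborel. exp (?mu * (T - v)))" by simp
    also have "\<dots> \<le> ?c * (exp (?mu * (T - s)) / ?mu)"
      using K_nonneg Suc.prems mu by (intro mult_left_mono integral_exp_time) auto
    finally have "L * (LINT v:{s..T}|lborel. H v) \<le> L * (?c * (exp (?mu * (T - s)) / ?mu))"
      using L_nonneg by (rule mult_left_mono)
    also have "\<dots> = (L / (1 + L)) * (?c / 2 * exp (?mu * (T - s)))" by (rule frac)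
    also have "\<dots> \<le> 1 * (?c / 2 * exp (?mu * (T - s)))"
      using L_nonneg K_nonneg by (intro mult_right_mono) auto
    finally show ?case using HL[OF Suc.prems] by simp
  qed
  have H0: "H s \<le> 0" if s: "s \<in> {0..T}" for s
  proof (rule tendsto_lowerbound)
    have "(\<lambda>n. 2 * K * (1/2) ^ n * exp (?mu * (T - s))) \<longlonglongrightarrow> 2 * K * 0 * exp (?mu * (T - s))"
      by (intro tendsto_intros LIMSEQ_power_zero) auto
    then show "(\<lambda>n. 2 * K * (1/2) ^ n * exp (?mu * (T - s))) \<longlonglongrightarrow> 0" by simp
  qed (use decay[OF s] in auto)
  have "(LINT s:{t..T}|lborel. H s) \<le> (LINT s:{t..T}|lborel. 0)"
    by (intro set_integral_mono Hint t H0) (use t in \<open>auto simp: set_integrable_def\<close>)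
  then have "expectation (\<lambda>\<omega>. \<bar>Y t \<omega> - X t \<omega>\<bar>) \<le> 0" using main[OF t] by simp
  moreover have "integrable P (\<lambda>\<omega>. \<bar>Y t \<omega> - X t \<omega>\<bar>)"
    using main[OF t] bounded_rv_integrable[OF XP[OF t]] by (intro integrable_abs Bochner_Integration.integrable_diff) auto
  moreover have "0 \<le> expectation (\<lambda>\<omega>. \<bar>Y t \<omega> - X t \<omega>\<bar>)"
    by (rule Bochner_Integration.integral_nonneg) simp
  ultimately have "AE \<omega> in P. \<bar>Y t \<omega> - X t \<omega>\<bar> = 0"
    using integral_nonneg_eq_0_iff_AE[of P "\<lambda>\<omega>. \<bar>Y t \<omega> - X t \<omega>\<bar>"] by auto
  then show ?thesis by (auto simp: X_def elim!: eventually_mono)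
qed

end

section \<open>Interpolation along the Brownian path\<close>

text \<open>Cauchy-Schwarz with the number of summands. The levels of the interpolated scheme share
  one Brownian path, so they are not treated as independent; a factor quadratic in the number of
  levels is harmless.\<close>

lemma (in prob_space) expectation_power2_sum_le:
  assumes J: "finite J" and X: "\<And>j. j \<in> J \<Longrightarrow> bounded_rv (X j)"
    and B: "\<And>j. j \<in> J \<Longrightarrow> expectation (\<lambda>\<omega>. (X j \<omega>)\<^sup>2) \<le> B"
  shows "expectation (\<lambda>\<omega>. (\<Sum>j\<in>J. X j \<omega>)\<^sup>2) \<le> (real (card J))\<^sup>2 * B"
proof -
  have i: "integrable M (\<lambda>\<omega>. (X j \<omega>)\<^sup>2)" if "j \<in> J" for j
    using X[OF that] by (intro bounded_rv_integrable bounded_rv_power2)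
  have "expectation (\<lambda>\<omega>. (\<Sum>j\<in>J. X j \<omega>)\<^sup>2) \<le> expectation (\<lambda>\<omega>. real (card J) * (\<Sum>j\<in>J. (X j \<omega>)\<^sup>2))"
  proof (rule integral_mono)
    show "integrable M (\<lambda>\<omega>. (\<Sum>j\<in>J. X j \<omega>)\<^sup>2)"
      by (intro bounded_rv_integrable bounded_rv_power2 bounded_rv_sum X)
    show "integrable M (\<lambda>\<omega>. real (card J) * (\<Sum>j\<in>J. (X j \<omega>)\<^sup>2))"
      by (intro integrable_mult_right Bochner_Integration.integrable_sum i)
    show "(\<Sum>j\<in>J. X j \<omega>)\<^sup>2 \<le> real (card J) * (\<Sum>j\<in>J. (X j \<omega>)\<^sup>2)" for \<omega>
      using Cauchy_Schwarz_ineq_sum[of "\<lambda>_. 1" "\<lambda>j. X j \<omega>" J] by simp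
  qed
  also have "\<dots> = real (card J) * (\<Sum>j\<in>J. expectation (\<lambda>\<omega>. (X j \<omega>)\<^sup>2))"
    using i by (simp add: Bochner_Integration.integral_sum)
  also have "\<dots> \<le> real (card J) * (\<Sum>j\<in>J. B)"
    by (intro mult_left_mono sum_mono B) auto
  finally show ?thesis by (simp add: power2_eq_square mult.assoc)
qed

definition interpolate :: "real \<Rightarrow> real \<Rightarrow> real \<Rightarrow> (real \<Rightarrow> real) \<Rightarrow> real \<Rightarrow> real"
  where "interpolate h a b \<phi> t = (b - t) / h * \<phi> a + (t - a) / h * \<phi> b"

lemma interpolate_diff: "interpolate h a b (\<lambda>s. \<phi> s - \<psi> s) t = interpolate h a b \<phi> t - interpolate h a b \<psi> t"
  by (simp add: interpolate_def right_diff_distrib)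

text \<open>The interpolation weights form a convex combination, so by convexity of the square the
  error is averaged over the two nodes, both within distance \<open>h\<close> of
  \<open>t\<close>.\<close>

lemma (in prob_space) interpolate_error:
  assumes X: "\<And>s. s \<in> {0..T} \<Longrightarrow> bounded_rv (X s)"
    and incr: "\<And>s t. s \<in> {0..T} \<Longrightarrow> t \<in> {0..T} \<Longrightarrow> expectation (\<lambda>\<omega>. (X s \<omega> - X t \<omega>)\<^sup>2) \<le> c * \<bar>s - t\<bar>"
    and h: "0 < h" "b - a = h" and t: "a \<le> t" "t \<le> b" "0 \<le> a" "b \<le> T" and c: "0 \<le> c"
  shows "expectation (\<lambda>\<omega>. (interpolate h a b (\<lambda>s. X s \<omega>) t - X t \<omega>)\<^sup>2) \<le> c * h"
    and "bounded_rv (\<lambda>\<omega>. interpolate h a b (\<lambda>s. X s \<omega>) t)"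
proof -
  let ?u = "(b - t) / h" and ?v = "(t - a) / h"
  have uv: "?u + ?v = 1" "0 \<le> ?u" "0 \<le> ?v" using h t by (auto simp: add_divide_distrib[symmetric])
  have in0: "a \<in> {0..T}" "b \<in> {0..T}" "t \<in> {0..T}" using t by auto
  note bX = X[OF in0(1)] X[OF in0(2)] X[OF in0(3)]
  show "bounded_rv (\<lambda>\<omega>. interpolate h a b (\<lambda>s. X s \<omega>) t)"
    unfolding interpolate_def by (intro bounded_rv_add bounded_rv_mult bounded_rv_const bX)
  have pt: "(interpolate h a b (\<lambda>s. X s \<omega>) t - X t \<omega>)\<^sup>2 \<le> ?u * (X a \<omega> - X t \<omega>)\<^sup>2 + ?v * (X b \<omega> - X t \<omega>)\<^sup>2" for \<omega>
  proof -
    have "interpolate h a b (\<lambda>s. X s \<omega>) t - X t \<omega> = ?u * X a \<omega> + ?v * X b \<omega> - (?u + ?v) * X t \<omega>"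
      unfolding uv by (simp add: interpolate_def)
    also have "\<dots> = ?u * (X a \<omega> - X t \<omega>) + ?v * (X b \<omega> - X t \<omega>)" by (simp add: algebra_simps)
    finally have e: "interpolate h a b (\<lambda>s. X s \<omega>) t - X t \<omega> = ?u * (X a \<omega> - X t \<omega>) + ?v * (X b \<omega> - X t \<omega>)" .
    have conv: "(u * x + v * y)\<^sup>2 \<le> u * x\<^sup>2 + v * y\<^sup>2" if "0 \<le> u" "0 \<le> v" "u + v = 1" for u v x y :: real
      using convex_power_even[of 2] that unfolding convex_on_def by auto
    show ?thesis unfolding e by (rule conv[OF uv(2,3,1)])
  qed
  have i: "integrable M (\<lambda>\<omega>. (X a \<omega> - X t \<omega>)\<^sup>2)" "integrable M (\<lambda>\<omega>. (X b \<omega> - X t \<omega>)\<^sup>2)"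
    using bX by (auto intro!: bounded_rv_integrable bounded_rv_power2 bounded_rv_diff)
  have "expectation (\<lambda>\<omega>. (interpolate h a b (\<lambda>s. X s \<omega>) t - X t \<omega>)\<^sup>2)
      \<le> expectation (\<lambda>\<omega>. ?u * (X a \<omega> - X t \<omega>)\<^sup>2 + ?v * (X b \<omega> - X t \<omega>)\<^sup>2)"
  proof (rule integral_mono)
    show "integrable M (\<lambda>\<omega>. (interpolate h a b (\<lambda>s. X s \<omega>) t - X t \<omega>)\<^sup>2)"
      unfolding interpolate_def
      by (intro bounded_rv_integrable bounded_rv_power2 bounded_rv_diff bounded_rv_add bounded_rv_mult bounded_rv_const bX)
    show "integrable M (\<lambda>\<omega>. ?u * (X a \<omega> - X t \<omega>)\<^sup>2 + ?v * (X b \<omega> - X t \<omega>)\<^sup>2)"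
      by (intro Bochner_Integration.integrable_add integrable_mult_right i)
  qed (rule pt)
  also have "\<dots> = ?u * expectation (\<lambda>\<omega>. (X a \<omega> - X t \<omega>)\<^sup>2) + ?v * expectation (\<lambda>\<omega>. (X b \<omega> - X t \<omega>)\<^sup>2)"
    using i by simp
  also have "\<dots> \<le> ?u * (c * h) + ?v * (c * h)"
  proof (intro add_mono mult_left_mono uv)
    have "c * \<bar>a - t\<bar> \<le> c * h" "c * \<bar>b - t\<bar> \<le> c * h" using c h t by (auto intro!: mult_left_mono)
    then show "expectation (\<lambda>\<omega>. (X a \<omega> - X t \<omega>)\<^sup>2) \<le> c * h" "expectation (\<lambda>\<omega>. (X b \<omega> - X t \<omega>)\<^sup>2) \<le> c * h"
      using incr[OF in0(1,3)] incr[OF in0(2,3)] by linarith+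
  qed
  also have "\<dots> = (?u + ?v) * (c * h)" by (rule distrib_right[symmetric])
  also have "\<dots> = c * h" unfolding uv by simp
  finally show "expectation (\<lambda>\<omega>. (interpolate h a b (\<lambda>s. X s \<omega>) t - X t \<omega>)\<^sup>2) \<le> c * h" .
qed

section \<open>The solution along the Brownian path\<close>

context semilinear
begin

text \<open>The factor 2 stems from the Brownian increment and the clock, which contribute
  equally.\<close>

lemma pdist2_path:
  assumes s: "s \<in> {0..T}" and t: "t \<in> {0..T}"
  shows "has_bochner_integral P (\<lambda>\<omega>. pdist2 d (t, W base t \<omega>) (s, W base s \<omega>)) (2 * (real d)\<^sup>2 * \<bar>t - s\<bar>)"
proof -
  let ?z = "\<lambda>i\<in>{1..d}. 0::real"
  have "vadd d ?z x = x" if "x \<in> Rd d" for x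
    using that by (intro Rd_eqI[of _ d]) (auto simp: vadd_def Rd_def)
  then have "pdist2 d (t, vadd d ?z (W base t \<omega>)) (s, vadd d ?z (W base s \<omega>)) = pdist2 d (t, W base t \<omega>) (s, W base s \<omega>)"
    if "\<omega> \<in> space P" for \<omega>
    using W_in_Rd[OF base_Theta s that] W_in_Rd[OF base_Theta t that] by simp
  then have "has_bochner_integral P (\<lambda>\<omega>. pdist2 d (t, W base t \<omega>) (s, W base s \<omega>))
      (real d * ((\<Sum>i=1..d. (?z i - ?z i)\<^sup>2) + real d * (\<bar>t - s\<bar> + \<bar>t - s\<bar>)))"
    using pdist2_shift_W[OF base_Theta s t, of t ?z s ?z]
    by (subst has_bochner_integral_cong[OF refl _ refl, symmetric]) auto
  then show ?thesis by (simp add: power2_eq_square mult_ac)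
qed

lemma sol_path_bounded_rv: "t \<in> {0..T} \<Longrightarrow> bounded_rv (\<lambda>\<omega>. sol (t, W base t \<omega>))"
proof (rule bounded_rvI[where C=solCu])
  assume t: "t \<in> {0..T}"
  show "(\<lambda>\<omega>. sol (t, W base t \<omega>)) \<in> borel_measurable P"
    by (rule measurable_compose[OF W_measurable_P[OF base_Theta t] sol_section_measurable[OF t]])
  show "\<bar>sol (t, W base t \<omega>)\<bar> \<le> solCu" if "\<omega> \<in> space P" for \<omega> by (rule sol_bound[OF path_in[OF t that]])
qed

lemma sol_path_increment:
  assumes s: "s \<in> {0..T}" and t: "t \<in> {0..T}"
  shows "expectation (\<lambda>\<omega>. (sol (s, W base s \<omega>) - sol (t, W base t \<omega>))\<^sup>2) \<le> solKu * (2 * (real d)\<^sup>2) * \<bar>s - t\<bar>"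
proof -
  note hb = has_bochner_integral_mult_right[OF pdist2_path[OF t s], of solKu]
  have "expectation (\<lambda>\<omega>. (sol (s, W base s \<omega>) - sol (t, W base t \<omega>))\<^sup>2)
    \<le> expectation (\<lambda>\<omega>. solKu * pdist2 d (s, W base s \<omega>) (t, W base t \<omega>))"
  proof (rule integral_mono)
    show "integrable P (\<lambda>\<omega>. (sol (s, W base s \<omega>) - sol (t, W base t \<omega>))\<^sup>2)"
      by (intro bounded_rv_integrable bounded_rv_power2 bounded_rv_diff sol_path_bounded_rv s t)
    show "(sol (s, W base s \<omega>) - sol (t, W base t \<omega>))\<^sup>2 \<le> solKu * pdist2 d (s, W base s \<omega>) (t, W base t \<omega>)"
      if "\<omega> \<in> space P" for \<omega> by (rule sol_Lip[OF path_in[OF s that] path_in[OF t that]])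
  qed (use hb in \<open>simp add: has_bochner_integral_iff\<close>)
  also have "\<dots> = solKu * (2 * (real d)\<^sup>2 * \<bar>s - t\<bar>)" by (rule has_bochner_integral_integral_eq[OF hb])
  finally show ?thesis by (simp add: mult.assoc)
qed

end

section \<open>Error of the interpolated scheme\<close>

context mlp_scheme
begin

definition path_error :: "int list \<Rightarrow> nat \<Rightarrow> real \<Rightarrow> 'a \<Rightarrow> real"
  where "path_error \<theta> n t \<omega> = U \<theta> n (t, W base t \<omega>) \<omega> - sol (t, W base t \<omega>)"

lemma rfield_error: "\<theta> \<in> Theta \<Longrightarrow> rfield (UNIV \<times> desc \<theta>) (\<lambda>p \<omega>. U \<theta> n p \<omega> - sol p)"
  by (intro rfield_diff rfield_U rfield_det[where C=solCu] sol_measurable sol_bound desc_Theta)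

lemma path_measurable: "t \<in> {0..T} \<Longrightarrow> (\<lambda>\<omega>. (t, W base t \<omega>)) \<in> measurable (galg {(False, base)}) E"
  by (intro measurable_timespaceI W_measurable[OF base_Theta]) auto

lemma path_error_bounded_rv:
  assumes \<theta>: "\<theta> \<in> Theta" and t: "t \<in> {0..T}"
  shows "bounded_rv (path_error \<theta> n t)"
proof -
  note V = rfield_error[OF \<theta>, of n]
  obtain C where C: "\<And>p \<omega>. p \<in> space E \<Longrightarrow> \<omega> \<in> space P \<Longrightarrow> \<bar>U \<theta> n p \<omega> - sol p\<bar> \<le> C" using V unfolding rfield_def by blast
  show ?thesis
  proof (rule bounded_rvI)
    show "\<bar>path_error \<theta> n t \<omega>\<bar> \<le> C" if "\<omega> \<in> space P" for \<omega>
      unfolding path_error_def by (rule C[OF path_in[OF t that] that])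
    have "(\<lambda>\<omega>. U \<theta> n (t, W base t \<omega>) \<omega> - sol (t, W base t \<omega>)) \<in> borel_measurable P"
      by (rule rfield_compose[OF V measurable_galg_P[OF _ path_measurable[OF t]] id_galg_P[OF desc_Theta[OF \<theta>]]]) auto
    then show "path_error \<theta> n t \<in> borel_measurable P" by (simp add: path_error_def[abs_def])
  qed
qed

text \<open>The bound of \<open>error_ctl\<close> with the weight at its largest value, at time
  0.\<close>

definition errQ :: "nat \<Rightarrow> real" where "errQ n = errA * errR ^ n / real M ^ n * exp (real M * T)"

lemma errQ_nonneg: "0 \<le> errQ n" using errA_nonneg errR_ge_1 by (simp add: errQ_def)

lemma path_error_bounds:
  assumes \<theta>: "\<theta> \<in> Theta" "base \<notin> desc \<theta>" and s: "s \<in> {0..T}" and t: "t \<in> {0..T}"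
  shows "expectation (\<lambda>\<omega>. (path_error \<theta> n t \<omega>)\<^sup>2) \<le> errQ n"
    and "expectation (\<lambda>\<omega>. (path_error \<theta> n s \<omega> - path_error \<theta> n t \<omega>)\<^sup>2) \<le> errQ n * (2 * (real d)\<^sup>2) * \<bar>s - t\<bar>"
proof -
  define V where "V = (\<lambda>p \<omega>. U \<theta> n p \<omega> - sol p)"
  have V: "rfield (UNIV \<times> desc \<theta>) V" unfolding V_def by (rule rfield_error[OF \<theta>(1)])
  obtain C where C: "\<And>p \<omega>. p \<in> space E \<Longrightarrow> \<omega> \<in> space P \<Longrightarrow> \<bar>V p \<omega>\<bar> \<le> C" using V unfolding rfield_def by blast
  note ctl = error_ctl[OF \<theta>(1), of n, folded V_def]
  have Q: "errA * errR ^ n / real M ^ n * exp (real M * (T - v)) \<le> errQ n" if "v \<in> {0..T}" for v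
    unfolding errQ_def using that errA_nonneg errR_ge_1 by (intro mult_left_mono) (auto intro!: mult_left_mono)
  have c1: "expectation (\<lambda>\<omega>. (V p \<omega>)\<^sup>2) \<le> errQ n" if "p \<in> space E" for p
    using order_trans[OF ms_ctlD(1)[OF ctl that] Q[of "fst p"]] that by (auto simp: space_timespace)
  have c2': "expectation (\<lambda>\<omega>. (V p \<omega> - V q \<omega>)\<^sup>2) \<le> errQ n * pdist2 d p q" if "p \<in> space E" "q \<in> space E" "fst p \<le> fst q" for p q
    using order_trans[OF ms_ctlD(2)[OF ctl that] mult_right_mono[OF Q[of "fst p"] pdist2_nonneg]] that by (auto simp: space_timespace)
  have c2: "expectation (\<lambda>\<omega>. (V p \<omega> - V q \<omega>)\<^sup>2) \<le> errQ n * pdist2 d p q" if "p \<in> space E" "q \<in> space E" for p q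
    using c2'[OF that] c2'[OF that(2,1)] by (cases "fst p \<le> fst q") (auto simp: power2_commute pdist2_commute)
  have ind: "indep_subalg (galg {(False, base)}) (galg (UNIV \<times> desc \<theta>))"
    using \<theta> by (intro indep_subalg_galg desc_Theta) auto
  let ?X = "\<lambda>\<omega>. ((s, W base s \<omega>), (t, W base t \<omega>))"
  have X: "?X \<in> measurable (galg {(False, base)}) (E \<Otimes>\<^sub>M E)" by (intro measurable_Pair path_measurable s t)
  have m1: "(\<lambda>z. (V (snd (fst z)) (snd z))\<^sup>2) \<in> borel_measurable ((E \<Otimes>\<^sub>M E) \<Otimes>\<^sub>M galg (UNIV \<times> desc \<theta>))"
    and m2: "(\<lambda>z. (V (fst (fst z)) (snd z) - V (snd (fst z)) (snd z))\<^sup>2) \<in> borel_measurable ((E \<Otimes>\<^sub>M E) \<Otimes>\<^sub>M galg (UNIV \<times> desc \<theta>))"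
    by (intro borel_measurable_power borel_measurable_diff rfield_compose[OF V]; simp)+
  have b1: "\<bar>(V (snd (fst z)) (snd z))\<^sup>2\<bar> \<le> C\<^sup>2" if "z \<in> space ((E \<Otimes>\<^sub>M E) \<Otimes>\<^sub>M galg (UNIV \<times> desc \<theta>))" for z
    using power_mono[OF C[of "snd (fst z)" "snd z"], of 2] that by (auto simp: space_pair_measure)
  have b2: "\<bar>(V (fst (fst z)) (snd z) - V (snd (fst z)) (snd z))\<^sup>2\<bar> \<le> (C + C)\<^sup>2" if "z \<in> space ((E \<Otimes>\<^sub>M E) \<Otimes>\<^sub>M galg (UNIV \<times> desc \<theta>))" for z
  proof -
    have "\<bar>V (fst (fst z)) (snd z) - V (snd (fst z)) (snd z)\<bar> \<le> C + C"
      using C[of "fst (fst z)" "snd z"] C[of "snd (fst z)" "snd z"] that by (auto simp: space_pair_measure)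
    from power_mono[OF this, of 2] show ?thesis by simp
  qed
  note e1 = expectation_indep_subalg[OF ind X measurable_ident_sets[OF refl] m1 b1, simplified]
  note e2 = expectation_indep_subalg[OF ind X measurable_ident_sets[OF refl] m2 b2, simplified]
  have "expectation (\<lambda>\<omega>. (path_error \<theta> n t \<omega>)\<^sup>2) = expectation (\<lambda>\<omega>'. expectation (\<lambda>\<omega>. (V (t, W base t \<omega>') \<omega>)\<^sup>2))"
    using e1(1) by (simp add: V_def path_error_def)
  also have "\<dots> \<le> expectation (\<lambda>\<omega>'. errQ n)"
    using c1[OF path_in[OF t]] by (intro integral_mono bounded_rv_integrable e1(2)) auto
  finally show "expectation (\<lambda>\<omega>. (path_error \<theta> n t \<omega>)\<^sup>2) \<le> errQ n" by (simp add: prob_space)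
  note hb = has_bochner_integral_mult_right[OF pdist2_path[OF t s], of "errQ n"]
  have "expectation (\<lambda>\<omega>. (path_error \<theta> n s \<omega> - path_error \<theta> n t \<omega>)\<^sup>2)
      = expectation (\<lambda>\<omega>'. expectation (\<lambda>\<omega>. (V (s, W base s \<omega>') \<omega> - V (t, W base t \<omega>') \<omega>)\<^sup>2))"
    using e2(1) by (simp add: V_def path_error_def)
  also have "\<dots> \<le> expectation (\<lambda>\<omega>'. errQ n * pdist2 d (s, W base s \<omega>') (t, W base t \<omega>'))"
    using c2[OF path_in[OF s] path_in[OF t]] hb
    by (intro integral_mono bounded_rv_integrable[OF e2(2)]) (auto simp: has_bochner_integral_iff)
  also have "\<dots> = errQ n * (2 * (real d)\<^sup>2 * \<bar>s - t\<bar>)" by (rule has_bochner_integral_integral_eq[OF hb])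
  finally show "expectation (\<lambda>\<omega>. (path_error \<theta> n s \<omega> - path_error \<theta> n t \<omega>)\<^sup>2) \<le> errQ n * (2 * (real d)\<^sup>2) * \<bar>s - t\<bar>"
    by (simp add: mult.assoc)
qed

text \<open>Chosen to dominate \<open>errA\<close>, \<open>2 * T * errA\<close> and
  \<open>2 * T * solKu\<close>, the constants that occur in the terms of the final error.\<close>

definition errC :: real where "errC = (errA + solKu) * (1 + 2 * T)"

lemma errC_nonneg: "0 \<le> errC"
  using errA_nonneg solKu_nonneg T_pos by (simp add: errC_def)

text \<open>
  The interpolation operators telescope over the levels up to the interpolation error of \<open>sol\<close>.
  In every level the error of \<open>U\<close> has small increments in mean square, so that the difference of two
  interpolations gains the factor \<open>M ^ - l\<close> missing in the accuracy of the level.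
\<close>

theorem interpolated_scheme_error:
  assumes grid: "\<And>k t. t \<in> {0..T} \<Longrightarrow> 0 \<le> fl (M ^ k) t \<and> fl (M ^ k) t \<le> t \<and> t \<le> ce (M ^ k) t \<and> ce (M ^ k) t \<le> T
      \<and> ce (M ^ k) t - fl (M ^ k) t = T / real (M ^ k)"
    and n: "1 \<le> n" and t: "t \<in> {0..T}"
    and YY: "\<And>\<omega>. \<omega> \<in> space P \<Longrightarrow> YY \<omega> = (\<Sum>l<n.
      interpolate (T / real M ^ (l+1)) (fl (M ^ (l+1)) t) (ce (M ^ (l+1)) t) (\<lambda>s. U [int l] (n - l) (s, W base s \<omega>) \<omega>) t
      - indicator {1..} l * interpolate (T / real M ^ l) (fl (M ^ l) t) (ce (M ^ l) t) (\<lambda>s. U [int l] (n - l) (s, W base s \<omega>) \<omega>) t)"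
  shows "expectation (\<lambda>\<omega>. (YY \<omega> - sol (t, W base t \<omega>))\<^sup>2)
      \<le> (real n + 1)\<^sup>2 * (4 * (errC * (real d)\<^sup>2 * errR ^ n * exp (real M * T) / real M ^ n))"
    and "bounded_rv (\<lambda>\<omega>. YY \<omega> - sol (t, W base t \<omega>))"
proof -
  define B where "B = errC * (real d)\<^sup>2 * errR ^ n * exp (real M * T) / real M ^ n"
  define I where "I = (\<lambda>k \<phi>. interpolate (T / real M ^ k) (fl (M ^ k) t) (ce (M ^ k) t) \<phi> t)"
  define u where "u = (\<lambda>s \<omega>. sol (s, W base s \<omega>))"
  define V where "V = (\<lambda>l. path_error [int l] (n - l))"
  \<comment> \<open>The terms for \<open>l < n\<close> are interpolation errors of the field errors
    \<open>V l\<close>; subtracting \<open>V l t\<close> is free for \<open>l \<ge> 1\<close>, as it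
    cancels between the two interpolations. The term \<open>l = n\<close> collects what remains
    after telescoping: the error of \<open>U [0] n\<close> at \<open>t\<close> itself and the error
    of interpolating \<open>sol\<close> on the finest grid.\<close>
  define X where "X = (\<lambda>l \<omega>. if l < n then (I (Suc l) (\<lambda>s. V l s \<omega>) - V l t \<omega>) - indicator {1..} l * (I l (\<lambda>s. V l s \<omega>) - V l t \<omega>)
      else V 0 t \<omega> + (I n (\<lambda>s. u s \<omega>) - u t \<omega>))"
  have M1: "1 \<le> real M" using M_pos by simp
  have h: "0 < T / real M ^ k" for k using M1 T_pos by simp
  have g: "0 \<le> fl (M ^ k) t" "fl (M ^ k) t \<le> t" "t \<le> ce (M ^ k) t" "ce (M ^ k) t \<le> T" "ce (M ^ k) t - fl (M ^ k) t = T / real M ^ k" for k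
    using grid[OF t, of k] by auto
  have d1: "1 \<le> (real d)\<^sup>2" using d_pos by simp
  have \<theta>: "[int l] \<in> Theta" "base \<notin> desc [int l]" for l by (auto simp: Theta_def desc_def base_def)
  have Vb: "bounded_rv (V l s)" if "s \<in> {0..T}" for l s unfolding V_def by (rule path_error_bounded_rv[OF \<theta>(1) that])
  have c0: "0 \<le> errQ (n - l) * (2 * (real d)\<^sup>2)" for l using errQ_nonneg[of "n - l"] by simp
  have V1: "expectation (\<lambda>\<omega>. (V l t \<omega>)\<^sup>2) \<le> errQ (n - l)" for l unfolding V_def by (rule path_error_bounds(1)[OF \<theta> t t])
  have Vinc: "expectation (\<lambda>\<omega>. (V l s \<omega> - V l t \<omega>)\<^sup>2) \<le> errQ (n - l) * (2 * (real d)\<^sup>2) * \<bar>s - t\<bar>"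
    if "s \<in> {0..T}" "t \<in> {0..T}" for l s t
    unfolding V_def by (rule path_error_bounds(2)[OF \<theta> that])
  have VI: "expectation (\<lambda>\<omega>. (I k (\<lambda>s. V l s \<omega>) - V l t \<omega>)\<^sup>2) \<le> errQ (n - l) * (2 * (real d)\<^sup>2) * (T / real M ^ k)" for k l
    unfolding I_def by (rule interpolate_error(1)[OF Vb Vinc h g(5) g(2) g(3) g(1) g(4) c0])
  have VIb: "bounded_rv (\<lambda>\<omega>. I k (\<lambda>s. V l s \<omega>))" for k l
    unfolding I_def by (rule interpolate_error(2)[OF Vb Vinc h g(5) g(2) g(3) g(1) g(4) c0])
  have c0': "0 \<le> solKu * (2 * (real d)\<^sup>2)" using solKu_nonneg by simp
  have uI: "expectation (\<lambda>\<omega>. (I n (\<lambda>s. u s \<omega>) - u t \<omega>)\<^sup>2) \<le> solKu * (2 * (real d)\<^sup>2) * (T / real M ^ n)"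
    unfolding I_def u_def by (rule interpolate_error(1)[OF sol_path_bounded_rv sol_path_increment h g(5) g(2) g(3) g(1) g(4) c0'])
  have uIb: "bounded_rv (\<lambda>\<omega>. I n (\<lambda>s. u s \<omega>))"
    unfolding I_def u_def by (rule interpolate_error(2)[OF sol_path_bounded_rv sol_path_increment h g(5) g(2) g(3) g(1) g(4) c0'])
  have ub: "bounded_rv (u t)" unfolding u_def using sol_path_bounded_rv[OF t] .
  have R0: "0 \<le> errA * errR ^ m" "1 \<le> errR ^ m" for m using errA_nonneg errR_ge_1 by auto
  have e1: "1 \<le> exp (real M * T)" using T_pos by simp
  \<comment> \<open>The accuracy \<open>1 / M ^ (n - l)\<close> of the field and the mesh
    \<open>T / M ^ k\<close> with \<open>l \<le> k\<close> combine to the order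
    \<open>1 / M ^ n\<close>. Level \<open>l\<close> is interpolated with \<open>k = l\<close> and
    \<open>k = l + 1\<close>.\<close>
  have main1: "errQ (n - l) * (2 * (real d)\<^sup>2) * (T / real M ^ k) \<le> B" if "l \<le> k" "l \<le> n" for k l
  proof -
    have "real M ^ n = real M ^ (n - l) * real M ^ l" using that by (simp add: power_add[symmetric])
    also have "\<dots> \<le> real M ^ (n - l) * real M ^ k" using that M1 by (intro mult_left_mono power_increasing) auto
    finally have Mle: "real M ^ n \<le> real M ^ (n - l) * real M ^ k" .
    have "errQ (n - l) * (2 * (real d)\<^sup>2) * (T / real M ^ k)
        = (errA * errR ^ (n - l) * exp (real M * T) * (2 * (real d)\<^sup>2) * T) / (real M ^ (n - l) * real M ^ k)"
      by (simp add: errQ_def)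
    also have "\<dots> \<le> (errA * errR ^ (n - l) * exp (real M * T) * (2 * (real d)\<^sup>2) * T) / real M ^ n"
      using Mle M1 R0 T_pos by (intro divide_left_mono) auto
    also have "\<dots> \<le> B"
      unfolding B_def
    proof (intro divide_right_mono)
      have "errA * errR ^ (n - l) * exp (real M * T) * (2 * (real d)\<^sup>2) * T = (errA * (2 * T)) * ((real d)\<^sup>2 * errR ^ (n - l) * exp (real M * T))"
        by simp
      also have "\<dots> \<le> errC * ((real d)\<^sup>2 * errR ^ n * exp (real M * T))"
      proof (intro mult_mono)
        show "errA * (2 * T) \<le> errC" unfolding errC_def
          using errA_nonneg solKu_nonneg T_pos by (intro mult_mono) auto
        show "errR ^ (n - l) \<le> errR ^ n" using errR_ge_1 by (intro power_increasing) auto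
      qed (use errC_nonneg errR_ge_1 in auto)
      finally show "errA * errR ^ (n - l) * exp (real M * T) * (2 * (real d)\<^sup>2) * T \<le> errC * (real d)\<^sup>2 * errR ^ n * exp (real M * T)"
        by (simp add: mult.assoc)
    qed (use M1 in auto)
    finally show ?thesis .
  qed
  have main2: "errQ n \<le> B"
  proof -
    have "errA * 1 * (errR ^ n * exp (real M * T)) \<le> errC * (real d)\<^sup>2 * (errR ^ n * exp (real M * T))"
    proof (intro mult_right_mono mult_mono d1)
      have "errA * 1 \<le> (errA + solKu) * (1 + 2 * T)"
        using errA_nonneg solKu_nonneg T_pos by (intro mult_mono) auto
      then show "errA \<le> errC" by (simp add: errC_def)
    qed (use errC_nonneg errR_ge_1 in auto)
    then have "errA * errR ^ n * exp (real M * T) / real M ^ n \<le> B"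
      unfolding B_def using M1 by (intro divide_right_mono) (auto simp: mult.assoc)
    then show ?thesis by (simp add: errQ_def)
  qed
  have main3: "solKu * (2 * (real d)\<^sup>2) * (T / real M ^ n) \<le> B"
  proof -
    have "solKu * (2 * T) * (real d)\<^sup>2 * 1 \<le> errC * (real d)\<^sup>2 * (errR ^ n * exp (real M * T))"
    proof (intro mult_mono)
      show "solKu * (2 * T) \<le> errC" unfolding errC_def
        using errA_nonneg solKu_nonneg T_pos by (intro mult_mono) auto
      show "1 \<le> errR ^ n * exp (real M * T)"
        using mult_mono[OF R0(2)[of n] e1] errR_ge_1 by simp
    qed (use errC_nonneg errR_ge_1 in auto)
    then have "solKu * (2 * T) * (real d)\<^sup>2 / real M ^ n \<le> B"
      unfolding B_def using M1 by (intro divide_right_mono) (auto simp: mult.assoc)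
    then show ?thesis by (simp add: mult_ac)
  qed
  have B0: "0 \<le> B" unfolding B_def using errC_nonneg errR_ge_1 by simp
  have four: "expectation (\<lambda>\<omega>. (Z \<omega>)\<^sup>2) \<le> 4 * B"
    if "bounded_rv A" "bounded_rv D" "\<And>\<omega>. \<bar>Z \<omega>\<bar> \<le> \<bar>A \<omega>\<bar> + \<bar>D \<omega>\<bar>" "expectation (\<lambda>\<omega>. (A \<omega>)\<^sup>2) \<le> B" "expectation (\<lambda>\<omega>. (D \<omega>)\<^sup>2) \<le> B"
    for A D Z :: "'a \<Rightarrow> real"
    using expectation_square_add_le[OF that(1,2), of Z] that(3-5) by simp
  have Xb: "bounded_rv (X l)" for l
    unfolding X_def using VIb uIb ub Vb[OF t] by (cases "l < n") (auto intro!: bounded_rv_add bounded_rv_diff bounded_rv_mult)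
  have XB: "expectation (\<lambda>\<omega>. (X l \<omega>)\<^sup>2) \<le> 4 * B" if "l \<le> n" for l
  proof (cases "l < n")
    case True
    let ?A = "\<lambda>\<omega>. I (Suc l) (\<lambda>s. V l s \<omega>) - V l t \<omega>" and ?D = "\<lambda>\<omega>. I l (\<lambda>s. V l s \<omega>) - V l t \<omega>"
    show ?thesis
    proof (rule four[of ?A ?D])
      show "bounded_rv ?A" "bounded_rv ?D" using VIb Vb[OF t] by auto
      show "\<bar>X l \<omega>\<bar> \<le> \<bar>?A \<omega>\<bar> + \<bar>?D \<omega>\<bar>" for \<omega> using True by (auto simp: X_def indicator_def)
      show "expectation (\<lambda>\<omega>. (?A \<omega>)\<^sup>2) \<le> B" "expectation (\<lambda>\<omega>. (?D \<omega>)\<^sup>2) \<le> B"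
        using order_trans[OF VI main1] True by auto
    qed
  next
    case False
    let ?D = "\<lambda>\<omega>. I n (\<lambda>s. u s \<omega>) - u t \<omega>"
    show ?thesis
    proof (rule four[of "V 0 t" ?D])
      show "bounded_rv (V 0 t)" "bounded_rv ?D" using Vb[OF t] uIb ub by auto
      show "\<bar>X l \<omega>\<bar> \<le> \<bar>V 0 t \<omega>\<bar> + \<bar>?D \<omega>\<bar>" for \<omega> using False by (auto simp: X_def)
      show "expectation (\<lambda>\<omega>. (V 0 t \<omega>)\<^sup>2) \<le> B" using order_trans[OF V1[of 0]] main2 by simp
      show "expectation (\<lambda>\<omega>. (?D \<omega>)\<^sup>2) \<le> B" by (rule order_trans[OF uI main3])
    qed
  qed
  have eq: "YY \<omega> - sol (t, W base t \<omega>) = (\<Sum>l\<in>{..n}. X l \<omega>)" if \<omega>: "\<omega> \<in> space P" for \<omega>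
  proof -
    have Idiff: "I k (\<lambda>s. V l s \<omega>) = I k (\<lambda>s. U [int l] (n - l) (s, W base s \<omega>) \<omega>) - I k (\<lambda>s. u s \<omega>)" for k l
      unfolding I_def V_def path_error_def u_def by (rule interpolate_diff)
    \<comment> \<open>The subtracted interpolation is absent for \<open>l = 0\<close>, so the
      telescoping sum has no lower boundary term.\<close>
    have tel: "(\<Sum>l<n. I (Suc l) (\<lambda>s. u s \<omega>) - indicator {1..} l * I l (\<lambda>s. u s \<omega>)) = I n (\<lambda>s. u s \<omega>)" if "1 \<le> n" for n
      using that
    proof (induction n rule: dec_induct)
      case (step n) then show ?case by simp
    qed simp
    have Vt: "(\<Sum>l<n. V l t \<omega> - indicator {1..} l * V l t \<omega>) = V 0 t \<omega>" if "1 \<le> n" for n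
      using that
    proof (induction n rule: dec_induct)
      case (step n) then show ?case by simp
    qed simp
    have "(\<Sum>l\<in>{..n}. X l \<omega>) = (\<Sum>l<n. X l \<omega>) + (V 0 t \<omega> + (I n (\<lambda>s. u s \<omega>) - u t \<omega>))"
      unfolding lessThan_Suc_atMost[symmetric] by (simp add: X_def)
    also have "(\<Sum>l<n. X l \<omega>) = (\<Sum>l<n. (I (Suc l) (\<lambda>s. U [int l] (n - l) (s, W base s \<omega>) \<omega>) - indicator {1..} l * I l (\<lambda>s. U [int l] (n - l) (s, W base s \<omega>) \<omega>))
        - (I (Suc l) (\<lambda>s. u s \<omega>) - indicator {1..} l * I l (\<lambda>s. u s \<omega>)) - (V l t \<omega> - indicator {1..} l * V l t \<omega>))"
      by (intro sum.cong refl) (simp add: X_def Idiff algebra_simps)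
    also have "\<dots> = YY \<omega> - I n (\<lambda>s. u s \<omega>) - V 0 t \<omega>"
      unfolding sum_subtractf[of _ _ "{..<n}"] tel[OF n] Vt[OF n] YY[OF \<omega>]
      using tel[OF n] Vt[OF n] by (simp add: I_def sum_subtractf)
    finally show ?thesis by (simp add: u_def)
  qed
  have "expectation (\<lambda>\<omega>. (YY \<omega> - sol (t, W base t \<omega>))\<^sup>2) = expectation (\<lambda>\<omega>. (\<Sum>l\<in>{..n}. X l \<omega>)\<^sup>2)"
    by (intro Bochner_Integration.integral_cong refl) (simp add: eq)
  also have "\<dots> \<le> (real (card {..n}))\<^sup>2 * (4 * B)"
    by (rule expectation_power2_sum_le) (use Xb XB in auto)
  finally show "expectation (\<lambda>\<omega>. (YY \<omega> - sol (t, W base t \<omega>))\<^sup>2)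
      \<le> (real n + 1)\<^sup>2 * (4 * (errC * (real d)\<^sup>2 * errR ^ n * exp (real M * T) / real M ^ n))"
    by (simp add: B_def add.commute)
  have "bounded_rv (\<lambda>\<omega>. \<Sum>l\<in>{..n}. X l \<omega>)" by (intro bounded_rv_sum Xb)
  then show "bounded_rv (\<lambda>\<omega>. YY \<omega> - sol (t, W base t \<omega>))"
    unfolding bounded_rv_def by (subst measurable_cong[where g="\<lambda>\<omega>. \<Sum>l\<in>{..n}. X l \<omega>"]) (auto simp: eq)
qed

end

section \<open>Computational cost and choice of parameters\<close>

text \<open>Each level costs at most \<open>M ^ n * (3 * d + 8 * d * 5 ^ l)\<close>, as both lower
  costs are bounded by the claim at level \<open>l\<close>. The base 5 makes the geometric sum of
  \<open>8 * 5 ^ l\<close> equal to \<open>2 * 5 ^ n - 2\<close>, which leaves room for the part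
  that is linear in \<open>n\<close>.\<close>

lemma scheme_cost_bound:
  fixes C :: "int \<Rightarrow> int \<Rightarrow> int \<Rightarrow> nat"
  assumes C: "\<And>n. C (int d) (int n) (int M) \<le> (d + 1) * M ^ n * indicator {1..} n
          + (\<Sum>l<n. M ^ (n - l) * (2 + d + C (int d) (int l) (int M) + C (int d) (int l - 1) (int M) * indicator {1..} l))"
    and d: "1 \<le> d" and M: "1 \<le> M"
  shows "C (int d) (int n) (int M) \<le> 4 * d * 5 ^ n * M ^ n"
proof (induction n rule: less_induct)
  case (less n)
  show ?case
  proof (cases "n = 0")
    case True then show ?thesis using C[of 0] by simp
  next
    case False
    have "(\<Sum>l<n. M ^ (n - l) * (2 + d + C (int d) (int l) (int M) + C (int d) (int l - 1) (int M) * indicator {1..} l))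
        \<le> (\<Sum>l<n. M ^ n * (3 * d + 8 * d * 5 ^ l))"
    proof (rule sum_mono)
      fix l assume l: "l \<in> {..<n}"
      have 1: "C (int d) (int l) (int M) \<le> 4 * d * 5 ^ l * M ^ l" using less l by simp
      have 2: "C (int d) (int l - 1) (int M) * indicator {1..} l \<le> 4 * d * 5 ^ l * M ^ l"
      proof (cases l)
        case (Suc k)
        have "C (int d) (int k) (int M) \<le> 4 * d * 5 ^ k * M ^ k" using less l Suc by simp
        also have "\<dots> \<le> 4 * d * 5 ^ l * M ^ l"
          using M Suc by (intro mult_mono power_increasing) auto
        finally show ?thesis by (simp add: Suc)
      qed simp
      have 3: "2 + d \<le> 3 * d * M ^ l"
      proof -
        have "2 + d \<le> 3 * d * 1" using d by simp
        also have "\<dots> \<le> 3 * d * M ^ l" using M by (intro mult_le_mono2) simp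
        finally show ?thesis .
      qed
      have "M ^ (n - l) * (2 + d + C (int d) (int l) (int M) + C (int d) (int l - 1) (int M) * indicator {1..} l)
          \<le> M ^ (n - l) * (3 * d * M ^ l + 4 * d * 5 ^ l * M ^ l + 4 * d * 5 ^ l * M ^ l)"
        using 1 2 3 by (intro mult_le_mono2 add_mono)
      also have "\<dots> = (M ^ (n - l) * M ^ l) * (3 * d + 8 * d * 5 ^ l)" by (simp add: algebra_simps)
      also have "M ^ (n - l) * M ^ l = M ^ n" using l by (simp add: power_add[symmetric])
      finally show "M ^ (n - l) * (2 + d + C (int d) (int l) (int M) + C (int d) (int l - 1) (int M) * indicator {1..} l)
          \<le> M ^ n * (3 * d + 8 * d * 5 ^ l)" .
    qed
    also have "\<dots> = M ^ n * (3 * d * n + d * (\<Sum>l<n. 8 * 5 ^ l))"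
      by (simp add: sum_distrib_left[symmetric] sum.distrib distrib_left mult_ac)
    finally have "C (int d) (int n) (int M) \<le> (d + 1) * M ^ n + M ^ n * (3 * d * n + d * (\<Sum>l<n. 8 * 5 ^ l))"
      using C[of n] False by simp
    also have "\<dots> \<le> (2 * d) * M ^ n + M ^ n * (3 * d * n + d * (\<Sum>l<n. 8 * 5 ^ l))"
      using d by (intro add_right_mono mult_le_mono1) simp
    also have "\<dots> = M ^ n * (d * (3 * n + ((\<Sum>l<n. 8 * 5 ^ l) + 2)))" by (simp add: algebra_simps)
    also have "(\<Sum>l<n. 8 * 5 ^ l) + 2 = 2 * (5::nat) ^ n" by (induction n) auto
    also have "3 * n + 2 * (5::nat) ^ n \<le> 4 * 5 ^ n"
    proof -
      have "3 * n \<le> 2 * (5::nat) ^ n"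
      proof (induction n)
        case (Suc n)
        have "1 \<le> (5::nat) ^ n" by simp
        then show ?case using Suc unfolding power_Suc mult_Suc_right by linarith
      qed simp
      then show ?thesis by simp
    qed
    finally show ?thesis by (simp add: mult_ac)
  qed
qed

text \<open>With \<open>n = M\<close> there are \<open>M\<close> levels, each of cost at most
  \<open>8 * d * 5 ^ M * (M * M ^ M)\<close>. The factor \<open>M * M\<close> is bounded by
  \<open>4 ^ M\<close>, whence the base 20. The term outside the sum adds 4 to the constant
  8.\<close>

lemma total_cost_bound:
  fixes C CC :: "int \<Rightarrow> int \<Rightarrow> int \<Rightarrow> nat"
  assumes C: "\<And>n. C (int d) (int n) (int M) \<le> 4 * d * 5 ^ n * M ^ n"
    and CC: "CC (int d) (int M) (int M) \<le> (d + 1) * (M ^ M + 1) + (\<Sum>l<M. (M ^ (l+1) + 1) * C (int d) (int (M - l)) (int M))"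
    and d: "1 \<le> d" and M: "1 \<le> M"
  shows "CC (int d) (int M) (int M) \<le> 12 * d * 20 ^ M * M ^ M"
proof -
  have MM: "1 \<le> M ^ M" using M by simp
  have "(\<Sum>l<M. (M ^ (l+1) + 1) * C (int d) (int (M - l)) (int M)) \<le> (\<Sum>l<M. 8 * d * 5 ^ M * (M * M ^ M))"
  proof (rule sum_mono)
    fix l assume l: "l \<in> {..<M}"
    have "(M ^ (l+1) + 1) * C (int d) (int (M - l)) (int M) \<le> (2 * M ^ (l+1)) * (4 * d * 5 ^ M * M ^ (M - l))"
    proof (rule mult_le_mono)
      show "M ^ (l+1) + 1 \<le> 2 * M ^ (l+1)" using M by simp
      have "4 * d * 5 ^ (M - l) * M ^ (M - l) \<le> 4 * d * 5 ^ M * M ^ (M - l)"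
        by (intro mult_le_mono order_refl power_increasing) auto
      then show "C (int d) (int (M - l)) (int M) \<le> 4 * d * 5 ^ M * M ^ (M - l)" using C[of "M - l"] by linarith
    qed
    also have "\<dots> = 8 * d * 5 ^ M * (M * (M ^ l * M ^ (M - l)))" by (simp add: mult_ac)
    also have "M ^ l * M ^ (M - l) = M ^ M" using l by (simp add: power_add[symmetric])
    finally show "(M ^ (l+1) + 1) * C (int d) (int (M - l)) (int M) \<le> 8 * d * 5 ^ M * (M * M ^ M)" .
  qed
  also have "\<dots> = 8 * d * 5 ^ M * ((M * M) * M ^ M)" by simp
  also have "\<dots> \<le> 8 * d * 5 ^ M * (4 ^ M * M ^ M)"
  proof (intro mult_le_mono order_refl)
    have "M * M \<le> 2 ^ M * 2 ^ M" by (intro mult_le_mono less_imp_le less_exp)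
    also have "\<dots> = 4 ^ M" by (simp add: power_mult_distrib[symmetric])
    finally show "M * M \<le> 4 ^ M" .
  qed
  also have "\<dots> = 8 * d * 20 ^ M * M ^ M"
  proof -
    have "(20::nat) ^ M = 5 ^ M * 4 ^ M" by (simp flip: power_mult_distrib)
    then show ?thesis by (simp add: mult_ac)
  qed
  finally have 1: "(\<Sum>l<M. (M ^ (l+1) + 1) * C (int d) (int (M - l)) (int M)) \<le> 8 * d * 20 ^ M * M ^ M" .
  have "(d + 1) * (M ^ M + 1) \<le> (2 * d) * (2 * M ^ M)" using d MM by (intro mult_le_mono) auto
  also have "\<dots> = 4 * d * 1 * M ^ M" by simp
  also have "\<dots> \<le> 4 * d * 20 ^ M * M ^ M" by (intro mult_le_mono order_refl) auto
  finally have "(d + 1) * (M ^ M + 1) \<le> 4 * d * 20 ^ M * M ^ M" .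
  then show ?thesis using CC 1 by linarith
qed

text \<open>Compares the cost at \<open>m + 1\<close> with the inverse squared error at
  \<open>m\<close>. The exponential factors together form \<open>b ^ m\<close>, and
  \<open>b \<le> m powr q\<close> from \<open>m0\<close> on, so an arbitrarily small power of
  \<open>m ^ m\<close> absorbs them; smaller \<open>m\<close> are covered by the constant.\<close>

lemma superexponential_bound:
  fixes S R q :: real
  assumes S: "1 \<le> S" and R: "1 \<le> R" and q: "0 < q"
  shows "\<exists>K\<ge>0. \<forall>m\<ge>1. S ^ Suc m * real (Suc m) ^ Suc m \<le> K * (real m ^ m / R ^ m) powr (1 + q)"
proof -
  \<comment> \<open>The factor 4 comes from
    \<open>(m + 1) ^ (m + 1) \<le> 4 ^ (m + 1) * m ^ m\<close>, \<open>S\<close> from the cost and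
    \<open>R powr (1 + q)\<close> from the error.\<close>
  define b where "b = 4 * S * R powr (1 + q)"
  define b' where "b' = max 1 b"
  define m0 where "m0 = nat \<lceil>b powr (1 / q)\<rceil>"
  have b0: "0 < b" using S R by (simp add: b_def)
  have key: "b ^ m \<le> b' ^ m0 * real m powr (q * real m)" if m: "1 \<le> m" for m :: nat
  proof (cases "m0 \<le> m")
    case True
    then have "b powr (1 / q) \<le> real m" unfolding m0_def by linarith
    then have "(b powr (1 / q)) powr q \<le> real m powr q" using q b0 by (intro powr_mono2) auto
    then have "b \<le> real m powr q" using q b0 by (simp add: powr_powr)
    then have "b ^ m \<le> (real m powr q) ^ m" using b0 by (intro power_mono) auto
    also have "\<dots> = 1 * real m powr (q * real m)" using m by (simp add: powr_realpow[symmetric] powr_powr)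
    also have "\<dots> \<le> b' ^ m0 * real m powr (q * real m)"
      by (intro mult_right_mono one_le_power) (auto simp: b'_def)
    finally show ?thesis .
  next
    case False
    have "b ^ m \<le> b' ^ m" using b0 by (intro power_mono) (auto simp: b'_def)
    also have "\<dots> \<le> b' ^ m0 * 1" using False by (simp add: b'_def power_increasing)
    also have "\<dots> \<le> b' ^ m0 * real m powr (q * real m)"
      using m q by (intro mult_left_mono ge_one_powr_ge_zero) (auto simp: b'_def)
    finally show ?thesis .
  qed
  have "S ^ Suc m * real (Suc m) ^ Suc m \<le> (4 * S * b' ^ m0) * (real m ^ m / R ^ m) powr (1 + q)" if m: "1 \<le> m" for m
  proof -
    have mm: "0 < real m ^ m" using m by simp
    have "real (Suc m) ^ Suc m \<le> (2 * real m) ^ Suc m" using m by (intro power_mono) auto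
    also have "\<dots> = 2 ^ Suc m * real m * real m ^ m" by (simp add: power_mult_distrib)
    also have "\<dots> \<le> 2 ^ Suc m * 2 ^ Suc m * real m ^ m"
    proof (intro mult_right_mono mult_left_mono)
      have "real m < 2 ^ m" by (rule of_nat_less_two_power)
      also have "\<dots> \<le> 2 ^ Suc m" by simp
      finally show "real m \<le> 2 ^ Suc m" by simp
    qed auto
    also have "2 ^ Suc m * 2 ^ Suc m = (4::real) ^ Suc m" by (simp add: power_mult_distrib[symmetric])
    finally have "S ^ Suc m * real (Suc m) ^ Suc m \<le> S ^ Suc m * (4 ^ Suc m * real m ^ m)"
      using S by (intro mult_left_mono) auto
    also have "\<dots> = 4 * S * ((4 * S) ^ m * real m ^ m)" by (simp add: power_mult_distrib)
    also have "(4 * S) ^ m * real m ^ m = b ^ m * real m ^ m / R powr ((1 + q) * real m)"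
      using R by (simp add: b_def power_mult_distrib powr_realpow[symmetric] powr_powr)
    also have "\<dots> \<le> (b' ^ m0 * real m powr (q * real m)) * real m ^ m / R powr ((1 + q) * real m)"
      using key[OF m] by (intro divide_right_mono mult_right_mono) auto
    also have "\<dots> = b' ^ m0 * (real m ^ m / R ^ m) powr (1 + q)"
    proof -
      have "(real m ^ m) powr (1 + q) = real m powr (real m * (1 + q))"
        using m by (simp add: powr_realpow[symmetric] powr_powr)
      also have "\<dots> = real m powr (q * real m) * real m ^ m"
        using m by (simp add: distrib_left powr_add powr_realpow mult_ac)
      finally have "(real m ^ m) powr (1 + q) = real m powr (q * real m) * real m ^ m" .
      moreover have "(R ^ m) powr (1 + q) = R powr ((1 + q) * real m)"
        using R by (simp add: powr_realpow[symmetric] powr_powr mult.commute)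
      ultimately show ?thesis using mm R by (simp add: powr_divide)
    qed
    finally show ?thesis using S by (simp add: mult_left_mono mult.assoc)
  qed
  moreover have "0 \<le> 4 * S * b' ^ m0" using S by (simp add: b'_def)
  ultimately show ?thesis by blast
qed

text \<open>\<open>N\<close> is the least parameter with the required accuracy. Its predecessor
  \<open>m\<close> fails, so \<open>m ^ m / R ^ m \<le> A * d\<^sup>2 / \<epsilon>\<^sup>2\<close>,
  and the cost at \<open>N\<close> is bounded by the power \<open>1 + \<delta> / 2\<close> of the
  left side.\<close>

lemma parameter_choice:
  fixes A R S \<delta> :: real
  assumes A: "1 \<le> A" and R: "1 \<le> R" and S: "1 \<le> S" and \<delta>: "0 < \<delta>"
  shows "\<exists>(c::real) (N :: nat \<Rightarrow> real \<Rightarrow> nat). 0 \<le> c \<and> (\<forall>d\<ge>1. \<forall>\<epsilon>\<in>{0<..1}. 1 \<le> N d \<epsilon> \<and>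
    A * (real d)\<^sup>2 * R ^ N d \<epsilon> / real (N d \<epsilon>) ^ N d \<epsilon> \<le> \<epsilon>\<^sup>2 \<and>
    real d * S ^ N d \<epsilon> * real (N d \<epsilon>) ^ N d \<epsilon> \<le> c * real d powr c * \<epsilon> powr (- (2 + \<delta>)))"
proof -
  \<comment> \<open>Halved because the accuracy enters as a square: the power \<open>1 + q\<close>
    of \<open>\<epsilon>\<^sup>2\<close> is the power \<open>2 + \<delta>\<close> of
    \<open>\<epsilon>\<close>.\<close>
  define q where "q = \<delta> / 2"
  have q: "0 < q" using \<delta> by (simp add: q_def)
  obtain K where K: "0 \<le> K" and Kle: "\<And>m. 1 \<le> m \<Longrightarrow> S ^ Suc m * real (Suc m) ^ Suc m \<le> K * (real m ^ m / R ^ m) powr (1 + q)"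
    using superexponential_bound[OF S R q] by blast
  define good where "good = (\<lambda>d \<epsilon> n. 1 \<le> n \<and> A * (real d)\<^sup>2 * R ^ n / real n ^ n \<le> \<epsilon>\<^sup>2)"
  define N where "N = (\<lambda>d \<epsilon>. LEAST n. good d \<epsilon> n)"
  \<comment> \<open>One constant for the prefactor and the exponent: \<open>S\<close> covers
    \<open>N = 1\<close>, where there is no predecessor to compare with, and
    \<open>3 + \<delta>\<close> is the exponent in \<open>d * d powr (2 + \<delta>)\<close>.\<close>
  define c where "c = max S (max (K * A powr (1 + q)) (3 + \<delta>))"
  have c: "S \<le> c" "K * A powr (1 + q) \<le> c" "3 + \<delta> \<le> c" "1 \<le> c" using \<delta> by (auto simp: c_def)
  have main: "1 \<le> N d \<epsilon> \<and> A * (real d)\<^sup>2 * R ^ N d \<epsilon> / real (N d \<epsilon>) ^ N d \<epsilon> \<le> \<epsilon>\<^sup>2 \<and>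
    real d * S ^ N d \<epsilon> * real (N d \<epsilon>) ^ N d \<epsilon> \<le> c * real d powr c * \<epsilon> powr (- (2 + \<delta>))"
    if d: "1 \<le> d" and \<epsilon>: "\<epsilon> \<in> {0<..1}" for d \<epsilon>
  proof -
    have ex: "\<exists>n. good d \<epsilon> n"
    proof -
      have "(\<lambda>n. A * (real d)\<^sup>2 * (1 / 2) ^ n) \<longlonglongrightarrow> A * (real d)\<^sup>2 * 0"
        by (intro tendsto_intros LIMSEQ_power_zero) auto
      then have "\<forall>\<^sub>F n in sequentially. A * (real d)\<^sup>2 * (1 / 2) ^ n < \<epsilon>\<^sup>2"
        using \<epsilon> by (intro order_tendstoD(2)) auto
      moreover have "\<forall>\<^sub>F n in sequentially. 2 * R \<le> real n"
        using filterlim_real_sequentially unfolding filterlim_at_top by blast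
      ultimately have "\<forall>\<^sub>F n in sequentially. A * (real d)\<^sup>2 * (1 / 2) ^ n < \<epsilon>\<^sup>2 \<and> 2 * R \<le> real n"
        by (rule eventually_conj)
      then obtain n where n: "A * (real d)\<^sup>2 * (1 / 2) ^ n < \<epsilon>\<^sup>2" "2 * R \<le> real n"
        using eventually_happens[of _ sequentially] by auto
      have n0: "0 < real n" using n(2) R by linarith
      have "(R / real n) ^ n \<le> (1 / 2) ^ n" using n R n0 by (intro power_mono) (auto simp: field_simps)
      then have "A * (real d)\<^sup>2 * (R / real n) ^ n \<le> A * (real d)\<^sup>2 * (1 / 2) ^ n"
        using A by (intro mult_left_mono) auto
      then have "good d \<epsilon> n" using n n0 by (simp add: good_def power_divide)
      then show ?thesis ..
    qed
    then have gN: "good d \<epsilon> (N d \<epsilon>)" unfolding N_def by (rule LeastI_ex)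
    have d1: "1 \<le> real d" using d by simp
    have e1: "1 \<le> \<epsilon> powr (- (2 + \<delta>))"
    proof -
      have "\<epsilon> powr (2 + \<delta>) \<le> 1" using \<epsilon> \<delta> by (intro powr_le1) auto
      then show ?thesis using \<epsilon> unfolding powr_minus by (simp add: one_le_inverse_iff)
    qed
    have "real d * S ^ N d \<epsilon> * real (N d \<epsilon>) ^ N d \<epsilon> \<le> c * real d powr c * \<epsilon> powr (- (2 + \<delta>))"
    proof (cases "N d \<epsilon> = 1")
      case True
      have "real d * S ^ N d \<epsilon> * real (N d \<epsilon>) ^ N d \<epsilon> = S * real d powr 1 * 1" using True d1 by simp
      also have "\<dots> \<le> c * real d powr c * \<epsilon> powr (- (2 + \<delta>))"
        using c S d1 e1 by (intro mult_mono powr_mono) auto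
      finally show ?thesis .
    next
      case False
      then obtain m where m: "N d \<epsilon> = Suc m" "1 \<le> m" using gN by (cases "N d \<epsilon>") (auto simp: good_def)
      have "\<not> good d \<epsilon> m" using not_less_Least[of m "good d \<epsilon>"] m by (simp add: N_def)
      then have "\<epsilon>\<^sup>2 < A * (real d)\<^sup>2 * R ^ m / real m ^ m" using m by (simp add: good_def)
      then have X: "real m ^ m / R ^ m \<le> A * (real d)\<^sup>2 / \<epsilon>\<^sup>2"
        using m \<epsilon> R by (simp add: field_simps)
      have "S ^ Suc m * real (Suc m) ^ Suc m \<le> K * (real m ^ m / R ^ m) powr (1 + q)" by (rule Kle[OF m(2)])
      also have "\<dots> \<le> K * (A * (real d)\<^sup>2 / \<epsilon>\<^sup>2) powr (1 + q)"
        using K X q R by (intro mult_left_mono powr_mono2) auto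
      also have "(A * (real d)\<^sup>2 / \<epsilon>\<^sup>2) powr (1 + q) = A powr (1 + q) * real d powr (2 + \<delta>) * \<epsilon> powr (- (2 + \<delta>))"
      proof -
        have "(x\<^sup>2) powr (1 + q) = x powr (2 + \<delta>)" if "0 < x" for x :: real
        proof -
          have "(x\<^sup>2) powr (1 + q) = (x powr 2) powr (1 + q)" using that by (simp add: powr_realpow[of x 2, simplified])
          also have "\<dots> = x powr (2 * (1 + q))" by (rule powr_powr)
          also have "2 * (1 + q) = 2 + \<delta>" by (simp add: q_def)
          finally show ?thesis .
        qed
        then have "(A * (real d)\<^sup>2 / \<epsilon>\<^sup>2) powr (1 + q) = A powr (1 + q) * real d powr (2 + \<delta>) / \<epsilon> powr (2 + \<delta>)"
          using A d1 \<epsilon> by (simp add: powr_divide powr_mult)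
        then show ?thesis unfolding powr_minus by (simp add: divide_inverse)
      qed
      finally have "real d * (S ^ Suc m * real (Suc m) ^ Suc m)
          \<le> real d * (K * (A powr (1 + q) * real d powr (2 + \<delta>) * \<epsilon> powr (- (2 + \<delta>))))"
        using d1 by (intro mult_left_mono) auto
      also have "\<dots> = (K * A powr (1 + q)) * real d powr (3 + \<delta>) * \<epsilon> powr (- (2 + \<delta>))"
      proof -
        have "real d * real d powr (2 + \<delta>) = real d powr 1 * real d powr (2 + \<delta>)" using d1 by simp
        also have "\<dots> = real d powr (3 + \<delta>)" by (subst powr_add[symmetric]) simp
        finally show ?thesis by (simp add: mult_ac)
      qed
      also have "\<dots> \<le> c * real d powr c * \<epsilon> powr (- (2 + \<delta>))"
        using c K A d1 by (intro mult_right_mono mult_mono powr_mono) auto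
      finally show ?thesis by (simp add: m mult.assoc)
    qed
    then show ?thesis using gN by (simp add: good_def)
  qed
  show ?thesis
    by (rule exI[of _ c], rule exI[of _ N]) (use main c in auto)
qed

section \<open>Regularity of the data\<close>

text \<open>For the second order bound, the difference \<open>f (a + v) - f (b + v)\<close> as a
  function of \<open>v\<close> has a derivative bounded by \<open>K * \<bar>a - b\<bar>\<close>,
  since \<open>deriv f\<close> is Lipschitz.\<close>

lemma C2_real_Lipschitz:
  fixes f :: "real \<Rightarrow> real"
  assumes f: "C2_real f" and K: "\<And>x. \<bar>deriv f x\<bar> \<le> K" "\<And>x. \<bar>deriv (deriv f) x\<bar> \<le> K"
  shows "\<bar>f a - f b\<bar> \<le> K * \<bar>a - b\<bar>"
    and "\<bar>f (a + v) - f a - (f (b + v) - f b)\<bar> \<le> K * \<bar>a - b\<bar> * \<bar>v\<bar>"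
proof -
  have d1: "(f has_field_derivative deriv f x) (at x)" and d2: "(deriv f has_field_derivative deriv (deriv f) x) (at x)" for x
    using f unfolding C2_real_def by (auto simp: DERIV_deriv_iff_real_differentiable)
  have L1: "\<bar>deriv f x - deriv f y\<bar> \<le> K * \<bar>x - y\<bar>" for x y
    using field_differentiable_bound[of UNIV "deriv f" "deriv (deriv f)" K x y] d2 K(2) by auto
  show "\<bar>f a - f b\<bar> \<le> K * \<bar>a - b\<bar>"
    using field_differentiable_bound[of UNIV f "deriv f" K a b] d1 K(1) by auto
  have "((\<lambda>v. f (a + v) - f (b + v)) has_field_derivative (deriv f (a + v) - deriv f (b + v))) (at v)" for v
    by (auto intro!: derivative_eq_intros DERIV_chain'[where f="\<lambda>v. _ + v" and g=f] d1)
  moreover have "\<bar>deriv f (a + v) - deriv f (b + v)\<bar> \<le> K * \<bar>a - b\<bar>" for v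
    using L1[of "a + v" "b + v"] by simp
  ultimately have "\<bar>(f (a + v) - f (b + v)) - (f (a + 0) - f (b + 0))\<bar> \<le> (K * \<bar>a - b\<bar>) * \<bar>v - 0\<bar>"
    using field_differentiable_bound[of UNIV "\<lambda>v. f (a + v) - f (b + v)" "\<lambda>v. deriv f (a + v) - deriv f (b + v)" "K * \<bar>a - b\<bar>" v 0]
    by auto
  then show "\<bar>f (a + v) - f a - (f (b + v) - f b)\<bar> \<le> K * \<bar>a - b\<bar> * \<bar>v\<bar>"
    by (simp add: algebra_simps)
qed

lemma fun_upd_Rd: "x \<in> Rd d \<Longrightarrow> i \<in> {1..d} \<Longrightarrow> x(i := h) \<in> Rd d"
  by (auto simp: Rd_def PiE_iff extensional_def)

text \<open>The points are joined by changing one coordinate at a time, so partial derivatives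
  suffice; each is at most \<open>sqrt K\<close>. Cauchy-Schwarz passes from the sum of the
  coordinate differences to the Euclidean norm and produces the factor \<open>d\<close>.\<close>

lemma C1_on_Rd_Lipschitz:
  assumes g: "C1_on_Rd d g" and K: "\<And>x. x \<in> Rd d \<Longrightarrow> (\<Sum>i=1..d. \<bar>partial_deriv i g x\<bar>\<^sup>2) \<le> K"
    and x: "x \<in> Rd d" and y: "y \<in> Rd d"
  shows "(g x - g y)\<^sup>2 \<le> K * (real d * (\<Sum>i=1..d. (x i - y i)\<^sup>2))"
proof -
  have K0: "0 \<le> K" using K[OF x] by (meson order_trans sum_nonneg zero_le_power2)
  have step: "\<bar>g (z(i := a)) - g (z(i := b))\<bar> \<le> sqrt K * \<bar>a - b\<bar>" if z: "z \<in> Rd d" and i: "i \<in> {1..d}" for z i a b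
  proof -
    have d: "((\<lambda>h. g (z(i := h))) has_field_derivative partial_deriv i g (z(i := h))) (at h)" for h
    proof -
      have zh: "z(i := h) \<in> Rd d" by (rule fun_upd_Rd[OF z i])
      then have "(\<lambda>h'. g ((z(i := h))(i := h'))) differentiable (at ((z(i := h)) i))"
        using g i unfolding C1_on_Rd_def by blast
      then have "(\<lambda>h'. g (z(i := h'))) differentiable (at h)" by simp
      then show ?thesis by (simp add: partial_deriv_def DERIV_deriv_iff_real_differentiable)
    qed
    have b: "\<bar>partial_deriv i g (z(i := h))\<bar> \<le> sqrt K" for h
    proof -
      have "\<bar>partial_deriv i g (z(i := h))\<bar>\<^sup>2 \<le> (\<Sum>j=1..d. \<bar>partial_deriv j g (z(i := h))\<bar>\<^sup>2)"
        by (rule member_le_sum[OF i]) auto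
      also have "\<dots> \<le> K" by (rule K[OF fun_upd_Rd[OF z i]])
      finally show ?thesis by (rule real_le_rsqrt)
    qed
    show ?thesis
      using field_differentiable_bound[of UNIV "\<lambda>h. g (z(i := h))" "\<lambda>h. partial_deriv i g (z(i := h))" "sqrt K" a b] d b by auto
  qed
  \<comment> \<open>The intermediate points: the first \<open>k\<close> coordinates are already
    those of \<open>y\<close>.\<close>
  define z where "z = (\<lambda>k i. if i \<le> k then y i else x i)"
  have z_in: "z k \<in> Rd d" for k using x y by (auto simp: z_def Rd_def PiE_iff extensional_def)
  have "\<bar>g x - g (z k)\<bar> \<le> sqrt K * (\<Sum>i=1..k. \<bar>x i - y i\<bar>)" if "k \<le> d" for k
    using that
  proof (induction k)
    case 0
    have "z 0 = x" by (rule Rd_eqI[OF z_in x]) (auto simp: z_def)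
    then show ?case by simp
  next
    case (Suc k)
    have "z (Suc k) = (z k)(Suc k := y (Suc k))" by (auto simp: z_def fun_eq_iff le_Suc_eq)
    moreover have "z k = (z k)(Suc k := x (Suc k))" by (auto simp: z_def fun_eq_iff)
    ultimately have "\<bar>g (z k) - g (z (Suc k))\<bar> \<le> sqrt K * \<bar>x (Suc k) - y (Suc k)\<bar>"
      using step[OF z_in[of k], of "Suc k" "x (Suc k)" "y (Suc k)"] Suc.prems by simp
    then show ?case using Suc by (simp add: distrib_left)
  qed
  from this[of d] have "\<bar>g x - g (z d)\<bar> \<le> sqrt K * (\<Sum>i=1..d. \<bar>x i - y i\<bar>)" by simp
  moreover have "z d = y" by (rule Rd_eqI[OF z_in y]) (auto simp: z_def)
  ultimately have "\<bar>g x - g y\<bar>\<^sup>2 \<le> (sqrt K * (\<Sum>i=1..d. \<bar>x i - y i\<bar>))\<^sup>2" by (intro power_mono) auto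
  also have "\<dots> = K * (\<Sum>i=1..d. 1 * \<bar>x i - y i\<bar>)\<^sup>2" using K0 by (simp add: power_mult_distrib)
  also have "\<dots> \<le> K * ((\<Sum>i=1..d. 1\<^sup>2) * (\<Sum>i=1..d. \<bar>x i - y i\<bar>\<^sup>2))"
    using K0 by (intro mult_left_mono Cauchy_Schwarz_ineq_sum)
  finally show ?thesis by simp
qed

text \<open>Continuity refers to the topology of all sequences, whose Borel sets are those of the
  product over all indices. Outside \<open>{1..d}\<close> the coordinates of points of
  \<open>Rd d\<close> have the constant value \<open>undefined\<close>, so the inclusion of
  \<open>Rd d\<close> is measurable.\<close>

lemma C1_on_Rd_measurable:
  assumes "C1_on_Rd d g"
  shows "g \<in> borel_measurable (Rd_borel d)"
proof -
  have "(\<lambda>x. x) \<in> measurable (Rd_borel d) (PiM UNIV (\<lambda>_. borel))"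
  proof (rule measurable_PiM_single')
    fix i :: nat
    show "(\<lambda>x. x i) \<in> borel_measurable (Rd_borel d)"
    proof (cases "i \<in> {1..d}")
      case True then show ?thesis by (intro measurable_Rd_component[of "\<lambda>x. x"]) auto
    next
      case False
      then have "x i = undefined" if "x \<in> space (Rd_borel d)" for x using that by (auto simp: Rd_def PiE_iff extensional_def)
      then show ?thesis by (subst measurable_cong[where g="\<lambda>_. undefined"]) auto
    qed
  qed auto
  then have "(\<lambda>x. x) \<in> measurable (Rd_borel d) (borel :: (nat \<Rightarrow> real) measure)"
    by (subst measurable_cong_sets[OF refl sets_PiM_equal_borel[symmetric]])
  then have "(\<lambda>x. x) \<in> measurable (Rd_borel d) (restrict_space borel (Rd d))"
    by (auto simp: measurable_restrict_space2_iff)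
  moreover have "g \<in> borel_measurable (restrict_space borel (Rd d))"
    using assms unfolding C1_on_Rd_def by (intro borel_measurable_continuous_on_restrict) auto
  ultimately show ?thesis by (rule measurable_compose)
qed

text \<open>At \<open>t = T\<close> the lower neighbour is the last grid point before
  \<open>T\<close> and the upper one is \<open>T\<close> itself; so every time, the end point
  included, lies in a cell of full length \<open>T / m\<close>.\<close>

lemma uniform_grid_neighbours:
  fixes T t :: real
  assumes T: "0 < T" and m: "1 \<le> m" and t: "t \<in> {0..T}"
    and fl: "fl = (GREATEST s. s \<in> ({0..t} - {T}) \<inter> time_grid T m)"
    and ce: "ce = (LEAST s. s \<in> ({t<..} \<union> {T}) \<inter> time_grid T m)"
  shows "0 \<le> fl \<and> fl \<le> t \<and> t \<le> ce \<and> ce \<le> T \<and> ce - fl = T / real m"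
proof -
  have m0: "0 < real m" using m by simp
  define k where "k = (if t = T then m - 1 else nat \<lfloor>t * real m / T\<rfloor>)"
  have tm0: "0 \<le> t * real m / T" using t T by auto
  have k1: "real k \<le> t * real m / T"
    using tm0 T m by (auto simp: k_def of_nat_diff)
  have k2: "t * real m / T < real k + 1" if "t \<noteq> T"
    using that tm0 unfolding k_def by simp
  have km: "k < m"
  proof (cases "t = T")
    case True then show ?thesis using m by (simp add: k_def)
  next
    case False
    then have "t * real m / T < real m" using t T m0 by (simp add: field_simps)
    then show ?thesis using k1 by linarith
  qed
  have kt: "real k * T / real m \<le> t" using k1 T m0 by (simp add: field_simps)
  have kt2: "t \<le> real (Suc k) * T / real m" "t \<noteq> T \<Longrightarrow> t < real (Suc k) * T / real m"
  proof -
    show 1: "t < real (Suc k) * T / real m" if "t \<noteq> T" using k2[OF that] T m0 by (simp add: field_simps)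
    have "real (Suc k) = real m" if "t = T" using that m by (simp add: k_def of_nat_diff)
    then show "t \<le> real (Suc k) * T / real m" using 1 m0 by (cases "t = T") auto
  qed
  have lt: "real k * T / real m < T" using km T m0 by (simp add: field_simps)
  have "fl = real k * T / real m"
    unfolding fl
  proof (rule Greatest_equality)
    show "real k * T / real m \<in> ({0..t} - {T}) \<inter> time_grid T m"
      using kt lt T m0 by (auto simp: time_grid_def)
    fix y assume "y \<in> ({0..t} - {T}) \<inter> time_grid T m"
    then obtain j where j: "y = real j * T / real m" and y: "y \<le> t" "y \<noteq> T" by (auto simp: time_grid_def)
    have "j \<le> k"
    proof (cases "t = T")
      case True
      have "real j * T \<le> real m * T" using j y True m0 by (simp add: pos_divide_le_eq mult.commute)
      moreover have "j \<noteq> m" using j y m0 by auto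
      ultimately have "j < m" using T by simp
      then show ?thesis using True by (simp add: k_def)
    next
      case False
      have "real j * T \<le> t * real m" using j y m0 by (simp add: pos_divide_le_eq)
      then have "real j \<le> t * real m / T" using T by (simp add: pos_le_divide_eq)
      then show ?thesis using k2[OF False] by linarith
    qed
    then show "y \<le> real k * T / real m" unfolding j using T m0 by (intro divide_right_mono mult_right_mono) auto
  qed
  moreover have "ce = real (Suc k) * T / real m"
    unfolding ce
  proof (rule Least_equality)
    have "real (Suc k) * T / real m = T" if "t = T" using that m m0 by (simp add: k_def of_nat_diff)
    then show "real (Suc k) * T / real m \<in> ({t<..} \<union> {T}) \<inter> time_grid T m"
      using kt2(2) unfolding time_grid_def by (cases "t = T") blast+
    fix y assume "y \<in> ({t<..} \<union> {T}) \<inter> time_grid T m"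
    then obtain j where j: "y = real j * T / real m" and y: "t < y \<or> y = T" by (auto simp: time_grid_def)
    have "Suc k \<le> j"
      using y
    proof
      assume "t < y"
      then have "t * real m < real j * T" using j m0 by (simp add: pos_less_divide_eq)
      then have "t * real m / T < real j" using T by (simp add: pos_divide_less_eq)
      then show ?thesis using k1 by linarith
    next
      assume "y = T"
      then have "real j = real m" using j T m0 by (simp add: field_simps)
      then show ?thesis using km by simp
    qed
    then show "real (Suc k) * T / real m \<le> y" unfolding j using T m0 by (intro divide_right_mono mult_right_mono) auto
  qed
  moreover have "real (Suc k) * T / real m \<le> T"
  proof -
    have "real (Suc k) * T \<le> real m * T" using km T by (intro mult_right_mono) auto
    then show ?thesis using m0 by (simp add: field_simps)
  qed
  moreover have "real (Suc k) * T / real m - real k * T / real m = T / real m"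
    by (simp add: diff_divide_distrib[symmetric] algebra_simps)
  moreover have "0 \<le> real k * T / real m" using T by simp
  ultimately show ?thesis using kt kt2(1) by simp
qed

section \<open>Independence of the sources of randomness\<close>

text \<open>Intersecting with the space includes the empty \<open>J\<close>, which occurs if a
  finite selection uses only one of the two families.\<close>

lemma (in prob_space) indep_sets_generated:
  assumes X: "indep_vars N X I" and fin: "finite J" "J \<subseteq> I"
    and A: "\<And>i. i \<in> J \<Longrightarrow> A i \<in> generated_sets M (X i) (N i)"
  shows "prob (space M \<inter> (\<Inter>i\<in>J. A i)) = (\<Prod>i\<in>J. prob (A i))"
proof (cases "J = {}")
  case False
  have m: "X i \<in> measurable M (N i)" if "i \<in> I" for i using X that unfolding indep_vars_def2 by auto
  have gen: "generated_sets M (X i) (N i) = {X i -` B \<inter> space M | B. B \<in> sets (N i)}" if "i \<in> I" for i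
    unfolding generated_sets_def using measurable_space[OF m[OF that]] by (intro sets_vimage_algebra2) auto
  have A': "\<forall>i\<in>J. A i \<in> {X i -` B \<inter> space M | B. B \<in> sets (N i)}"
  proof
    fix i assume "i \<in> J"
    then show "A i \<in> {X i -` B \<inter> space M | B. B \<in> sets (N i)}" using A[of i] gen[of i] fin by auto
  qed
  have "indep_sets (\<lambda>i. {X i -` B \<inter> space M | B. B \<in> sets (N i)}) I"
    using X unfolding indep_vars_def2 by simp
  from indep_setsD[OF this fin(2) False fin(1) A']
  have "prob (\<Inter>i\<in>J. A i) = (\<Prod>i\<in>J. prob (A i))" .
  moreover have "(\<Inter>i\<in>J. A i) \<subseteq> space M"
  proof -
    obtain i where i: "i \<in> J" using False by auto
    then have "A i \<subseteq> space M" using bspec[OF A' i] by auto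
    then show ?thesis using i by auto
  qed
  ultimately show ?thesis by (simp add: Int_absorb1)
qed (simp add: prob_space)

text \<open>Preimages under a component are preimages of cylinder sets under the whole family. This
  allows the independence of two families to be applied to sets of their members.\<close>

lemma generated_sets_component:
  assumes A: "A \<in> generated_sets M (X i) (N i)" and i: "i \<in> I"
    and X: "\<And>i \<omega>. i \<in> I \<Longrightarrow> \<omega> \<in> space M \<Longrightarrow> X i \<omega> \<in> space (N i)"
  shows "A \<in> generated_sets M (\<lambda>\<omega>. \<lambda>i\<in>I. X i \<omega>) (PiM I N)"
proof -
  obtain B where B: "B \<in> sets (N i)" "A = X i -` B \<inter> space M"
    using A X i unfolding generated_sets_def by (subst (asm) sets_vimage_algebra2) auto
  have "(\<lambda>x. x i) -` B \<inter> space (PiM I N) \<in> sets (PiM I N)"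
    using B i by (intro measurable_sets[OF measurable_component_singleton]) auto
  then have "(\<lambda>\<omega>. \<lambda>i\<in>I. X i \<omega>) -` ((\<lambda>x. x i) -` B \<inter> space (PiM I N)) \<inter> space M
      \<in> generated_sets M (\<lambda>\<omega>. \<lambda>i\<in>I. X i \<omega>) (PiM I N)"
    unfolding generated_sets_def by (rule in_vimage_algebra)
  also have "(\<lambda>\<omega>. \<lambda>i\<in>I. X i \<omega>) -` ((\<lambda>x. x i) -` B \<inter> space (PiM I N)) \<inter> space M = A"
    using X i by (auto simp: B space_PiM)
  finally show ?thesis .
qed

text \<open>A finite selection splits into an intersection of sets of the first family and one of
  the second. Independence of the families separates the two intersections, and independence within
  each family factorises them. The injection \<open>\<kappa>\<close> selects a subfamily; in the
  application these are the Brownian motions of one dimension.\<close>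

lemma (in prob_space) indep_sets_two_families:
  assumes X: "indep_vars N X I" and Y: "indep_vars L Y K"
    and XY: "indep_set (generated_sets M (\<lambda>\<omega>. \<lambda>i\<in>I. X i \<omega>) (PiM I N)) (generated_sets M (\<lambda>\<omega>. \<lambda>k\<in>K. Y k \<omega>) (PiM K L))"
    and K: "\<kappa> ` \<Theta> \<subseteq> K" "inj_on \<kappa> \<Theta>" and I: "\<Theta> \<subseteq> I"
  shows "indep_sets (\<lambda>(b, \<theta>). if b then generated_sets M (X \<theta>) (N \<theta>) else generated_sets M (Y (\<kappa> \<theta>)) (L (\<kappa> \<theta>))) (UNIV \<times> \<Theta>)"
proof -
  let ?S = "\<lambda>(b, \<theta>). if b then generated_sets M (X \<theta>) (N \<theta>) else generated_sets M (Y (\<kappa> \<theta>)) (L (\<kappa> \<theta>))"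
  have Xs: "X i \<omega> \<in> space (N i)" if "i \<in> I" "\<omega> \<in> space M" for i \<omega>
    using X that unfolding indep_vars_def2 by (auto dest: measurable_space)
  have Ys: "Y k \<omega> \<in> space (L k)" if "k \<in> K" "\<omega> \<in> space M" for k \<omega>
    using Y that unfolding indep_vars_def2 by (auto dest: measurable_space)
  have Xe: "generated_sets M (X i) (N i) \<subseteq> events" if "i \<in> I" for i
    using X that Xs unfolding indep_vars_def2 generated_sets_def
    by (subst sets_vimage_algebra2) (auto intro: measurable_sets)
  have Ye: "generated_sets M (Y k) (L k) \<subseteq> events" if "k \<in> K" for k
    using Y that Ys unfolding indep_vars_def2 generated_sets_def
    by (subst sets_vimage_algebra2) (auto intro: measurable_sets)
  show ?thesis
  proof (rule indep_setsI)
    show S_events: "?S j \<subseteq> events" if "j \<in> UNIV \<times> \<Theta>" for j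
    proof -
      obtain b \<theta> where j: "j = (b, \<theta>)" "\<theta> \<in> \<Theta>" using \<open>j \<in> _\<close> by auto
      then have "\<theta> \<in> I" "\<kappa> \<theta> \<in> K" using I K by auto
      then show ?thesis using Xe[of \<theta>] Ye[of "\<kappa> \<theta>"] by (simp add: j)
    qed
    fix A J assume J: "J \<noteq> {}" "J \<subseteq> UNIV \<times> \<Theta>" "finite J" and A: "\<forall>j\<in>J. A j \<in> ?S j"
    define J1 where "J1 = {\<theta>. (True, \<theta>) \<in> J}"
    define J0 where "J0 = {\<theta>. (False, \<theta>) \<in> J}"
    have "j \<in> J \<longleftrightarrow> j \<in> Pair True ` J1 \<union> Pair False ` J0" for j
      by (cases j; cases "fst j") (auto simp: J1_def J0_def)
    then have Jeq: "J = Pair True ` J1 \<union> Pair False ` J0" by (rule set_eqI)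
    have fin: "finite J1" "finite J0"
      using finite_vimageI[OF J(3), of "Pair True"] finite_vimageI[OF J(3), of "Pair False"]
      by (auto simp: vimage_def inj_on_def J1_def J0_def)
    have sub: "J1 \<subseteq> \<Theta>" "J0 \<subseteq> \<Theta>" using J(2) by (auto simp: J1_def J0_def)
    define a where "a = space M \<inter> (\<Inter>\<theta>\<in>J1. A (True, \<theta>))"
    \<comment> \<open>Indexed by the image of \<open>\<kappa>\<close>, because the second family is
      indexed by \<open>K\<close>; the inverse recovers the original index.\<close>
    define b where "b = space M \<inter> (\<Inter>k\<in>\<kappa> ` J0. A (False, the_inv_into \<Theta> \<kappa> k))"
    have inv: "the_inv_into \<Theta> \<kappa> (\<kappa> \<theta>) = \<theta>" if "\<theta> \<in> J0" for \<theta>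
      using that sub by (intro the_inv_into_f_f[OF K(2)]) auto
    have A1: "A (True, \<theta>) \<in> generated_sets M (X \<theta>) (N \<theta>)" if "\<theta> \<in> J1" for \<theta>
      using A that by (auto simp: J1_def)
    have A0: "A (False, \<theta>) \<in> generated_sets M (Y (\<kappa> \<theta>)) (L (\<kappa> \<theta>))" if "\<theta> \<in> J0" for \<theta>
      using A that by (auto simp: J0_def)
    have pa: "prob a = (\<Prod>\<theta>\<in>J1. prob (A (True, \<theta>)))"
      unfolding a_def by (rule indep_sets_generated[OF X fin(1)]) (use sub I A1 in auto)
    have "prob b = (\<Prod>k\<in>\<kappa> ` J0. prob (A (False, the_inv_into \<Theta> \<kappa> k)))"
      unfolding b_def by (rule indep_sets_generated[OF Y]) (use fin sub K A0 inv in auto)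
    also have "\<dots> = (\<Prod>\<theta>\<in>J0. prob (A (False, \<theta>)))"
      using inj_on_subset[OF K(2) sub(2)] by (subst prod.reindex) (auto simp: inv)
    finally have pb: "prob b = (\<Prod>\<theta>\<in>J0. prob (A (False, \<theta>)))" .
    have gen_INT: "space M \<inter> (\<Inter>i\<in>J. B i) \<in> generated_sets M Z Q"
      if "finite J" "\<And>i. i \<in> J \<Longrightarrow> B i \<in> generated_sets M Z Q" for J :: "'z set" and B and Z :: "'a \<Rightarrow> 'w" and Q
      using that
    proof (induction J rule: finite_induct)
      case empty
      then show ?case using sets.top[of "vimage_algebra (space M) Z Q"] by (simp add: generated_sets_def)
    next
      case (insert i J)
      have 1: "B i \<in> generated_sets M Z Q" "space M \<inter> (\<Inter>i\<in>J. B i) \<in> generated_sets M Z Q"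
        using insert by auto
      have "B i \<inter> (space M \<inter> (\<Inter>i\<in>J. B i)) \<in> generated_sets M Z Q"
        using 1 unfolding generated_sets_def by (rule sets.Int)
      then show ?case by (simp add: Int_ac)
    qed
    have ga: "a \<in> generated_sets M (\<lambda>\<omega>. \<lambda>i\<in>I. X i \<omega>) (PiM I N)"
      unfolding a_def
    proof (rule gen_INT[OF fin(1)])
      fix \<theta> assume "\<theta> \<in> J1"
      then show "A (True, \<theta>) \<in> generated_sets M (\<lambda>\<omega>. \<lambda>i\<in>I. X i \<omega>) (PiM I N)"
        using sub I by (intro generated_sets_component[OF A1 _ Xs]) auto
    qed
    have gb: "b \<in> generated_sets M (\<lambda>\<omega>. \<lambda>k\<in>K. Y k \<omega>) (PiM K L)"
      unfolding b_def
    proof (rule gen_INT)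
      fix k assume "k \<in> \<kappa> ` J0"
      then obtain \<theta> where k: "k = \<kappa> \<theta>" "\<theta> \<in> J0" by auto
      show "A (False, the_inv_into \<Theta> \<kappa> k) \<in> generated_sets M (\<lambda>\<omega>. \<lambda>k\<in>K. Y k \<omega>) (PiM K L)"
        by (rule generated_sets_component[where i=k]) (use A0[OF k(2)] k sub K Ys inv in auto)
    qed (use fin in auto)
    have "prob (\<Inter>j\<in>J. A j) = prob (a \<inter> b)"
    proof (rule arg_cong[where f=prob])
      obtain j where j: "j \<in> J" using J(1) by auto
      then have "A j \<in> events" using S_events[of j] J(2) A by blast
      then have "(\<Inter>j\<in>J. A j) \<subseteq> space M" using j sets.sets_into_space by blast
      moreover have "(\<Inter>j\<in>J. A j) = (\<Inter>\<theta>\<in>J1. A (True, \<theta>)) \<inter> (\<Inter>\<theta>\<in>J0. A (False, \<theta>))"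
        by (subst Jeq) auto
      moreover have "(\<Inter>k\<in>\<kappa> ` J0. A (False, the_inv_into \<Theta> \<kappa> k)) = (\<Inter>\<theta>\<in>J0. A (False, \<theta>))"
        using inv by simp
      ultimately show "(\<Inter>j\<in>J. A j) = a \<inter> b" unfolding a_def b_def by auto
    qed
    also have "\<dots> = prob a * prob b" by (rule indep_setD[OF XY ga gb])
    also have "\<dots> = (\<Prod>j\<in>J. prob (A j))"
    proof -
      have "(\<Prod>j\<in>J. prob (A j)) = (\<Prod>j\<in>Pair True ` J1. prob (A j)) * (\<Prod>j\<in>Pair False ` J0. prob (A j))"
        unfolding Jeq by (rule prod.union_disjoint) (use fin in auto)
      then show ?thesis by (simp add: pa pb prod.reindex inj_on_def)
    qed
    finally show "prob (\<Inter>j\<in>J. A j) = (\<Prod>j\<in>J. prob (A j))" .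
  qed
qed

lemma root_mean_square_le:
  assumes X: "integrable P (\<lambda>\<omega>. (X \<omega>)\<^sup>2)" and le: "(\<integral>\<omega>. (X \<omega>)\<^sup>2 \<partial>P) \<le> e\<^sup>2" and e: "0 \<le> e"
    and ae: "AE \<omega> in P. Y \<omega> = X \<omega>"
  shows "root_mean_square P Y \<le> ennreal e"
proof -
  have "(\<integral>\<^sup>+ \<omega>. ennreal (\<bar>Y \<omega>\<bar>\<^sup>2) \<partial>P) = (\<integral>\<^sup>+ \<omega>. ennreal ((X \<omega>)\<^sup>2) \<partial>P)"
    using ae by (intro nn_integral_cong_AE) (auto elim!: eventually_mono)
  also have "\<dots> = ennreal (\<integral>\<omega>. (X \<omega>)\<^sup>2 \<partial>P)"
    using X by (intro nn_integral_eq_integral) auto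
  finally have m: "(\<integral>\<^sup>+ \<omega>. ennreal (\<bar>Y \<omega>\<bar>\<^sup>2) \<partial>P) = ennreal (\<integral>\<omega>. (X \<omega>)\<^sup>2 \<partial>P)" .
  have "0 \<le> (\<integral>\<omega>. (X \<omega>)\<^sup>2 \<partial>P)" by (rule Bochner_Integration.integral_nonneg) simp
  moreover have "sqrt (\<integral>\<omega>. (X \<omega>)\<^sup>2 \<partial>P) \<le> e" using real_sqrt_le_mono[OF le] e by simp
  ultimately show ?thesis unfolding root_mean_square_def m Let_def by (simp add: ennreal_leI)
qed

theorem theorem1p1:
  fixes T \<delta> :: real
    and f :: "real \<Rightarrow> real"
    and g :: "nat \<Rightarrow> (nat \<Rightarrow> real) \<Rightarrow> real"
    and P :: "'a measure"
    and F :: "real \<Rightarrow> 'a measure"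
    and r :: "int list \<Rightarrow> 'a \<Rightarrow> real"
    and W :: "nat \<Rightarrow> int list \<Rightarrow> real \<Rightarrow> 'a \<Rightarrow> nat \<Rightarrow> real"
    and U :: "nat \<Rightarrow> int list \<Rightarrow> nat \<Rightarrow> nat \<Rightarrow> real \<Rightarrow> (nat \<Rightarrow> real) \<Rightarrow> 'a \<Rightarrow> real"
    and fl ce :: "nat \<Rightarrow> real \<Rightarrow> real"
    and YY :: "nat \<Rightarrow> nat \<Rightarrow> nat \<Rightarrow> real \<Rightarrow> 'a \<Rightarrow> real"
    and C CC :: "int \<Rightarrow> int \<Rightarrow> int \<Rightarrow> nat"
    and Y :: "nat \<Rightarrow> real \<Rightarrow> 'a \<Rightarrow> real"
    and Z :: "nat \<Rightarrow> nat \<Rightarrow> real \<Rightarrow> 'a \<Rightarrow> real"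
  assumes T_pos: "T > 0" and \<delta>_pos: "\<delta> > 0"
    and f_C2: "C2_real f"
    and g_C1: "\<And>d. d \<ge> 1 \<Longrightarrow> C1_on_Rd d (g d)"
    and fg_bounded: "(SUP d\<in>{1..}. SUP x\<in>Rd d.
        ereal (\<bar>f (x 1)\<bar> + \<bar>deriv f (x 1)\<bar> + \<bar>deriv (deriv f) (x 1)\<bar> + \<bar>g d x\<bar>
          + (\<Sum>i=1..d. \<bar>partial_deriv i (g d) x\<bar>\<^sup>2))) < \<infinity>"
    and prob: "prob_space P"
    and filt: "filtration_upto P T F"
    and r_range: "\<And>\<theta> \<omega>. \<theta> \<in> Theta \<Longrightarrow> \<omega> \<in> space P \<Longrightarrow> r \<theta> \<omega> \<in> {0..1}"
    and r_indep: "prob_space.indep_vars P (\<lambda>_. borel) r Theta"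
    and r_ident: "\<And>\<theta>. \<theta> \<in> Theta \<Longrightarrow> distr P borel (r \<theta>) = distr P borel (r [0])"
    and r_uniform: "\<And>t. 0 < t \<Longrightarrow> t < 1 \<Longrightarrow> measure P {\<omega>\<in>space P. r [0] \<omega> \<le> t} = t"
    and W_BM: "\<And>d \<theta>. d \<ge> 1 \<Longrightarrow> \<theta> \<in> Theta \<Longrightarrow> std_brownian_motion P F T d (W d \<theta>)"
    and W_indep: "prob_space.indep_vars P (\<lambda>(d, \<theta>). path_space T d)
        (\<lambda>(d, \<theta>). trajectory T (W d \<theta>)) ({1..} \<times> Theta)"
    and r_W_indep: "prob_space.indep_set P
        (generated_sets P (\<lambda>\<omega>. \<lambda>\<theta>\<in>Theta. r \<theta> \<omega>) (PiM Theta (\<lambda>_. borel)))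
        (generated_sets P (\<lambda>\<omega>. \<lambda>(d, \<theta>)\<in>{1..} \<times> Theta. trajectory T (W d \<theta>) \<omega>)
          (PiM ({1..} \<times> Theta) (\<lambda>(d, \<theta>). path_space T d)))"
    and U_eq: "\<And>d M n \<theta> t x \<omega>. d \<ge> 1 \<Longrightarrow> M \<ge> 1 \<Longrightarrow> \<theta> \<in> Theta \<Longrightarrow> t \<in> {0..T} \<Longrightarrow>
        x \<in> Rd d \<Longrightarrow> \<omega> \<in> space P \<Longrightarrow>
        U d \<theta> n M t x \<omega> =
          (T - t) * f 0 * indicator {1..} n
          + indicator {1..} n / real M ^ n *
            (\<Sum>i=1..M ^ n. g d (vadd d x (W d (\<theta> @ [0, - int i]) (T - t) \<omega>)))
          + (\<Sum>l\<in>{1..<n}. (T - t) / real M ^ (n - l) *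
              (\<Sum>i=1..M ^ (n - l).
                let \<eta> = \<theta> @ [int l, int i];
                    s = (T - t) * r \<eta> \<omega>;
                    x' = vadd d x (W d \<eta> s \<omega>)
                in f (U d \<eta> l M (t + s) x' \<omega>)
                   - f (U d (\<theta> @ [- int l, int i]) (l - 1) M (t + s) x' \<omega>)))"
    and fl_eq: "\<And>M t. M \<ge> 1 \<Longrightarrow> t \<in> {0..T} \<Longrightarrow>
        fl M t = (GREATEST s. s \<in> ({0..t} - {T}) \<inter> time_grid T M)"
    and ce_eq: "\<And>M t. M \<ge> 1 \<Longrightarrow> t \<in> {0..T} \<Longrightarrow>
        ce M t = (LEAST s. s \<in> ({t<..} \<union> {T}) \<inter> time_grid T M)"
    and YY_eq: "\<And>d n M t \<omega>. d \<ge> 1 \<Longrightarrow> n \<ge> 1 \<Longrightarrow> M \<ge> 1 \<Longrightarrow> t \<in> {0..T} \<Longrightarrow> \<omega> \<in> space P \<Longrightarrow>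
        YY d n M t \<omega> = (\<Sum>l<n.
          (ce (M ^ (l+1)) t - t) / (T / real M ^ (l+1)) *
              U d [int l] (n - l) M (fl (M ^ (l+1)) t) (W d [0] (fl (M ^ (l+1)) t) \<omega>) \<omega>
          + (t - fl (M ^ (l+1)) t) / (T / real M ^ (l+1)) *
              U d [int l] (n - l) M (ce (M ^ (l+1)) t) (W d [0] (ce (M ^ (l+1)) t) \<omega>) \<omega>
          - indicator {1..} l *
            ((ce (M ^ l) t - t) / (T / real M ^ l) *
                U d [int l] (n - l) M (fl (M ^ l) t) (W d [0] (fl (M ^ l) t) \<omega>) \<omega>
             + (t - fl (M ^ l) t) / (T / real M ^ l) *
                U d [int l] (n - l) M (ce (M ^ l) t) (W d [0] (ce (M ^ l) t) \<omega>) \<omega>))"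
    and C_le: "\<And>d n M :: nat. d \<ge> 1 \<Longrightarrow>
        C (int d) (int n) (int M) \<le> (d + 1) * M ^ n * indicator {1..} n
          + (\<Sum>l<n. M ^ (n - l) *
              (2 + d + C (int d) (int l) (int M)
               + C (int d) (int l - 1) (int M) * indicator {1..} l))"
    and CC_le: "\<And>d n M :: nat. d \<ge> 1 \<Longrightarrow>
        CC (int d) (int n) (int M) \<le> (d + 1) * (M ^ n + 1)
          + (\<Sum>l<n. (M ^ (l+1) + 1) * C (int d) (int (n - l)) (int M))"
    and Y_pred: "\<And>d. d \<ge> 1 \<Longrightarrow> predictable P F T (Y d)"
    and Z_pred: "\<And>d j. d \<ge> 1 \<Longrightarrow> j \<in> {1..d} \<Longrightarrow> predictable P F T (Z d j)"
    and YZ_int: "\<And>d. d \<ge> 1 \<Longrightarrow>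
        (\<integral>\<^sup>+ s \<in> {0..T}. (\<integral>\<^sup>+ \<omega>.
            ennreal (\<bar>Y d s \<omega>\<bar> + (\<Sum>j=1..d. \<bar>Z d j s \<omega>\<bar>\<^sup>2)) \<partial>P) \<partial>lborel) < \<infinity>"
    and BSDE: "\<And>d t. d \<ge> 1 \<Longrightarrow> t \<in> {0..T} \<Longrightarrow>
        \<exists>J. (\<forall>j\<in>{1..d}. has_ito_integral P F (\<lambda>s \<omega>. W d [0] s \<omega> j) t T (Z d j) (J j)) \<and>
            (AE \<omega> in P. Y d t \<omega> = g d (W d [0] T \<omega>)
                + (LINT s:{t..T}|lborel. f (Y d s \<omega>)) - (\<Sum>j=1..d. J j \<omega>))"
  shows "\<exists>(c::real) (N :: nat \<Rightarrow> real \<Rightarrow> nat). \<forall>d\<ge>1. \<forall>\<epsilon>\<in>{0<..1}.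
      N d \<epsilon> \<ge> 1 \<and>
      (\<forall>t\<in>{0..T}. (\<lambda>\<omega>. YY d (N d \<epsilon>) (N d \<epsilon>) t \<omega> - Y d t \<omega>) \<in> borel_measurable P) \<and>
      (SUP t\<in>{0..T}. root_mean_square P (\<lambda>\<omega>. YY d (N d \<epsilon>) (N d \<epsilon>) t \<omega> - Y d t \<omega>)) \<le> ennreal \<epsilon> \<and>
      real (CC (int d) (int (N d \<epsilon>)) (int (N d \<epsilon>))) \<le> c * real d powr c * \<epsilon> powr (- (2 + \<delta>))"
proof -
  interpret prob_space P by (rule prob)
  define Sup1 where "Sup1 = (SUP d\<in>{1..}. SUP x\<in>Rd d.
        ereal (\<bar>f (x 1)\<bar> + \<bar>deriv f (x 1)\<bar> + \<bar>deriv (deriv f) (x 1)\<bar> + \<bar>g d x\<bar>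
          + (\<Sum>i=1..d. \<bar>partial_deriv i (g d) x\<bar>\<^sup>2)))"
  \<comment> \<open>A single bound for all dimensions, from which all constants of the error
    analysis are built.\<close>
  define K where "K = real_of_ereal Sup1"
  have Kall: "\<bar>f (x 1)\<bar> + \<bar>deriv f (x 1)\<bar> + \<bar>deriv (deriv f) (x 1)\<bar> + \<bar>g d x\<bar>
          + (\<Sum>i=1..d. \<bar>partial_deriv i (g d) x\<bar>\<^sup>2) \<le> K" if "d \<ge> 1" "x \<in> Rd d" for d x
  proof -
    have "ereal (\<bar>f (x 1)\<bar> + \<bar>deriv f (x 1)\<bar> + \<bar>deriv (deriv f) (x 1)\<bar> + \<bar>g d x\<bar>
          + (\<Sum>i=1..d. \<bar>partial_deriv i (g d) x\<bar>\<^sup>2)) \<le> Sup1"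
      unfolding Sup1_def using that by (intro SUP_upper2[of d] SUP_upper) auto
    moreover have "Sup1 < \<infinity>" using fg_bounded by (simp add: Sup1_def)
    ultimately show ?thesis unfolding K_def by (cases Sup1) auto
  qed
  have fK: "\<bar>f a\<bar> \<le> K" "\<bar>deriv f a\<bar> \<le> K" "\<bar>deriv (deriv f) a\<bar> \<le> K" for a
  proof -
    \<comment> \<open>Every real number is the coordinate of a point of dimension one, so the bounds
      on \<open>f\<close> and its derivatives hold on the whole line.\<close>
    define x :: "nat \<Rightarrow> real" where "x = (\<lambda>i\<in>{1..1}. a)"
    have "x \<in> Rd 1" "x 1 = a" by (auto simp: x_def Rd_def)
    then have "\<bar>f a\<bar> + \<bar>deriv f a\<bar> + \<bar>deriv (deriv f) a\<bar> + \<bar>g 1 x\<bar> + \<bar>partial_deriv 1 (g 1) x\<bar>\<^sup>2 \<le> K"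
      using Kall[of 1 x] by simp
    moreover have "0 \<le> \<bar>partial_deriv 1 (g 1) x\<bar>\<^sup>2" by simp
    ultimately show "\<bar>f a\<bar> \<le> K" "\<bar>deriv f a\<bar> \<le> K" "\<bar>deriv (deriv f) a\<bar> \<le> K"
      by linarith+
  qed
  have gK: "\<bar>g d x\<bar> \<le> K" "(\<Sum>i=1..d. \<bar>partial_deriv i (g d) x\<bar>\<^sup>2) \<le> K" if "d \<ge> 1" "x \<in> Rd d" for d x
  proof -
    have "0 \<le> (\<Sum>i=1..d. \<bar>partial_deriv i (g d) x\<bar>\<^sup>2)" by (intro sum_nonneg) auto
    then show "\<bar>g d x\<bar> \<le> K" "(\<Sum>i=1..d. \<bar>partial_deriv i (g d) x\<bar>\<^sup>2) \<le> K"
      using Kall[OF that] by linarith+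
  qed
  have K0: "0 \<le> K" using fK(1)[of 0] by linarith
  \<comment> \<open>Serves both as the bound for the square of \<open>g\<close> and as the constant
    for its squared increments, which are \<open>K\<^sup>2\<close> and \<open>K\<close>.\<close>
  define Kg where "Kg = K\<^sup>2 + K"
  have zero_Theta: "[0] \<in> Theta" by (simp add: Theta_def)
  have r_meas: "r \<theta> \<in> borel_measurable P" if "\<theta> \<in> Theta" for \<theta>
    using r_indep that unfolding indep_vars_def2 by auto
  have r_law: "distr P borel (r \<theta>) = density lborel (indicator {0..1})" if "\<theta> \<in> Theta" for \<theta>
    using r_ident[OF that] distr_uniform_01[OF prob r_meas[OF zero_Theta] r_range[OF zero_Theta] r_uniform] by simp
  define src where "src = (\<lambda>d (b, \<theta>). if b then generated_sets P (r \<theta>) borel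
    else generated_sets P (trajectory T (W d \<theta>)) (path_space T d))"
  have sl: "semilinear P T d F r (W d) (src d) f (g d) K K Kg" if d: "d \<ge> 1" for d
  proof -
    have "indep_sets (src d) (UNIV \<times> Theta)"
    proof -
      have "indep_sets (\<lambda>(b, \<theta>). if b then generated_sets P (r \<theta>) borel
          else generated_sets P ((\<lambda>(d, \<theta>). trajectory T (W d \<theta>)) (d, \<theta>)) ((\<lambda>(d, \<theta>). path_space T d) (d, \<theta>))) (UNIV \<times> Theta)"
      proof (rule indep_sets_two_families[OF r_indep W_indep])
        show "indep_set (generated_sets P (\<lambda>\<omega>. \<lambda>i\<in>Theta. r i \<omega>) (PiM Theta (\<lambda>_. borel)))
          (generated_sets P (\<lambda>\<omega>. \<lambda>k\<in>{1..} \<times> Theta. (case k of (d, \<theta>) \<Rightarrow> trajectory T (W d \<theta>)) \<omega>)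
            (PiM ({1..} \<times> Theta) (\<lambda>(d, \<theta>). path_space T d)))"
          using r_W_indep by (simp add: case_prod_unfold)
      qed (use d in \<open>auto simp: inj_on_def\<close>)
      then show ?thesis unfolding src_def prod.case .
    qed
    moreover have "(g d x)\<^sup>2 \<le> Kg" if "x \<in> Rd d" for x
      using power_mono[OF gK(1)[OF d that], of 2] K0 by (simp add: Kg_def)
    moreover have "(g d x - g d y)\<^sup>2 \<le> Kg * (real d * (\<Sum>i=1..d. (x i - y i)\<^sup>2))" if "x \<in> Rd d" "y \<in> Rd d" for x y
    proof -
      have "(g d x - g d y)\<^sup>2 \<le> K * (real d * (\<Sum>i=1..d. (x i - y i)\<^sup>2))"
        by (rule C1_on_Rd_Lipschitz[OF g_C1[OF d] gK(2)[OF d] that])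
      also have "\<dots> \<le> Kg * (real d * (\<Sum>i=1..d. (x i - y i)\<^sup>2))"
        by (intro mult_right_mono) (auto simp: Kg_def sum_nonneg)
      finally show ?thesis .
    qed
    ultimately show ?thesis
      using T_pos d filt r_meas r_range r_law W_BM[OF d] fK(1) K0 C2_real_Lipschitz[OF f_C2 fK(2,3)]
        C1_on_Rd_measurable[OF g_C1[OF d]]
      by unfold_locales (auto simp: src_def)
  qed
  define U' where "U' = (\<lambda>d M \<theta> n p \<omega>. U d \<theta> n M (fst p) (snd p) \<omega>)"
  have mlp: "mlp_scheme P T d F r (W d) (src d) f (g d) K K Kg M (U' d M)" if d: "d \<ge> 1" and M: "M \<ge> 1" for d M
  proof -
    interpret S: semilinear P T d F r "W d" "src d" f "g d" K K Kg by (rule sl[OF d])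
    show ?thesis
    proof unfold_locales
      fix \<theta> p \<omega> n assume "\<theta> \<in> Theta" "p \<in> space (timespace T d)" "\<omega> \<in> space P"
      then show "U' d M \<theta> n p \<omega> = (T - fst p) * f 0 * indicator {1..} n
        + indicator {1..} n / real M ^ n * (\<Sum>i=1..M ^ n. g d (vadd d (snd p) (W d (\<theta> @ [0, - int i]) (T - fst p) \<omega>)))
        + (\<Sum>l\<in>{1..<n}. (T - fst p) / real M ^ (n - l) *
            (\<Sum>i=1..M ^ (n - l).
              f (U' d M (\<theta> @ [int l, int i]) l (S.shift (\<theta> @ [int l, int i]) p \<omega>) \<omega>)
              - f (U' d M (\<theta> @ [- int l, int i]) (l - 1) (S.shift (\<theta> @ [int l, int i]) p \<omega>) \<omega>)))"
        unfolding U'_def S.shift_def fst_conv snd_conv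
        by (subst U_eq[OF d M]) (auto simp: space_timespace Let_def)
    qed (rule M)
  qed
  \<comment> \<open>\<open>errC\<close> and \<open>errR\<close> are functions of \<open>T\<close>,
    \<open>K\<close> and \<open>Kg\<close>, but not of \<open>d\<close> or \<open>M\<close>; hence
    \<open>A\<close> and \<open>R\<close> can be fixed before these are chosen.\<close>
  define A where "A = 1 + 4 * mlp_scheme.errC T K K Kg"
  \<comment> \<open>The factor 4 accounts for the number of levels by
    \<open>(n + 1)\<^sup>2 \<le> 4 ^ n\<close>, and \<open>exp T\<close> for the weight
    \<open>exp (n * T)\<close> that belongs to \<open>M = n\<close>.\<close>
  define R where "R = 4 * mlp_scheme.errR T K K Kg * exp T"
  \<comment> \<open>An arbitrary instance, from which the signs of the two constants are read
    off.\<close>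
  interpret one: mlp_scheme P T 1 F r "W 1" "src 1" f "g 1" K K Kg 1 "U' 1 1" by (rule mlp) auto
  have A1: "1 \<le> A" using one.errC_nonneg by (simp add: A_def)
  have R1: "1 \<le> R"
  proof -
    have "1 * 1 \<le> (4 * one.errR) * exp T" using one.errR_ge_1 T_pos by (intro mult_mono) auto
    then show ?thesis by (simp add: R_def)
  qed
  \<comment> \<open>20 is the exponential base of the total cost.\<close>
  have "1 \<le> (20::real)" by simp
  from parameter_choice[OF A1 R1 this \<delta>_pos]
  obtain c0 N where c0: "0 \<le> c0" and N: "\<forall>d\<ge>1. \<forall>\<epsilon>\<in>{0<..1}. 1 \<le> N d \<epsilon> \<and>
    A * (real d)\<^sup>2 * R ^ N d \<epsilon> / real (N d \<epsilon>) ^ N d \<epsilon> \<le> \<epsilon>\<^sup>2 \<and>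
    real d * 20 ^ N d \<epsilon> * real (N d \<epsilon>) ^ N d \<epsilon> \<le> c0 * real d powr c0 * \<epsilon> powr (- (2 + \<delta>))"
    by (elim exE conjE)
  \<comment> \<open>At least \<open>c0\<close>, so that it can also replace the exponent of
    \<open>d\<close>.\<close>
  define c where "c = 12 * c0"
  have main: "1 \<le> n \<and> (\<forall>t\<in>{0..T}. (\<lambda>\<omega>. YY d n n t \<omega> - Y d t \<omega>) \<in> borel_measurable P) \<and>
      (SUP t\<in>{0..T}. root_mean_square P (\<lambda>\<omega>. YY d n n t \<omega> - Y d t \<omega>)) \<le> ennreal \<epsilon> \<and>
      real (CC (int d) (int n) (int n)) \<le> c * real d powr c * \<epsilon> powr (- (2 + \<delta>))"
    if d: "d \<ge> 1" and \<epsilon>: "\<epsilon> \<in> {0<..1}" and n: "n = N d \<epsilon>" for d \<epsilon> n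
  proof -
    have n1: "1 \<le> n" and err: "A * (real d)\<^sup>2 * R ^ n / real n ^ n \<le> \<epsilon>\<^sup>2"
      and cost: "real d * 20 ^ n * real n ^ n \<le> c0 * real d powr c0 * \<epsilon> powr (- (2 + \<delta>))"
      using N d \<epsilon> n by auto
    interpret S: mlp_scheme P T d F r "W d" "src d" f "g d" K K Kg n "U' d n" by (rule mlp[OF d n1])
    have base: "S.base = [0]" by (rule S.base_def)
    have sol: "AE \<omega> in P. Y d t \<omega> = S.sol (t, W d [0] t \<omega>)" if "t \<in> {0..T}" for t
      using S.bsde_solution[OF Y_pred[OF d] _ that, of "Z d"] BSDE[OF d] unfolding base by blast
    have grid: "0 \<le> fl (n ^ k) t \<and> fl (n ^ k) t \<le> t \<and> t \<le> ce (n ^ k) t \<and> ce (n ^ k) t \<le> T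
      \<and> ce (n ^ k) t - fl (n ^ k) t = T / real (n ^ k)" if "t \<in> {0..T}" for k t
      using n1 that by (intro uniform_grid_neighbours[OF T_pos _ that fl_eq ce_eq]) auto
    have each: "(\<lambda>\<omega>. YY d n n t \<omega> - Y d t \<omega>) \<in> borel_measurable P \<and>
        root_mean_square P (\<lambda>\<omega>. YY d n n t \<omega> - Y d t \<omega>) \<le> ennreal \<epsilon>" if t: "t \<in> {0..T}" for t
    proof -
      have YY: "YY d n n t \<omega> = (\<Sum>l<n.
        interpolate (T / real n ^ (l+1)) (fl (n ^ (l+1)) t) (ce (n ^ (l+1)) t) (\<lambda>s. U' d n [int l] (n - l) (s, W d S.base s \<omega>) \<omega>) t
        - indicator {1..} l * interpolate (T / real n ^ l) (fl (n ^ l) t) (ce (n ^ l) t) (\<lambda>s. U' d n [int l] (n - l) (s, W d S.base s \<omega>) \<omega>) t)"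
        if "\<omega> \<in> space P" for \<omega>
        unfolding YY_eq[OF d n1 n1 t that] interpolate_def U'_def base fst_conv snd_conv ..
      note err1 = S.interpolated_scheme_error[OF grid n1 t YY, unfolded base]
      let ?X = "\<lambda>\<omega>. YY d n n t \<omega> - S.sol (t, W d [0] t \<omega>)"
      have Xint: "integrable P (\<lambda>\<omega>. (?X \<omega>)\<^sup>2)"
        by (intro bounded_rv_integrable bounded_rv_power2 err1(2))
      have "expectation (\<lambda>\<omega>. (?X \<omega>)\<^sup>2) \<le> (real n + 1)\<^sup>2 * (4 * (S.errC * (real d)\<^sup>2 * S.errR ^ n * exp (real n * T) / real n ^ n))"
        by (rule err1(1))
      also have "\<dots> \<le> 4 ^ n * (4 * (S.errC * (real d)\<^sup>2 * S.errR ^ n * exp (real n * T) / real n ^ n))"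
      proof (rule mult_right_mono)
        have "n + 1 \<le> 2 ^ n" using Suc_leI[OF less_exp[of n]] by simp
        then have "real (n + 1) \<le> real (2 ^ n)" by (simp only: of_nat_le_iff)
        then have "real n + 1 \<le> 2 ^ n" by simp
        then have "(real n + 1)\<^sup>2 \<le> (2 ^ n)\<^sup>2" by (intro power_mono) auto
        also have "\<dots> = 4 ^ n" by (subst power_mult[symmetric], subst mult.commute, subst power_mult) simp
        finally show "(real n + 1)\<^sup>2 \<le> 4 ^ n" .
      qed (use S.errC_nonneg S.errR_ge_1 in auto)
      also have "\<dots> = (4 * S.errC) * (real d)\<^sup>2 * R ^ n / real n ^ n"
        by (simp add: R_def power_mult_distrib exp_of_nat_mult)
      also have "\<dots> \<le> A * (real d)\<^sup>2 * R ^ n / real n ^ n"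
        using R1 by (intro divide_right_mono mult_right_mono) (auto simp: A_def)
      also have "\<dots> \<le> \<epsilon>\<^sup>2" by (rule err)
      finally have ms: "expectation (\<lambda>\<omega>. (?X \<omega>)\<^sup>2) \<le> \<epsilon>\<^sup>2" .
      have ae: "AE \<omega> in P. YY d n n t \<omega> - Y d t \<omega> = ?X \<omega>"
        using sol[OF t] by (auto elim!: eventually_mono)
      have "?X \<in> borel_measurable P" by (rule bounded_rv_measurable[OF err1(2)])
      moreover have "(\<lambda>\<omega>. S.sol (t, W d [0] t \<omega>)) \<in> borel_measurable P"
        using bounded_rv_measurable[OF S.sol_path_bounded_rv[OF t]] unfolding base .
      moreover have "Y d t \<in> borel_measurable P"
        by (rule S.measurable_F_P[OF t S.predictable_section[OF Y_pred[OF d] t]])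
      \<comment> \<open>Measurability of the scheme along the path is recovered from that of its
        error.\<close>
      ultimately have "(\<lambda>\<omega>. ?X \<omega> + S.sol (t, W d [0] t \<omega>) - Y d t \<omega>) \<in> borel_measurable P"
        by (rule borel_measurable_diff[OF borel_measurable_add])
      then have "(\<lambda>\<omega>. YY d n n t \<omega> - Y d t \<omega>) \<in> borel_measurable P" by simp
      then show ?thesis using root_mean_square_le[OF Xint ms _ ae] \<epsilon> by auto
    qed
    have "real (CC (int d) (int n) (int n)) \<le> c * real d powr c * \<epsilon> powr (- (2 + \<delta>))"
    proof -
      have "CC (int d) (int n) (int n) \<le> 12 * d * 20 ^ n * n ^ n"
      proof (rule total_cost_bound[where C=C and CC=CC])
        show "C (int d) (int k) (int n) \<le> 4 * d * 5 ^ k * n ^ k" for k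
          by (rule scheme_cost_bound[where C=C, OF _ d n1]) (rule C_le[OF d])
      qed (rule CC_le[OF d] d n1)+
      then have "real (CC (int d) (int n) (int n)) \<le> real (12 * d * 20 ^ n * n ^ n)" by (simp only: of_nat_le_iff)
      also have "\<dots> = 12 * (real d * 20 ^ n * real n ^ n)" by simp
      also have "\<dots> \<le> 12 * (c0 * real d powr c0 * \<epsilon> powr (- (2 + \<delta>)))" using cost by simp
      also have "\<dots> = c * real d powr c0 * \<epsilon> powr (- (2 + \<delta>))" by (simp add: c_def)
      also have "\<dots> \<le> c * real d powr c * \<epsilon> powr (- (2 + \<delta>))"
        using c0 d by (intro mult_right_mono mult_left_mono powr_mono) (auto simp: c_def)
      finally show ?thesis .
    qed
    moreover have "(SUP t\<in>{0..T}. root_mean_square P (\<lambda>\<omega>. YY d n n t \<omega> - Y d t \<omega>)) \<le> ennreal \<epsilon>"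
      using each by (intro SUP_least) auto
    ultimately show ?thesis using n1 each by blast
  qed
  show ?thesis
    by (rule exI[of _ c], rule exI[of _ N]) (use main in blast)
qed

end
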